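(* Let $G$ be a simple and simply-connected complex algebraic group and $k$ a non-negative integer. For all non-negative integers $g,g_1,g_2,n,n_1,n_2$ and all vectors $\vec\lambda,\vec\lambda_1,\vec\lambda_2$ of level-$k$ integrable dominant weights (of lengths $n-2$, $n_1$, $n_2$ respectively, with $n\ge2$ in the first identity), one has for all sufficiently small $t$ $$d_{g+1,n-2}(\vec\lambda)=\sum_{\lambda\in\Lambda_k}d_{g,n}(\vec\lambda,\lambda,\lambda^* )\,d_\lambda$$ and $$d_{g_1+g_2,n_1+n_2}(\vec\lambda_1,\vec\lambda_2)=\sum_{\lambda\in\Lambda_k}d_{g_1,n_1+1}(\vec\lambda_1,\lambda)\,d_{g_2,n_2+1}(\vec\lambda_2,\lambda^* )\,d_\lambda .$$
   Context: $\Lambda_k$ is the set of dominant weights $\lambda$ of $G$ with $\langle\lambda,\vartheta\rangle\le k$, $\vartheta$ the highest root (level-$k$ integrable dominant weights); $\lambda^*$ is the dual weight $-w_0(\lambda)$. For $\vec\lambda=(\lambda_1,\dots,\lambda_n)\in\Lambda_k^n$ and sufficiently small $t$, $$d_{g,n}(\vec\lambda)(t)=\sum_{f\in F^{\rm reg}_{\rho,t}/W}\theta_t(f)^{1-g}\prod_{i=1}^n\Theta_{\lambda_i,t}(f),\qquad d_\lambda(t)=d_{0,2}(\lambda,\lambda^* )(t)^{-1}.$$ Here (all parabolic subgroups being the Borel subgroup) $$\Theta_{\lambda,t}=\sum_{w\in W}\frac{e^{w(\lambda)}}{\prod_{\alpha\in\mathfrak R_+}(1-e^{-w(\alpha)})(1-te^{w(\alpha)})}.$$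 Group data. $K$ is the compact form of $G$, $T$ a maximal torus, $T_K=T\cap K$, $W$ the Weyl group, $\mathfrak R$ the roots, $\mathfrak R_+$ the positive roots, $h$ the dual Coxeter number, $Q^\vee$ the coroot lattice, $\mathfrak t_{\mathbb R}=Q^\vee\otimes\mathbb R$, $(\cdot,\cdot)$ the $W$-invariant positive-definite form on $\mathfrak t_{\mathbb R}$ normalized so that the longest root has norm squared $2$. Write $f=e^{2\pi i x}\in T_K$ with $x\in\mathfrak t_{\mathbb R}/Q^\vee$, $e^{\mu}(f)=e^{2\pi i\mu(x)}$. $F=\{e^{2\pi i x}:(k+h)(x,y)\in\mathbb Z\ \forall y\in Q^\vee\}$. For real $t$ close to $0$, $F_{\rho,t}\subset T_K$ is the set of $f=e^{2\pi i x}$ with $$e^{2\pi i (k+h)(x,y)}\prod_{\alpha\in\mathfrak R_+}\left(\frac{1-te^{-\alpha}(f)}{1-te^{\alpha}(f)}\right)^{\alpha(y)}=1\quad\text{for all }y\in Q^\vee,$$ and $F^{\rm reg}_{\rho,t}$ is its subset of elements with trivial stabilizer in $W$. $H_t^\dagger(f)$ is the endomorphism of $\mathfrak t_{\mathbb R}$ with $(k+h)(H_t^\dagger(f)y,y')=(k+h)(y,y')+\sum_{\alpha\in\mathfrak R}\frac{te^{\alpha}(f)}{1-te^{\alpha}(f)}\alpha(y)\alpha(y')$, and $$\theta_t(f)=(1-t)^{\mathrm{rk}\,G}\frac{1}{|F|}\frac{\prod_{\alpha\in\mathfrak R}(1-e^\alpha(f))(1-te^\alpha(f))}{\det H_t^\dagger(f)}.$$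 *)

theory Defs
  imports "HOL-Analysis.Analysis"
begin

text \<open>
  A simple, simply connected complex group of rank \<open>n\<close> is represented by its root system \<open>R\<close> with a
  base \<open>D\<close> (the choice of a Borel subgroup).  The space \<open>t\<close> of the text below is the real span of
  the coroots, modelled by \<open>real ^ 'n\<close> in such a way that the invariant form \<open>(x, y)\<close> is the standard
  inner product \<open>x \<bullet> y\<close>.  Roots and weights, which are linear forms on \<open>t\<close>, are identified with
  vectors through this form: \<open>\<mu>(x) = \<mu> \<bullet> x\<close>.  Simplicity is the irreducibility of \<open>R\<close>; simple
  connectedness says that the cocharacter lattice is the coroot lattice, so that the compact torus
  is \<open>t\<close> modulo the coroot lattice and the characters are all the weights.
\<close>

type_synonym 'n vec_R = "(real, 'n) vec"

definition coroot :: "'n::finite vec_R \<Rightarrow> 'n vec_R" where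
  "coroot \<alpha> = (2 / (\<alpha> \<bullet> \<alpha>)) *\<^sub>R \<alpha>"

definition reflection :: "'n::finite vec_R \<Rightarrow> 'n vec_R \<Rightarrow> 'n vec_R" where
  "reflection \<alpha> x = x - (\<alpha> \<bullet> x) *\<^sub>R coroot \<alpha>"

definition root_system :: "'n::finite vec_R set \<Rightarrow> bool" where
  "root_system R \<longleftrightarrow>
     finite R \<and> span R = UNIV \<and> 0 \<notin> R \<and>
     (\<forall>\<alpha>\<in>R. reflection \<alpha> ` R = R) \<and>
     (\<forall>\<alpha>\<in>R. \<forall>\<beta>\<in>R. \<beta> \<bullet> coroot \<alpha> \<in> \<int>) \<and>
     (\<forall>\<alpha>\<in>R. \<forall>c. c *\<^sub>R \<alpha> \<in> R \<longrightarrow> c = 1 \<or> c = -1)"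

definition irreducible_root_system :: "'n::finite vec_R set \<Rightarrow> bool" where
  "irreducible_root_system R \<longleftrightarrow>
     root_system R \<and>
     \<not> (\<exists>A B. A \<noteq> {} \<and> B \<noteq> {} \<and> A \<union> B = R \<and> A \<inter> B = {} \<and> (\<forall>\<alpha>\<in>A. \<forall>\<beta>\<in>B. \<alpha> \<bullet> \<beta> = 0))"

definition normalized_form :: "'n::finite vec_R set \<Rightarrow> bool" where
  "normalized_form R \<longleftrightarrow> (\<forall>\<alpha>\<in>R. \<alpha> \<bullet> \<alpha> \<le> 2) \<and> (\<exists>\<alpha>\<in>R. \<alpha> \<bullet> \<alpha> = 2)"

definition nat_span :: "'n::finite vec_R set \<Rightarrow> 'n vec_R set" where
  "nat_span D = {\<Sum>\<alpha>\<in>D. real (c \<alpha>) *\<^sub>R \<alpha> | c :: 'n vec_R \<Rightarrow> nat. True}"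

definition root_base :: "'n::finite vec_R set \<Rightarrow> 'n vec_R set \<Rightarrow> bool" where
  "root_base R D \<longleftrightarrow>
     D \<subseteq> R \<and> independent D \<and> (\<forall>\<beta>\<in>R. \<beta> \<in> nat_span D \<or> - \<beta> \<in> nat_span D)"

definition positive_roots :: "'n::finite vec_R set \<Rightarrow> 'n vec_R set \<Rightarrow> 'n vec_R set" where
  "positive_roots R D = R \<inter> nat_span D"

definition highest_root :: "'n::finite vec_R set \<Rightarrow> 'n vec_R set \<Rightarrow> 'n vec_R" where
  "highest_root R D = (THE \<theta>. \<theta> \<in> R \<and> (\<forall>\<beta>\<in>R. \<theta> - \<beta> \<in> nat_span D))"

definition half_sum_positive :: "'n::finite vec_R set \<Rightarrow> 'n vec_R set \<Rightarrow> 'n vec_R" where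
  "half_sum_positive R D = (1/2) *\<^sub>R (\<Sum>\<alpha>\<in>positive_roots R D. \<alpha>)"

definition dual_Coxeter_number :: "'n::finite vec_R set \<Rightarrow> 'n vec_R set \<Rightarrow> real" where
  "dual_Coxeter_number R D = 1 + half_sum_positive R D \<bullet> coroot (highest_root R D)"

inductive_set weyl_group :: "'n::finite vec_R set \<Rightarrow> ('n vec_R \<Rightarrow> 'n vec_R) set"
  for R :: "'n::finite vec_R set"
  where
    id: "id \<in> weyl_group R"
  | reflection: "w \<in> weyl_group R \<Longrightarrow> \<alpha> \<in> R \<Longrightarrow> reflection \<alpha> \<circ> w \<in> weyl_group R"

definition longest_element ::
    "'n::finite vec_R set \<Rightarrow> 'n vec_R set \<Rightarrow> 'n vec_R \<Rightarrow> 'n vec_R" where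
  "longest_element R D =
     (THE w. w \<in> weyl_group R \<and> w ` positive_roots R D = uminus ` positive_roots R D)"

definition dual_weight :: "'n::finite vec_R set \<Rightarrow> 'n vec_R set \<Rightarrow> 'n vec_R \<Rightarrow> 'n vec_R" where
  "dual_weight R D \<mu> = - longest_element R D \<mu>"

definition dominant_weights :: "'n::finite vec_R set \<Rightarrow> 'n vec_R set \<Rightarrow> 'n vec_R set" where
  "dominant_weights R D =
     {\<mu>. (\<forall>\<alpha>\<in>R. \<mu> \<bullet> coroot \<alpha> \<in> \<int>) \<and> (\<forall>\<alpha>\<in>positive_roots R D. 0 \<le> \<mu> \<bullet> coroot \<alpha>)}"

definition level_weights :: "'n::finite vec_R set \<Rightarrow> 'n vec_R set \<Rightarrow> nat \<Rightarrow> 'n vec_R set" where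
  "level_weights R D k = {\<mu> \<in> dominant_weights R D. \<mu> \<bullet> highest_root R D \<le> real k}"

definition coroot_lattice :: "'n::finite vec_R set \<Rightarrow> 'n vec_R set" where
  "coroot_lattice R = {\<Sum>\<alpha>\<in>R. real_of_int (c \<alpha>) *\<^sub>R coroot \<alpha> | c :: 'n vec_R \<Rightarrow> int. True}"

text \<open>
  A point \<open>f = e\<^sup>2\<^sup>\<pi>\<^sup>i\<^sup>x\<close> of the compact torus is the coset of \<open>x\<close> modulo the coroot lattice; \<open>torus_log f\<close>
  is an arbitrary such \<open>x\<close>.  The functions of \<open>f\<close> below do not depend on this choice, and a Weyl
  group element \<open>w\<close> acts on cosets by \<open>f \<mapsto> w ` f\<close>.
\<close>

definition compact_torus :: "'n::finite vec_R set \<Rightarrow> 'n vec_R set set" where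
  "compact_torus R = UNIV // {(x, y). x - y \<in> coroot_lattice R}"

definition torus_log :: "'n::finite vec_R set \<Rightarrow> 'n vec_R" where
  "torus_log f = (SOME x. x \<in> f)"

definition torus_char :: "'n::finite vec_R \<Rightarrow> 'n vec_R set \<Rightarrow> complex" where
  "torus_char \<mu> f = exp (2 * pi * \<i> * (\<mu> \<bullet> torus_log f))"

definition F_group :: "'n::finite vec_R set \<Rightarrow> 'n vec_R set \<Rightarrow> nat \<Rightarrow> 'n vec_R set set" where
  "F_group R D k =
     {f \<in> compact_torus R.
        \<forall>y\<in>coroot_lattice R. (real k + dual_Coxeter_number R D) * (torus_log f \<bullet> y) \<in> \<int>}"

text \<open>The exponent \<open>\<alpha>(y)\<close> is an integer because \<open>y\<close> lies in the coroot lattice.\<close>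

definition F_rho ::
    "'n::finite vec_R set \<Rightarrow> 'n vec_R set \<Rightarrow> nat \<Rightarrow> real \<Rightarrow> 'n vec_R set set" where
  "F_rho R D k t =
     {f \<in> compact_torus R. \<forall>y\<in>coroot_lattice R.
        exp (2 * pi * \<i> * ((real k + dual_Coxeter_number R D) * (torus_log f \<bullet> y))) *
        (\<Prod>\<alpha>\<in>positive_roots R D.
           ((1 - t * torus_char (- \<alpha>) f) / (1 - t * torus_char \<alpha> f)) powi \<lfloor>\<alpha> \<bullet> y\<rfloor>) = 1}"

definition F_rho_reg ::
    "'n::finite vec_R set \<Rightarrow> 'n vec_R set \<Rightarrow> nat \<Rightarrow> real \<Rightarrow> 'n vec_R set set" where
  "F_rho_reg R D k t = {f \<in> F_rho R D k t. \<forall>w\<in>weyl_group R. w ` f = f \<longrightarrow> w = id}"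

definition weyl_orbits ::
    "'n::finite vec_R set \<Rightarrow> 'n vec_R set set \<Rightarrow> 'n vec_R set set set" where
  "weyl_orbits R S = (\<lambda>f. (\<lambda>w. w ` f) ` weyl_group R) ` S"

definition H_dagger ::
    "'n::finite vec_R set \<Rightarrow> 'n vec_R set \<Rightarrow> nat \<Rightarrow> real \<Rightarrow> 'n vec_R set \<Rightarrow> 'n vec_R \<Rightarrow> 'n vec_R" where
  "H_dagger R D k t f =
     (THE H. linear H \<and>
        (\<forall>y y'. complex_of_real ((real k + dual_Coxeter_number R D) * (H y \<bullet> y')) =
           complex_of_real ((real k + dual_Coxeter_number R D) * (y \<bullet> y')) +
           (\<Sum>\<alpha>\<in>R. t * torus_char \<alpha> f / (1 - t * torus_char \<alpha> f) * (\<alpha> \<bullet> y) * (\<alpha> \<bullet> y'))))"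

lemma H_dagger_well_defined:
  assumes neg: "uminus ` R = R"
    and kh: "real k + dual_Coxeter_number R D \<noteq> 0"
  shows "linear (H_dagger R D k t f)" (is "?A")
    and "complex_of_real ((real k + dual_Coxeter_number R D) * (H_dagger R D k t f y \<bullet> y')) =
           complex_of_real ((real k + dual_Coxeter_number R D) * (y \<bullet> y')) +
           (\<Sum>\<alpha>\<in>R. t * torus_char \<alpha> f / (1 - t * torus_char \<alpha> f) * (\<alpha> \<bullet> y) * (\<alpha> \<bullet> y'))" (is "?B y y'")
proof -
  let ?c = "real k + dual_Coxeter_number R D"
  let ?z = "\<lambda>\<alpha>. t * torus_char \<alpha> f / (1 - t * torus_char \<alpha> f)"
  define H where "H = (\<lambda>y. y + (1/?c) *\<^sub>R (\<Sum>\<alpha>\<in>R. (Re (?z \<alpha>) * (\<alpha> \<bullet> y)) *\<^sub>R \<alpha>))"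
  let ?P = "\<lambda>H. linear H \<and> (\<forall>y y'. complex_of_real (?c * (H y \<bullet> y')) =
           complex_of_real (?c * (y \<bullet> y')) + (\<Sum>\<alpha>\<in>R. ?z \<alpha> * (\<alpha> \<bullet> y) * (\<alpha> \<bullet> y')))"
  have cnjz: "?z (-\<alpha>) = cnj (?z \<alpha>)" for \<alpha>
    by (simp add: torus_char_def exp_cnj)
  have sumre: "(\<Sum>\<alpha>\<in>R. ?z \<alpha> * (\<alpha> \<bullet> y) * (\<alpha> \<bullet> y')) = complex_of_real (\<Sum>\<alpha>\<in>R. Re (?z \<alpha>) * (\<alpha> \<bullet> y) * (\<alpha> \<bullet> y'))"
    (is "?S = _") for y y'
  proof -
    have "?S = (\<Sum>\<alpha>\<in>R. ?z (-\<alpha>) * ((-\<alpha>) \<bullet> y) * ((-\<alpha>) \<bullet> y'))"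
      by (rule sum.reindex_bij_witness[where i=uminus and j=uminus]) (use neg in auto)
    also have "\<dots> = cnj ?S" by (simp only: cnjz) simp
    finally have S: "?S = cnj ?S" .
    have "s = complex_of_real (Re s)" if "s = cnj s" for s
      using that by (simp add: complex_eq_iff)
    note this[OF S]
    moreover have "Re ?S = (\<Sum>\<alpha>\<in>R. Re (?z \<alpha>) * (\<alpha> \<bullet> y) * (\<alpha> \<bullet> y'))"
      by (simp only: Re_sum Re_complex_of_real times_complex.sel Im_complex_of_real) simp
    ultimately show ?thesis by (simp only:)
  qed
  have lin: "linear H" unfolding H_def
    by (rule linearI)
       (auto simp: inner_simps algebra_simps sum.distrib scaleR_sum_right scaleR_add_left)
  have eq: "?c * (H y \<bullet> y') = ?c * (y \<bullet> y') + (\<Sum>\<alpha>\<in>R. Re (?z \<alpha>) * (\<alpha> \<bullet> y) * (\<alpha> \<bullet> y'))" for y y'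
    using kh unfolding H_def inner_add_left inner_scaleR_left inner_sum_left distrib_left by simp
  have P: "?P H" using lin by (simp only: sumre eq of_real_add) simp
  have uniq: "G = H" if "?P G" for G
  proof
    fix y
    have "G y \<bullet> y' = H y \<bullet> y'" for y'
    proof -
      have "complex_of_real (?c * (G y \<bullet> y')) = complex_of_real (?c * (H y \<bullet> y'))"
        by (simp only: that P)
      then show ?thesis using kh by (simp only: of_real_eq_iff mult_cancel_left) blast
    qed
    then show "G y = H y" by (metis inner_eq_zero_iff inner_diff_left right_minus_eq)
  qed
  have "?P (H_dagger R D k t f)" unfolding H_dagger_def
    by (rule theI[of ?P, OF P]) (use uniq in blast)
  then show ?A "?B y y'" by auto
qed

definition theta ::
    "'n::finite vec_R set \<Rightarrow> 'n vec_R set \<Rightarrow> nat \<Rightarrow> real \<Rightarrow> 'n vec_R set \<Rightarrow> complex" where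
  "theta R D k t f =
     (1 - t) ^ CARD('n) * (1 / card (F_group R D k)) *
     ((\<Prod>\<alpha>\<in>R. (1 - torus_char \<alpha> f) * (1 - t * torus_char \<alpha> f)) /
      complex_of_real (det (matrix (H_dagger R D k t f))))"

definition Theta ::
    "'n::finite vec_R set \<Rightarrow> 'n vec_R set \<Rightarrow> 'n vec_R \<Rightarrow> real \<Rightarrow> 'n vec_R set \<Rightarrow> complex" where
  "Theta R D \<mu> t f =
     (\<Sum>w\<in>weyl_group R. torus_char (w \<mu>) f /
        (\<Prod>\<alpha>\<in>positive_roots R D. (1 - torus_char (- w \<alpha>) f) * (1 - t * torus_char (w \<alpha>) f)))"

text \<open>
  In \<open>verlinde R D k g \<mu>s t\<close> the number of insertions is the length of the list \<open>\<mu>s\<close>.  The summand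
  is invariant under the Weyl group, so any element of the orbit may be used to evaluate it.
\<close>

definition verlinde ::
    "'n::finite vec_R set \<Rightarrow> 'n vec_R set \<Rightarrow> nat \<Rightarrow> nat \<Rightarrow> 'n vec_R list \<Rightarrow> real \<Rightarrow> complex" where
  "verlinde R D k g \<mu>s t =
     (\<Sum>orb\<in>weyl_orbits R (F_rho_reg R D k t).
        let f = (SOME f. f \<in> orb)
        in theta R D k t f powi (1 - int g) * (\<Prod>i<length \<mu>s. Theta R D (\<mu>s ! i) t f))"

definition verlinde_norm ::
    "'n::finite vec_R set \<Rightarrow> 'n vec_R set \<Rightarrow> nat \<Rightarrow> 'n vec_R \<Rightarrow> real \<Rightarrow> complex" where
  "verlinde_norm R D k \<mu> t = inverse (verlinde R D k 0 [\<mu>, dual_weight R D \<mu>] t)"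

end

theory Submission
  imports Defs
begin

text \<open>
  Put \<open>c = k + h\<close>.  Taking arguments in the Bethe equations turns them into the condition that
  \<open>Phi x = c x + \<dots>\<close> is a weight, where for small \<open>t\<close> the map \<open>Phi\<close> is a Weyl-equivariant
  diffeomorphism with derivative \<open>c\<close> times \<open>H_dagger\<close>.  By Poisson summation, a sum over the
  solutions weighted by \<open>1 / det H_dagger\<close> is therefore controlled by the integrals over the torus of
  the summand against the characters \<open>exp (2 \<pi> i (Phi x \<bullet> y))\<close> with \<open>y\<close> in the coroot lattice.

  For \<open>\<Theta>\<^sub>\<kappa>\<close> times the conjugate of \<open>\<Theta>\<^sub>\<mu>\<close>, all denominators \<open>1 - e\<^sup>\<alpha>\<close> cancel and the
  integrand is a sum of products of geometric series whose frequencies can be read off; since weights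
  of level \<open>k\<close> lie in \<open>k\<close> times the Voronoi cell of the coroot lattice, frequency zero occurs only for
  \<open>\<kappa> = \<mu>\<close>.  So the \<open>\<Theta>\<^sub>\<kappa>\<close> are orthogonal on the regular orbits with weight \<open>\<theta>\<^sub>t\<close>.  There are at most
  as many regular orbits as weights of level \<open>k\<close>, hence orthogonality of the rows \<open>\<Theta>\<^sub>\<kappa>\<close> implies that of
  the columns, and this dual orthogonality is the gluing law.
\<close>

section \<open>Root systems and their Weyl groups\<close>

text \<open>The level comes out exactly because two shifts cancel. Expanding the Bethe factors costs
  \<open>h *\<^sub>R y\<close>, the sum of \<open>(\<alpha> \<bullet> y) *\<^sub>R \<alpha>\<close>
  over the positive roots, and the quotient of denominators costs \<open>w rho - w' rho\<close>.
  Both disappear against \<open>(k + h) *\<^sub>R y\<close> and the shifts of the weights by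
  \<open>rho\<close>, which leaves the frequency
  \<open>w \<kappa> - w' \<mu> + k *\<^sub>R y + X\<close>. About \<open>X\<close> only one-sided
  sign information is available, so the argument assumes
  \<open>norm \<mu> \<le> norm \<kappa>\<close> and conjugation supplies the other case. Singular
  solutions of the Bethe equations may be added to the sums, since the antisymmetric numerators
  vanish there. A dual weight acts as complex conjugation, so \<open>verlinde_norm\<close> is the
  inverse of a squared norm. That this norm is not zero is a separate matter: at
  \<open>t = 0\<close> it follows from the independence of characters, and it persists for small
  \<open>t\<close> because a solution moves continuously with \<open>t\<close>. Smallness of
  \<open>t\<close> also keeps \<open>Phi\<close> close to a dilation.\<close>

lemma coroot_inner: "x \<bullet> coroot \<alpha> = 2 * (x \<bullet> \<alpha>) / (\<alpha> \<bullet> \<alpha>)"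
  by (simp add: coroot_def)

lemma reflection_alt: "reflection \<alpha> x = x - (x \<bullet> coroot \<alpha>) *\<^sub>R \<alpha>"
  by (simp add: reflection_def coroot_def inner_commute)

lemma linear_reflection: "linear (reflection \<alpha>)"
  unfolding reflection_def by (rule linearI) (auto simp: inner_simps algebra_simps)

lemma reflection_self: "\<alpha> \<noteq> 0 \<Longrightarrow> reflection \<alpha> \<alpha> = - \<alpha>"
  by (simp add: reflection_def coroot_def scaleR_2)

lemma reflection_inner:
  assumes "\<alpha> \<noteq> 0" shows "reflection \<alpha> x \<bullet> reflection \<alpha> y = x \<bullet> y"
  using assms by (simp add: reflection_def coroot_def inner_simps inner_commute field_simps)

lemma reflection_reflection:
  assumes "\<alpha> \<noteq> 0" shows "reflection \<alpha> (reflection \<alpha> x) = x"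
  using assms by (simp add: reflection_def coroot_def inner_simps field_simps)

lemma reflection_comp: "\<alpha> \<noteq> 0 \<Longrightarrow> reflection \<alpha> \<circ> reflection \<alpha> = id"
  by (auto simp: reflection_reflection)

lemma reflection_adjoint: "\<alpha> \<noteq> 0 \<Longrightarrow> reflection \<alpha> x \<bullet> y = x \<bullet> reflection \<alpha> y"
  by (metis reflection_inner reflection_reflection)

lemma coroot_uminus [simp]: "coroot (- \<alpha>) = - coroot \<alpha>"
  by (simp add: coroot_def)

lemma reflection_fixed_iff:
  assumes "\<alpha> \<noteq> 0" shows "reflection \<alpha> x = x \<longleftrightarrow> \<alpha> \<bullet> x = 0"
  using assms by (auto simp: reflection_def coroot_def)

lemma reflection_orthogonal_conj:
  assumes "linear w" "\<And>x y. w x \<bullet> w y = x \<bullet> y"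
  shows "reflection (w \<alpha>) (w x) = w (reflection \<alpha> x)"
  using assms by (simp add: reflection_def coroot_def linear_diff linear_scale)

lemma coroot_orthogonal:
  assumes "linear w" "\<And>x y. w x \<bullet> w y = x \<bullet> y"
  shows "coroot (w \<alpha>) = w (coroot \<alpha>)"
  using assms by (simp add: coroot_def linear_scale)

lemma nat_span_sum_mem: "(\<Sum>\<alpha>\<in>D. real (c \<alpha>) *\<^sub>R \<alpha>) \<in> nat_span D"
  by (auto simp: nat_span_def)

lemma nat_span_0: "0 \<in> nat_span D"
  using nat_span_sum_mem[of "\<lambda>_. 0" D] by simp

lemma nat_span_base: "finite D \<Longrightarrow> a \<in> D \<Longrightarrow> a \<in> nat_span D"
  using nat_span_sum_mem[of "\<lambda>x. if x = a then 1 else 0" D]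
  by (simp add: if_distrib[where f=real] if_distrib[where f="\<lambda>c. c *\<^sub>R _"] cong: if_cong)

lemma nat_span_add: "x \<in> nat_span D \<Longrightarrow> y \<in> nat_span D \<Longrightarrow> x + y \<in> nat_span D"
proof -
  assume "x \<in> nat_span D" "y \<in> nat_span D"
  then obtain c d :: "_ \<Rightarrow> nat" where "x = (\<Sum>\<alpha>\<in>D. real (c \<alpha>) *\<^sub>R \<alpha>)" "y = (\<Sum>\<alpha>\<in>D. real (d \<alpha>) *\<^sub>R \<alpha>)"
    by (auto simp: nat_span_def)
  then have "x + y = (\<Sum>\<alpha>\<in>D. real (c \<alpha> + d \<alpha>) *\<^sub>R \<alpha>)"
    by (simp add: scaleR_add_left sum.distrib)
  then show ?thesis using nat_span_sum_mem[of "\<lambda>a. c a + d a" D] by (simp only:)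
qed

lemma nat_span_inner_nonneg:
  assumes "x \<in> nat_span D" "\<And>a. a \<in> D \<Longrightarrow> 0 \<le> v \<bullet> a" shows "0 \<le> v \<bullet> x"
  using assms by (auto simp: nat_span_def inner_sum_right intro!: sum_nonneg)

lemma weyl_comp: "w \<in> weyl_group R \<Longrightarrow> v \<in> weyl_group R \<Longrightarrow> w \<circ> v \<in> weyl_group R"
  by (induction rule: weyl_group.induct) (auto simp: o_assoc[symmetric] intro: weyl_group.intros)

lemma weyl_reflection: "\<alpha> \<in> R \<Longrightarrow> reflection \<alpha> \<in> weyl_group R"
  using weyl_group.reflection[OF weyl_group.id] by fastforce

locale root_system_base =
  fixes R D :: "(real ^ 'n::finite) set"
  assumes root_system: "root_system R" and root_base: "root_base R D"
begin

abbreviation W where "W \<equiv> weyl_group R"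
abbreviation Pos where "Pos \<equiv> positive_roots R D"

lemma finite_R: "finite R" and span_R: "span R = UNIV" and zero_notin: "0 \<notin> R"
  and refl_R: "\<alpha> \<in> R \<Longrightarrow> reflection \<alpha> ` R = R"
  and cartan_int: "\<alpha> \<in> R \<Longrightarrow> \<beta> \<in> R \<Longrightarrow> \<beta> \<bullet> coroot \<alpha> \<in> \<int>"
  and reduced: "\<alpha> \<in> R \<Longrightarrow> c *\<^sub>R \<alpha> \<in> R \<Longrightarrow> c = 1 \<or> c = -1"
  using root_system by (auto simp: root_system_def)

lemma D_sub: "D \<subseteq> R" and indep_D: "independent D"
  and pos_or_neg_span: "\<beta> \<in> R \<Longrightarrow> \<beta> \<in> nat_span D \<or> - \<beta> \<in> nat_span D"
  using root_base by (auto simp: root_base_def)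

lemma finite_D: "finite D" using D_sub finite_R finite_subset by blast

lemma nz: "\<alpha> \<in> R \<Longrightarrow> \<alpha> \<noteq> 0" using zero_notin by auto

lemma norm_pos: "\<alpha> \<in> R \<Longrightarrow> 0 < \<alpha> \<bullet> \<alpha>" using nz by auto

lemma refl_mem: "\<alpha> \<in> R \<Longrightarrow> \<beta> \<in> R \<Longrightarrow> reflection \<alpha> \<beta> \<in> R" using refl_R by blast

lemma uminus_mem: "\<alpha> \<in> R \<Longrightarrow> - \<alpha> \<in> R"
  by (metis refl_mem reflection_self nz)

lemma uminus_R: "uminus ` R = R"
  using uminus_mem by (force simp: image_iff intro: bexI[of _ "- _"])

text \<open>The inductive definition only multiplies by reflections on the left, so inverses have to
  be carried along in the same induction: if \<open>v\<close> inverts \<open>w\<close>, then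
  \<open>v \<circ> reflection \<alpha>\<close> inverts
  \<open>reflection \<alpha> \<circ> w\<close>.\<close>

lemma W_props:
  assumes "w \<in> W"
  shows "linear w \<and> (\<forall>x y. w x \<bullet> w y = x \<bullet> y) \<and> w ` R = R \<and>
    (\<exists>v\<in>W. w \<circ> v = id \<and> v \<circ> w = id)"
  using assms
proof (induction)
  case id
  have "linear (id :: real^'n \<Rightarrow> real^'n)" by (rule linear_id)
  moreover have "\<exists>v\<in>W. id \<circ> v = id \<and> v \<circ> id = id" by (rule bexI[OF _ weyl_group.id]) simp
  ultimately show ?case by (metis id_apply image_id)
next
  case (reflection w \<alpha>)
  then obtain v where v: "v \<in> W" "w \<circ> v = id" "v \<circ> w = id" by blast
  have s: "reflection \<alpha> \<circ> reflection \<alpha> = id" using reflection nz reflection_comp by blast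
  have 1: "(reflection \<alpha> \<circ> w) \<circ> (v \<circ> reflection \<alpha>) = id"
    using v s by (metis comp_id fun.map_comp o_assoc)
  have 2: "(v \<circ> reflection \<alpha>) \<circ> (reflection \<alpha> \<circ> w) = id"
    using v s by (metis comp_id fun.map_comp o_assoc)
  have "(reflection \<alpha> \<circ> w) ` R = R" using reflection refl_R by (metis image_comp)
  moreover have "linear (reflection \<alpha> \<circ> w)" using reflection linear_reflection linear_compose by blast
  moreover have "v \<circ> reflection \<alpha> \<in> W" using v reflection weyl_comp weyl_reflection by blast
  moreover have "\<forall>x y. (reflection \<alpha> \<circ> w) x \<bullet> (reflection \<alpha> \<circ> w) y = x \<bullet> y"
    using reflection.IH reflection_inner[OF nz[OF reflection.hyps(2)]] by simp
  ultimately show ?case using 1 2 by blast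
qed

lemma W_linear: "w \<in> W \<Longrightarrow> linear w" and W_inner: "w \<in> W \<Longrightarrow> w x \<bullet> w y = x \<bullet> y"
  and W_R: "w \<in> W \<Longrightarrow> w ` R = R"
  using W_props by blast+

lemma W_inv: assumes "w \<in> W" shows "inv w \<in> W" "w (inv w x) = x" "inv w (w x) = x" "bij w"
proof -
  obtain v where v: "v \<in> W" "w \<circ> v = id" "v \<circ> w = id" using assms W_props by blast
  then have "inv w = v" by (simp add: inv_unique_comp)
  then show "inv w \<in> W" "w (inv w x) = x" "inv w (w x) = x"
    using v by (simp_all add: pointfree_idE)
  show "bij w" using v o_bij by blast
qed

lemma W_mem: "w \<in> W \<Longrightarrow> \<beta> \<in> R \<Longrightarrow> w \<beta> \<in> R" using W_R by blast

lemma W_adj: "w \<in> W \<Longrightarrow> w x \<bullet> y = x \<bullet> inv w y"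
  by (metis W_inner W_inv(2))

lemma W_adj': "w \<in> W \<Longrightarrow> x \<bullet> w y = inv w x \<bullet> y"
  by (metis W_inner W_inv(2))

lemma W_simps:
  assumes "w \<in> W"
  shows "w 0 = 0" "w (- x) = - w x" "w (x + y) = w x + w y" "w (x - y) = w x - w y" "w (c *\<^sub>R x) = c *\<^sub>R w x"
  using W_linear[OF assms]
  by (auto simp: linear_0 linear_neg linear_add linear_diff linear_scale)

lemma W_coroot: "w \<in> W \<Longrightarrow> coroot (w \<alpha>) = w (coroot \<alpha>)"
  by (simp add: coroot_orthogonal W_linear W_inner)

lemma W_reflection: "w \<in> W \<Longrightarrow> reflection (w \<alpha>) (w x) = w (reflection \<alpha> x)"
  by (simp add: reflection_orthogonal_conj W_linear W_inner)

lemma W_inj: "w \<in> W \<Longrightarrow> w x = w y \<longleftrightarrow> x = y" by (metis W_inv(3))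

text \<open>Since \<open>R\<close> spans, a linear map is determined by its values on
  \<open>R\<close>, and a Weyl group element maps this finite set to itself.\<close>

lemma finite_W: "finite W"
proof -
  have "inj_on (\<lambda>w. restrict w R) W"
  proof (rule inj_onI)
    fix v w assume vw: "v \<in> W" "w \<in> W" "restrict v R = restrict w R"
    show "v = w"
    proof
      fix x
      have "x \<in> span R" by (simp add: span_R)
      moreover have "v b = w b" if "b \<in> R" for b using vw(3) that by (metis restrict_apply')
      ultimately show "v x = w x" using vw W_linear linear_eq_on_span[of v w R] by blast
    qed
  qed
  moreover have "(\<lambda>w. restrict w R) ` W \<subseteq> R \<rightarrow>\<^sub>E R" using W_mem by auto
  moreover have "finite (R \<rightarrow>\<^sub>E R)" using finite_R by (intro finite_PiE)
  ultimately show ?thesis by (metis finite_imageD finite_subset)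
qed

lemma span_D: "span D = UNIV"
proof -
  have "nat_span D \<subseteq> span D" unfolding nat_span_def
    by (auto intro!: span_sum span_scale intro: span_base)
  then have "R \<subseteq> span D" using pos_or_neg_span span_neg by fastforce
  then show ?thesis using span_R by (metis span_mono span_span top.extremum_unique)
qed

lemma eqI_inner_D: assumes "\<And>a. a \<in> D \<Longrightarrow> x \<bullet> a = y \<bullet> a" shows "x = y"
proof -
  have "(x - y) \<bullet> z = 0" for z
  proof -
    have "z \<in> span D" by (simp add: span_D)
    then show ?thesis
      by (induction rule: span_induct_alt) (auto simp: inner_simps assms)
  qed
  from this[of "x - y"] show ?thesis by simp
qed

lemma coeff_unique:
  assumes "(\<Sum>a\<in>D. c a *\<^sub>R a) = (\<Sum>a\<in>D. d a *\<^sub>R a)" "a \<in> D" shows "c a = d a"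
proof -
  have "(\<Sum>a\<in>D. (c a - d a) *\<^sub>R a) = 0" using assms by (simp add: scaleR_left_diff_distrib sum_subtractf)
  then have "c a - d a = 0"
    using assms(2) independentD[OF indep_D finite_D order_refl, of "\<lambda>a. c a - d a" a] by blast
  then show ?thesis by simp
qed

lemma Pos_sub: "Pos \<subseteq> R" and finite_Pos: "finite Pos"
  using finite_R by (auto simp: positive_roots_def)

lemma D_Pos: "a \<in> D \<Longrightarrow> a \<in> Pos"
  using D_sub nat_span_base finite_D by (auto simp: positive_roots_def)

lemma Pos_coeffs:
  assumes "\<beta> \<in> Pos" obtains c :: "_ \<Rightarrow> nat" where "\<beta> = (\<Sum>a\<in>D. real (c a) *\<^sub>R a)"
  using assms by (auto simp: positive_roots_def nat_span_def)

lemma Pos_neg: "\<beta> \<in> Pos \<Longrightarrow> - \<beta> \<notin> Pos"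
proof
  assume b: "\<beta> \<in> Pos" "- \<beta> \<in> Pos"
  obtain c :: "_ \<Rightarrow> nat" where c: "\<beta> = (\<Sum>a\<in>D. real (c a) *\<^sub>R a)" using Pos_coeffs b by blast
  obtain d :: "_ \<Rightarrow> nat" where d: "-\<beta> = (\<Sum>a\<in>D. real (d a) *\<^sub>R a)" using Pos_coeffs b by blast
  have "(\<Sum>a\<in>D. (real (c a) + real (d a)) *\<^sub>R a) = (\<Sum>a\<in>D. 0 *\<^sub>R a)"
    using c d by (simp add: scaleR_add_left sum.distrib flip: c d)
  from coeff_unique[OF this] have "\<forall>a\<in>D. c a = 0" by fastforce
  then have "\<beta> = 0" using c by simp
  then show False using b zero_notin Pos_sub by blast
qed

lemma Pos_cases: "\<beta> \<in> R \<Longrightarrow> \<beta> \<in> Pos \<or> - \<beta> \<in> Pos"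
  using pos_or_neg_span uminus_mem by (auto simp: positive_roots_def)

lemma R_eq: "R = Pos \<union> uminus ` Pos"
  using Pos_cases Pos_sub uminus_mem by force

lemma neg_Pos_iff: "\<beta> \<in> R \<Longrightarrow> - \<beta> \<in> Pos \<longleftrightarrow> \<beta> \<notin> Pos"
  using Pos_neg Pos_cases by auto

text \<open>\<open>reflection a\<close> changes only the coefficient of \<open>a\<close>. If the
  image were negative, all other coefficients of \<open>\<beta>\<close> would have to vanish, and
  \<open>\<beta>\<close> would be a positive multiple of \<open>a\<close>, hence \<open>a\<close>
  itself because \<open>R\<close> is reduced.\<close>

lemma simple_refl_pos:
  assumes a: "a \<in> D" and b: "\<beta> \<in> Pos" "\<beta> \<noteq> a" shows "reflection a \<beta> \<in> Pos"
proof (rule ccontr)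
  let ?g = "reflection a \<beta>"
  assume n: "?g \<notin> Pos"
  have bR: "\<beta> \<in> R" using b Pos_sub by blast
  then have gR: "?g \<in> R" using a D_sub refl_mem by blast
  then have "- ?g \<in> Pos" using n Pos_cases by blast
  then obtain d :: "_ \<Rightarrow> nat" where d: "- ?g = (\<Sum>x\<in>D. real (d x) *\<^sub>R x)" using Pos_coeffs by blast
  obtain c :: "_ \<Rightarrow> nat" where c: "\<beta> = (\<Sum>x\<in>D. real (c x) *\<^sub>R x)" using Pos_coeffs b by blast
  define m where "m = \<beta> \<bullet> coroot a"
  have "(\<Sum>x\<in>D. (real (c x) + real (d x)) *\<^sub>R x) = \<beta> - ?g"
    using c d by (simp add: scaleR_add_left sum.distrib flip: c d)
  also have "\<dots> = (\<Sum>x\<in>D. (if x = a then m else 0) *\<^sub>R x)"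
    using a finite_D by (simp add: reflection_alt m_def if_distrib[where f="\<lambda>c. c *\<^sub>R _"] cong: if_cong)
  finally have e: "real (c x) + real (d x) = (if x = a then m else 0)" if "x \<in> D" for x
    using coeff_unique[of "\<lambda>x. real (c x) + real (d x)" "\<lambda>x. if x = a then m else 0" x] that by blast
  have "c x = 0" if "x \<in> D" "x \<noteq> a" for x using e[OF that(1)] that by simp
  then have "\<beta> = (\<Sum>x\<in>D. (if x = a then real (c a) else 0) *\<^sub>R x)"
    unfolding c by (intro sum.cong) auto
  also have "\<dots> = real (c a) *\<^sub>R a" using a finite_D by (simp add: if_distrib[where f="\<lambda>c. c *\<^sub>R _"] cong: if_cong)
  finally have "\<beta> = real (c a) *\<^sub>R a" .
  with reduced[of a "real (c a)"] a D_sub bR have "real (c a) = 1 \<or> real (c a) = -1" by auto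
  with \<open>\<beta> = real (c a) *\<^sub>R a\<close> b show False by auto
qed

lemma simple_refl_Pos:
  assumes a: "a \<in> D" shows "reflection a ` (Pos - {a}) = Pos - {a}"
proof -
  have a0: "a \<noteq> 0" using a D_sub nz by blast
  have sub: "reflection a ` (Pos - {a}) \<subseteq> Pos - {a}"
  proof
    fix g assume "g \<in> reflection a ` (Pos - {a})"
    then obtain b where b: "b \<in> Pos" "b \<noteq> a" "g = reflection a b" by blast
    have "g \<noteq> a"
    proof
      assume "g = a"
      then have "b = - a" using b a0 by (metis reflection_reflection reflection_self)
      then show False using b a D_Pos Pos_neg by blast
    qed
    then show "g \<in> Pos - {a}" using b simple_refl_pos a by blast
  qed
  show ?thesis
  proof
    show "Pos - {a} \<subseteq> reflection a ` (Pos - {a})"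
      using image_mono[OF sub, of "reflection a"] by (simp add: image_image reflection_reflection[OF a0])
  qed (rule sub)
qed

definition rho where "rho = half_sum_positive R D"

text \<open>The simple reflection permutes the positive roots other than \<open>a\<close> and
  negates \<open>a\<close>, so the sum of all positive roots drops by
  \<open>2 *\<^sub>R a\<close>.\<close>

lemma rho_refl: assumes a: "a \<in> D" shows "reflection a rho = rho - a"
proof -
  have a0: "a \<noteq> 0" using a D_sub nz by blast
  have L: "linear (reflection a)" by (rule linear_reflection)
  have "(\<Sum>\<alpha>\<in>Pos. reflection a \<alpha>) = reflection a a + (\<Sum>\<alpha>\<in>Pos - {a}. reflection a \<alpha>)"
    using D_Pos[OF a] finite_Pos by (simp add: sum.remove)
  also have "(\<Sum>\<alpha>\<in>Pos - {a}. reflection a \<alpha>) = \<Sum>(reflection a ` (Pos - {a}))"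
    by (rule sum.reindex_cong[symmetric, where l="reflection a"]) (auto simp: a0 intro!: inj_on_inverseI[of _ "reflection a"] reflection_reflection)
  also have "\<dots> = \<Sum>(Pos - {a})" by (simp add: simple_refl_Pos[OF a])
  also have "\<dots> = \<Sum>Pos - a" using D_Pos[OF a] finite_Pos by (simp add: sum_diff1)
  finally have "reflection a (\<Sum>Pos) = \<Sum>Pos - 2 *\<^sub>R a"
    using a0 by (simp add: reflection_self linear_sum[OF L] scaleR_2)
  then show ?thesis by (simp add: rho_def half_sum_positive_def linear_scale[OF L] scaleR_diff_right)
qed

lemma rho_coroot: assumes "a \<in> D" shows "rho \<bullet> coroot a = 1"
proof -
  have "(rho \<bullet> coroot a) *\<^sub>R a = a" using rho_refl[OF assms] by (simp add: reflection_alt)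
  then show ?thesis using assms D_sub nz by (metis scaleR_cancel_right scaleR_one subsetD)
qed

lemma rho_simple: assumes "a \<in> D" shows "rho \<bullet> a > 0"
proof -
  have a: "a \<bullet> a > 0" using assms D_sub norm_pos by blast
  have "2 * (rho \<bullet> a) / (a \<bullet> a) = 1" using rho_coroot[OF assms] by (simp only: coroot_inner)
  then have "2 * (rho \<bullet> a) = a \<bullet> a" using a by (simp add: divide_eq_1_iff)
  then show ?thesis using a by linarith
qed

lemma strict_dom_pos:
  assumes x: "\<And>a. a \<in> D \<Longrightarrow> 0 < x \<bullet> a" and b: "\<beta> \<in> Pos" shows "0 < x \<bullet> \<beta>"
proof -
  obtain c :: "_ \<Rightarrow> nat" where c: "\<beta> = (\<Sum>a\<in>D. real (c a) *\<^sub>R a)" using Pos_coeffs b by blast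
  have nn: "0 \<le> x \<bullet> (real (c a) *\<^sub>R a)" if "a \<in> D" for a
    using x[OF that] by simp
  have "x \<bullet> \<beta> \<noteq> 0"
  proof
    assume "x \<bullet> \<beta> = 0"
    then have "\<forall>a\<in>D. x \<bullet> (real (c a) *\<^sub>R a) = 0"
      using nn finite_D unfolding c inner_sum_right by (subst (asm) sum_nonneg_eq_0_iff) auto
    then have "\<forall>a\<in>D. c a = 0" using x by fastforce
    then show False using c b Pos_sub zero_notin by auto
  qed
  moreover have "0 \<le> x \<bullet> \<beta>" unfolding c inner_sum_right by (intro sum_nonneg nn)
  ultimately show ?thesis by simp
qed

lemma dom_pos: "(\<And>a. a \<in> D \<Longrightarrow> 0 \<le> x \<bullet> a) \<Longrightarrow> \<beta> \<in> Pos \<Longrightarrow> 0 \<le> x \<bullet> \<beta>"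
  by (auto simp: positive_roots_def intro: nat_span_inner_nonneg)

lemma rho_Pos: "\<beta> \<in> Pos \<Longrightarrow> 0 < rho \<bullet> \<beta>"
  using strict_dom_pos rho_simple by blast

section \<open>Words in simple reflections and the dominant chamber\<close>

definition word :: "(real^'n) list \<Rightarrow> real^'n \<Rightarrow> real^'n" where
  "word l = foldr (\<lambda>a f. reflection a \<circ> f) l id"

lemma word_simps [simp]: "word [] = id" "word (a # l) = reflection a \<circ> word l"
  by (auto simp: word_def)

lemma word_append: "word (l @ m) = word l \<circ> word m"
  by (induction l) (auto simp: o_assoc)

lemma word_W: "set l \<subseteq> R \<Longrightarrow> word l \<in> W"
  by (induction l) (auto intro: weyl_group.intros)

lemma word_W_D: "set l \<subseteq> D \<Longrightarrow> word l \<in> W"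
  using word_W D_sub by blast

lemma word_rev: "set l \<subseteq> R \<Longrightarrow> word (rev l) \<circ> word l = id"
proof (induction l)
  case (Cons a l)
  then have "reflection a (reflection a x) = x" for x using nz reflection_reflection by auto
  then show ?case using Cons by (simp add: word_append fun_eq_iff)
qed simp

text \<open>Among the positive roots reachable from \<open>\<beta>\<close> by simple reflections,
  let \<open>\<gamma>\<close> have the smallest pairing with \<open>rho\<close>. As
  \<open>\<gamma> \<bullet> \<gamma>\<close> is positive, some simple \<open>a\<close> has
  \<open>0 < \<gamma> \<bullet> a\<close>; reflecting in \<open>a\<close> would lower the pairing
  with \<open>rho\<close> by \<open>\<gamma> \<bullet> a\<close> and stay positive unless
  \<open>\<gamma> = a\<close>.\<close>

lemma root_word:
  assumes b: "\<beta> \<in> R" shows "\<exists>l a. set l \<subseteq> D \<and> a \<in> D \<and> \<beta> = word l a"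
proof -
  have pos: "\<exists>l a. set l \<subseteq> D \<and> a \<in> D \<and> \<beta> = word l a" if b: "\<beta> \<in> Pos" for \<beta>
  proof -
    let ?S = "{\<gamma> \<in> Pos. \<exists>l. set l \<subseteq> D \<and> \<gamma> = word l \<beta>}"
    have ne: "?S \<noteq> {}" using b by (auto intro!: exI[of _ "[]"])
    have fin: "finite ?S" using finite_Pos by auto
    obtain \<gamma> where g: "\<gamma> \<in> ?S" and mn: "\<And>\<delta>. \<delta> \<in> ?S \<Longrightarrow> rho \<bullet> \<gamma> \<le> rho \<bullet> \<delta>"
      using fin ne by (metis (no_types, lifting) arg_min_if_finite(1) arg_min_least)
    then obtain l where l: "set l \<subseteq> D" "\<gamma> = word l \<beta>" by blast
    obtain c :: "_ \<Rightarrow> nat" where c: "\<gamma> = (\<Sum>a\<in>D. real (c a) *\<^sub>R a)" using Pos_coeffs g by blast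
    have "0 < \<gamma> \<bullet> \<gamma>" using g Pos_sub norm_pos by blast
    then have "0 < (\<Sum>a\<in>D. real (c a) * (\<gamma> \<bullet> a))"
      by (subst (asm) (2) c) (simp add: inner_sum_right)
    then obtain a where a: "a \<in> D" "0 < real (c a) * (\<gamma> \<bullet> a)"
      by (meson sum_nonpos not_le)
    then have ga: "0 < \<gamma> \<bullet> a" by (simp add: zero_less_mult_iff)
    have "\<gamma> = a"
    proof (rule ccontr)
      assume "\<gamma> \<noteq> a"
      then have "reflection a \<gamma> \<in> ?S"
        using a l g simple_refl_pos by (auto intro!: exI[of _ "a # l"])
      then have "rho \<bullet> \<gamma> \<le> rho \<bullet> reflection a \<gamma>" using mn by blast
      then have "rho \<bullet> \<gamma> \<le> (rho - a) \<bullet> \<gamma>"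
        using reflection_adjoint[of a rho \<gamma>] rho_refl[OF a(1)] a D_sub nz by auto
      then show False using ga by (simp add: inner_simps inner_commute)
    qed
    then have "\<beta> = word (rev l) a" using l word_rev[of l] D_sub by (auto simp: fun_eq_iff)
    then show ?thesis using l a by (metis set_rev)
  qed
  show ?thesis
  proof (cases "\<beta> \<in> Pos")
    case False
    then obtain l a where la: "set l \<subseteq> D" "a \<in> D" "- \<beta> = word l a" using pos Pos_cases[OF b] by blast
    have "word (l @ [a]) a = - word l a"
      using la D_sub nz W_simps(2)[OF word_W_D] by (auto simp: word_append reflection_self)
    then have "\<beta> = word (l @ [a]) a" using la(3) by (metis minus_minus)
    then show ?thesis using la by (intro exI[of _ "l @ [a]"] exI[of _ a]) auto
  qed (rule pos)
qed

text \<open>If \<open>\<beta>\<close> is the image of a simple root \<open>a\<close> under a word,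
  its reflection is the conjugate of \<open>reflection a\<close> by that word.\<close>

lemma refl_word: assumes b: "\<beta> \<in> R" shows "\<exists>l. set l \<subseteq> D \<and> reflection \<beta> = word l"
proof -
  obtain l a where la: "set l \<subseteq> D" "a \<in> D" "\<beta> = word l a" using root_word b by blast
  have lR: "set l \<subseteq> R" using la D_sub by blast
  have "reflection \<beta> x = word (l @ [a] @ rev l) x" for x
  proof -
    have "word l (word (rev l) x) = x" using word_rev[of "rev l"] lR by (auto simp: fun_eq_iff)
    then show ?thesis
      using W_reflection[OF word_W[OF lR], of a "word (rev l) x"] la by (simp add: word_append)
  qed
  then show ?thesis using la by (intro exI[of _ "l @ [a] @ rev l"]) auto
qed

lemma W_word: assumes "w \<in> W" shows "\<exists>l. set l \<subseteq> D \<and> w = word l"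
  using assms
proof induction
  case id show ?case by (intro exI[of _ "[]"]) auto
next
  case (reflection w \<alpha>)
  then obtain l m where "set l \<subseteq> D" "w = word l" "set m \<subseteq> D" "reflection \<alpha> = word m"
    using refl_word by metis
  then show ?case by (intro exI[of _ "m @ l"]) (auto simp: word_append)
qed

text \<open>Applied letter by letter from the right, the word must make \<open>\<beta>\<close>
  negative at some letter, and a simple reflection makes no positive root negative except its
  own.\<close>

lemma word_crossing:
  assumes "set l \<subseteq> D" "\<beta> \<in> Pos" "word l \<beta> \<notin> Pos"
  shows "\<exists>l1 a l2. l = l1 @ a # l2 \<and> word l2 \<beta> = a"
  using assms
proof (induction l)
  case (Cons a l)
  show ?case
  proof (cases "word l \<beta> \<in> Pos")
    case True
    then have "word l \<beta> = a" using Cons simple_refl_pos[of a "word l \<beta>"] by auto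
    then show ?thesis by blast
  next
    case False
    then obtain l1 b l2 where "l = l1 @ b # l2" "word l2 \<beta> = b" using Cons by auto
    then show ?thesis by (metis append_Cons)
  qed
qed simp

text \<open>Induction on the length, looking at the last letter \<open>a\<close>. If
  \<open>word l a\<close> is positive, then \<open>word m a\<close> is negative, so by
  \<open>word_crossing\<close> some letter of \<open>m\<close> cancels against the last one (the
  exchange condition), which leaves a word shorter by two. Otherwise dominance of \<open>x\<close>
  and of its image squeezes \<open>x \<bullet> a\<close> to zero: the last letter fixes
  \<open>x\<close>, and this case cannot occur for strictly dominant \<open>x\<close>.\<close>

lemma word_dominant:
  assumes "set l \<subseteq> D" "\<And>a. a \<in> D \<Longrightarrow> 0 \<le> x \<bullet> a" "\<And>a. a \<in> D \<Longrightarrow> 0 \<le> word l x \<bullet> a"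
  shows "word l x = x \<and> ((\<forall>a\<in>D. 0 < x \<bullet> a) \<longrightarrow> word l = id)"
  using assms(1,3)
proof (induction "length l" arbitrary: l rule: less_induct)
  case less
  show ?case
  proof (cases l rule: rev_cases)
    case Nil then show ?thesis by simp
  next
    case (snoc m a)
    have aD: "a \<in> D" and mD: "set m \<subseteq> D" using less snoc by auto
    have a0: "a \<noteq> 0" using aD D_sub nz by blast
    have lW: "word l \<in> W" using less word_W_D by blast
    have wl: "word l = word m \<circ> reflection a" by (simp add: snoc word_append)
    show ?thesis
    proof (cases "word l a \<in> Pos")
      case True
      have "word m a \<notin> Pos"
      proof
        assume "word m a \<in> Pos"
        moreover have "word l a = - word m a"
          using W_simps(2)[OF word_W_D[OF mD]] by (simp add: wl reflection_self a0)
        ultimately show False using True Pos_neg by auto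
      qed
      then obtain m1 b m2 where m: "m = m1 @ b # m2" "word m2 a = b"
        using word_crossing[OF mD D_Pos[OF aD]] by blast
      have m2W: "word m2 \<in> W" using m mD word_W_D by auto
      have "reflection b (word m2 (reflection a y)) = word m2 y" for y
        using W_reflection[OF m2W, of a "reflection a y"] m by (simp add: reflection_reflection a0)
      then have e: "word l = word (m1 @ m2)" by (auto simp: wl m word_append fun_eq_iff)
      then show ?thesis using less(1)[of "m1 @ m2"] less(2,3) snoc m by auto
    next
      case False
      have "word l x \<bullet> (- word l a) \<ge> 0"
        using dom_pos[OF less(3), of "- word l a"] False Pos_cases W_mem[OF lW, of a] aD D_sub by blast
      then have "x \<bullet> a \<le> 0" using W_inner[OF lW] by simp
      then have xa: "x \<bullet> a = 0" using assms(2)[OF aD] by simp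
      then have "reflection a x = x" by (simp add: reflection_fixed_iff a0 inner_commute)
      then have e: "word l x = word m x" by (simp add: wl)
      have "word m x = x" using less(1)[of m] less(3) mD snoc e by auto
      then show ?thesis using e xa aD by auto
    qed
  qed
qed

lemma dominant_unique:
  assumes "w \<in> W" "\<And>a. a \<in> D \<Longrightarrow> 0 \<le> x \<bullet> a" "\<And>a. a \<in> D \<Longrightarrow> 0 \<le> w x \<bullet> a"
  shows "w x = x"
  using W_word[OF assms(1)] word_dominant[of _ x] assms(2,3) by blast

lemma dominant_regular:
  assumes "w \<in> W" "\<And>a. a \<in> D \<Longrightarrow> 0 < x \<bullet> a" "w x = x"
  shows "w = id"
  using W_word[OF assms(1)] word_dominant[of _ x] assms(2,3) by (metis order_less_imp_le)

text \<open>Take \<open>w\<close> with the largest \<open>w x \<bullet> rho\<close>: a further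
  simple reflection in \<open>a\<close> changes this pairing by \<open>- (w x \<bullet> a)\<close>,
  which therefore cannot be positive.\<close>

lemma dominant_exists: "\<exists>w\<in>W. \<forall>a\<in>D. 0 \<le> w x \<bullet> a"
proof -
  obtain w where w: "w \<in> W" and mx: "\<And>v. v \<in> W \<Longrightarrow> - (w x \<bullet> rho) \<le> - (v x \<bullet> rho)"
    using arg_min_if_finite(1)[OF finite_W, of "\<lambda>w. - (w x \<bullet> rho)"] 
      arg_min_least[OF finite_W, of _ "\<lambda>w. - (w x \<bullet> rho)"] weyl_group.id by blast
  have "0 \<le> w x \<bullet> a" if a: "a \<in> D" for a
  proof -
    have "reflection a \<circ> w \<in> W" using a D_sub w weyl_group.reflection by blast
    from mx[OF this] have "reflection a (w x) \<bullet> rho \<le> w x \<bullet> rho" by simp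
    then have "w x \<bullet> (rho - a) \<le> w x \<bullet> rho"
      using reflection_adjoint[of a "w x" rho] rho_refl[OF a] a D_sub nz by auto
    then show ?thesis by (simp add: inner_diff_right)
  qed
  then show ?thesis using w by blast
qed

text \<open>Conjugation by an element that makes \<open>x\<close> dominant turns the absence of
  orthogonal roots into strict dominance, where \<open>dominant_regular\<close> applies.\<close>

lemma regular_stabilizer:
  assumes w: "w \<in> W" "w x = x" and x: "\<And>\<alpha>. \<alpha> \<in> R \<Longrightarrow> \<alpha> \<bullet> x \<noteq> 0" shows "w = id"
proof -
  obtain v where v: "v \<in> W" "\<forall>a\<in>D. 0 \<le> v x \<bullet> a" using dominant_exists by blast
  have "0 < v x \<bullet> a" if "a \<in> D" for a
  proof -
    have "v x \<bullet> a = inv v a \<bullet> x" using v by (metis W_adj inner_commute)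
    moreover have "inv v a \<in> R" using W_inv(1)[OF v(1)] W_mem that D_sub by blast
    ultimately show ?thesis using x v that by (metis less_eq_real_def)
  qed
  moreover have "v \<circ> w \<circ> inv v \<in> W" using v w weyl_comp W_inv(1) by blast
  moreover have "(v \<circ> w \<circ> inv v) (v x) = v x" using v w by (simp add: W_inv)
  ultimately have "v \<circ> w \<circ> inv v = id" using dominant_regular by blast
  then have "v (w (inv v (v y))) = v y" for y by (metis comp_apply id_apply)
  then show ?thesis using v by (auto simp: W_inv W_inj)
qed

end

context root_system_base
begin

text \<open>The sign is multiplicative because it is the factor that the product of any odd function over the
  positive roots picks up under \<open>w\<close>.\<close>

definition root_sign :: "real^'n \<Rightarrow> real" where
  "root_sign \<beta> = (if \<beta> \<in> Pos then 1 else -1)"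

definition weyl_sign :: "(real^'n \<Rightarrow> real^'n) \<Rightarrow> real" where
  "weyl_sign w = (\<Prod>\<alpha>\<in>Pos. root_sign (w \<alpha>))"

text \<open>Up to signs \<open>w\<close> permutes the positive roots: \<open>p\<close> is this
  permutation, and oddness of \<open>g\<close> collects the signs in
  \<open>weyl_sign w\<close>.\<close>

lemma prod_Pos_odd:
  fixes g :: "real^'n \<Rightarrow> 'a::{real_normed_field}"
  assumes w: "w \<in> W" and g: "\<And>\<alpha>. \<alpha> \<in> R \<Longrightarrow> g (- \<alpha>) = - g \<alpha>"
  shows "(\<Prod>\<alpha>\<in>Pos. g (w \<alpha>)) = of_real (weyl_sign w) * (\<Prod>\<alpha>\<in>Pos. g \<alpha>)"
proof -
  define p where "p \<alpha> = (if w \<alpha> \<in> Pos then w \<alpha> else - w \<alpha>)" for \<alpha>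
  have wR: "w \<alpha> \<in> R" if "\<alpha> \<in> Pos" for \<alpha> using that W_mem[OF w] Pos_sub by blast
  have pP: "p ` Pos \<subseteq> Pos" using wR Pos_cases by (auto simp: p_def)
  have inj: "inj_on p Pos"
  proof (rule inj_onI)
    fix \<alpha> \<beta> assume ab: "\<alpha> \<in> Pos" "\<beta> \<in> Pos" "p \<alpha> = p \<beta>"
    then have "w \<alpha> = w \<beta> \<or> w \<alpha> = w (- \<beta>)"
      unfolding p_def W_simps[OF w] by (metis minus_minus)
    then have "\<alpha> = \<beta> \<or> \<alpha> = - \<beta>" using W_inj[OF w] by blast
    then show "\<alpha> = \<beta>" using ab Pos_neg by blast
  qed
  then have im: "p ` Pos = Pos" using pP finite_Pos by (simp add: endo_inj_surj)
  have "(\<Prod>\<alpha>\<in>Pos. g (w \<alpha>)) = (\<Prod>\<alpha>\<in>Pos. of_real (root_sign (w \<alpha>)) * g (p \<alpha>))"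
    using g[OF W_mem[OF w]] Pos_sub by (intro prod.cong) (auto simp: p_def root_sign_def)
  also have "\<dots> = of_real (weyl_sign w) * (\<Prod>\<alpha>\<in>Pos. g (p \<alpha>))"
    by (simp add: prod.distrib weyl_sign_def)
  also have "(\<Prod>\<alpha>\<in>Pos. g (p \<alpha>)) = (\<Prod>\<alpha>\<in>p ` Pos. g \<alpha>)" by (simp add: prod.reindex[OF inj])
  finally show ?thesis by (simp add: im)
qed

lemma root_sign_uminus: "\<beta> \<in> R \<Longrightarrow> root_sign (- \<beta>) = - root_sign \<beta>"
  using Pos_neg Pos_cases by (auto simp: root_sign_def)

lemma weyl_sign_comp: assumes "v \<in> W" "w \<in> W" shows "weyl_sign (v \<circ> w) = weyl_sign v * weyl_sign w"
proof -
  have "weyl_sign (v \<circ> w) = (\<Prod>\<alpha>\<in>Pos. (\<lambda>\<beta>. root_sign (v \<beta>)) (w \<alpha>))" by (simp add: weyl_sign_def)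
  also have "\<dots> = of_real (weyl_sign w) * (\<Prod>\<alpha>\<in>Pos. root_sign (v \<alpha>))"
    by (rule prod_Pos_odd[OF assms(2)]) (simp add: W_simps[OF assms(1)] root_sign_uminus W_mem[OF assms(1)])
  finally show ?thesis by (simp add: weyl_sign_def)
qed

lemma weyl_sign_id: "weyl_sign id = 1"
  by (simp add: weyl_sign_def root_sign_def)

lemma weyl_sign_abs: "weyl_sign w * weyl_sign w = 1"
  unfolding weyl_sign_def by (simp flip: prod.distrib) (simp add: root_sign_def prod.neutral)

lemma weyl_sign_simple: assumes a: "a \<in> D" shows "weyl_sign (reflection a) = -1"
proof -
  have a0: "a \<noteq> 0" using a D_sub nz by blast
  have "weyl_sign (reflection a) = root_sign (reflection a a) * (\<Prod>\<alpha>\<in>Pos - {a}. root_sign (reflection a \<alpha>))"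
    unfolding weyl_sign_def using D_Pos[OF a] finite_Pos by (simp add: prod.remove)
  also have "(\<Prod>\<alpha>\<in>Pos - {a}. root_sign (reflection a \<alpha>)) = 1"
    using simple_refl_pos[OF a] by (intro prod.neutral) (auto simp: root_sign_def)
  finally show ?thesis using Pos_neg[OF D_Pos[OF a]] by (simp add: root_sign_def reflection_self[OF a0])
qed

text \<open>Every reflection is conjugate to a simple one, and a multiplicative sign does not see
  conjugation.\<close>

lemma weyl_sign_reflection: assumes b: "\<beta> \<in> R" shows "weyl_sign (reflection \<beta>) = -1"
proof -
  obtain l a where la: "set l \<subseteq> D" "a \<in> D" "\<beta> = word l a" using root_word b by blast
  let ?w = "word l"
  have wW: "?w \<in> W" using la word_W_D by blast
  have aW: "reflection a \<in> W" using la D_sub weyl_reflection by blast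
  have "reflection \<beta> \<circ> ?w = ?w \<circ> reflection a" using W_reflection[OF wW] la by (auto simp: fun_eq_iff)
  then have "weyl_sign (reflection \<beta>) * weyl_sign ?w = weyl_sign ?w * weyl_sign (reflection a)"
    using weyl_sign_comp wW aW b weyl_reflection by metis
  then show ?thesis using weyl_sign_simple[OF la(2)] weyl_sign_abs[of ?w]
    by (metis mult.commute mult_cancel_right mult_zero_right zero_neq_one)
qed

lemma sum_Pos: "\<Sum>Pos = 2 *\<^sub>R rho"
  by (simp add: rho_def half_sum_positive_def)

lemma W_Pos_split:
  assumes "w \<in> W" "x \<in> R"
  shows "x \<in> uminus ` w ` Pos \<longleftrightarrow> x \<notin> w ` Pos"
proof -
  have i: "inv w x \<in> R" using assms W_inv(1) W_mem by blast
  have e: "x = w (inv w x)" using assms by (simp add: W_inv)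
  have 1: "x \<in> w ` Pos \<longleftrightarrow> inv w x \<in> Pos" using e W_inj[OF assms(1)] by (metis image_iff)
  have "x \<in> uminus ` w ` Pos \<longleftrightarrow> - x \<in> w ` Pos" by (metis (no_types) imageE image_eqI minus_minus)
  also have "\<dots> \<longleftrightarrow> - inv w x \<in> Pos"
  proof -
    have "- x = w (- inv w x)" using e W_simps(2)[OF assms(1)] by metis
    then show ?thesis using W_inj[OF assms(1)] by (metis image_iff)
  qed
  finally show ?thesis using 1 neg_Pos_iff[OF i] by blast
qed

text \<open>The two systems of positive roots differ by flipping exactly the roots in
  \<open>S\<close>. This bookkeeping underlies both \<open>W_rho_diff\<close> and the quotient of
  denominators in \<open>ratio_prod\<close>.\<close>

lemma W_Pos_decomp:
  assumes v: "v \<in> W" and w: "w \<in> W"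
  defines "I \<equiv> v ` Pos \<inter> w ` Pos" and "S \<equiv> v ` Pos \<inter> uminus ` w ` Pos"
  shows "v ` Pos = I \<union> S" "w ` Pos = I \<union> uminus ` S" "I \<inter> S = {}" "I \<inter> uminus ` S = {}"
proof -
  have AR: "v ` Pos \<subseteq> R" "w ` Pos \<subseteq> R" using v w W_mem Pos_sub by blast+
  show "v ` Pos = I \<union> S" using W_Pos_split[OF w] AR unfolding I_def S_def by blast
  show "w ` Pos = I \<union> uminus ` S"
  proof (intro equalityI subsetI)
    fix x assume x: "x \<in> w ` Pos"
    then have "x \<in> v ` Pos \<or> x \<in> uminus ` v ` Pos" using W_Pos_split[OF v] AR by blast
    then show "x \<in> I \<union> uminus ` S" using x unfolding I_def S_def by force
  qed (force simp: I_def S_def)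
  show "I \<inter> S = {}" using W_Pos_split[OF w] AR unfolding I_def S_def by blast
  show "I \<inter> uminus ` S = {}" using W_Pos_split[OF v] AR unfolding I_def S_def by blast
qed

text \<open>The common roots cancel in the difference of the two root sums, while each root of the
  flipped set is counted twice; this matches the factor in
  \<open>\<Sum>Pos = 2 *\<^sub>R rho\<close>. It is the identity that removes the \<open>rho\<close>
  shifts in \<open>term_mean_0\<close>.\<close>

lemma W_rho_diff:
  assumes v: "v \<in> W" and w: "w \<in> W"
  shows "\<Sum>(v ` Pos \<inter> uminus ` w ` Pos) = v rho - w rho"
proof -
  let ?I = "v ` Pos \<inter> w ` Pos" and ?S = "v ` Pos \<inter> uminus ` w ` Pos"
  note dec = W_Pos_decomp[OF v w]
  have fin: "finite ?I" "finite ?S" using finite_Pos by auto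
  have s: "\<Sum>(u ` Pos) = 2 *\<^sub>R u rho" if "u \<in> W" for u
  proof -
    have "inj_on u Pos" using W_inj[OF that] by (auto intro: inj_onI)
    then have "\<Sum>(u ` Pos) = (\<Sum>\<alpha>\<in>Pos. u \<alpha>)" by (simp add: sum.reindex)
    also have "\<dots> = u (\<Sum>Pos)" by (simp add: linear_sum[OF W_linear[OF that]])
    finally show ?thesis by (simp add: sum_Pos W_simps[OF that])
  qed
  have "\<Sum>(v ` Pos) = \<Sum>?I + \<Sum>?S"
    by (subst dec(1), rule sum.union_disjoint) (use fin dec(3) in auto)
  moreover have "\<Sum>(w ` Pos) = \<Sum>?I + \<Sum>(uminus ` ?S)"
    by (subst dec(2), rule sum.union_disjoint) (use fin dec(4) in auto)
  moreover have "\<Sum>(uminus ` ?S) = - \<Sum>?S"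
    by (simp add: sum.reindex sum_negf)
  ultimately have "2 *\<^sub>R v rho - 2 *\<^sub>R w rho = 2 *\<^sub>R \<Sum>?S"
    unfolding s[OF v] s[OF w] by (simp add: scaleR_2)
  then have "2 *\<^sub>R (v rho - w rho) = 2 *\<^sub>R \<Sum>?S" by (simp add: scaleR_diff_right)
  then show ?thesis by simp
qed

text \<open>An element that makes \<open>- rho\<close> dominant works: it sends every positive root
  to a root pairing negatively with a dominant vector.\<close>

lemma longest_element_exists: "\<exists>w\<in>W. w ` Pos = uminus ` Pos"
proof -
  obtain w where w: "w \<in> W" "\<forall>a\<in>D. 0 \<le> w (- rho) \<bullet> a" using dominant_exists by blast
  have n: "w \<alpha> \<bullet> w (- rho) < 0" if "\<alpha> \<in> Pos" for \<alpha>
    using rho_Pos[OF that] W_inner[OF w(1)] by (simp add: inner_commute)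
  have s: "w ` Pos \<subseteq> uminus ` Pos"
  proof
    fix x assume "x \<in> w ` Pos"
    then obtain \<alpha> where a: "\<alpha> \<in> Pos" "x = w \<alpha>" by blast
    then have "x \<notin> Pos" using n[OF a(1)] dom_pos[of "w (- rho)" x] w(2) by (force simp: inner_commute)
    moreover have "x \<in> R" using a w W_mem Pos_sub by blast
    ultimately show "x \<in> uminus ` Pos" using R_eq by blast
  qed
  moreover have "card (w ` Pos) = card (uminus ` Pos)"
    using W_inj[OF w(1)] by (simp add: card_image inj_on_def)
  ultimately have "w ` Pos = uminus ` Pos" using finite_Pos by (simp add: card_subset_eq)
  then show ?thesis using w by blast
qed

text \<open>The description by THE is justified because any such element sends \<open>rho\<close> to
  \<open>- rho\<close>, and the strictly dominant \<open>rho\<close> has trivial stabilizer.\<close>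

lemma longest_element_props:
  "longest_element R D \<in> W" "longest_element R D ` Pos = uminus ` Pos"
proof -
  have "\<exists>!w. w \<in> W \<and> w ` Pos = uminus ` Pos"
  proof (rule ex_ex1I)
    show "\<exists>w. w \<in> W \<and> w ` Pos = uminus ` Pos" using longest_element_exists by blast
    fix v w assume vw: "v \<in> W \<and> v ` Pos = uminus ` Pos" "w \<in> W \<and> w ` Pos = uminus ` Pos"
    have s: "2 *\<^sub>R u rho = - (2 *\<^sub>R rho)" if "u \<in> W" "u ` Pos = uminus ` Pos" for u
    proof -
      have "2 *\<^sub>R u rho = u (\<Sum>Pos)" by (simp add: sum_Pos W_simps[OF that(1)])
      also have "\<dots> = \<Sum>(u ` Pos)"
        using W_inj[OF that(1)] by (simp add: linear_sum[OF W_linear[OF that(1)]] sum.reindex inj_on_def)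
      also have "\<dots> = - (2 *\<^sub>R rho)" by (simp add: that(2) sum.reindex sum_negf sum_Pos)
      finally show ?thesis .
    qed
    then have "2 *\<^sub>R v rho = 2 *\<^sub>R w rho" using vw by metis
    then have "v rho = w rho" by simp
    then have "(inv w \<circ> v) rho = rho" using vw by (simp add: W_inv)
    moreover have "inv w \<circ> v \<in> W" using vw by (intro weyl_comp W_inv(1)) auto
    ultimately have "inv w \<circ> v = id" by (intro dominant_regular[of "inv w \<circ> v" rho]) (simp_all add: rho_simple)
    then have "w (inv w (v x)) = w x" for x by (metis comp_apply id_apply)
    then show "v = w" using vw by (auto simp: W_inv)
  qed
  from theI'[OF this, folded longest_element_def]
  show "longest_element R D \<in> W" "longest_element R D ` Pos = uminus ` Pos" by auto
qed

text \<open>By strict Cauchy-Schwarz the product of the two Cartan integers is less than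
  \<open>4\<close>, and both are positive, so one of them is \<open>1\<close>. Then one reflection
  produces the difference of the roots and the other one the difference of the coroots.\<close>

lemma root_diff:
  assumes "\<alpha> \<in> R" "\<beta> \<in> R" "0 < \<alpha> \<bullet> \<beta>" "\<alpha> \<noteq> \<beta>"
  shows "\<alpha> - \<beta> \<in> R" and "coroot \<alpha> - coroot \<beta> \<in> coroot ` R"
proof -
  have p: "0 < \<alpha> \<bullet> \<alpha>" "0 < \<beta> \<bullet> \<beta>" using assms norm_pos by auto
  obtain m n :: int where m: "\<alpha> \<bullet> coroot \<beta> = of_int m" and n: "\<beta> \<bullet> coroot \<alpha> = of_int n"
    using cartan_int assms by (metis Ints_cases)
  have mn: "of_int (m * n) = 4 * (\<alpha> \<bullet> \<beta>)^2 / ((\<alpha> \<bullet> \<alpha>) * (\<beta> \<bullet> \<beta>))"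
    unfolding of_int_mult m[symmetric] n[symmetric]
    by (simp add: coroot_inner power2_eq_square inner_commute)
  have pos: "0 < m" "0 < n" 
  proof -
    have "0 < \<alpha> \<bullet> coroot \<beta>" "0 < \<beta> \<bullet> coroot \<alpha>" using assms p by (simp_all add: coroot_inner inner_commute)
    then show "0 < m" "0 < n" by (simp_all add: m n)
  qed
  have strict: "(\<alpha> \<bullet> \<beta>)^2 < (\<alpha> \<bullet> \<alpha>) * (\<beta> \<bullet> \<beta>)"
  proof (rule ccontr)
    assume "\<not> ?thesis"
    then have eq: "(\<alpha> \<bullet> \<beta>)^2 = (\<alpha> \<bullet> \<alpha>) * (\<beta> \<bullet> \<beta>)" using Cauchy_Schwarz_ineq[of \<alpha> \<beta>] by simp
    define c where "c = (\<alpha> \<bullet> \<beta>) / (\<beta> \<bullet> \<beta>)"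
    have "(\<alpha> - c *\<^sub>R \<beta>) \<bullet> (\<alpha> - c *\<^sub>R \<beta>) = \<alpha> \<bullet> \<alpha> - 2 * c * (\<alpha> \<bullet> \<beta>) + c * c * (\<beta> \<bullet> \<beta>)"
      by (simp add: inner_simps inner_commute algebra_simps)
    also have "\<dots> = 0" using eq p unfolding c_def by (simp add: field_simps power2_eq_square)
    finally have e: "\<alpha> = c *\<^sub>R \<beta>" by simp
    have "c = 1 \<or> c = -1" using reduced[OF assms(2), of c] assms(1) e by simp
    moreover have "0 < c" using assms p by (simp add: c_def)
    ultimately show False using e assms(4) by auto
  qed
  have "m * n < 4"
  proof -
    have "(of_int (m * n) :: real) < 4"
      unfolding mn using strict p by (simp add: divide_less_eq mult_pos_pos)
    then show ?thesis by linarith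
  qed
  then have "m = 1 \<or> n = 1"
  proof -
    { assume "m \<ge> 2" "n \<ge> 2"
      then have "m * n \<ge> 2 * 2" by (intro mult_mono) auto
      then have False using \<open>m * n < 4\<close> by simp }
    then show ?thesis using pos by force
  qed
  then have "\<alpha> - \<beta> \<in> R \<and> coroot \<alpha> - coroot \<beta> \<in> coroot ` R"
  proof
    assume "m = 1"
    then have 1: "reflection \<beta> \<alpha> = \<alpha> - \<beta>" by (simp add: reflection_alt m)
    have "coroot (reflection \<alpha> \<beta>) = reflection \<alpha> (coroot \<beta>)"
      using W_coroot[OF weyl_reflection] assms by blast
    also have "\<dots> = coroot \<beta> - coroot \<alpha>" using \<open>m = 1\<close> m by (simp add: reflection_def)
    finally have "coroot \<alpha> - coroot \<beta> = coroot (- reflection \<alpha> \<beta>)" by simp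
    moreover have "- reflection \<alpha> \<beta> \<in> R" using assms refl_mem uminus_mem by blast
    ultimately show ?thesis using 1 refl_mem assms by (metis image_eqI)
  next
    assume "n = 1"
    then have 1: "reflection \<alpha> \<beta> = \<beta> - \<alpha>" by (simp add: reflection_alt n)
    have "coroot (reflection \<beta> \<alpha>) = reflection \<beta> (coroot \<alpha>)"
      using W_coroot[OF weyl_reflection] assms by blast
    also have "\<dots> = coroot \<alpha> - coroot \<beta>" using \<open>n = 1\<close> n by (simp add: reflection_def)
    finally have 2: "coroot \<alpha> - coroot \<beta> = coroot (reflection \<beta> \<alpha>)" by simp
    have "- (\<beta> - \<alpha>) \<in> R" using 1 refl_mem[OF assms(1,2)] uminus_mem by metis
    then show ?thesis using 2 refl_mem assms by (metis image_eqI minus_diff_eq)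
  qed
  then show "\<alpha> - \<beta> \<in> R" and "coroot \<alpha> - coroot \<beta> \<in> coroot ` R" by auto
qed

text \<open>Otherwise \<open>a - b\<close> would be a root whose coefficients in the base have both
  signs.\<close>

lemma simple_obtuse: assumes "a \<in> D" "b \<in> D" "a \<noteq> b" shows "a \<bullet> b \<le> 0"
proof (rule ccontr)
  assume "\<not> ?thesis"
  then have d: "a - b \<in> R" using root_diff(1)[of a b] assms D_sub by auto
  have ne: False if p: "(\<Sum>x\<in>D. real (c x) *\<^sub>R x) = a - b" "a \<in> D" "b \<in> D" "a \<noteq> b" for c :: "_ \<Rightarrow> nat" and a b
  proof -
    have "(\<Sum>x\<in>D. real (c x) *\<^sub>R x) = (\<Sum>x\<in>D. ((if x = a then 1 else 0) - (if x = b then 1 else 0)) *\<^sub>R x)"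
      using p finite_D by (simp add: scaleR_left_diff_distrib sum_subtractf if_distrib[where f="\<lambda>c. c *\<^sub>R _"] cong: if_cong)
    from coeff_unique[OF this p(3)] p(4) show False by simp
  qed
  from Pos_cases[OF d] show False
  proof
    assume "a - b \<in> Pos"
    then obtain c :: "_ \<Rightarrow> nat" where "a - b = (\<Sum>x\<in>D. real (c x) *\<^sub>R x)" by (rule Pos_coeffs)
    then show False using ne[of c a b] assms by simp
  next
    assume "- (a - b) \<in> Pos"
    then obtain c :: "_ \<Rightarrow> nat" where "- (a - b) = (\<Sum>x\<in>D. real (c x) *\<^sub>R x)" by (rule Pos_coeffs)
    then show False using ne[of c b a] assms by simp
  qed
qed

section \<open>The coroot lattice and its Voronoi cell\<close>

lemma coroot_lattice_mem: "(\<Sum>\<alpha>\<in>R. real_of_int (c \<alpha>) *\<^sub>R coroot \<alpha>) \<in> coroot_lattice R"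
  by (auto simp: coroot_lattice_def)

lemma coroot_lattice_coroot: assumes "\<alpha> \<in> R" shows "coroot \<alpha> \<in> coroot_lattice R"
proof -
  have "coroot \<alpha> = (\<Sum>x\<in>R. real_of_int (if x = \<alpha> then 1 else 0) *\<^sub>R coroot x)"
    using assms finite_R by (simp add: if_distrib[where f=of_int] if_distrib[where f="\<lambda>c. c *\<^sub>R _"] cong: if_cong)
  then show ?thesis using coroot_lattice_mem[of "\<lambda>x. if x = \<alpha> then 1 else 0"] by (simp only:)
qed

lemma coroot_lattice_0: "0 \<in> coroot_lattice R"
  unfolding coroot_lattice_def by (auto intro!: exI[of _ "\<lambda>_. 0"])

lemma coroot_lattice_add: assumes "x \<in> coroot_lattice R" "y \<in> coroot_lattice R" shows "x + y \<in> coroot_lattice R"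
proof -
  obtain c d :: "_ \<Rightarrow> int" where "x = (\<Sum>\<alpha>\<in>R. of_int (c \<alpha>) *\<^sub>R coroot \<alpha>)" "y = (\<Sum>\<alpha>\<in>R. of_int (d \<alpha>) *\<^sub>R coroot \<alpha>)"
    using assms by (auto simp: coroot_lattice_def)
  then have "x + y = (\<Sum>\<alpha>\<in>R. of_int (c \<alpha> + d \<alpha>) *\<^sub>R coroot \<alpha>)"
    by (simp add: scaleR_add_left sum.distrib)
  then show ?thesis using coroot_lattice_mem[of "\<lambda>\<alpha>. c \<alpha> + d \<alpha>"] by (simp only:)
qed

lemma coroot_lattice_minus: assumes "x \<in> coroot_lattice R" shows "- x \<in> coroot_lattice R"
proof -
  obtain c :: "_ \<Rightarrow> int" where "x = (\<Sum>\<alpha>\<in>R. of_int (c \<alpha>) *\<^sub>R coroot \<alpha>)"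
    using assms by (auto simp: coroot_lattice_def)
  then have "- x = (\<Sum>\<alpha>\<in>R. of_int (- c \<alpha>) *\<^sub>R coroot \<alpha>)"
    by (simp add: sum_negf)
  then show ?thesis using coroot_lattice_mem[of "\<lambda>\<alpha>. - c \<alpha>"] by (simp only:)
qed

lemma coroot_lattice_scale: assumes "x \<in> coroot_lattice R" shows "of_int n *\<^sub>R x \<in> coroot_lattice R"
proof -
  obtain c :: "_ \<Rightarrow> int" where "x = (\<Sum>\<alpha>\<in>R. of_int (c \<alpha>) *\<^sub>R coroot \<alpha>)"
    using assms by (auto simp: coroot_lattice_def)
  then have "of_int n *\<^sub>R x = (\<Sum>\<alpha>\<in>R. of_int (n * c \<alpha>) *\<^sub>R coroot \<alpha>)"
    by (simp add: scaleR_sum_right)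
  then show ?thesis using coroot_lattice_mem[of "\<lambda>\<alpha>. n * c \<alpha>"] by (simp only:)
qed

lemma coroot_lattice_sum: assumes "\<And>i. i \<in> I \<Longrightarrow> f i \<in> coroot_lattice R" shows "sum f I \<in> coroot_lattice R"
  using assms by (induction I rule: infinite_finite_induct) (auto simp: coroot_lattice_0 coroot_lattice_add)

lemma coroot_lattice_W: assumes "w \<in> W" "x \<in> coroot_lattice R" shows "w x \<in> coroot_lattice R"
proof -
  obtain c :: "_ \<Rightarrow> int" where "x = (\<Sum>\<alpha>\<in>R. of_int (c \<alpha>) *\<^sub>R coroot \<alpha>)"
    using assms by (auto simp: coroot_lattice_def)
  then have "w x = (\<Sum>\<alpha>\<in>R. of_int (c \<alpha>) *\<^sub>R coroot (w \<alpha>))"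
    using assms by (simp add: linear_sum[OF W_linear] W_simps W_coroot)
  moreover have "of_int (c \<alpha>) *\<^sub>R coroot (w \<alpha>) \<in> coroot_lattice R" if "\<alpha> \<in> R" for \<alpha>
    by (rule coroot_lattice_scale, rule coroot_lattice_coroot, rule W_mem[OF assms(1) that])
  ultimately show ?thesis
    using coroot_lattice_sum[of R "\<lambda>\<alpha>. of_int (c \<alpha>) *\<^sub>R coroot (w \<alpha>)"] by simp
qed

lemma coroot_lattice_W_iff: assumes "w \<in> W" shows "w x \<in> coroot_lattice R \<longleftrightarrow> x \<in> coroot_lattice R"
  using coroot_lattice_W[OF assms, of x] coroot_lattice_W[OF W_inv(1)[OF assms], of "w x"] assms by (auto simp: W_inv)

text \<open>\<open>R\<close> is closed under negation, so integral combinations of coroots are plain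
  sums with repetition; lists allow a minimal length to be chosen.\<close>

lemma coroot_lattice_list:
  assumes "y \<in> coroot_lattice R" shows "\<exists>l. set l \<subseteq> R \<and> y = sum_list (map coroot l)"
proof -
  define G where "G y \<longleftrightarrow> (\<exists>l. set l \<subseteq> R \<and> y = sum_list (map coroot l))" for y :: "real^'n"
  have G0: "G 0" unfolding G_def by (intro exI[of _ "[]"]) simp
  have Ga: "G (x + y)" if "G x" "G y" for x y
    using that unfolding G_def by (metis le_sup_iff map_append set_append sum_list_append)
  have Gc: "G (coroot \<alpha>)" if "\<alpha> \<in> R" for \<alpha>
    using that unfolding G_def by (intro exI[of _ "[\<alpha>]"]) simp
  have Gn: "G (real n *\<^sub>R coroot \<alpha>)" if "\<alpha> \<in> R" for n \<alpha>
    by (induction n) (auto simp: G0 algebra_simps intro: Ga Gc that)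
  have Gi: "G (of_int i *\<^sub>R coroot \<alpha>)" if "\<alpha> \<in> R" for i \<alpha>
  proof (cases "i \<ge> 0")
    case True then show ?thesis using Gn[OF that, of "nat i"] by simp
  next
    case False then show ?thesis using Gn[OF uminus_mem[OF that], of "nat (- i)"] by simp
  qed
  obtain c :: "_ \<Rightarrow> int" where c: "y = (\<Sum>\<alpha>\<in>R. of_int (c \<alpha>) *\<^sub>R coroot \<alpha>)"
    using assms by (auto simp: coroot_lattice_def)
  have "G (\<Sum>\<alpha>\<in>A. of_int (c \<alpha>) *\<^sub>R coroot \<alpha>)" if "A \<subseteq> R" for A
    using finite_subset[OF that finite_R] that
    by (induction A rule: finite_induct) (auto simp: G0 intro: Ga Gi)
  then show ?thesis using c by (auto simp: G_def)
qed

lemma not_sorted_wrt_decomp: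
  assumes "\<not> sorted_wrt P l" shows "\<exists>l1 x l2 y l3. l = l1 @ x # l2 @ y # l3 \<and> \<not> P x y"
  using assms
proof (induction l)
  case (Cons a l)
  show ?case
  proof (cases "sorted_wrt P l")
    case True
    then obtain y where "y \<in> set l" "\<not> P a y" using Cons by auto
    then show ?thesis by (metis append_Nil split_list)
  next
    case False then show ?thesis using Cons by (metis append_Cons)
  qed
qed simp

text \<open>In a shortest expression of a lattice vector as a sum of coroots, no two coroots are at an obtuse
  angle, since they could be merged.\<close>

lemma coroot_lattice_acute_list:
  assumes "y \<in> coroot_lattice R"
  shows "\<exists>l. set l \<subseteq> R \<and> y = sum_list (map coroot l) \<and> sorted_wrt (\<lambda>\<alpha> \<beta>. 0 \<le> \<alpha> \<bullet> \<beta>) l"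
proof -
  let ?P = "\<lambda>l. set l \<subseteq> R \<and> y = sum_list (map coroot l)"
  obtain l where l: "?P l" and mn: "\<And>m. ?P m \<Longrightarrow> length l \<le> length m"
    using arg_min_natI[of ?P _ length] arg_min_nat_le[of ?P _ length] coroot_lattice_list[OF assms] by blast
  have "sorted_wrt (\<lambda>\<alpha> \<beta>. 0 \<le> \<alpha> \<bullet> \<beta>) l"
  proof (rule ccontr)
    assume "\<not> ?thesis"
    from not_sorted_wrt_decomp[OF this] obtain l1 x l2 z l3
      where d: "l = l1 @ x # l2 @ z # l3" and neg: "x \<bullet> z < 0" by force
    have xz: "x \<in> R" "z \<in> R" using l d by auto
    show False
    proof (cases "x = - z")
      case True
      have "?P (l1 @ l2 @ l3)" using l d True by auto
      then show False using mn[of "l1 @ l2 @ l3"] d by simp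
    next
      case False
      then obtain b where "b \<in> R" "coroot x - coroot (- z) = coroot b"
        using root_diff(2)[of x "- z"] xz neg uminus_mem by auto
      then have "?P (b # l1 @ l2 @ l3)" using l d by (auto simp: algebra_simps)
      then show False using mn[of "b # l1 @ l2 @ l3"] d by simp
    qed
  qed
  then show ?thesis using l by blast
qed

text \<open>Prepending \<open>b\<close> adds \<open>(4 * (k - x \<bullet> b) + 4 * k * (b \<bullet>
  Y)) / (b \<bullet> b)\<close> to the slack
  \<open>k * (y \<bullet> y) - 2 * (x \<bullet> y)\<close>, and both terms are nonnegative, the
  second by acuteness. Equality forces \<open>x \<bullet> b = k\<close> and
  \<open>b \<bullet> Y = 0\<close>; then subtracting \<open>k *\<^sub>R coroot b\<close> from
  \<open>x - k *\<^sub>R Y\<close> is the reflection in \<open>b\<close>, so the Weyl group element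
  grows by one factor.\<close>

lemma voronoi_list:
  assumes "set l \<subseteq> R" "sorted_wrt (\<lambda>\<alpha> \<beta>. 0 \<le> \<alpha> \<bullet> \<beta>) l" "\<And>\<beta>. \<beta> \<in> R \<Longrightarrow> x \<bullet> \<beta> \<le> k" "0 < k"
  defines "y \<equiv> sum_list (map coroot l)"
  shows "2 * (x \<bullet> y) \<le> k * (y \<bullet> y) \<and> (2 * (x \<bullet> y) = k * (y \<bullet> y) \<longrightarrow> (\<exists>u\<in>W. x - k *\<^sub>R y = u x) \<and>
    (y \<noteq> 0 \<longrightarrow> (\<exists>\<beta>\<in>R. x \<bullet> \<beta> = k)))"
  using assms(1,2) unfolding y_def
proof (induction l)
  case Nil then show ?case using weyl_group.id[of R] by (auto intro: bexI[of _ id])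
next
  case (Cons b l)
  define Y where "Y = sum_list (map coroot l)"
  have bR: "b \<in> R" using Cons by simp
  have bb: "0 < b \<bullet> b" using bR norm_pos by blast
  have IH: "2 * (x \<bullet> Y) \<le> k * (Y \<bullet> Y)" "2 * (x \<bullet> Y) = k * (Y \<bullet> Y) \<Longrightarrow> (\<exists>u\<in>W. x - k *\<^sub>R Y = u x)"
    using Cons unfolding Y_def by auto
  have "0 \<le> b \<bullet> coroot \<gamma>" if "\<gamma> \<in> set l" for \<gamma>
    using Cons that norm_pos by (simp add: coroot_inner subset_iff)
  then have bY: "0 \<le> b \<bullet> Y" unfolding Y_def by (induction l) (auto simp: inner_add_right)
  have xb: "x \<bullet> b \<le> k" using assms(3) bR by blast
  have e: "k * ((coroot b + Y) \<bullet> (coroot b + Y)) - 2 * (x \<bullet> (coroot b + Y))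
     = (4 * (k - x \<bullet> b) + 4 * k * (b \<bullet> Y)) / (b \<bullet> b) + (k * (Y \<bullet> Y) - 2 * (x \<bullet> Y))"
    using bb by (simp add: inner_simps coroot_def field_simps inner_commute)
  have nn: "0 \<le> (4 * (k - x \<bullet> b) + 4 * k * (b \<bullet> Y)) / (b \<bullet> b)" using bb xb bY assms(4) by simp
  have s: "sum_list (map coroot (b # l)) = coroot b + Y" by (simp add: Y_def)
  have "(\<exists>u\<in>W. x - k *\<^sub>R (coroot b + Y) = u x) \<and> x \<bullet> b = k"
    if "2 * (x \<bullet> (coroot b + Y)) = k * ((coroot b + Y) \<bullet> (coroot b + Y))"
  proof -
    have "(4 * (k - x \<bullet> b) + 4 * k * (b \<bullet> Y)) / (b \<bullet> b) = 0" and y0: "2 * (x \<bullet> Y) = k * (Y \<bullet> Y)"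
      using e nn that IH(1) by linarith+
    then have z: "(k - x \<bullet> b) + k * (b \<bullet> Y) = 0" using bb by simp
    have kb: "0 \<le> k * (b \<bullet> Y)" using bY assms(4) by simp
    have 1: "x \<bullet> b = k" "k * (b \<bullet> Y) = 0" using z kb xb by linarith+
    then have 2: "b \<bullet> Y = 0" using assms(4) by simp
    obtain u where u: "u \<in> W" "x - k *\<^sub>R Y = u x" using IH(2)[OF y0] by blast
    have "reflection b (u x) = x - k *\<^sub>R (coroot b + Y)"
      unfolding u(2)[symmetric] reflection_def using 1 2 by (simp add: inner_simps inner_commute algebra_simps)
    moreover have "reflection b \<circ> u \<in> W" using u bR weyl_group.reflection by blast
    ultimately show ?thesis using 1 by (metis comp_apply)
  qed
  then show ?case unfolding s using e nn IH(1) bR by auto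
qed

lemma voronoi:
  assumes "y \<in> coroot_lattice R" "\<And>\<beta>. \<beta> \<in> R \<Longrightarrow> x \<bullet> \<beta> \<le> k" "0 < k"
  shows "2 * (x \<bullet> y) \<le> k * (y \<bullet> y)"
    and "2 * (x \<bullet> y) = k * (y \<bullet> y) \<Longrightarrow> \<exists>u\<in>W. x - k *\<^sub>R y = u x"
    and "2 * (x \<bullet> y) = k * (y \<bullet> y) \<Longrightarrow> y \<noteq> 0 \<Longrightarrow> \<exists>\<beta>\<in>R. x \<bullet> \<beta> = k"
  using coroot_lattice_acute_list[OF assms(1)] voronoi_list[OF _ _ assms(2,3)] by blast+

text \<open>The weight lattice, introduced as the dual of the coroot lattice; these are the
  characters of the torus.\<close>

definition weights :: "(real^'n) set" where
  "weights = {p. \<forall>y\<in>coroot_lattice R. p \<bullet> y \<in> \<int>}"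

lemma weights_iff: "p \<in> weights \<longleftrightarrow> (\<forall>\<alpha>\<in>R. p \<bullet> coroot \<alpha> \<in> \<int>)"
proof
  assume "p \<in> weights" then show "\<forall>\<alpha>\<in>R. p \<bullet> coroot \<alpha> \<in> \<int>"
    using coroot_lattice_coroot by (auto simp: weights_def)
next
  assume "\<forall>\<alpha>\<in>R. p \<bullet> coroot \<alpha> \<in> \<int>"
  then show "p \<in> weights"
    by (auto simp: weights_def coroot_lattice_def inner_sum_right intro!: Ints_sum)
qed

text \<open>Every coroot arises from a simple one by simple reflections, and each of these changes a
  coroot by an integral multiple of a simple coroot.\<close>

lemma simple_coroot_lattice: 
  assumes "y \<in> coroot_lattice R" shows "\<exists>c :: _ \<Rightarrow> int. y = (\<Sum>a\<in>D. of_int (c a) *\<^sub>R coroot a)"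
proof -
  define G where "G y \<longleftrightarrow> (\<exists>c :: _ \<Rightarrow> int. y = (\<Sum>a\<in>D. of_int (c a) *\<^sub>R coroot a))" for y :: "real^'n"
  have G0: "G 0" unfolding G_def by (intro exI[of _ "\<lambda>_. 0"]) simp
  have Ga: "G (x + y)" if xy: "G x" "G y" for x y
  proof -
    obtain c d :: "_ \<Rightarrow> int" where "x = (\<Sum>a\<in>D. of_int (c a) *\<^sub>R coroot a)" "y = (\<Sum>a\<in>D. of_int (d a) *\<^sub>R coroot a)"
      using xy by (auto simp: G_def)
    then show ?thesis unfolding G_def
      by (intro exI[of _ "\<lambda>a. c a + d a"]) (simp add: scaleR_add_left sum.distrib)
  qed
  have Gs: "G (of_int n *\<^sub>R x)" if x: "G x" for x n
  proof -
    obtain c :: "_ \<Rightarrow> int" where "x = (\<Sum>a\<in>D. of_int (c a) *\<^sub>R coroot a)"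
      using x by (auto simp: G_def)
    then show ?thesis unfolding G_def
      by (intro exI[of _ "\<lambda>a. n * c a"]) (simp add: scaleR_sum_right)
  qed
  have GD: "G (coroot a)" if "a \<in> D" for a
    unfolding G_def using that finite_D
    by (intro exI[of _ "\<lambda>x. if x = a then 1 else 0"])
       (simp add: if_distrib[where f=of_int] if_distrib[where f="\<lambda>c. c *\<^sub>R _"] cong: if_cong)
  have Gw: "G (coroot (word l a))" if "set l \<subseteq> D" "a \<in> D" for l a
    using that(1)
  proof (induction l)
    case (Cons b l)
    have bR: "b \<in> R" and lW: "word l \<in> W" using Cons D_sub word_W_D by auto
    have aR: "word l a \<in> R" using W_mem[OF lW] that D_sub by blast
    have "b \<bullet> coroot (word l a) \<in> \<int>" using cartan_int bR aR by blast
    then obtain n where "b \<bullet> coroot (word l a) = of_int n" by (metis Ints_cases)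
    moreover have "coroot (word (b # l) a) = reflection b (coroot (word l a))"
      using W_coroot[OF weyl_reflection[OF bR]] by simp
    ultimately have "coroot (word (b # l) a) = coroot (word l a) + of_int (- n) *\<^sub>R coroot b"
      by (simp add: reflection_def)
    then show ?case using Cons Ga Gs GD by (metis insert_subset list.simps(15))
  qed (use that GD in simp)
  have Gr: "G (coroot \<alpha>)" if "\<alpha> \<in> R" for \<alpha> using root_word[OF that] Gw by blast
  obtain c :: "_ \<Rightarrow> int" where c: "y = (\<Sum>\<alpha>\<in>R. of_int (c \<alpha>) *\<^sub>R coroot \<alpha>)"
    using assms by (auto simp: coroot_lattice_def)
  have "G (\<Sum>\<alpha>\<in>A. of_int (c \<alpha>) *\<^sub>R coroot \<alpha>)" if "A \<subseteq> R" for A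
    using finite_subset[OF that finite_R] that
    by (induction A rule: finite_induct) (auto simp: G0 intro: Ga Gs Gr)
  then show ?thesis using c by (auto simp: G_def)
qed

lemma weights_iff_simple: "p \<in> weights \<longleftrightarrow> (\<forall>a\<in>D. p \<bullet> coroot a \<in> \<int>)"
proof
  assume "p \<in> weights" then show "\<forall>a\<in>D. p \<bullet> coroot a \<in> \<int>" using weights_iff D_sub by blast
next
  assume s: "\<forall>a\<in>D. p \<bullet> coroot a \<in> \<int>"
  have "p \<bullet> y \<in> \<int>" if "y \<in> coroot_lattice R" for y
    using simple_coroot_lattice[OF that] s by (auto simp: inner_sum_right intro!: Ints_sum)
  then show "p \<in> weights" by (auto simp: weights_def)
qed

lemma rho_weight: "rho \<in> weights"
  by (simp add: weights_iff_simple rho_coroot)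

lemma root_weight: "\<alpha> \<in> R \<Longrightarrow> \<alpha> \<in> weights"
  using cartan_int by (auto simp: weights_iff)

lemma weights_add: "p \<in> weights \<Longrightarrow> q \<in> weights \<Longrightarrow> p + q \<in> weights"
  and weights_diff: "p \<in> weights \<Longrightarrow> q \<in> weights \<Longrightarrow> p - q \<in> weights"
  and weights_minus: "p \<in> weights \<Longrightarrow> - p \<in> weights"
  and weights_0: "0 \<in> weights"
  and weights_scale: "p \<in> weights \<Longrightarrow> of_int n *\<^sub>R p \<in> weights"
  by (auto simp: weights_def inner_simps)

lemma weights_sum: "(\<And>i. i \<in> I \<Longrightarrow> f i \<in> weights) \<Longrightarrow> sum f I \<in> weights"
  by (induction I rule: infinite_finite_induct) (auto simp: weights_0 weights_add)

lemma weights_W: "w \<in> W \<Longrightarrow> p \<in> weights \<Longrightarrow> w p \<in> weights"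
  using W_adj[of w p] coroot_lattice_W[OF W_inv(1)] by (auto simp: weights_def)

lemma simple_coroot_inner_eqI: assumes "\<And>a. a \<in> D \<Longrightarrow> x \<bullet> coroot a = y \<bullet> coroot a" shows "x = y"
proof (rule eqI_inner_D)
  fix a assume a: "a \<in> D"
  then have "0 < a \<bullet> a" using D_sub norm_pos by blast
  then show "x \<bullet> a = y \<bullet> a" using assms[OF a] by (simp add: coroot_inner)
qed

end

section \<open>Irreducible normalized root systems\<close>

locale normalized_root_system = root_system_base R D for R D :: "(real ^ 'n::finite) set" +
  assumes irreducible: "irreducible_root_system R" and normalized: "normalized_form R"
begin

lemma not_decomposable:
  assumes "A \<union> B = R" "A \<inter> B = {}" "\<forall>\<alpha>\<in>A. \<forall>\<beta>\<in>B. \<alpha> \<bullet> \<beta> = 0"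
  shows "A = {} \<or> B = {}"
proof (rule ccontr)
  assume "\<not> ?thesis"
  then have "\<exists>A B. A \<noteq> {} \<and> B \<noteq> {} \<and> A \<union> B = R \<and> A \<inter> B = {} \<and> (\<forall>\<alpha>\<in>A. \<forall>\<beta>\<in>B. \<alpha> \<bullet> \<beta> = 0)"
    using assms by (intro exI[of _ A] exI[of _ B]) simp
  then show False using irreducible by (simp add: irreducible_root_system_def)
qed

text \<open>A level set of \<open>f\<close> and its complement in \<open>R\<close> are orthogonal,
  so irreducibility leaves a single level set.\<close>

lemma irreducible_const:
  assumes f: "\<And>\<alpha> \<beta>. \<alpha> \<in> R \<Longrightarrow> \<beta> \<in> R \<Longrightarrow> \<alpha> \<bullet> \<beta> \<noteq> 0 \<Longrightarrow> f \<alpha> = f \<beta>" and ab: "\<alpha> \<in> R" "\<beta> \<in> R"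
  shows "f \<alpha> = f \<beta>"
proof (rule ccontr)
  assume ne: "f \<alpha> \<noteq> f \<beta>"
  let ?A = "{\<gamma> \<in> R. f \<gamma> = f \<alpha>}" and ?B = "{\<gamma> \<in> R. f \<gamma> \<noteq> f \<alpha>}"
  have "?A \<noteq> {}" "?B \<noteq> {}" "?A \<union> ?B = R" "?A \<inter> ?B = {}" using ab ne by auto
  moreover have "\<forall>\<gamma>\<in>?A. \<forall>\<delta>\<in>?B. \<gamma> \<bullet> \<delta> = 0" using f by force
  ultimately show False using not_decomposable[of ?A ?B] by blast
qed

lemma R_norm_le: "\<alpha> \<in> R \<Longrightarrow> \<alpha> \<bullet> \<alpha> \<le> 2" and R_long: "\<exists>\<alpha>\<in>R. \<alpha> \<bullet> \<alpha> = 2"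
  using normalized by (auto simp: normalized_form_def)

lemma nat_span_rho_0: assumes "x \<in> nat_span D" "rho \<bullet> x \<le> 0" shows "x = 0"
proof -
  obtain c :: "_ \<Rightarrow> nat" where c: "x = (\<Sum>a\<in>D. real (c a) *\<^sub>R a)" using assms by (auto simp: nat_span_def)
  have nn: "0 \<le> real (c a) * (rho \<bullet> a)" if "a \<in> D" for a using rho_simple[OF that] by simp
  have "(\<Sum>a\<in>D. real (c a) * (rho \<bullet> a)) \<le> 0" using assms(2) unfolding c by (simp add: inner_sum_right)
  then have "(\<Sum>a\<in>D. real (c a) * (rho \<bullet> a)) = 0" using nn by (meson order_antisym sum_nonneg)
  then have "\<forall>a\<in>D. real (c a) * (rho \<bullet> a) = 0" using nn finite_D by (simp add: sum_nonneg_eq_0_iff)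
  then have "\<forall>a\<in>D. c a = 0" using rho_simple by fastforce
  then show ?thesis by (simp add: c)
qed

section \<open>The highest root\<close>

definition maximal_root where
  "maximal_root \<gamma> \<longleftrightarrow> \<gamma> \<in> R \<and> (\<forall>\<delta>\<in>R. \<delta> - \<gamma> \<in> nat_span D \<longrightarrow> \<delta> = \<gamma>)"

text \<open>If \<open>\<gamma> \<bullet> a\<close> were negative, then \<open>\<gamma> + a\<close>
  would be a larger root. The case \<open>\<gamma> = - a\<close> lies outside
  \<open>root_diff\<close>, but there \<open>a\<close> itself is larger.\<close>

lemma maximal_root_dominant: assumes m: "maximal_root \<gamma>" and a: "a \<in> D" shows "0 \<le> \<gamma> \<bullet> a"
proof (rule ccontr)
  assume neg: "\<not> ?thesis"
  have g: "\<gamma> \<in> R" using m by (simp add: maximal_root_def)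
  have aR: "a \<in> R" using a D_sub by blast
  have aN: "a \<in> nat_span D" using nat_span_base finite_D a by blast
  show False
  proof (cases "\<gamma> = - a")
    case True
    then have "a - \<gamma> = a + a" by simp
    then have "a - \<gamma> \<in> nat_span D" using nat_span_add aN by metis
    then have "a = \<gamma>" using m aR by (auto simp: maximal_root_def)
    then have "2 *\<^sub>R a = 0" using True by (metis scaleR_2 add.right_inverse)
    then show False using nz[OF aR] by (metis scaleR_eq_0_iff zero_neq_numeral)
  next
    case False
    then have "\<gamma> - (- a) \<in> R" using root_diff(1)[OF g uminus_mem[OF aR]] neg by simp
    moreover have "(\<gamma> - (- a)) - \<gamma> \<in> nat_span D" using aN by simp
    ultimately have "\<gamma> - (- a) = \<gamma>" using m unfolding maximal_root_def by blast
    then show False using nz[OF aR] by simp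
  qed
qed

lemma maximal_root_Pos: assumes m: "maximal_root \<gamma>" shows "\<gamma> \<in> Pos"
proof (rule ccontr)
  assume n: "\<gamma> \<notin> Pos"
  have g: "\<gamma> \<in> R" using m by (simp add: maximal_root_def)
  then have "- \<gamma> \<in> Pos" using n Pos_cases by blast
  then have "0 \<le> \<gamma> \<bullet> (- \<gamma>)" using dom_pos maximal_root_dominant[OF m] by blast
  then show False using norm_pos[OF g] by simp
qed

lemma orthogonal_span: assumes "\<forall>a\<in>A. \<forall>b\<in>B. a \<bullet> b = 0" "x \<in> span A" "y \<in> span B" shows "x \<bullet> y = 0"
proof -
  have "x \<bullet> b = 0" if "b \<in> B" for b
    using assms(2) by (induction rule: span_induct_alt) (use assms(1) that in \<open>auto simp: inner_simps\<close>)
  show ?thesis using assms(3)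
    by (induction rule: span_induct_alt) (auto simp: inner_simps \<open>\<And>b. b \<in> B \<Longrightarrow> x \<bullet> b = 0\<close>)
qed

text \<open>Simple reflections preserve the span of each of two orthogonal parts of the base. As
  every root is a word applied to a simple root, the splitting would extend to all of
  \<open>R\<close>.\<close>

lemma base_connected:
  assumes D: "D = D1 \<union> D2" and orth: "\<forall>a\<in>D1. \<forall>b\<in>D2. a \<bullet> b = 0" and D1: "D1 \<noteq> {}"
  shows "D2 = {}"
proof (rule ccontr)
  assume D2: "D2 \<noteq> {}"
  have stay: "word l x \<in> span A" if "D = A \<union> B" "\<forall>a\<in>A. \<forall>b\<in>B. a \<bullet> b = 0" "set l \<subseteq> D" "x \<in> span A" for A B l x
    using that(3)
  proof (induction l)
    case (Cons a l)
    then have IH: "word l x \<in> span A" by simp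
    have "a \<in> A \<or> a \<in> B" using Cons that by auto
    then show ?case
    proof
      assume "a \<in> A"
      then show ?thesis using IH by (simp add: reflection_alt span_diff span_scale span_base)
    next
      assume "a \<in> B"
      then have "word l x \<bullet> a = 0" using orthogonal_span[OF that(2) IH] span_base by blast
      then show ?thesis using IH by (simp add: reflection_alt coroot_inner)
    qed
  qed (use that in simp)
  have orth': "\<forall>a\<in>D2. \<forall>b\<in>D1. a \<bullet> b = 0" using orth by (metis inner_commute)
  have cover: "\<beta> \<in> span D1 \<or> \<beta> \<in> span D2" if b: "\<beta> \<in> R" for \<beta>
  proof -
    obtain l a where la: "set l \<subseteq> D" "a \<in> D" "\<beta> = word l a" using root_word b by blast
    then have "a \<in> D1 \<or> a \<in> D2" using D by blast
    moreover have "D = D2 \<union> D1" using D by blast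
    ultimately show ?thesis
      using stay[OF D orth la(1)] stay[OF _ orth' la(1)] la(3) span_base by blast
  qed
  let ?A = "R \<inter> span D1" and ?B = "R \<inter> span D2"
  obtain a b where "a \<in> D1" "b \<in> D2" using D1 D2 by blast
  then have "a \<in> ?A" "b \<in> ?B" using D D_sub span_base[of a D1] span_base[of b D2] by auto
  then have "?A \<noteq> {}" "?B \<noteq> {}" by blast+
  moreover have "?A \<union> ?B = R" using cover by blast
  moreover have o: "\<forall>\<alpha>\<in>?A. \<forall>\<beta>\<in>?B. \<alpha> \<bullet> \<beta> = 0" using orthogonal_span[OF orth] by blast
  moreover have "?A \<inter> ?B = {}"
  proof -
    have False if "x \<in> ?A" "x \<in> ?B" for x
    proof -
      have "x \<bullet> x = 0" using o that by blast
      then show False using that nz by auto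
    qed
    then show ?thesis by blast
  qed
  ultimately show False using not_decomposable[of ?A ?B] by blast
qed

text \<open>Simple roots are pairwise obtuse, so dominance of \<open>\<gamma>\<close> forces each
  simple root missing from its expansion to be orthogonal to all those present; connectedness of the
  base then leaves none missing.\<close>

lemma maximal_root_coeffs:
  assumes m: "maximal_root \<gamma>" and c: "\<gamma> = (\<Sum>a\<in>D. real (c a) *\<^sub>R a)" and a: "a \<in> D"
  shows "0 < c a"
proof -
  let ?D1 = "{a \<in> D. 0 < c a}" and ?D2 = "{a \<in> D. c a = 0}"
  have g: "\<gamma> \<in> R" using m by (simp add: maximal_root_def)
  have orth: "\<forall>a\<in>?D1. \<forall>b\<in>?D2. a \<bullet> b = 0"
  proof (intro ballI)
    fix a b assume a: "a \<in> ?D1" and b: "b \<in> ?D2"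
    have np: "real (c x) * (x \<bullet> b) \<le> 0" if "x \<in> D" for x
    proof (cases "x = b")
      case True then show ?thesis using b by simp
    next
      case False then show ?thesis using simple_obtuse[OF that, of b] b by (simp add: mult_nonneg_nonpos)
    qed
    have "0 \<le> \<gamma> \<bullet> b" using maximal_root_dominant[OF m] b by blast
    then have "0 \<le> (\<Sum>x\<in>D. real (c x) * (x \<bullet> b))" unfolding c by (simp add: inner_sum_left)
    then have "(\<Sum>x\<in>D. - (real (c x) * (x \<bullet> b))) \<le> 0" by (simp add: sum_negf)
    moreover have nn: "0 \<le> - (real (c x) * (x \<bullet> b))" if "x \<in> D" for x using np[OF that] by simp
    ultimately have "(\<Sum>x\<in>D. - (real (c x) * (x \<bullet> b))) = 0" by (intro order_antisym sum_nonneg) auto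
    then have "\<forall>x\<in>D. - (real (c x) * (x \<bullet> b)) = 0"
      using nn sum_nonneg_eq_0_iff[OF finite_D, of "\<lambda>x. - (real (c x) * (x \<bullet> b))"] by blast
    then show "a \<bullet> b = 0" using a by auto
  qed
  have "?D1 \<noteq> {}"
  proof
    assume "?D1 = {}"
    then have "\<gamma> = 0" unfolding c by (intro sum.neutral) auto
    then show False using nz[OF g] by simp
  qed
  moreover have "D = ?D1 \<union> ?D2" by auto
  ultimately have "?D2 = {}" using base_connected orth by blast
  then show ?thesis using a by auto
qed

text \<open>Both roots are dominant and \<open>\<gamma>\<close> involves every simple root, hence
  \<open>0 < \<gamma> \<bullet> \<delta>\<close>. Thus \<open>\<gamma> - \<delta>\<close> is a root,
  and whichever sign it has contradicts one of the two maximalities.\<close>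

lemma maximal_root_unique: assumes m: "maximal_root \<gamma>" "maximal_root \<delta>" shows "\<gamma> = \<delta>"
proof (rule ccontr)
  assume ne: "\<gamma> \<noteq> \<delta>"
  have g: "\<gamma> \<in> R" "\<delta> \<in> R" using m by (auto simp: maximal_root_def)
  obtain c :: "_ \<Rightarrow> nat" where c: "\<gamma> = (\<Sum>a\<in>D. real (c a) *\<^sub>R a)" using maximal_root_Pos[OF m(1)] Pos_coeffs by blast
  have nn: "0 \<le> real (c a) * (a \<bullet> \<delta>)" if "a \<in> D" for a
    using maximal_root_dominant[OF m(2) that] by (simp add: inner_commute)
  have "\<exists>a\<in>D. \<delta> \<bullet> a \<noteq> 0"
  proof (rule ccontr)
    assume "\<not> ?thesis"
    then have "\<delta> = 0" by (intro eqI_inner_D) auto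
    then show False using nz g by simp
  qed
  then obtain a where a: "a \<in> D" "\<delta> \<bullet> a \<noteq> 0" by blast
  have "0 < a \<bullet> \<delta>" using a maximal_root_dominant[OF m(2) a(1)] by (simp add: inner_commute)
  then have "0 < real (c a) * (a \<bullet> \<delta>)" using maximal_root_coeffs[OF m(1) c a(1)] by simp
  then have "0 < \<gamma> \<bullet> \<delta>"
    unfolding c using nn a finite_D by (simp add: inner_sum_left) (meson sum_pos2)
  then have d: "\<gamma> - \<delta> \<in> R" using root_diff(1) g ne by blast
  from Pos_cases[OF d] show False
    using m g ne by (auto simp: positive_roots_def maximal_root_def)
qed

lemma maximal_root_above: assumes b: "\<beta> \<in> R" shows "\<exists>\<gamma>. maximal_root \<gamma> \<and> \<gamma> - \<beta> \<in> nat_span D"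
proof -
  let ?S = "{\<gamma> \<in> R. \<gamma> - \<beta> \<in> nat_span D}"
  have fin: "finite ?S" using finite_R by auto
  have ne: "?S \<noteq> {}" using b nat_span_0[of D] by (auto intro: exI[of _ \<beta>])
  obtain \<gamma> where g: "\<gamma> \<in> ?S" and mx: "\<And>\<delta>. \<delta> \<in> ?S \<Longrightarrow> rho \<bullet> \<delta> \<le> rho \<bullet> \<gamma>"
    using arg_min_if_finite(1)[OF fin ne, of "\<lambda>\<delta>. - (rho \<bullet> \<delta>)"] arg_min_least[OF fin ne, of _ "\<lambda>\<delta>. - (rho \<bullet> \<delta>)"]
    by (metis (no_types, lifting) neg_le_iff_le)
  have "\<delta> = \<gamma>" if d: "\<delta> \<in> R" "\<delta> - \<gamma> \<in> nat_span D" for \<delta>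
  proof -
    have "(\<delta> - \<gamma>) + (\<gamma> - \<beta>) \<in> nat_span D" using d g nat_span_add by blast
    then have "rho \<bullet> \<delta> \<le> rho \<bullet> \<gamma>" using mx d by simp
    then have "\<delta> - \<gamma> = 0" using nat_span_rho_0[OF d(2)] by (simp add: inner_diff_right)
    then show ?thesis by simp
  qed
  then show ?thesis using g by (auto simp: maximal_root_def)
qed

definition theta_root where "theta_root = highest_root R D"

lemma theta_root: "maximal_root theta_root" and theta_root_above: "\<beta> \<in> R \<Longrightarrow> theta_root - \<beta> \<in> nat_span D"
proof -
  obtain \<beta> where "\<beta> \<in> R" using R_long by blast
  then obtain \<gamma> where g: "maximal_root \<gamma>" using maximal_root_above by blast
  then have gR: "\<gamma> \<in> R" by (simp add: maximal_root_def)
  have ab: "\<gamma> - \<beta> \<in> nat_span D" if "\<beta> \<in> R" for \<beta>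
    using maximal_root_above[OF that] maximal_root_unique[OF g] by blast
  have "theta_root = \<gamma>" unfolding theta_root_def highest_root_def
  proof (rule the_equality)
    show "\<gamma> \<in> R \<and> (\<forall>\<beta>\<in>R. \<gamma> - \<beta> \<in> nat_span D)" using ab gR by blast
    fix \<delta> assume "\<delta> \<in> R \<and> (\<forall>\<beta>\<in>R. \<delta> - \<beta> \<in> nat_span D)"
    then show "\<delta> = \<gamma>" using g by (auto simp: maximal_root_def)
  qed
  then show "maximal_root theta_root" "\<beta> \<in> R \<Longrightarrow> theta_root - \<beta> \<in> nat_span D" for \<beta> using g ab by auto
qed

lemma theta_R: "theta_root \<in> R" using theta_root by (simp add: maximal_root_def)
lemma theta_Pos: "theta_root \<in> Pos" using theta_root maximal_root_Pos by blast
lemma theta_dominant: "a \<in> D \<Longrightarrow> 0 \<le> theta_root \<bullet> a" using theta_root maximal_root_dominant by blast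

lemma dominant_le_theta:
  assumes "\<And>a. a \<in> D \<Longrightarrow> 0 \<le> x \<bullet> a" "\<beta> \<in> R" shows "x \<bullet> \<beta> \<le> x \<bullet> theta_root"
  using nat_span_inner_nonneg[OF theta_root_above[OF assms(2)] assms(1)] by (simp add: inner_diff_right)

text \<open>Move a long root into the dominant chamber and compare twice with the highest root: its
  squared norm is at most its pairing with \<open>theta_root\<close>, and that is at most
  \<open>theta_root \<bullet> theta_root\<close>.\<close>

lemma theta_norm: "theta_root \<bullet> theta_root = 2"
proof -
  obtain \<beta> where b: "\<beta> \<in> R" "\<beta> \<bullet> \<beta> = 2" using R_long by blast
  obtain w where w: "w \<in> W" "\<forall>a\<in>D. 0 \<le> w \<beta> \<bullet> a" using dominant_exists by blast
  have wb: "w \<beta> \<in> R" using W_mem w b by blast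
  have "w \<beta> \<bullet> w \<beta> \<le> w \<beta> \<bullet> theta_root" using dominant_le_theta[of "w \<beta>" "w \<beta>"] w wb by blast
  moreover have "theta_root \<bullet> w \<beta> \<le> theta_root \<bullet> theta_root" using dominant_le_theta[of theta_root "w \<beta>"] theta_dominant wb by blast
  ultimately have "2 \<le> theta_root \<bullet> theta_root" using W_inner[OF w(1)] b by (simp add: inner_commute)
  then show ?thesis using R_norm_le[OF theta_R] by simp
qed

lemma coroot_theta: "coroot theta_root = theta_root"
  by (simp add: coroot_def theta_norm)

section \<open>The dual Coxeter number and integrality at level \<open>k + h\<close>\<close>

abbreviation h where "h \<equiv> dual_Coxeter_number R D"

lemma h_eq: "h = 1 + rho \<bullet> theta_root"
  by (simp add: dual_Coxeter_number_def rho_def flip: theta_root_def) (simp add: coroot_theta)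

text \<open>A pairing of at least \<open>2\<close> would make \<open>\<alpha> - theta_root\<close> a
  vector of nonpositive squared norm. The values \<open>0\<close> and \<open>1\<close> equal their
  own squares, which is how \<open>sum_roots_scalar\<close> turns a quadratic sum into a pairing
  with \<open>rho\<close>.\<close>

lemma theta_inner: assumes a: "\<alpha> \<in> Pos" "\<alpha> \<noteq> theta_root" shows "\<alpha> \<bullet> theta_root = 0 \<or> \<alpha> \<bullet> theta_root = 1"
proof -
  have aR: "\<alpha> \<in> R" using a Pos_sub by blast
  have "\<alpha> \<bullet> coroot theta_root \<in> \<int>" using cartan_int theta_R aR by blast
  then obtain n where n: "\<alpha> \<bullet> theta_root = of_int n" using coroot_theta by (metis Ints_cases)
  have "0 \<le> theta_root \<bullet> \<alpha>" using dom_pos theta_dominant a by blast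
  then have "0 \<le> n" using n by (simp add: inner_commute)
  have "n < 2"
  proof (rule ccontr)
    assume "\<not> n < 2"
    then have "(2::real) \<le> of_int n" by simp
    then have g: "2 \<le> \<alpha> \<bullet> theta_root" using n by simp
    have "(\<alpha> - theta_root) \<bullet> (\<alpha> - theta_root) = \<alpha> \<bullet> \<alpha> - 2 * (\<alpha> \<bullet> theta_root) + 2"
      by (simp add: inner_simps inner_commute theta_norm)
    also have "\<dots> \<le> 0" using R_norm_le[OF aR] g by linarith
    finally have "(\<alpha> - theta_root) \<bullet> (\<alpha> - theta_root) \<le> 0" .
    then show False using a(2) by (metis inner_ge_zero inner_eq_zero_iff order_antisym right_minus_eq)
  qed
  then have "n = 0 \<or> n = 1" using \<open>0 \<le> n\<close> by linarith
  then show ?thesis using n by auto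
qed

lemma sum_R: fixes f :: "real^'n \<Rightarrow> 'b::ab_group_add" 
  shows "sum f R = (\<Sum>\<alpha>\<in>Pos. f \<alpha> + f (- \<alpha>))"
proof -
  have "sum f R = sum f Pos + sum f (uminus ` Pos)"
    by (subst R_eq, rule sum.union_disjoint) (use finite_Pos Pos_neg in auto)
  also have "sum f (uminus ` Pos) = (\<Sum>\<alpha>\<in>Pos. f (- \<alpha>))" by (simp add: sum.reindex)
  finally show ?thesis by (simp add: sum.distrib)
qed

lemma prod_R: fixes f :: "real^'n \<Rightarrow> 'b::comm_monoid_mult" 
  shows "prod f R = (\<Prod>\<alpha>\<in>Pos. f \<alpha> * f (- \<alpha>))"
proof -
  have "prod f R = prod f Pos * prod f (uminus ` Pos)"
    by (subst R_eq, rule prod.union_disjoint) (use finite_Pos Pos_neg in auto)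
  also have "prod f (uminus ` Pos) = (\<Prod>\<alpha>\<in>Pos. f (- \<alpha>))" by (simp add: prod.reindex)
  finally show ?thesis by (simp add: prod.distrib)
qed

text \<open>The invariant form \<open>\<Sum>\<alpha>(y)\<alpha>(y')\<close> is scalar on each root line by reflection, hence scalar by
  irreducibility; the scalar is found by evaluating at the highest root.\<close>

lemma sum_roots_scalar: "(\<Sum>\<alpha>\<in>Pos. (\<alpha> \<bullet> y) *\<^sub>R \<alpha>) = h *\<^sub>R y"
proof -
  define T where "T y = (\<Sum>\<alpha>\<in>R. (\<alpha> \<bullet> y) *\<^sub>R \<alpha>)" for y :: "real^'n"
  have lin: "linear T" unfolding T_def
    by (rule linearI) (auto simp: inner_simps algebra_simps sum.distrib scaleR_sum_right)
  have TW: "T (w y) = w (T y)" if w: "w \<in> W" for w y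
  proof -
    have "T (w y) = (\<Sum>\<alpha>\<in>w ` R. (\<alpha> \<bullet> w y) *\<^sub>R \<alpha>)" by (simp add: T_def W_R[OF w])
    also have "\<dots> = (\<Sum>\<alpha>\<in>R. (w \<alpha> \<bullet> w y) *\<^sub>R w \<alpha>)"
      by (subst sum.reindex) (use W_inj[OF w] in \<open>auto simp: inj_on_def\<close>)
    finally show ?thesis
      unfolding T_def by (simp add: linear_sum[OF W_linear[OF w]] W_simps[OF w] W_inner[OF w])
  qed
  define cc where "cc \<beta> = (T \<beta> \<bullet> coroot \<beta>) / 2" for \<beta>
  have Tb: "T \<beta> = cc \<beta> *\<^sub>R \<beta>" if b: "\<beta> \<in> R" for \<beta>
  proof -
    have "reflection \<beta> (T \<beta>) = T (- \<beta>)"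
      using TW[OF weyl_reflection[OF b], of \<beta>] reflection_self[OF nz[OF b]] by simp
    also have "\<dots> = - T \<beta>" by (simp add: linear_neg[OF lin])
    finally have "2 *\<^sub>R T \<beta> = (T \<beta> \<bullet> coroot \<beta>) *\<^sub>R \<beta>" by (simp add: reflection_alt scaleR_2 algebra_simps)
    then have "(1/2) *\<^sub>R 2 *\<^sub>R T \<beta> = (1/2) *\<^sub>R (T \<beta> \<bullet> coroot \<beta>) *\<^sub>R \<beta>" by simp
    then show ?thesis by (simp add: cc_def)
  qed
  have sym: "T x \<bullet> y = x \<bullet> T y" for x y
    by (simp add: T_def inner_sum_left inner_sum_right inner_commute mult.commute)
  have "cc \<alpha> = cc \<beta>" if "\<alpha> \<in> R" "\<beta> \<in> R" "\<alpha> \<bullet> \<beta> \<noteq> 0" for \<alpha> \<beta>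
    using sym[of \<alpha> \<beta>] that Tb by simp
  then have cc: "cc \<beta> = cc theta_root" if "\<beta> \<in> R" for \<beta> using irreducible_const theta_R that by blast
  have Ty: "T y = cc theta_root *\<^sub>R y"
  proof -
    have "y \<in> span R" by (simp add: span_R)
    then show ?thesis
      using linear_eq_on_span[OF lin linear_scaleR[of "cc theta_root"], of R y] Tb cc by simp
  qed
  have pos: "T y = 2 *\<^sub>R (\<Sum>\<alpha>\<in>Pos. (\<alpha> \<bullet> y) *\<^sub>R \<alpha>)" for y
    by (simp add: T_def sum_R scaleR_sum_right flip: scaleR_2)
  have "2 * cc theta_root = T theta_root \<bullet> theta_root"
    using Tb[OF theta_R] theta_norm by simp
  also have "\<dots> = 2 * (\<Sum>\<alpha>\<in>Pos. (\<alpha> \<bullet> theta_root)\<^sup>2)"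
    by (simp add: pos inner_sum_left power2_eq_square)
  also have "(\<Sum>\<alpha>\<in>Pos. (\<alpha> \<bullet> theta_root)\<^sup>2) = 4 + (\<Sum>\<alpha>\<in>Pos - {theta_root}. (\<alpha> \<bullet> theta_root)\<^sup>2)"
    using theta_Pos finite_Pos by (simp add: sum.remove theta_norm)
  also have "(\<Sum>\<alpha>\<in>Pos - {theta_root}. (\<alpha> \<bullet> theta_root)\<^sup>2) = (\<Sum>\<alpha>\<in>Pos - {theta_root}. \<alpha> \<bullet> theta_root)"
    using theta_inner by (intro sum.cong) fastforce+
  also have "\<dots> = \<Sum>Pos \<bullet> theta_root - 2"
    using theta_Pos finite_Pos by (simp add: sum_diff1 theta_norm inner_sum_left)
  also have "\<dots> = 2 * h - 4" by (simp add: sum_Pos h_eq)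
  finally have "cc theta_root = 2 * h" by simp
  then have "2 *\<^sub>R (\<Sum>\<alpha>\<in>Pos. (\<alpha> \<bullet> y) *\<^sub>R \<alpha>) = 2 *\<^sub>R (h *\<^sub>R y)" using Ty pos[of y] by simp
  then show ?thesis by (subst (asm) real_vector.scale_cancel_left) simp
qed

text \<open>Being non-orthogonal to some member of the Weyl orbit of \<open>theta_root\<close>
  passes from a root to every root not orthogonal to it, so \<open>irreducible_const\<close> applies
  to this truth value.\<close>

lemma long_root_nonorthogonal: assumes a: "\<alpha> \<in> R" shows "\<exists>w\<in>W. \<alpha> \<bullet> w theta_root \<noteq> 0"
proof -
  define f where "f \<alpha> \<longleftrightarrow> (\<exists>w\<in>W. \<alpha> \<bullet> w theta_root \<noteq> 0)" for \<alpha>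
  have imp: "f \<beta>" if "\<alpha> \<in> R" "\<beta> \<in> R" "\<alpha> \<bullet> \<beta> \<noteq> 0" and fa: "f \<alpha>" for \<alpha> \<beta>
  proof (rule ccontr)
    assume nf: "\<not> f \<beta>"
    obtain w where w: "w \<in> W" "\<alpha> \<bullet> w theta_root \<noteq> 0" using fa unfolding f_def by blast
    have "reflection \<alpha> \<circ> w \<in> W" using w that weyl_group.reflection by blast
    then have "\<beta> \<bullet> (reflection \<alpha> \<circ> w) theta_root = 0" using nf unfolding f_def by blast
    then have "\<beta> \<bullet> reflection \<alpha> (w theta_root) = 0" by simp
    moreover have "\<beta> \<bullet> w theta_root = 0" using nf w unfolding f_def by blast
    ultimately have "(w theta_root \<bullet> coroot \<alpha>) * (\<beta> \<bullet> \<alpha>) = 0" by (simp add: reflection_alt inner_simps)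
    moreover have "w theta_root \<bullet> \<alpha> \<noteq> 0" "\<beta> \<bullet> \<alpha> \<noteq> 0" using w that by (simp_all add: inner_commute)
    moreover have "0 < \<alpha> \<bullet> \<alpha>" using that norm_pos by blast
    ultimately show False by (simp add: coroot_inner)
  qed
  have "f theta_root" unfolding f_def using theta_norm weyl_group.id[of R] by (intro bexI[of _ id]) auto
  moreover have "f \<alpha> = f \<beta>" if "\<alpha> \<in> R" "\<beta> \<in> R" "\<alpha> \<bullet> \<beta> \<noteq> 0" for \<alpha> \<beta>
    using imp[OF that] imp[OF that(2,1)] that(3) by (auto simp: inner_commute)
  then have "f \<alpha> = f theta_root" using irreducible_const[of f] a theta_R by blast
  ultimately show ?thesis by (simp add: f_def)
qed

text \<open>The point is that \<open>2 / (\<alpha> \<bullet> \<alpha>)\<close> is an integer. For a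
  short root choose a long root \<open>\<beta>\<close> not orthogonal to it: Cauchy-Schwarz leaves
  \<open>\<alpha> \<bullet> \<beta>\<close> only the values \<open>1\<close> and \<open>-1\<close>,
  and the Cartan integer \<open>\<beta> \<bullet> coroot \<alpha>\<close> is
  \<open>2 / (\<alpha> \<bullet> \<alpha>)\<close> up to sign.\<close>

lemma coroot_weight: assumes a: "\<alpha> \<in> R" shows "coroot \<alpha> \<in> weights"
proof -
  have "2 / (\<alpha> \<bullet> \<alpha>) \<in> \<int>"
  proof (cases "\<alpha> \<bullet> \<alpha> = 2")
    case False
    then have lt: "\<alpha> \<bullet> \<alpha> < 2" using R_norm_le[OF a] by simp
    obtain w where w: "w \<in> W" "\<alpha> \<bullet> w theta_root \<noteq> 0" using long_root_nonorthogonal a by blast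
    define \<beta> where "\<beta> = w theta_root"
    have b: "\<beta> \<in> R" "\<beta> \<bullet> \<beta> = 2" using w W_mem theta_R W_inner theta_norm by (auto simp: \<beta>_def)
    have "\<alpha> \<bullet> coroot \<beta> \<in> \<int>" using a b cartan_int by blast
    then obtain n where n: "\<alpha> \<bullet> \<beta> = of_int n" using b by (auto simp: coroot_inner elim: Ints_cases)
    have "(\<alpha> \<bullet> \<beta>)\<^sup>2 \<le> (\<alpha> \<bullet> \<alpha>) * (\<beta> \<bullet> \<beta>)" by (rule Cauchy_Schwarz_ineq)
    also have "\<dots> < 4" using lt b by simp
    finally have "(of_int (n\<^sup>2) :: real) < of_int 4" using n by simp
    then have "n\<^sup>2 < 2\<^sup>2" by (simp only: of_int_less_iff) simp
    then have "\<bar>n\<bar> < 2" using power2_less_imp_less[of "\<bar>n\<bar>" 2] by simp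
    moreover have "n \<noteq> 0" using n w by (auto simp: \<beta>_def)
    ultimately have "n = 1 \<or> n = -1" by linarith
    moreover have "\<beta> \<bullet> coroot \<alpha> \<in> \<int>" using a b cartan_int by blast
    then have "2 * of_int n / (\<alpha> \<bullet> \<alpha>) \<in> \<int>" using n by (simp add: coroot_inner inner_commute)
    ultimately show ?thesis using Ints_minus by fastforce
  qed simp
  then have "2 / (\<alpha> \<bullet> \<alpha>) * (\<alpha> \<bullet> coroot \<beta>) \<in> \<int>" if "\<beta> \<in> R" for \<beta>
    using cartan_int[OF that a] Ints_mult by blast
  then show ?thesis unfolding weights_iff by (metis coroot_def inner_scaleR_left)
qed

lemma coroot_lattice_weights: assumes "y \<in> coroot_lattice R" shows "y \<in> weights"
proof -
  obtain c :: "_ \<Rightarrow> int" where "y = (\<Sum>\<alpha>\<in>R. of_int (c \<alpha>) *\<^sub>R coroot \<alpha>)"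
    using assms by (auto simp: coroot_lattice_def)
  then show ?thesis by (auto intro!: weights_sum weights_scale coroot_weight)
qed

text \<open>\<open>sum_roots_scalar\<close> exhibits \<open>h *\<^sub>R y\<close> as an integral
  combination of roots. As a consequence, translating \<open>x\<close> by the coroot lattice changes
  \<open>Phi x\<close> by a weight.\<close>

lemma level_scale_weight: assumes "y \<in> coroot_lattice R" shows "(real k + h) *\<^sub>R y \<in> weights"
proof -
  have "h *\<^sub>R y \<in> weights" unfolding sum_roots_scalar[symmetric]
  proof (rule weights_sum)
    fix \<alpha> assume "\<alpha> \<in> Pos"
    then have a: "\<alpha> \<in> weights" using root_weight Pos_sub by blast
    then obtain n where "\<alpha> \<bullet> y = of_int n" using assms unfolding weights_def by (auto elim: Ints_cases)
    then show "(\<alpha> \<bullet> y) *\<^sub>R \<alpha> \<in> weights" using weights_scale a by simp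
  qed
  moreover have "of_int (int k) *\<^sub>R y \<in> weights" using weights_scale coroot_lattice_weights assms by blast
  ultimately show ?thesis using weights_add by (simp add: scaleR_add_left)
qed

lemma theta_lattice: "theta_root \<in> coroot_lattice R"
  using coroot_lattice_coroot[OF theta_R] by (simp add: coroot_theta)

lemma rho_theta_pos: "0 < rho \<bullet> theta_root" using rho_Pos theta_Pos by blast

lemma h_pos: "0 < real k + h" using h_eq rho_theta_pos by simp

lemma level_weightsD:
  assumes "\<mu> \<in> level_weights R D k"
  shows "\<mu> \<in> weights" "a \<in> D \<Longrightarrow> 0 \<le> \<mu> \<bullet> a" "\<beta> \<in> R \<Longrightarrow> \<mu> \<bullet> \<beta> \<le> real k" "\<beta> \<in> Pos \<Longrightarrow> 0 \<le> \<mu> \<bullet> \<beta>"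
proof -
  have dom: "0 \<le> \<mu> \<bullet> a" if "a \<in> D" for a
  proof -
    have "0 \<le> \<mu> \<bullet> coroot a" using assms D_Pos[OF that] by (auto simp: level_weights_def dominant_weights_def)
    moreover have "0 < a \<bullet> a" using that D_sub norm_pos by blast
    ultimately show ?thesis by (simp add: coroot_inner zero_le_divide_iff zero_le_mult_iff)
  qed
  show "\<mu> \<in> weights" using assms by (auto simp: level_weights_def dominant_weights_def weights_iff)
  show "a \<in> D \<Longrightarrow> 0 \<le> \<mu> \<bullet> a" by (rule dom)
  show "\<beta> \<in> Pos \<Longrightarrow> 0 \<le> \<mu> \<bullet> \<beta>" using dom dom_pos by blast
  show "\<beta> \<in> R \<Longrightarrow> \<mu> \<bullet> \<beta> \<le> real k"
    using dominant_le_theta[of \<mu> \<beta>] dom assms by (fastforce simp: level_weights_def theta_root_def)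
qed

lemma level_weightsI:
  assumes "\<mu> \<in> weights" "\<And>a. a \<in> D \<Longrightarrow> 0 \<le> \<mu> \<bullet> a" "\<mu> \<bullet> theta_root \<le> real k"
  shows "\<mu> \<in> level_weights R D k"
proof -
  have "0 \<le> \<mu> \<bullet> coroot \<alpha>" if "\<alpha> \<in> Pos" for \<alpha>
    using dom_pos[OF assms(2) that] norm_pos[of \<alpha>] that Pos_sub by (auto simp: coroot_inner)
  then show ?thesis using assms by (auto simp: level_weights_def dominant_weights_def weights_iff theta_root_def)
qed

text \<open>A weight is determined by its integral pairings with the simple coroots, and these range
  over a finite box.\<close>

lemma finite_bounded_weights:
  assumes A: "A \<subseteq> weights" and bd: "\<And>x a. x \<in> A \<Longrightarrow> a \<in> D \<Longrightarrow> \<bar>x \<bullet> coroot a\<bar> \<le> b a" shows "finite A"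
proof -
  define N where "N = \<lceil>\<Sum>a\<in>D. \<bar>b a\<bar>\<rceil>"
  define f where "f x = restrict (\<lambda>a. \<lfloor>x \<bullet> coroot a\<rfloor>) D" for x :: "real^'n"
  have fl: "of_int \<lfloor>x \<bullet> coroot a\<rfloor> = x \<bullet> coroot a" if "x \<in> A" "a \<in> D" for x a
  proof -
    have "x \<bullet> coroot a \<in> \<int>" using that A by (auto simp: weights_iff_simple)
    then show ?thesis by (simp add: of_int_floor_cancel)
  qed
  have "inj_on f A"
  proof (rule inj_onI)
    fix x y assume xy: "x \<in> A" "y \<in> A" "f x = f y"
    have "\<lfloor>x \<bullet> coroot a\<rfloor> = \<lfloor>y \<bullet> coroot a\<rfloor>" if "a \<in> D" for a
      using fun_cong[OF xy(3), of a] that by (simp add: f_def)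
    then show "x = y" using fl[OF xy(1)] fl[OF xy(2)] by (intro simple_coroot_inner_eqI) metis
  qed
  moreover have "f ` A \<subseteq> D \<rightarrow>\<^sub>E {-N..N}"
  proof
    fix g assume "g \<in> f ` A"
    then obtain x where x: "x \<in> A" "g = f x" by blast
    have "\<lfloor>x \<bullet> coroot a\<rfloor> \<in> {-N..N}" if a: "a \<in> D" for a
    proof -
      have "\<bar>x \<bullet> coroot a\<bar> \<le> \<bar>b a\<bar>" using bd[OF x(1) a] by linarith
      also have "\<dots> \<le> (\<Sum>a\<in>D. \<bar>b a\<bar>)"
        using a finite_D by (intro member_le_sum) auto
      also have "\<dots> \<le> of_int N" by (simp add: N_def)
      finally have "\<bar>of_int \<lfloor>x \<bullet> coroot a\<rfloor>\<bar> \<le> (of_int N :: real)" by (simp only: fl[OF x(1) a])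
      then show ?thesis by (auto simp: abs_le_iff)
    qed
    then show "g \<in> D \<rightarrow>\<^sub>E {-N..N}" using x by (auto simp: f_def)
  qed
  moreover have "finite (D \<rightarrow>\<^sub>E {-N..N})" using finite_D by (intro finite_PiE) auto
  ultimately show ?thesis by (metis finite_imageD finite_subset)
qed

lemma finite_weights_ball: "finite {x \<in> weights. norm x \<le> r}"
proof (rule finite_bounded_weights[where b="\<lambda>a. r * norm (coroot a)"])
  fix x a assume "x \<in> {x \<in> weights. norm x \<le> r}"
  then show "\<bar>x \<bullet> coroot a\<bar> \<le> r * norm (coroot a)"
    using Cauchy_Schwarz_ineq2[of x "coroot a"] mult_right_mono[of "norm x" r "norm (coroot a)"] by auto
qed auto

lemma finite_level_weights: "finite (level_weights R D k)"
proof (rule finite_bounded_weights[where b="\<lambda>a. 2 * real k / (a \<bullet> a)"])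
  fix x a assume x: "x \<in> level_weights R D k" and a: "a \<in> D"
  have aR: "a \<in> R" using a D_sub by blast
  have aa: "0 < a \<bullet> a" using aR norm_pos by blast
  have "x \<bullet> coroot a \<le> 2 * real k / (a \<bullet> a)"
    unfolding coroot_inner using level_weightsD(3)[OF x aR] aa by (intro divide_right_mono) auto
  moreover have "0 \<le> x \<bullet> coroot a" using level_weightsD(2)[OF x a] aa by (simp add: coroot_inner)
  ultimately show "\<bar>x \<bullet> coroot a\<bar> \<le> 2 * real k / (a \<bullet> a)" by simp
qed (use level_weightsD(1) in blast)

end

section \<open>Fourier analysis on lattices\<close>

definition character :: "'a::real_inner \<Rightarrow> 'a \<Rightarrow> complex" where
  "character \<nu> x = exp (2 * pi * \<i> * (\<nu> \<bullet> x))"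

lemma character_add: "character (\<mu> + \<nu>) x = character \<mu> x * character \<nu> x"
  by (simp add: character_def inner_add_left distrib_left exp_add)

lemma character_add_arg: "character \<nu> (x + y) = character \<nu> x * character \<nu> y"
  by (simp add: character_def inner_add_right distrib_left exp_add)

lemma character_0 [simp]: "character 0 x = 1"
  by (simp add: character_def)

lemma norm_character [simp]: "norm (character \<nu> x) = 1"
  by (simp add: character_def)

lemma character_cnj: "cnj (character \<nu> x) = character (- \<nu>) x"
  by (simp add: character_def exp_cnj)

lemma continuous_on_character [continuous_intros]:
  "continuous_on S f \<Longrightarrow> continuous_on S (\<lambda>x. character \<nu> (f x))"
  unfolding character_def by (intro continuous_intros)

lemma character_eq_1_iff: "character \<nu> x = 1 \<longleftrightarrow> \<nu> \<bullet> x \<in> \<int>"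
proof -
  have "character \<nu> x = 1 \<longleftrightarrow> (\<exists>n::int. \<nu> \<bullet> x * 2 = of_int (2 * n))"
    unfolding character_def exp_eq_1 by (simp add: field_simps)
  also have "\<dots> \<longleftrightarrow> \<nu> \<bullet> x \<in> \<int>" by (auto simp: Ints_def)
  finally show ?thesis .
qed

lemma character_periodic: "\<nu> \<bullet> q \<in> \<int> \<Longrightarrow> character \<nu> (x + q) = character \<nu> x"
  using character_eq_1_iff[of \<nu> q] by (simp add: character_add_arg)

text \<open>The uniform closure of the trigonometric polynomials with frequencies in
  \<open>E\<close>. Generating it inductively lets frequencies be followed through sums, products
  and limits by rule induction instead of manipulating multiple series.\<close>

inductive spectrum_in :: "'a::real_inner set \<Rightarrow> ('a \<Rightarrow> complex) \<Rightarrow> bool" for E where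
  zero: "spectrum_in E (\<lambda>x. 0)"
| char: "\<nu> \<in> E \<Longrightarrow> spectrum_in E (\<lambda>x. c * character \<nu> x)"
| add: "spectrum_in E f \<Longrightarrow> spectrum_in E g \<Longrightarrow> spectrum_in E (\<lambda>x. f x + g x)"
| lim: "(\<And>\<epsilon>. 0 < \<epsilon> \<Longrightarrow> \<exists>g. spectrum_in E g \<and> (\<forall>x. norm (f x - g x) \<le> \<epsilon>)) \<Longrightarrow> spectrum_in E f"

lemma spectrum_in_bounded: "spectrum_in E f \<Longrightarrow> \<exists>B>0. \<forall>x. norm (f x) \<le> B"
proof (induction rule: spectrum_in.induct)
  case (char \<nu> c)
  show ?case by (intro exI[of _ "norm c + 1"]) (auto simp: norm_mult intro: add_nonneg_pos)
next
  case (add f g)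
  then obtain B C where "B > 0" "C > 0" "\<forall>x. norm (f x) \<le> B" "\<forall>x. norm (g x) \<le> C" by blast
  then show ?case by (intro exI[of _ "B + C"]) (auto intro: norm_triangle_mono)
next
  case (lim f)
  from lim.IH[of 1] obtain g B where g: "\<forall>x. norm (f x - g x) \<le> 1" "B > 0" "\<forall>x. norm (g x) \<le> B" by auto
  have "norm (f x) \<le> 1 + B" for x
    using norm_triangle_mono[of "f x - g x" 1 "g x" B] g by simp
  then show ?case using g(2) by (intro exI[of _ "1 + B"]) auto
qed (auto intro: exI[of _ 1])

lemma spectrum_in_continuous: "spectrum_in E f \<Longrightarrow> continuous_on UNIV f"
proof (induction rule: spectrum_in.induct)
  case (lim f)
  from lim.IH have "\<exists>g. \<forall>n::nat. continuous_on UNIV (g n) \<and> (\<forall>x. norm (f x - g n x) \<le> 1 / Suc n)"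
    by (intro choice) (metis of_nat_0_less_iff zero_less_Suc zero_less_divide_1_iff)
  then obtain g where g: "\<And>n::nat. continuous_on UNIV (g n)" "\<And>n x. norm (f x - g n x) \<le> 1 / Suc n" by blast
  have "uniform_limit UNIV g f sequentially"
  proof (rule uniform_limitI)
    fix e :: real assume e: "0 < e"
    obtain N where N: "1 / real (Suc N) < e" using e by (metis nat_approx_posE)
    have "dist (g n x) (f x) < e" if "n \<ge> N" for n x
    proof -
      have "dist (g n x) (f x) \<le> 1 / Suc n" using g(2)[of x n] by (simp add: dist_norm norm_minus_commute)
      also have "\<dots> \<le> 1 / Suc N" using that by (intro divide_left_mono) auto
      finally show ?thesis using N by simp
    qed
    then show "\<forall>\<^sub>F n in sequentially. \<forall>x\<in>UNIV. dist (g n x) (f x) < e"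
      unfolding eventually_sequentially by blast
  qed
  then show ?case using g(1) by (intro uniform_limit_theorem[where F=sequentially and f=g]) auto
qed (auto intro!: continuous_intros)

lemma spectrum_in_mono: "spectrum_in E f \<Longrightarrow> E \<subseteq> E' \<Longrightarrow> spectrum_in E' f"
proof (induction rule: spectrum_in.induct)
  case (lim f) then show ?case by (intro spectrum_in.lim) blast
qed (auto intro: spectrum_in.intros)

lemma spectrum_in_cmult: "spectrum_in E f \<Longrightarrow> spectrum_in E (\<lambda>x. c * f x)"
proof (induction rule: spectrum_in.induct)
  case (char \<nu> d) then show ?case using spectrum_in.char[of \<nu> E "c * d"] by (simp add: mult.assoc)
next
  case (lim f)
  show ?case
  proof (rule spectrum_in.lim)
    fix \<epsilon> :: real assume e: "0 < \<epsilon>"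
    then have "0 < \<epsilon> / (norm c + 1)" by (simp add: add_nonneg_pos)
    from lim.IH[OF this] obtain g where g: "spectrum_in E (\<lambda>x. c * g x)" "\<forall>x. norm (f x - g x) \<le> \<epsilon> / (norm c + 1)"
      by blast
    have "norm (c * f x - c * g x) \<le> \<epsilon>" for x
    proof -
      have "norm (c * f x - c * g x) = norm c * norm (f x - g x)" by (metis norm_mult right_diff_distrib)
      also have "\<dots> \<le> (norm c + 1) * (\<epsilon> / (norm c + 1))"
        using g(2) by (intro mult_mono) auto
      also have "\<dots> = \<epsilon>" by (simp add: add_nonneg_eq_0_iff)
      finally show ?thesis .
    qed
    then show "\<exists>g. spectrum_in E g \<and> (\<forall>x. norm (c * f x - g x) \<le> \<epsilon>)" using g(1) by blast
  qed
qed (auto simp: distrib_left intro: spectrum_in.intros)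

lemma spectrum_in_sum:
  "(\<And>i. i \<in> I \<Longrightarrow> spectrum_in E (f i)) \<Longrightarrow> spectrum_in E (\<lambda>x. \<Sum>i\<in>I. f i x)"
  by (induction I rule: infinite_finite_induct) (auto intro: spectrum_in.intros)

text \<open>Nested induction, the inner one for a single character times \<open>g\<close>. Limits
  pass through the product because the other factor is bounded.\<close>

lemma spectrum_in_mult:
  assumes f: "spectrum_in E f" and g: "spectrum_in F g" and G: "\<And>\<mu> \<nu>. \<mu> \<in> E \<Longrightarrow> \<nu> \<in> F \<Longrightarrow> \<mu> + \<nu> \<in> G"
  shows "spectrum_in G (\<lambda>x. f x * g x)"
  using f
proof (induction rule: spectrum_in.induct)
  case (char \<mu> c)
  from g show ?case
  proof (induction rule: spectrum_in.induct)
    case (char \<nu> d)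
    have "(\<lambda>x. c * character \<mu> x * (d * character \<nu> x)) = (\<lambda>x. (c * d) * character (\<mu> + \<nu>) x)"
      by (auto simp: character_add)
    then show ?case using spectrum_in.char[OF G[OF \<open>\<mu> \<in> E\<close> char]] by simp
  next
    case (lim g)
    show ?case
    proof (rule spectrum_in.lim)
      fix \<epsilon> :: real assume e: "0 < \<epsilon>"
      then have "0 < \<epsilon> / (norm c + 1)" by (simp add: add_nonneg_pos)
      from lim.IH[OF this] obtain h where h: "spectrum_in G (\<lambda>x. c * character \<mu> x * h x)" "\<forall>x. norm (g x - h x) \<le> \<epsilon> / (norm c + 1)"
        by blast
      have "norm (c * character \<mu> x * g x - c * character \<mu> x * h x) \<le> \<epsilon>" for x
      proof -
        have "norm (c * character \<mu> x * g x - c * character \<mu> x * h x) = norm c * norm (g x - h x)"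
          by (simp add: norm_mult flip: right_diff_distrib)
        also have "\<dots> \<le> (norm c + 1) * (\<epsilon> / (norm c + 1))"
          using h(2) by (intro mult_mono) auto
        also have "\<dots> = \<epsilon>" by (simp add: add_nonneg_eq_0_iff)
        finally show ?thesis .
      qed
      then show "\<exists>h. spectrum_in G h \<and> (\<forall>x. norm (c * character \<mu> x * g x - h x) \<le> \<epsilon>)" using h(1) by blast
    qed
  qed (auto simp: distrib_left intro: spectrum_in.intros)
next
  case (lim f)
  obtain B where B: "B > 0" "\<forall>x. norm (g x) \<le> B" using spectrum_in_bounded[OF g] by blast
  show ?case
  proof (rule spectrum_in.lim)
    fix \<epsilon> :: real assume e: "0 < \<epsilon>"
    then have "0 < \<epsilon> / B" using B by simp
    from lim.IH[OF this] obtain h where h: "spectrum_in G (\<lambda>x. h x * g x)" "\<forall>x. norm (f x - h x) \<le> \<epsilon> / B"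
      by blast
    have "norm (f x * g x - h x * g x) \<le> \<epsilon>" for x
    proof -
      have "norm (f x * g x - h x * g x) = norm (f x - h x) * norm (g x)"
        by (metis norm_mult left_diff_distrib)
      also have "\<dots> \<le> (\<epsilon> / B) * B" using h(2) B e by (intro mult_mono) auto
      finally show ?thesis using B by simp
    qed
    then show "\<exists>h. spectrum_in G h \<and> (\<forall>x. norm (f x * g x - h x) \<le> \<epsilon>)" using h(1) by blast
  qed
qed (auto simp: distrib_right intro: spectrum_in.intros)

lemma spectrum_in_one: "0 \<in> E \<Longrightarrow> spectrum_in E (\<lambda>x. 1)"
  using spectrum_in.char[of 0 E 1] by simp

lemma spectrum_in_character: "\<nu> \<in> E \<Longrightarrow> spectrum_in E (character \<nu>)"
  using spectrum_in.char[of \<nu> E 1] by (simp add: eta_contract_eq)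

lemma spectrum_in_prod:
  assumes "finite I" "\<And>i. i \<in> I \<Longrightarrow> spectrum_in (E i) (f i)"
  shows "spectrum_in {\<Sum>i\<in>I. e i | e. \<forall>i\<in>I. e i \<in> E i} (\<lambda>x. \<Prod>i\<in>I. f i x)"
  using assms
proof (induction I rule: finite_induct)
  case empty then show ?case by (simp add: spectrum_in_one)
next
  case (insert j I)
  have "spectrum_in {\<Sum>i\<in>insert j I. e i | e. \<forall>i\<in>insert j I. e i \<in> E i} (\<lambda>x. f j x * (\<Prod>i\<in>I. f i x))"
  proof (rule spectrum_in_mult)
    show "spectrum_in (E j) (f j)" using insert by simp
    show "spectrum_in {\<Sum>i\<in>I. e i | e. \<forall>i\<in>I. e i \<in> E i} (\<lambda>x. \<Prod>i\<in>I. f i x)" using insert by simp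
    fix \<mu> \<nu> assume m: "\<mu> \<in> E j" and "\<nu> \<in> {\<Sum>i\<in>I. e i | e. \<forall>i\<in>I. e i \<in> E i}"
    then obtain e where e: "\<nu> = (\<Sum>i\<in>I. e i)" "\<forall>i\<in>I. e i \<in> E i" by blast
    have "\<mu> + \<nu> = (\<Sum>i\<in>insert j I. (e(j := \<mu>)) i)"
      using insert e by (simp cong: sum.cong) (intro sum.cong, auto)
    moreover have "\<forall>i\<in>insert j I. (e(j := \<mu>)) i \<in> E i" using m e by auto
    ultimately show "\<mu> + \<nu> \<in> {\<Sum>i\<in>insert j I. e i | e. \<forall>i\<in>insert j I. e i \<in> E i}" by blast
  qed
  then show ?case using insert by simp
qed

section \<open>Periodization and integration over a quotient torus\<close>

definition bounded_support :: "('a::real_normed_vector \<Rightarrow> 'b::zero) \<Rightarrow> bool" where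
  "bounded_support f \<longleftrightarrow> (\<exists>r. \<forall>x. f x \<noteq> 0 \<longrightarrow> norm x \<le> r)"

lemma integrable_continuous_bounded_support:
  fixes f :: "'a::euclidean_space \<Rightarrow> 'b::{banach, second_countable_topology}"
  assumes "continuous_on UNIV f" "bounded_support f"
  shows "integrable lborel f"
proof -
  obtain r where r: "\<And>x. f x \<noteq> 0 \<Longrightarrow> norm x \<le> r" using assms by (auto simp: bounded_support_def)
  have "integrable lborel (\<lambda>x. indicator (cball 0 r) x *\<^sub>R f x)"
    by (rule borel_integrable_compact) (use assms continuous_on_subset in auto)
  also have "(\<lambda>x. indicator (cball 0 r) x *\<^sub>R f x) = f"
    using r by (auto simp: indicator_def fun_eq_iff dist_norm)
  finally show ?thesis .
qed

lemma continuous_null_integral: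
  fixes g :: "'a::euclidean_space \<Rightarrow> real"
  assumes "continuous_on UNIV g" "bounded_support g" "\<And>x. 0 \<le> g x" "(\<integral>x. g x \<partial>lborel) = 0"
  shows "g x = 0"
proof -
  have "AE x in lborel. g x = 0"
    using integral_nonneg_eq_0_iff_AE[OF integrable_continuous_bounded_support[OF assms(1,2)]] assms(3,4) by simp
  moreover have o: "open {x. g x \<noteq> 0}"
    using open_Collect_neq[OF assms(1) continuous_on_const] by simp
  ultimately have "{x. g x \<noteq> 0} \<in> null_sets lborel" by (subst AE_iff_null_sets) auto
  then have "negligible {x. g x \<noteq> 0}" using negligible_iff_null_sets null_sets_completionI by blast
  then have "{x. g x \<noteq> 0} = {}" using open_not_negligible o by blast
  then show ?thesis by blast
qed

lemma integral_lborel_translate: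
  fixes f :: "'a::euclidean_space \<Rightarrow> complex"
  assumes "continuous_on UNIV f"
  shows "(\<integral>x. f (x + q) \<partial>lborel) = (\<integral>x. f x \<partial>lborel)"
proof -
  have "(\<integral>x. f x \<partial>lborel) = (\<integral>x. f x \<partial>(distr lborel borel ((+) q)))" by (simp add: lborel_distr_plus)
  also have "\<dots> = (\<integral>x. f (q + x) \<partial>lborel)"
    by (rule integral_distr) (use assms borel_measurable_continuous_onI in auto)
  finally show ?thesis by (simp add: add.commute)
qed

text \<open>Integration against \<open>\<phi>\<close> is continuous for uniform convergence, with
  constant the integral of \<open>norm (\<phi> x)\<close>, so vanishing on characters extends to the
  closure.\<close>

lemma spectrum_in_integral_0:
  fixes \<phi> :: "'a::euclidean_space \<Rightarrow> complex"
  assumes \<phi>: "continuous_on UNIV \<phi>" "bounded_support \<phi>"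
    and E: "\<And>\<nu>. \<nu> \<in> E \<Longrightarrow> (\<integral>x. \<phi> x * character \<nu> x \<partial>lborel) = 0"
    and f: "spectrum_in E f"
  shows "(\<integral>x. \<phi> x * f x \<partial>lborel) = 0"
  using f
proof (induction rule: spectrum_in.induct)
  case (char \<nu> c)
  have "(\<lambda>x. \<phi> x * (c * character \<nu> x)) = (\<lambda>x. c * (\<phi> x * character \<nu> x))" by auto
  then show ?case using E[OF char] by simp
next
  case (add f g)
  have i: "integrable lborel (\<lambda>x. \<phi> x * f x)" if "spectrum_in E f" for f
    using \<phi> spectrum_in_continuous[OF that]
    by (intro integrable_continuous_bounded_support continuous_intros) (auto simp: bounded_support_def)
  show ?case using i add by (simp add: distrib_left)
next
  case (lim f)
  have fE: "spectrum_in E f" using lim by (intro spectrum_in.lim) blast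
  have i: "integrable lborel (\<lambda>x. \<phi> x * f x)" if "spectrum_in E f" for f
    using \<phi> spectrum_in_continuous[OF that]
    by (intro integrable_continuous_bounded_support continuous_intros) (auto simp: bounded_support_def)
  have j: "integrable lborel (\<lambda>x. norm (\<phi> x))" using \<phi> integrable_continuous_bounded_support by blast
  define I where "I = (\<integral>x. norm (\<phi> x) \<partial>lborel)"
  have I0: "0 \<le> I" by (simp add: I_def)
  have "norm (\<integral>x. \<phi> x * f x \<partial>lborel) \<le> e" if e: "0 < e" for e
  proof -
    have "0 < e / (I + 1)" using e I0 by simp
    from lim.IH[OF this] obtain g where g: "spectrum_in E g" "(\<integral>x. \<phi> x * g x \<partial>lborel) = 0" "\<forall>x. norm (f x - g x) \<le> e / (I + 1)" by blast
    have "(\<integral>x. \<phi> x * f x \<partial>lborel) = (\<integral>x. \<phi> x * f x - \<phi> x * g x \<partial>lborel)"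
      using i fE g by simp
    also have "norm \<dots> \<le> (\<integral>x. norm (\<phi> x * f x - \<phi> x * g x) \<partial>lborel)"
      by (rule integral_norm_bound)
    also have "\<dots> \<le> (\<integral>x. norm (\<phi> x) * (e / (I + 1)) \<partial>lborel)"
    proof (rule integral_mono)
      show "integrable lborel (\<lambda>x. norm (\<phi> x * f x - \<phi> x * g x))" using i fE g by simp
      show "integrable lborel (\<lambda>x. norm (\<phi> x) * (e / (I + 1)))" using j by simp
      show "norm (\<phi> x * f x - \<phi> x * g x) \<le> norm (\<phi> x) * (e / (I + 1))" for x
        using g(3) by (simp add: mult_left_mono norm_mult flip: right_diff_distrib del: times_divide_eq_right)
    qed
    also have "\<dots> = I * (e / (I + 1))" by (simp add: I_def)
    also have "\<dots> \<le> e" using I0 e by (simp add: field_simps)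
    finally show ?thesis .
  qed
  then have "norm (\<integral>x. \<phi> x * f x \<partial>lborel) \<le> 0" by (rule field_le_epsilon) simp
  then show ?case by simp
qed simp

text \<open>A lattice of full rank, described by local finiteness and by the bound on coset
  representatives; neither a basis nor a fundamental domain is chosen.\<close>

locale lattice =
  fixes L :: "'a::euclidean_space set"
  assumes zero_L: "0 \<in> L" and add_L: "x \<in> L \<Longrightarrow> y \<in> L \<Longrightarrow> x + y \<in> L" and minus_L: "x \<in> L \<Longrightarrow> - x \<in> L"
    and finite_ball_L: "finite {x \<in> L. norm x \<le> r}"
    and cocompact: "\<exists>r. \<forall>x. \<exists>q\<in>L. norm (x + q) \<le> r"
begin

text \<open>Only the nonzero terms are collected, so that for bounded support the lattice sum is a
  finite sum.\<close>

definition periodize :: "('a \<Rightarrow> 'b::comm_monoid_add) \<Rightarrow> 'a \<Rightarrow> 'b" where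
  "periodize \<phi> x = (\<Sum>q\<in>{q \<in> L. \<phi> (x + q) \<noteq> 0}. \<phi> (x + q))"

lemma periodize_eq:
  assumes "finite A" "A \<subseteq> L" "\<And>q. q \<in> L \<Longrightarrow> \<phi> (x + q) \<noteq> 0 \<Longrightarrow> q \<in> A"
  shows "periodize \<phi> x = (\<Sum>q\<in>A. \<phi> (x + q))"
  unfolding periodize_def by (rule sum.mono_neutral_left) (use assms in auto)

lemma periodize_ball:
  assumes "\<And>x. \<phi> x \<noteq> 0 \<Longrightarrow> norm x \<le> r" "norm x \<le> s"
  shows "periodize \<phi> x = (\<Sum>q\<in>{q \<in> L. norm q \<le> r + s}. \<phi> (x + q))"
proof (rule periodize_eq)
  fix q assume "q \<in> L" "\<phi> (x + q) \<noteq> 0"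
  then have "norm (x + q) \<le> r" using assms by blast
  then have "norm q \<le> r + s" using norm_triangle_ineq4[of "x + q" x] assms(2) by simp
  then show "q \<in> {q \<in> L. norm q \<le> r + s}" using \<open>q \<in> L\<close> by simp
qed (auto simp: finite_ball_L)

lemma periodize_add: assumes "p \<in> L" shows "periodize \<phi> (x + p) = periodize \<phi> x"
  unfolding periodize_def
  by (rule sum.reindex_bij_witness[of _ "\<lambda>q. q - p" "\<lambda>q. p + q"])
     (use assms add_L minus_L in \<open>auto simp: add.assoc intro: add_L[of _ "- p", simplified]\<close>)

lemma continuous_periodize:
  fixes \<phi> :: "'a \<Rightarrow> 'b::real_normed_vector"
  assumes "continuous_on UNIV \<phi>" "bounded_support \<phi>"
  shows "continuous_on UNIV (periodize \<phi>)"
proof -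
  obtain r where r: "\<And>x. \<phi> x \<noteq> 0 \<Longrightarrow> norm x \<le> r" using assms by (auto simp: bounded_support_def)
  have "isCont (periodize \<phi>) x" for x
  proof -
    let ?g = "\<lambda>y. \<Sum>q\<in>{q \<in> L. norm q \<le> r + (norm x + 1)}. \<phi> (y + q)"
    have "continuous_on UNIV ?g"
      by (intro continuous_intros continuous_on_compose2[OF assms(1)]) auto
    then have "continuous_on (ball 0 (norm x + 1)) ?g" by (rule continuous_on_subset) auto
    then have "continuous_on (ball 0 (norm x + 1)) (periodize \<phi>)"
      using periodize_ball[where \<phi>=\<phi> and s="norm x + 1", OF r]
      by (subst continuous_on_cong[OF refl, of _ _ ?g]) auto
    then show ?thesis by (rule continuous_on_interior) simp
  qed
  then show ?thesis by (simp add: continuous_at_imp_continuous_on)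
qed

text \<open>The cone \<open>\<eta>\<close> is at least \<open>1\<close> on the ball of radius
  \<open>r\<close>, which meets every coset, so its periodization is positive everywhere; dividing
  by it normalizes the lattice sum to \<open>1\<close>.\<close>

lemma partition_exists:
  "\<exists>\<psi> :: 'a \<Rightarrow> real. continuous_on UNIV \<psi> \<and> bounded_support \<psi> \<and> (\<forall>x. 0 \<le> \<psi> x) \<and> (\<forall>x. periodize \<psi> x = 1)"
proof -
  obtain r where r: "\<And>x. \<exists>q\<in>L. norm (x + q) \<le> r" using cocompact by blast
  define \<eta> where "\<eta> x = max 0 (r + 1 - norm x)" for x :: 'a
  have c: "continuous_on UNIV \<eta>" unfolding \<eta>_def by (intro continuous_intros)
  have s: "\<eta> x \<noteq> 0 \<Longrightarrow> norm x \<le> r + 1" for x by (auto simp: \<eta>_def max_def split: if_splits)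
  then have b: "bounded_support \<eta>" unfolding bounded_support_def by blast
  have nn: "0 \<le> \<eta> x" for x by (simp add: \<eta>_def)
  have pos: "0 < periodize \<eta> x" for x
  proof -
    obtain q where q: "q \<in> L" "norm (x + q) \<le> r" using r by blast
    let ?A = "{q \<in> L. norm q \<le> r + 1 + norm x}"
    have "0 < \<eta> (x + q)" using q by (simp add: \<eta>_def)
    moreover have "norm q \<le> r + 1 + norm x" using q norm_triangle_ineq4[of "x + q" x] by simp
    ultimately have "0 < (\<Sum>q\<in>?A. \<eta> (x + q))" using q nn
      by (intro sum_pos2[of ?A q]) (auto simp: finite_ball_L)
    then show ?thesis using periodize_ball[where \<phi>=\<eta> and x=x, OF s order_refl] by simp
  qed
  define \<psi> where "\<psi> x = \<eta> x / periodize \<eta> x" for x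
  have supp: "\<psi> x \<noteq> 0 \<longleftrightarrow> \<eta> x \<noteq> 0" for x using pos[of x] by (simp add: \<psi>_def)
  have "periodize \<psi> x = 1" for x
  proof -
    have "periodize \<psi> x = (\<Sum>q\<in>{q \<in> L. \<eta> (x + q) \<noteq> 0}. \<eta> (x + q) / periodize \<eta> x)"
      unfolding periodize_def[of \<psi>] supp by (rule sum.cong) (auto simp: \<psi>_def periodize_add)
    also have "\<dots> = (\<Sum>q\<in>{q \<in> L. \<eta> (x + q) \<noteq> 0}. \<eta> (x + q)) / periodize \<eta> x"
      by (simp only: sum_divide_distrib)
    also have "\<dots> = periodize \<eta> x / periodize \<eta> x" by (simp only: periodize_def)
    finally show ?thesis using pos[of x] by simp
  qed
  moreover have "continuous_on UNIV \<psi>" unfolding \<psi>_def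
    using pos by (intro continuous_intros c continuous_periodize b) (auto simp: less_le)
  moreover have "bounded_support \<psi>" using b supp by (auto simp: bounded_support_def)
  moreover have "0 \<le> \<psi> x" for x using nn pos[of x] by (simp add: \<psi>_def)
  ultimately show ?thesis by blast
qed

text \<open>Integrating a periodic function against \<open>partition\<close> stands for integrating
  it over the quotient by \<open>L\<close>.\<close>

definition partition where
  "partition = (SOME \<psi> :: 'a \<Rightarrow> real. continuous_on UNIV \<psi> \<and> bounded_support \<psi> \<and> (\<forall>x. 0 \<le> \<psi> x) \<and> (\<forall>x. periodize \<psi> x = 1))"

lemma continuous_partition: "continuous_on UNIV partition" 
  and bounded_support_partition: "bounded_support partition"
  and partition_nonneg: "0 \<le> partition x" and periodize_partition: "periodize partition x = 1"
  using someI_ex[OF partition_exists, folded partition_def] by auto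

text \<open>Insert \<open>periodize partition x = 1\<close> under the integral, move each lattice
  translation from \<open>partition\<close> to \<open>\<phi>\<close> by translation invariance, and
  sum again.\<close>

lemma integral_unfold:
  fixes \<phi> f :: "'a \<Rightarrow> complex"
  assumes \<phi>: "continuous_on UNIV \<phi>" "bounded_support \<phi>"
    and f: "continuous_on UNIV f" "\<And>x q. q \<in> L \<Longrightarrow> f (x + q) = f x"
  shows "(\<integral>x. \<phi> x * f x \<partial>lborel) = (\<integral>x. partition x * periodize \<phi> x * f x \<partial>lborel)"
proof -
  obtain r where r: "\<And>x. \<phi> x \<noteq> 0 \<Longrightarrow> norm x \<le> r" using \<phi> by (auto simp: bounded_support_def)
  obtain s where s: "\<And>x. partition x \<noteq> 0 \<Longrightarrow> norm x \<le> s" using bounded_support_partition by (auto simp: bounded_support_def)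
  let ?A = "{q \<in> L. norm q \<le> s + r}"
  have cp: "continuous_on UNIV (\<lambda>x. complex_of_real (partition (x + q)))" for q
    by (intro continuous_intros continuous_on_compose2[OF continuous_partition]) auto
  have ct: "continuous_on UNIV (\<lambda>x. \<phi> (x + q))" for q
    by (intro continuous_intros continuous_on_compose2[OF \<phi>(1)]) auto
  have 1: "\<phi> x * f x = (\<Sum>q\<in>?A. partition (x + q) * \<phi> x * f x)" for x
  proof (cases "\<phi> x = 0")
    case False
    then have "(\<Sum>q\<in>?A. partition (x + q)) = 1"
      using periodize_ball[where \<phi>=partition, OF s r[OF False]] periodize_partition[of x] by simp
    from arg_cong[OF this, of complex_of_real]
    have "(\<Sum>q\<in>?A. complex_of_real (partition (x + q))) = 1" by simp
    then have "\<phi> x * f x = (\<Sum>q\<in>?A. complex_of_real (partition (x + q))) * (\<phi> x * f x)" by simp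
    then show ?thesis by (simp only: sum_distrib_right mult.assoc)
  qed simp
  have i1: "integrable lborel (\<lambda>x. partition (x + q) * \<phi> x * f x)" for q
    using \<phi>(2) by (intro integrable_continuous_bounded_support continuous_intros cp \<phi> f) (auto simp: bounded_support_def)
  have i2: "integrable lborel (\<lambda>x. partition x * \<phi> (x + q) * f x)" for q
    using bounded_support_partition cp[of 0]
    by (intro integrable_continuous_bounded_support continuous_intros ct f) (auto simp: bounded_support_def)
  have "(\<integral>x. \<phi> x * f x \<partial>lborel) = (\<Sum>q\<in>?A. \<integral>x. partition (x + q) * \<phi> x * f x \<partial>lborel)"
    unfolding 1 using i1 by (intro Bochner_Integration.integral_sum)
  also have "\<dots> = (\<Sum>q\<in>?A. \<integral>x. partition x * \<phi> (x + - q) * f x \<partial>lborel)"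
  proof (rule sum.cong[OF refl])
    fix q assume q: "q \<in> ?A"
    let ?g = "\<lambda>x. partition x * \<phi> (x + - q) * f x"
    have "continuous_on UNIV ?g" using cp[of 0] by (intro continuous_intros ct f) simp
    from integral_lborel_translate[OF this, of q]
    show "(\<integral>x. partition (x + q) * \<phi> x * f x \<partial>lborel) = (\<integral>x. ?g x \<partial>lborel)"
      using f(2)[of q] q by simp
  qed
  also have "\<dots> = (\<Sum>q\<in>?A. \<integral>x. partition x * \<phi> (x + q) * f x \<partial>lborel)"
    by (rule sum.reindex_bij_witness[of _ uminus uminus]) (auto simp: minus_L)
  also have "\<dots> = (\<integral>x. (\<Sum>q\<in>?A. partition x * \<phi> (x + q) * f x) \<partial>lborel)"
    using i2 by (intro Bochner_Integration.integral_sum[symmetric])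
  also have "(\<lambda>x. \<Sum>q\<in>?A. partition x * \<phi> (x + q) * f x) = (\<lambda>x. partition x * periodize \<phi> x * f x)"
  proof
    fix x show "(\<Sum>q\<in>?A. partition x * \<phi> (x + q) * f x) = partition x * periodize \<phi> x * f x"
    proof (cases "partition x = 0")
      case False
      then have "norm x \<le> s" using s by blast
      then have "periodize \<phi> x = (\<Sum>q\<in>?A. \<phi> (x + q))"
        using periodize_ball[where \<phi>=\<phi> and r=r and x=x and s=s, OF r] by (simp add: add.commute)
      then show ?thesis by (simp add: sum_distrib_left sum_distrib_right)
    qed simp
  qed
  finally show ?thesis .
qed

text \<open>The vector \<open>a\<close> satisfies \<open>\<nu> \<bullet> a = 1/2\<close>, so
  translation by \<open>a\<close> multiplies the character by \<open>-1\<close>. The translated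
  \<open>partition\<close> still periodizes to \<open>1\<close>, and by
  \<open>integral_unfold\<close> any two such functions give the same integral of a periodic
  function; hence the integral equals its own negative.\<close>

lemma integral_character_0:
  assumes n: "\<nu> \<noteq> 0" "\<And>q. q \<in> L \<Longrightarrow> \<nu> \<bullet> q \<in> \<int>"
  shows "(\<integral>x. partition x * character \<nu> x \<partial>lborel) = 0"
proof -
  define a where "a = (1 / (2 * (\<nu> \<bullet> \<nu>))) *\<^sub>R \<nu>"
  have "\<nu> \<bullet> a = 1/2" using n by (simp add: a_def)
  then have "complex_of_real (\<nu> \<bullet> a) = 1/2" by (simp only: of_real_divide of_real_1 of_real_numeral)
  then have "character \<nu> a = exp (pi * \<i>)" unfolding character_def by (simp only:) simp
  then have a: "character \<nu> a = -1" by simp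
  let ?\<phi> = "\<lambda>x. complex_of_real (partition (x + - a))"
  have c: "continuous_on UNIV ?\<phi>"
    by (intro continuous_intros continuous_on_compose2[OF continuous_partition]) auto
  obtain s where s: "\<And>x. partition x \<noteq> 0 \<Longrightarrow> norm x \<le> s" using bounded_support_partition by (auto simp: bounded_support_def)
  have b: "bounded_support ?\<phi>" unfolding bounded_support_def
  proof (intro exI allI impI)
    fix x assume "?\<phi> x \<noteq> 0"
    then have "norm (x + - a) \<le> s" using s by simp
    then show "norm x \<le> s + norm a" using norm_triangle_ineq2[of x a] by simp
  qed
  have p: "periodize ?\<phi> x = 1" for x
  proof -
    have "periodize ?\<phi> x = complex_of_real (periodize partition (x + - a))"
      unfolding periodize_def by (simp add: algebra_simps)
    then show ?thesis by (simp only: periodize_partition) simp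
  qed
  have "(\<integral>x. ?\<phi> x * character \<nu> x \<partial>lborel) = (\<integral>x. partition x * character \<nu> x \<partial>lborel)"
    using integral_unfold[where f="character \<nu>", OF c b] n character_periodic[of \<nu>] p
    by (simp add: continuous_on_character[OF continuous_on_id])
  moreover have "(\<integral>x. ?\<phi> (x + a) * character \<nu> (x + a) \<partial>lborel) = (\<integral>x. ?\<phi> x * character \<nu> x \<partial>lborel)"
    by (rule integral_lborel_translate) (intro continuous_intros c)
  ultimately show ?thesis by (simp add: character_add_arg a)
qed

lemma spectrum_in_mean_0:
  fixes f :: "'a \<Rightarrow> complex"
  assumes f: "spectrum_in E f" and E: "0 \<notin> E" "\<And>\<nu> q. \<nu> \<in> E \<Longrightarrow> q \<in> L \<Longrightarrow> \<nu> \<bullet> q \<in> \<int>"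
  shows "(\<integral>x. partition x * f x \<partial>lborel) = 0"
proof (rule spectrum_in_integral_0[where \<phi>="\<lambda>x. complex_of_real (partition x)" and f=f])
  show "spectrum_in E f" by (rule f)
  show "continuous_on UNIV (\<lambda>x. complex_of_real (partition x))"
    by (intro continuous_intros continuous_partition)
  show "bounded_support (\<lambda>x. complex_of_real (partition x))"
    using bounded_support_partition by (auto simp: bounded_support_def)
  show "(\<integral>x. partition x * character \<nu> x \<partial>lborel) = 0" if "\<nu> \<in> E" for \<nu>
    using E that by (intro integral_character_0) auto
qed

end

text \<open>Continuous functions periodic under the dual lattice of the vectors \<open>b i\<close> factor through
  the torus map \<open>z \<mapsto> (character (b i) z)\<^sub>i\<close>, so they can be approximated by Stone--Weierstrass.\<close>

lemma spectrum_in_real_polynomial: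
  fixes b :: "'m::finite \<Rightarrow> 'a::euclidean_space" and p :: "complex^'m \<Rightarrow> real"
  assumes p: "real_polynomial_function p"
    and b: "\<And>i. b i \<in> L" and L: "0 \<in> L" "\<And>x y. x \<in> L \<Longrightarrow> y \<in> L \<Longrightarrow> x + y \<in> L" "\<And>x. x \<in> L \<Longrightarrow> - x \<in> L"
  shows "spectrum_in L (\<lambda>z. complex_of_real (p (\<chi> i. character (b i) z)))"
  using p
proof (induction rule: real_polynomial_function.induct)
  case (linear p)
  then interpret bounded_linear p .
  have "p (\<chi> i. character (b i) z) = (\<Sum>u\<in>Basis. ((\<chi> i. character (b i) z) \<bullet> u) * p u)" for z
  proof -
    have "p (\<chi> i. character (b i) z) = p (\<Sum>u\<in>Basis. ((\<chi> i. character (b i) z) \<bullet> u) *\<^sub>R u)"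
      by (simp only: euclidean_representation)
    then show ?thesis by (simp add: sum scaleR)
  qed
  then have e: "complex_of_real (p (\<chi> i. character (b i) z)) = (\<Sum>u\<in>Basis. of_real (p u) * complex_of_real ((\<chi> i. character (b i) z) \<bullet> u))" for z
    by (simp add: mult.commute)
  have "spectrum_in L (\<lambda>z. complex_of_real ((\<chi> i. character (b i) z) \<bullet> u))" if u: "u \<in> Basis" for u :: "complex^'m"
  proof -
    obtain i v where v: "u = axis i v" using u by (auto simp: Basis_vec_def)
    \<comment> \<open>A real-linear coordinate of a complex number combines the number with its
      conjugate, and the conjugate of a character has the opposite frequency.\<close>
    have "complex_of_real (z \<bullet> v) = cnj v / 2 * z + v / 2 * cnj z" for z
      by (simp add: complex_eq_iff inner_complex_def field_simps)
    then have "complex_of_real ((\<chi> i. character (b i) z) \<bullet> u) = cnj v / 2 * character (b i) z + v / 2 * character (- b i) z" for z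
      by (simp add: v inner_axis character_cnj)
    then show ?thesis by (simp only:) (intro spectrum_in.add spectrum_in.char b L)
  qed
  then show ?case unfolding e by (intro spectrum_in_sum spectrum_in_cmult)
next
  case (const c) then show ?case using spectrum_in.char[OF L(1), of "of_real c"] by simp
next
  case (add f g) then show ?case by (simp add: spectrum_in.add)
next
  case (mult f g) then show ?case using L by (auto intro: spectrum_in_mult)
qed

text \<open>\<open>P\<close> holds the periods and \<open>L\<close> the frequencies, and finitely
  many \<open>b i\<close> in \<open>L\<close> suffice to detect \<open>P\<close>. The application
  takes the weight lattice, the coroot lattice and the simple coroots.\<close>

locale dual_lattices = P: lattice P for P :: "'a::euclidean_space set" +
  fixes L :: "'a set" and b :: "'m::finite \<Rightarrow> 'a"
  assumes zero_L': "0 \<in> L" and add_L': "x \<in> L \<Longrightarrow> y \<in> L \<Longrightarrow> x + y \<in> L" and minus_L': "x \<in> L \<Longrightarrow> - x \<in> L"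
    and b_L: "b i \<in> L" and dual: "z \<in> P \<longleftrightarrow> (\<forall>i. b i \<bullet> z \<in> \<int>)" and dual': "y \<in> L \<Longrightarrow> z \<in> P \<Longrightarrow> y \<bullet> z \<in> \<int>"
begin

lemma spectrum_in_periodic:
  fixes f :: "'a \<Rightarrow> complex"
  assumes f: "continuous_on UNIV f" and per: "\<And>x q. q \<in> P \<Longrightarrow> f (x + q) = f x"
  shows "spectrum_in L f"
proof -
  define E where "E z = (\<chi> i. character (b i) z)" for z
  have cE: "continuous_on S E" for S unfolding E_def by (intro continuous_intros)
  have EE: "f x = f y" if "E x = E y" for x y
  proof -
    have "character (b i) (x - y) = 1" for i
    proof -
      have "character (b i) x = character (b i) y" using that by (simp add: E_def vec_eq_iff)
      then have "character (b i) (x + - y) = character (b i) (y + - y)" by (simp only: character_add_arg)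
      then show ?thesis by (simp add: character_def)
    qed
    then have "x - y \<in> P" using character_eq_1_iff dual by blast
    then show ?thesis using per[of "x - y" y] by simp
  qed
  obtain r where r: "\<And>x. \<exists>q\<in>P. norm (x + q) \<le> r" using P.cocompact by blast
  let ?K = "cball (0::'a) r" and ?T = "range E"
  have im: "E ` ?K = ?T"
  proof
    show "range E \<subseteq> E ` ?K"
    proof clarify
      fix x obtain q where q: "q \<in> P" "norm (x + q) \<le> r" using r by blast
      have "E (x + q) = E x" unfolding E_def using q dual' b_L by (simp add: character_periodic)
      then show "E x \<in> E ` ?K" using q by (metis image_eqI mem_cball_0)
    qed
  qed auto
  have compT: "compact ?T" using compact_continuous_image[OF cE compact_cball] im by metis
  define F where "F v = f (SOME x. E x = v)" for v
  have FE: "F (E x) = f x" for x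
    unfolding F_def by (rule EE) (rule someI[of "\<lambda>y. E y = E x" x], simp)
  \<comment> \<open>\<open>E\<close> already maps the compact ball \<open>?K\<close> onto the torus,
    so the preimage under \<open>F\<close> of a closed set is the image of a compact set.\<close>
  have cF: "continuous_on ?T F"
  proof -
    have "\<exists>A. closed A \<and> A \<inter> ?T = F -` B \<inter> ?T" if B: "closed B" for B
    proof -
      have "compact (?K \<inter> f -` B)"
        using continuous_closed_vimage[OF B] f by (intro compact_Int_closed) (auto simp: continuous_on_eq_continuous_at)
      then have "closed (E ` (?K \<inter> f -` B))" using compact_continuous_image[OF cE] compact_imp_closed by blast
      moreover have "E ` (?K \<inter> f -` B) \<inter> ?T = F -` B \<inter> ?T"
      proof
        show "F -` B \<inter> ?T \<subseteq> E ` (?K \<inter> f -` B) \<inter> ?T"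
        proof
          fix v assume v: "v \<in> F -` B \<inter> ?T"
          then obtain x where x: "x \<in> ?K" "v = E x" using im by blast
          then have "f x \<in> B" using v FE by auto
          then show "v \<in> E ` (?K \<inter> f -` B) \<inter> ?T" using x by blast
        qed
        show "E ` (?K \<inter> f -` B) \<inter> ?T \<subseteq> F -` B \<inter> ?T"
        proof
          fix v assume "v \<in> E ` (?K \<inter> f -` B) \<inter> ?T"
          then obtain x where "v = E x" "f x \<in> B" by blast
          then show "v \<in> F -` B \<inter> ?T" using FE by simp
        qed
      qed
      ultimately show ?thesis by blast
    qed
    then show ?thesis unfolding continuous_on_closed_invariant by blast
  qed
  have sp: "spectrum_in L (\<lambda>z. complex_of_real (G (E z)))" if G: "continuous_on ?T G" for G :: "complex^'m \<Rightarrow> real"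
  proof (rule spectrum_in.lim)
    fix \<epsilon> :: real assume e: "0 < \<epsilon>"
    obtain p where p: "real_polynomial_function p" "\<And>v. v \<in> ?T \<Longrightarrow> \<bar>G v - p v\<bar> < \<epsilon>"
      using Stone_Weierstrass_real_polynomial_function[OF compT G e] by blast
    have "spectrum_in L (\<lambda>z. complex_of_real (p (E z)))"
      unfolding E_def by (rule spectrum_in_real_polynomial[OF p(1)]) (auto intro: b_L zero_L' add_L' minus_L')
    moreover have "norm (complex_of_real (G (E z)) - complex_of_real (p (E z))) \<le> \<epsilon>" for z
      using p(2)[of "E z"] by (simp flip: of_real_diff)
    ultimately show "\<exists>g. spectrum_in L g \<and> (\<forall>x. norm (complex_of_real (G (E x)) - g x) \<le> \<epsilon>)" by blast
  qed
  have "spectrum_in L (\<lambda>z. complex_of_real (Re (F (E z))) + \<i> * complex_of_real (Im (F (E z))))"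
    by (intro spectrum_in.add spectrum_in_cmult sp continuous_intros cF)
  also have "(\<lambda>z. complex_of_real (Re (F (E z))) + \<i> * complex_of_real (Im (F (E z)))) = f"
    by (auto simp: FE complex_eq_iff)
  finally show ?thesis .
qed

text \<open>The hypothesis makes the periodization \<open>?w\<close> orthogonal to every character
  with frequency in \<open>L\<close>. By \<open>spectrum_in_periodic\<close> its conjugate lies in
  the closure of these characters, so \<open>?w\<close> is orthogonal to itself and vanishes by
  continuity. Stated for vanishing coefficients, Poisson summation raises no question of
  convergence.\<close>

lemma poisson_summation_0:
  fixes \<phi> :: "'a \<Rightarrow> complex"
  assumes \<phi>: "continuous_on UNIV \<phi>" "bounded_support \<phi>"
    and 0: "\<And>y. y \<in> L \<Longrightarrow> (\<integral>z. \<phi> z * character y z \<partial>lborel) = 0"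
  shows "P.periodize \<phi> x = 0"
proof -
  let ?w = "P.periodize \<phi>"
  have cw: "continuous_on UNIV ?w" using \<phi> P.continuous_periodize by blast
  have pw: "?w (x + q) = ?w x" if "q \<in> P" for x q using that P.periodize_add by blast
  let ?\<Phi> = "\<lambda>x. complex_of_real (P.partition x) * ?w x"
  have c: "continuous_on UNIV ?\<Phi>" by (intro continuous_intros P.continuous_partition cw)
  have bs: "bounded_support ?\<Phi>" using P.bounded_support_partition by (auto simp: bounded_support_def)
  have "spectrum_in L (\<lambda>x. cnj (?w x))"
    by (rule spectrum_in_periodic) (auto intro!: continuous_intros cw simp: pw)
  then have "(\<integral>x. ?\<Phi> x * cnj (?w x) \<partial>lborel) = 0"
  proof (rule spectrum_in_integral_0[OF c bs, rotated])
    fix y assume y: "y \<in> L"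
    show "(\<integral>x. ?\<Phi> x * character y x \<partial>lborel) = 0"
      using P.integral_unfold[where f="character y", OF \<phi>] 0[OF y] character_periodic[of y] dual'[OF y]
      by (simp add: continuous_on_character[OF continuous_on_id])
  qed
  also have "(\<lambda>x. ?\<Phi> x * cnj (?w x)) = (\<lambda>x. complex_of_real (P.partition x * (norm (?w x))\<^sup>2))"
    by (rule ext) (simp only: of_real_mult complex_norm_square mult.assoc)
  finally have z: "(\<integral>x. P.partition x * (norm (?w x))\<^sup>2 \<partial>lborel) = 0"
    by (metis integral_complex_of_real of_real_eq_0_iff)
  have v: "P.partition x * (norm (?w x))\<^sup>2 = 0" for x
  proof (rule continuous_null_integral[OF _ _ _ z])
    show "continuous_on UNIV (\<lambda>x. P.partition x * (norm (?w x))\<^sup>2)"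
      by (intro continuous_intros P.continuous_partition cw)
    show "bounded_support (\<lambda>x. P.partition x * (norm (?w x))\<^sup>2)"
      using P.bounded_support_partition by (auto simp: bounded_support_def)
  qed (simp add: P.partition_nonneg)
  \<comment> \<open>\<open>P.partition\<close> may vanish at \<open>x\<close> itself, so the
    conclusion is read off at a translate of \<open>x\<close> where it does not.\<close>
  have "{q \<in> P. P.partition (x + q) \<noteq> 0} \<noteq> {}"
    using P.periodize_partition[of x] unfolding P.periodize_def by (metis sum.empty zero_neq_one)
  then obtain q where "q \<in> P" "P.partition (x + q) \<noteq> 0" by blast
  then show ?thesis using v[of "x + q"] pw[of q x] by simp
qed

end

section \<open>Change of variables and Poisson summation\<close>

text \<open>The change of variables theorem of the library is stated for index types with a well-order,
  so an arbitrary finite index type is replaced by a well-ordered copy.\<close>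

typedef 'a wo = "UNIV :: 'a set" morphisms of_wo to_wo by auto

lemma bij_of_wo: "bij of_wo" and bij_to_wo: "bij to_wo"
  by (metis bijI' of_wo_inject of_wo_inverse to_wo_inverse UNIV_I)+

instance wo :: (finite) finite
  by standard (metis bij_of_wo bij_betw_finite finite)

definition wo_rank :: "'a::finite wo \<Rightarrow> nat" where
  "wo_rank = (SOME f. inj f)"

lemma inj_wo_rank: "inj (wo_rank :: 'a::finite wo \<Rightarrow> nat)"
proof -
  have "\<exists>f :: 'a wo \<Rightarrow> nat. inj f" using finite_imp_inj_to_nat_seg[of "UNIV :: 'a wo set"] by auto
  from someI_ex[OF this] show ?thesis by (simp add: wo_rank_def)
qed

instantiation wo :: (finite) wellorder
begin
definition "x \<le> y \<longleftrightarrow> wo_rank x \<le> wo_rank y"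
definition "x < y \<longleftrightarrow> wo_rank x < wo_rank y"
instance
proof
  fix P :: "'a wo \<Rightarrow> bool" and a
  assume step: "\<And>x. (\<And>y. y < x \<Longrightarrow> P y) \<Longrightarrow> P x"
  show "P a"
  proof (induction a rule: measure_induct_rule[of wo_rank])
    case (less x)
    show ?case by (rule step) (use less in \<open>simp add: less_wo_def\<close>)
  qed
next
  fix x y :: "'a wo" assume "x \<le> y" "y \<le> x"
  then have "wo_rank x = wo_rank y" by (simp add: less_eq_wo_def)
  then show "x = y" by (rule injD[OF inj_wo_rank])
qed (auto simp: less_eq_wo_def less_wo_def)
end

definition reindex :: "'b ^ 'n::finite \<Rightarrow> 'b ^ 'n wo" where
  "reindex v = (\<chi> i. v $ of_wo i)"

definition unindex :: "'b ^ 'n wo \<Rightarrow> 'b ^ 'n::finite" where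
  "unindex v = (\<chi> i. v $ to_wo i)"

lemma reindex_unindex [simp]: "reindex (unindex v) = v" "unindex (reindex u) = u"
  by (simp_all add: reindex_def unindex_def to_wo_inverse of_wo_inverse vec_eq_iff)

lemma linear_reindex: "linear (reindex :: real^'n::finite \<Rightarrow> _)" and linear_unindex: "linear (unindex :: _ \<Rightarrow> real^'n::finite)"
  by (auto intro!: linearI simp: reindex_def unindex_def vec_eq_iff)

lemma prod_of_wo: "(\<Prod>i\<in>UNIV. f (of_wo i)) = (\<Prod>i\<in>UNIV. f i)"
  using prod.reindex_bij_betw[OF bij_of_wo, of f] .

text \<open>Conjugation by the bijection of index types preserves the sign of a permutation, which
  is checked on transpositions; the Leibniz sums then agree term by term.\<close>

lemma det_reindex:
  fixes A :: "real^'n::finite^'n"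
  shows "det (\<chi> i j. A $ of_wo i $ of_wo j) = det A"
proof -
  define c where "c p = to_wo \<circ> p \<circ> of_wo" for p :: "'n \<Rightarrow> 'n"
  have comp: "c (p \<circ> q) = c p \<circ> c q" for p q by (auto simp: c_def to_wo_inverse)
  have tr: "c (Transposition.transpose a b) = Transposition.transpose (to_wo a) (to_wo b)" for a b
    by (auto simp: c_def fun_eq_iff Transposition.transpose_def) (metis of_wo_inverse to_wo_inverse UNIV_I)+
  have c: "c p permutes UNIV \<and> sign (c p) = sign p" if "p permutes (UNIV :: 'n set)" for p
    using that finite
  proof (induction rule: permutes_induct)
    case id
    have "c id = id" by (auto simp: c_def of_wo_inverse)
    then show ?case by (simp only: permutes_id sign_id)
  next
    case (swap a b p)
    have ab: "to_wo a \<noteq> to_wo b" using swap by (metis to_wo_inverse UNIV_I)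
    have 1: "permutation (Transposition.transpose (to_wo a) (to_wo b))" "permutation (Transposition.transpose a b)"
      by (rule permutation_swap_id)+
    have 2: "permutation (c p)" "permutation p"
      using swap by (auto intro: permutes_imp_permutation[of UNIV])
    have "sign (Transposition.transpose (to_wo a) (to_wo b) \<circ> c p) = sign (Transposition.transpose a b \<circ> p)"
      using swap ab 1 2 by (simp only: sign_compose sign_swap_id if_False)
    moreover have "Transposition.transpose (to_wo a) (to_wo b) \<circ> c p permutes UNIV"
      using swap by (intro permutes_compose permutes_swap_id) auto
    ultimately show ?case unfolding comp tr by blast
  qed
  have inv: "to_wo \<circ> (of_wo \<circ> q \<circ> to_wo) \<circ> of_wo = q" for q :: "'n wo \<Rightarrow> 'n wo"
    by (auto simp: of_wo_inverse)
  have inv': "of_wo \<circ> (to_wo \<circ> p \<circ> of_wo) \<circ> to_wo = p" for p :: "'n \<Rightarrow> 'n"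
    by (auto simp: to_wo_inverse)
  have "det A = (\<Sum>p | p permutes UNIV. of_int (sign p) * (\<Prod>i\<in>UNIV. A $ i $ p i))"
    by (simp add: det_def)
  also have "\<dots> = (\<Sum>q | q permutes UNIV. of_int (sign q) * (\<Prod>i\<in>UNIV. A $ of_wo i $ of_wo (q i)))"
  proof (rule sum.reindex_bij_witness[of _ "\<lambda>q. of_wo \<circ> q \<circ> to_wo" c])
    fix p :: "'n \<Rightarrow> 'n" assume p: "p \<in> {p. p permutes UNIV}"
    show "of_wo \<circ> c p \<circ> to_wo = p" unfolding c_def by (rule inv')
    show "c p \<in> {q. q permutes UNIV}" using c p by blast
    have "(\<Prod>i\<in>UNIV. A $ of_wo i $ of_wo (c p i)) = (\<Prod>i\<in>UNIV. A $ of_wo i $ p (of_wo i))"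
      by (simp add: c_def to_wo_inverse)
    also have "\<dots> = (\<Prod>i\<in>UNIV. A $ i $ p i)" by (rule prod_of_wo)
    finally show "of_int (sign (c p)) * (\<Prod>i\<in>UNIV. A $ of_wo i $ of_wo (c p i)) = of_int (sign p) * (\<Prod>i\<in>UNIV. A $ i $ p i)"
      using c p by simp
  next
    fix q :: "'n wo \<Rightarrow> 'n wo" assume q: "q \<in> {q. q permutes UNIV}"
    show "c (of_wo \<circ> q \<circ> to_wo) = q" unfolding c_def by (rule inv)
    have "bij (of_wo \<circ> q \<circ> to_wo)" using q bij_of_wo bij_to_wo permutes_bij by (auto intro!: bij_comp)
    then have "of_wo \<circ> q \<circ> to_wo permutes UNIV" by (intro bij_imp_permutes) auto
    then show "of_wo \<circ> q \<circ> to_wo \<in> {p. p permutes UNIV}" by blast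
  qed
  also have "\<dots> = det (\<chi> i j. A $ of_wo i $ of_wo j)" by (simp add: det_def)
  finally show ?thesis by simp
qed

lemma matrix_reindex:
  fixes g :: "real^'n::finite \<Rightarrow> real^'n"
  shows "matrix (\<lambda>v. reindex (g (unindex v))) = (\<chi> i j. matrix g $ of_wo i $ of_wo j)"
proof -
  have "unindex (axis j 1) = (axis (of_wo j) 1 :: real^'n)" for j :: "'n wo"
    by (auto simp: unindex_def axis_def vec_eq_iff to_wo_inverse of_wo_inverse)
  then show ?thesis by (simp add: matrix_def reindex_def)
qed

text \<open>Renaming coordinates carries boxes to boxes with the same side lengths, and this
  characterizes \<open>lborel\<close>.\<close>

lemma lborel_reindex: "distr lborel borel (reindex :: real^'n::finite \<Rightarrow> _) = lborel"
proof (rule lborel_eqI[symmetric])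
  let ?T = "reindex :: real^'n \<Rightarrow> real^'n wo"
  have m: "?T \<in> borel_measurable borel"
    by (intro borel_measurable_continuous_onI linear_continuous_on) (simp add: linear_reindex linear_conv_bounded_linear[symmetric])
  fix l u :: "real^'n wo" assume lu: "\<And>b. b \<in> Basis \<Longrightarrow> l \<bullet> b \<le> u \<bullet> b"
  have le: "l $ i \<le> u $ i" for i using lu[of "axis i 1"] by (simp add: inner_axis axis_in_Basis_iff)
  have "?T -` box l u = box (unindex l) (unindex u)"
  proof -
    have "(\<forall>i. l $ i < x $ of_wo i \<and> x $ of_wo i < u $ i) \<longleftrightarrow> (\<forall>i. l $ to_wo i < x $ i \<and> x $ i < u $ to_wo i)" for x :: "real^'n"
      by (metis of_wo_inverse to_wo_inverse UNIV_I)
    then show ?thesis by (auto simp: mem_box_cart reindex_def unindex_def)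
  qed
  then have "emeasure (distr lborel borel ?T) (box l u) = emeasure lborel (box (unindex l) (unindex u :: real^'n))"
    by (subst emeasure_distr) (use m in auto)
  also have "\<dots> = (\<Prod>b\<in>Basis. (unindex u - unindex l :: real^'n) \<bullet> b)"
    by (rule emeasure_lborel_box) (use le in \<open>auto simp: Basis_vec_def inner_axis unindex_def\<close>)
  also have "(\<Prod>b\<in>Basis. (unindex u - unindex l :: real^'n) \<bullet> b) = (\<Prod>i\<in>UNIV. (u - l) $ to_wo i)"
    by (simp add: Basis_vec_def UNION_singleton_eq_range prod.reindex inj_on_def axis_eq_axis inner_axis unindex_def)
  also have "\<dots> = (\<Prod>i\<in>UNIV. (u - l) $ i)" by (rule prod.reindex_bij_betw[OF bij_to_wo])
  also have "\<dots> = (\<Prod>b\<in>Basis. (u - l) \<bullet> b)"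
    by (simp add: Basis_vec_def UNION_singleton_eq_range prod.reindex inj_on_def axis_eq_axis inner_axis)
  finally show "emeasure (distr lborel borel ?T) (box l u) = ennreal (\<Prod>b\<in>Basis. (u - l) \<bullet> b)" .
qed simp

lemma continuous_reindex: "continuous_on S (reindex :: real^'n::finite \<Rightarrow> _)"
  and continuous_unindex: "continuous_on S' (unindex :: _ \<Rightarrow> real^'n::finite)"
  by (auto intro!: linear_continuous_on simp: linear_reindex linear_unindex linear_conv_bounded_linear[symmetric])

lemma integral_reindex:
  fixes f :: "real^'n::finite wo \<Rightarrow> real"
  assumes "continuous_on UNIV f"
  shows "(\<integral>x. f x \<partial>lborel) = (\<integral>x. f (reindex x) \<partial>lborel)"
proof -
  have "(\<integral>x. f x \<partial>lborel) = (\<integral>x. f x \<partial>(distr lborel borel reindex))" by (simp add: lborel_reindex)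
  also have "\<dots> = (\<integral>x. f (reindex x) \<partial>lborel)"
    by (rule integral_distr) (use assms continuous_reindex borel_measurable_continuous_onI in auto)
  finally show ?thesis .
qed

lemma norm_unindex: "norm (unindex v :: real^'n::finite) = norm (v :: real^'n wo)"
proof -
  have "(\<Sum>i\<in>UNIV. (v $ to_wo i)\<^sup>2) = (\<Sum>i\<in>UNIV. (v $ i)\<^sup>2)"
    by (rule sum.reindex_bij_betw[OF bij_to_wo])
  then show ?thesis by (simp add: norm_vec_def L2_set_def unindex_def)
qed

lemma integral_change_of_variables_wo:
  fixes g :: "real^'m::{finite,wellorder} \<Rightarrow> real^'m::_" and f :: "real^'m::_ \<Rightarrow> real"
  assumes f: "continuous_on UNIV f" "bounded_support f"
    and fg: "continuous_on UNIV (\<lambda>x. \<bar>det (matrix (g' x))\<bar> * f (g x))" "bounded_support (\<lambda>x. \<bar>det (matrix (g' x))\<bar> * f (g x))"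
    and g: "\<And>x. (g has_derivative g' x) (at x)" "bij g"
  shows "(\<integral>x. f x \<partial>lborel) = (\<integral>x. \<bar>det (matrix (g' x))\<bar> * f (g x) \<partial>lborel)"
proof -
  let ?r = "\<lambda>x. \<bar>det (matrix (g' x))\<bar> * f (g x)"
  \<comment> \<open>Values are wrapped in \<open>real^1\<close> because
    \<open>integral_change_of_variables\<close> speaks of vector-valued functions.\<close>
  let ?F = "\<lambda>x. vec (f x) :: real^1"
  have rg: "range g = UNIV" using g(2) by (simp add: bij_is_surj)
  have cF: "continuous_on UNIV ?F" using f(1) by (simp add: vec_def continuous_on_vec_lambda)
  have "integrable lborel ?F"
    by (rule integrable_continuous_bounded_support[OF cF]) (use f in \<open>auto simp: bounded_support_def vec_eq_iff\<close>)
  then have "integrable lebesgue ?F" by (subst integrable_completion) auto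
  then have aF: "?F absolutely_integrable_on UNIV" by (simp add: set_integrable_def)
  have "integral (range g) ?F = integral UNIV (\<lambda>x. \<bar>det (matrix (g' x))\<bar> *\<^sub>R ?F (g x))"
    by (rule integral_change_of_variables) (use g aF rg in \<open>auto simp: bij_is_inj\<close>)
  then have "integral UNIV ?F = integral UNIV (\<lambda>x. vec (?r x) :: real^1)"
    by (simp add: rg scaleR_vec_def vec_def)
  then have "integral UNIV f = integral UNIV ?r"
    by (simp add: integral_on_1_eq vec_eq_iff)
  then show ?thesis
    using integral_lborel[OF integrable_continuous_bounded_support[OF f]]
      integral_lborel[OF integrable_continuous_bounded_support[OF fg]] by simp
qed

lemma bounded_support_comp_isometry:
  fixes g :: "'a::real_normed_vector \<Rightarrow> 'c::real_normed_vector"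
  assumes "bounded_support f" "\<And>x. norm (g x) = norm x"
  shows "bounded_support (\<lambda>x. f (g x))"
  using assms unfolding bounded_support_def by metis

lemma integral_change_of_variables_real:
  fixes g :: "real^'n::finite \<Rightarrow> real^'n" and f :: "real^'n \<Rightarrow> real"
  assumes f: "continuous_on UNIV f" "bounded_support f"
    and fg: "continuous_on UNIV (\<lambda>x. \<bar>det (matrix (g' x))\<bar> * f (g x))" "bounded_support (\<lambda>x. \<bar>det (matrix (g' x))\<bar> * f (g x))"
    and g: "\<And>x. (g has_derivative g' x) (at x)" "bij g"
  shows "(\<integral>x. f x \<partial>lborel) = (\<integral>x. \<bar>det (matrix (g' x))\<bar> * f (g x) \<partial>lborel)"
proof -
  define G where "G v = reindex (g (unindex v))" for v :: "real^'n wo"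
  define G' where "G' v u = reindex (g' (unindex v) (unindex u))" for v u :: "real^'n wo"
  have det: "det (matrix (G' v)) = det (matrix (g' (unindex v)))" for v
  proof -
    have "matrix (G' v) = (\<chi> i j. matrix (g' (unindex v)) $ of_wo i $ of_wo j)"
      unfolding G'_def by (rule matrix_reindex)
    then show ?thesis by (simp add: det_reindex)
  qed
  have blu: "bounded_linear (unindex :: _ \<Rightarrow> real^'n)" and blr: "bounded_linear (reindex :: real^'n \<Rightarrow> _)"
    using linear_unindex linear_reindex linear_conv_bounded_linear by blast+
  have dG: "(G has_derivative G' v) (at v)" for v
    unfolding G_def G'_def
    by (rule bounded_linear.has_derivative[OF blr])
       (rule has_derivative_compose[OF bounded_linear.has_derivative[OF blu has_derivative_ident] g(1)])
  have bG: "bij G"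
  proof (rule o_bij)
    show "(\<lambda>v. reindex (inv g (unindex v))) \<circ> G = id" "G \<circ> (\<lambda>v. reindex (inv g (unindex v))) = id"
      using g(2) by (auto simp: G_def fun_eq_iff bij_is_inj bij_is_surj surj_f_inv_f)
  qed
  let ?r = "\<lambda>x. \<bar>det (matrix (g' x))\<bar> * f (g x)"
  let ?f = "\<lambda>v. f (unindex v)"
  have e: "\<bar>det (matrix (G' v))\<bar> * ?f (G v) = ?r (unindex v)" for v by (simp add: det) (simp add: G_def)
  have cu: "continuous_on UNIV (\<lambda>v. k (unindex v))" if "continuous_on UNIV k" for k :: "real^'n \<Rightarrow> real"
    by (rule continuous_on_compose2[OF that continuous_unindex]) auto
  have "(\<integral>v. ?f v \<partial>lborel) = (\<integral>v. \<bar>det (matrix (G' v))\<bar> * ?f (G v) \<partial>lborel)"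
  proof (rule integral_change_of_variables_wo[OF _ _ _ _ dG bG])
    show "continuous_on UNIV ?f" by (rule cu[OF f(1)])
    show "bounded_support ?f" by (rule bounded_support_comp_isometry[OF f(2) norm_unindex])
    show "continuous_on UNIV (\<lambda>v. \<bar>det (matrix (G' v))\<bar> * ?f (G v))" unfolding e by (rule cu[OF fg(1)])
    show "bounded_support (\<lambda>v. \<bar>det (matrix (G' v))\<bar> * ?f (G v))"
      unfolding e by (rule bounded_support_comp_isometry[OF fg(2) norm_unindex])
  qed
  then have "(\<integral>v. ?f v \<partial>lborel) = (\<integral>v. ?r (unindex v) \<partial>lborel)" unfolding e .
  then show ?thesis using integral_reindex[OF cu[OF f(1)]] integral_reindex[OF cu[OF fg(1)]] by simp
qed

lemma integral_change_of_variables_complex: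
  fixes g :: "real^'n::finite \<Rightarrow> real^'n" and f :: "real^'n \<Rightarrow> complex"
  assumes f: "continuous_on UNIV f" "bounded_support f"
    and fg: "continuous_on UNIV (\<lambda>x. \<bar>det (matrix (g' x))\<bar> * f (g x))" "bounded_support (\<lambda>x. \<bar>det (matrix (g' x))\<bar> * f (g x))"
    and g: "\<And>x. (g has_derivative g' x) (at x)" "bij g"
  shows "(\<integral>x. f x \<partial>lborel) = (\<integral>x. \<bar>det (matrix (g' x))\<bar> * f (g x) \<partial>lborel)"
proof -
  let ?r = "\<lambda>x. complex_of_real \<bar>det (matrix (g' x))\<bar> * f (g x)"
  have i: "integrable lborel f" "integrable lborel ?r"
    using f fg integrable_continuous_bounded_support by blast+
  have "(\<integral>x. Re (f x) \<partial>lborel) = (\<integral>x. \<bar>det (matrix (g' x))\<bar> * Re (f (g x)) \<partial>lborel)"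
  proof (rule integral_change_of_variables_real[OF _ _ _ _ g])
    show "continuous_on UNIV (\<lambda>x. \<bar>det (matrix (g' x))\<bar> * Re (f (g x)))"
      using continuous_on_Re[OF fg(1)] by simp
    show "continuous_on UNIV (\<lambda>x. Re (f x))" by (intro continuous_intros f)
    obtain r where "\<forall>x. f x \<noteq> 0 \<longrightarrow> norm x \<le> r" using f by (auto simp: bounded_support_def)
    then show "bounded_support (\<lambda>x. Re (f x))" unfolding bounded_support_def by (metis zero_complex.sel)
    obtain r where r: "\<forall>x. ?r x \<noteq> 0 \<longrightarrow> norm x \<le> r" using fg unfolding bounded_support_def by blast
    have "?r x \<noteq> 0" if "\<bar>det (matrix (g' x))\<bar> * Re (f (g x)) \<noteq> 0" for x using that by auto
    then show "bounded_support (\<lambda>x. \<bar>det (matrix (g' x))\<bar> * Re (f (g x)))"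
      unfolding bounded_support_def using r by blast
  qed
  moreover have "(\<integral>x. Im (f x) \<partial>lborel) = (\<integral>x. \<bar>det (matrix (g' x))\<bar> * Im (f (g x)) \<partial>lborel)"
  proof (rule integral_change_of_variables_real[OF _ _ _ _ g])
    show "continuous_on UNIV (\<lambda>x. \<bar>det (matrix (g' x))\<bar> * Im (f (g x)))"
      using continuous_on_Im[OF fg(1)] by simp
    show "continuous_on UNIV (\<lambda>x. Im (f x))" by (intro continuous_intros f)
    obtain r where "\<forall>x. f x \<noteq> 0 \<longrightarrow> norm x \<le> r" using f by (auto simp: bounded_support_def)
    then show "bounded_support (\<lambda>x. Im (f x))" unfolding bounded_support_def by (metis zero_complex.sel)
    obtain r where r: "\<forall>x. ?r x \<noteq> 0 \<longrightarrow> norm x \<le> r" using fg unfolding bounded_support_def by blast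
    have "?r x \<noteq> 0" if "\<bar>det (matrix (g' x))\<bar> * Im (f (g x)) \<noteq> 0" for x using that by auto
    then show "bounded_support (\<lambda>x. \<bar>det (matrix (g' x))\<bar> * Im (f (g x)))"
      unfolding bounded_support_def using r by blast
  qed
  moreover have "(\<integral>x. Re (?r x) \<partial>lborel) = (\<integral>x. \<bar>det (matrix (g' x))\<bar> * Re (f (g x)) \<partial>lborel)"
    "(\<integral>x. Im (?r x) \<partial>lborel) = (\<integral>x. \<bar>det (matrix (g' x))\<bar> * Im (f (g x)) \<partial>lborel)" by simp_all
  ultimately show ?thesis
    using integral_Re[OF i(1)] integral_Im[OF i(1)] integral_Re[OF i(2)] integral_Im[OF i(2)]
    by (intro complex_eqI) (simp_all only:)
qed

text \<open>Poisson summation is applied to \<open>\<phi>\<close>, the transport of \<open>u\<close>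
  by \<open>\<Psi>\<close> divided by the Jacobian. Substituting \<open>z = \<Phi> x\<close> cancels
  this factor in the Fourier integrals, whereas it remains in the sum over \<open>P\<close>; this is
  the origin of the weight \<open>1 / det\<close> in the orthogonality relations.\<close>

lemma poisson_pullback_0:
  fixes \<Phi> \<Psi> :: "real^'n::finite \<Rightarrow> real^'n" and u :: "real^'n \<Rightarrow> complex" and b :: "'m::finite \<Rightarrow> real^'n"
  assumes "dual_lattices P L b"
  assumes u: "continuous_on UNIV u" "bounded_support u"
    and inv: "\<And>x. \<Psi> (\<Phi> x) = x" "\<And>z. \<Phi> (\<Psi> z) = z" and cont: "continuous_on UNIV \<Psi>"
    and der: "\<And>x. (\<Phi> has_derivative \<Phi>' x) (at x)"
    and det: "continuous_on UNIV (\<lambda>x. det (matrix (\<Phi>' x)))" "\<And>x. 0 < det (matrix (\<Phi>' x))"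
    and 0: "\<And>y. y \<in> L \<Longrightarrow> (\<integral>x. u x * character y (\<Phi> x) \<partial>lborel) = 0"
  shows "(\<Sum>p | p \<in> P \<and> u (\<Psi> p) \<noteq> 0. u (\<Psi> p) / det (matrix (\<Phi>' (\<Psi> p)))) = 0"
proof -
  interpret dual_lattices P L b by (rule assms(1))
  define \<phi> where "\<phi> z = u (\<Psi> z) / det (matrix (\<Phi>' (\<Psi> z)))" for z
  have d0: "det (matrix (\<Phi>' x)) \<noteq> 0" for x using det(2)[of x] by simp
  have c\<Phi>: "continuous_on UNIV \<Phi>" using der has_derivative_continuous_on by blast
  have c\<phi>: "continuous_on UNIV \<phi>" unfolding \<phi>_def
    by (intro continuous_intros continuous_on_compose2[OF u(1) cont] continuous_on_compose2[OF det(1) cont]) (auto simp: d0)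
  obtain r where r: "\<And>x. u x \<noteq> 0 \<Longrightarrow> norm x \<le> r" using u by (auto simp: bounded_support_def)
  have "bounded (\<Phi> ` cball 0 r)"
    using compact_continuous_image[OF continuous_on_subset[OF c\<Phi>] compact_cball] compact_imp_bounded by blast
  then obtain s where "\<forall>z\<in>\<Phi> ` cball 0 r. norm z \<le> s" by (auto simp: bounded_iff)
  then have s: "norm (\<Phi> x) \<le> s" if "norm x \<le> r" for x using that by simp
  have sz: "norm z \<le> s" if "u (\<Psi> z) \<noteq> 0" for z using s[OF r[OF that]] inv by simp
  have b\<phi>: "bounded_support \<phi>" unfolding bounded_support_def \<phi>_def using sz by (intro exI[of _ s]) auto
  have "(\<integral>z. \<phi> z * character y z \<partial>lborel) = 0" if y: "y \<in> L" for y
  proof -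
    have e: "complex_of_real \<bar>det (matrix (\<Phi>' x))\<bar> * (\<phi> (\<Phi> x) * character y (\<Phi> x)) = u x * character y (\<Phi> x)" for x
      using det(2)[of x] d0[of x] by (simp add: \<phi>_def inv)
    have cy: "continuous_on UNIV (\<lambda>x. u x * character y (\<Phi> x))" by (intro continuous_intros u c\<Phi>)
    have "(\<integral>z. \<phi> z * character y z \<partial>lborel)
      = (\<integral>x. complex_of_real \<bar>det (matrix (\<Phi>' x))\<bar> * (\<phi> (\<Phi> x) * character y (\<Phi> x)) \<partial>lborel)"
    proof (rule integral_change_of_variables_complex[OF _ _ _ _ der])
      show "continuous_on UNIV (\<lambda>z. \<phi> z * character y z)" by (intro continuous_intros c\<phi>)
      show "bounded_support (\<lambda>z. \<phi> z * character y z)" using b\<phi> by (auto simp: bounded_support_def)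
      show "bij \<Phi>" using inv by (intro o_bij[of \<Psi>]) (auto simp: fun_eq_iff)
    qed (unfold e, use cy u in \<open>auto simp: bounded_support_def\<close>)
    then show ?thesis using 0[OF y] unfolding e by simp
  qed
  then have "P.periodize \<phi> 0 = 0" by (rule poisson_summation_0[OF c\<phi> b\<phi>])
  then show ?thesis by (simp add: P.periodize_def \<phi>_def d0)
qed

section \<open>The Bethe equations\<close>

text \<open>The argument of \<open>1 - t * exp (- (\<i> * s))\<close>; arctan gives it without
  ambiguity because the real part is positive for \<open>\<bar>t\<bar> < 1\<close>.\<close>

definition angle :: "real \<Rightarrow> real \<Rightarrow> real" where
  "angle t s = arctan (t * sin s / (1 - t * cos s))"

lemma one_minus_cos_pos: fixes t :: real assumes "\<bar>t\<bar> < 1" shows "0 < 1 - t * cos s"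
proof -
  have "\<bar>t * cos s\<bar> \<le> \<bar>t\<bar> * 1" unfolding abs_mult by (intro mult_left_mono) auto
  then show ?thesis using assms by linarith
qed

lemma angle_uminus [simp]: "angle t (- s) = - angle t s"
  by (simp add: angle_def arctan_minus)

lemma angle_periodic: "angle t (s + 2 * pi * of_int n) = angle t s"
  by (simp add: angle_def sin_add cos_add sin_int_2pin cos_int_2pin)

lemma exp_angle:
  assumes t: "\<bar>t\<bar> < 1"
  shows "(1 - t * exp (- (\<i> * s))) / (1 - t * exp (\<i> * s)) = exp (2 * \<i> * angle t s)"
proof -
  define a where "a = 1 - t * cos s"
  define b where "b = t * sin s"
  define \<theta> where "\<theta> = angle t s"
  \<comment> \<open>The modulus of the number with real part \<open>a\<close> and imaginary part
    \<open>b\<close>, in the form that fits \<open>cos_arctan\<close> and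
    \<open>sin_arctan\<close>.\<close>
  define r where "r = a * sqrt (1 + (b/a)^2)"
  have a: "0 < a" using one_minus_cos_pos[OF t] by (simp add: a_def)
  have q: "0 < sqrt (1 + (b/a)^2)" by (simp add: add_pos_nonneg)
  have r: "r \<noteq> 0" using a q by (simp add: r_def)
  have c: "r * cos \<theta> = a" using q by (simp add: r_def \<theta>_def angle_def cos_arctan flip: a_def b_def)
  have s: "r * sin \<theta> = b" using q a by (simp add: r_def \<theta>_def angle_def sin_arctan flip: a_def b_def)
  have e: "exp (\<i> * complex_of_real x) = Complex (cos x) (sin x)" "exp (- (\<i> * complex_of_real x)) = Complex (cos x) (- sin x)" for x
    by (simp_all add: complex_eq_iff Re_exp Im_exp)
  have n: "1 - t * exp (- (\<i> * s)) = r * exp (\<i> * \<theta>)"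
    unfolding e by (simp add: complex_eq_iff c s) (simp add: a_def b_def)
  have d: "1 - t * exp (\<i> * s) = r * exp (- (\<i> * \<theta>))"
    unfolding e by (simp add: complex_eq_iff c s) (simp add: a_def b_def)
  have "exp (2 * \<i> * \<theta>) * exp (- (\<i> * \<theta>)) = exp (\<i> * \<theta>)"
    by (simp add: exp_add[symmetric])
  then show ?thesis unfolding n d \<theta>_def[symmetric] using r by (simp add: field_simps)
qed

text \<open>The derivative is the real part of the coefficient occurring in \<open>H_dagger\<close>,
  which is why that endomorphism appears as the Jacobian of the Bethe map.\<close>

lemma DERIV_angle:
  assumes t: "\<bar>t\<bar> < 1"
  shows "(angle t has_real_derivative Re (t * exp (\<i> * s) / (1 - t * exp (\<i> * s)))) (at s)"
proof -
  define a where "a = 1 - t * cos s"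
  define b where "b = t * sin s"
  have a: "0 < a" using one_minus_cos_pos[OF t] by (simp add: a_def)
  have ab: "0 < a^2 + b^2" using a by (simp add: add_pos_nonneg)
  have sc: "b^2 = t^2 - (t * cos s)^2" by (simp add: b_def power_mult_distrib sin_squared_eq algebra_simps)
  have "((\<lambda>s. t * sin s) has_real_derivative t * cos s) (at s)" "((\<lambda>s. 1 - t * cos s) has_real_derivative t * sin s) (at s)"
    by (auto intro!: derivative_eq_intros)
  from DERIV_divide[OF this] have "((\<lambda>s. t * sin s / (1 - t * cos s)) has_real_derivative (t * cos s * a - b * b) / (a * a)) (at s)"
    using a by (simp add: a_def b_def)
  from DERIV_chain2[OF DERIV_arctan this]
  have "(angle t has_real_derivative inverse (1 + (b/a)^2) * ((t * cos s * a - b * b) / (a * a))) (at s)"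
    unfolding angle_def[abs_def] a_def b_def .
  also have "1 + (b/a)^2 = (a^2 + b^2) / (a * a)" using a by (simp add: field_simps power2_eq_square)
  also have "inverse ((a^2 + b^2) / (a * a)) * ((t * cos s * a - b * b) / (a * a)) = (t * cos s * a - b * b) / (a^2 + b^2)"
    using a by simp
  also have "\<dots> = Re (t * exp (\<i> * s) / (1 - t * exp (\<i> * s)))"
    by (simp add: Re_divide Re_exp Im_exp a_def b_def power2_eq_square algebra_simps)
  finally show ?thesis .
qed

lemma norm_geometric_le:
  fixes t :: real and z :: complex
  assumes "\<bar>t\<bar> \<le> 1/2" "norm z = 1"
  shows "norm (t * z / (1 - t * z)) \<le> 2 * \<bar>t\<bar>"
proof -
  have "norm (t * z) = \<bar>t\<bar>" using assms by (simp add: norm_mult)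
  then have "1/2 \<le> norm (1 - t * z)" using norm_triangle_ineq2[of 1 "t * z"] assms by simp
  then have "norm (t * z / (1 - t * z)) \<le> \<bar>t\<bar> / (1/2)"
    unfolding norm_divide using assms \<open>norm (t * z) = \<bar>t\<bar>\<close> by (intro frac_le) auto
  then show ?thesis by simp
qed

lemma one_minus_nonzero: "\<bar>t\<bar> < 1 \<Longrightarrow> norm z = 1 \<Longrightarrow> 1 - complex_of_real t * z \<noteq> 0"
  by (metis norm_mult norm_of_real mult.right_neutral norm_one order_less_irrefl right_minus_eq)

text \<open>All maps \<open>v + s *\<^sub>R K v\<close> with \<open>s\<close> between
  \<open>0\<close> and \<open>1\<close> are injective, so the determinant cannot change sign along
  the way from the identity.\<close>

lemma det_add_small:
  fixes K :: "real^'n::finite \<Rightarrow> real^'n"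
  assumes K: "linear K" "\<And>v. norm (K v) \<le> norm v / 2"
  shows "0 < det (matrix (\<lambda>v. v + K v))"
proof -
  define f where "f s = det (matrix (\<lambda>v. v + s *\<^sub>R K v))" for s
  have nz: "f s \<noteq> 0" if s: "0 \<le> s" "s \<le> 1" for s
  proof -
    have l: "linear (\<lambda>v. v + s *\<^sub>R K v)"
      using K(1) by (auto intro!: linearI simp: linear_add linear_scale algebra_simps)
    have "v = 0" if "v + s *\<^sub>R K v = 0" for v
    proof -
      have "norm v = norm (s *\<^sub>R K v)" using that by (metis add_eq_0_iff norm_minus_cancel)
      also have "\<dots> = s * norm (K v)" using s by simp
      also have "\<dots> \<le> 1 * (norm v / 2)" using s K(2)[of v] by (intro mult_mono) auto
      finally show ?thesis by simp
    qed
    then have "inj (\<lambda>v. v + s *\<^sub>R K v)" using linear_injective_0[OF l] by blast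
    then show ?thesis unfolding f_def using det_nz_iff_inj[OF l] by blast
  qed
  have c: "continuous_on {0..1} f"
    unfolding f_def det_def matrix_def by (auto intro!: continuous_intros)
  have "f 0 = 1"
  proof -
    have "matrix (\<lambda>v::real^'n. v) = mat 1" using matrix_id_mat_1 by (simp add: id_def)
    then show ?thesis by (simp add: f_def)
  qed
  have "0 < f 1"
  proof (rule ccontr)
    assume "\<not> 0 < f 1"
    then have "\<exists>x\<ge>0. x \<le> 1 \<and> f x = 0" using \<open>f 0 = 1\<close> c by (intro IVT2') auto
    then show False using nz by blast
  qed
  then show ?thesis by (simp add: f_def)
qed

lemma det_matrix_scaleR:
  fixes H :: "real^'n::finite \<Rightarrow> real^'n"
  shows "det (matrix (\<lambda>v. c *\<^sub>R H v)) = c ^ CARD('n) * det (matrix H)"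
proof -
  have "matrix (\<lambda>v. c *\<^sub>R H v) = (\<chi> i. c *s (matrix H $ i))"
    by (simp add: matrix_def vec_eq_iff)
  then show ?thesis using det_rows_mul[of "\<lambda>_. c" "\<lambda>i. matrix H $ i"] by (simp add: vec_nth_inverse)
qed

text \<open>The constants serve \<open>perturb'_bound\<close>:
  \<open>\<bar>t\<bar> \<le> 1/2\<close> bounds each coefficient by
  \<open>2 * \<bar>t\<bar>\<close>, roots have squared norm at most \<open>2\<close>, so all roots
  together stretch a vector by at most \<open>4 * card R * \<bar>t\<bar>\<close>, and
  \<open>t_small\<close> makes this at most half of the dilation by \<open>k + h\<close>.\<close>

locale bethe = normalized_root_system R D for R D :: "(real^'n::finite) set" +
  fixes k :: nat and t :: real
  assumes t_half: "\<bar>t\<bar> \<le> 1/2" and t_small: "8 * real (card R) * \<bar>t\<bar> \<le> real k + h"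
begin

abbreviation c where "c \<equiv> real k + h"

lemma c_pos: "0 < c" by (rule h_pos)

lemma t_less: "\<bar>t\<bar> < 1" using t_half by simp

definition zeta :: "real^'n \<Rightarrow> real^'n \<Rightarrow> complex" where
  "zeta x \<alpha> = t * character \<alpha> x / (1 - t * character \<alpha> x)"

text \<open>The sum runs over all roots and is divided by \<open>2 * pi\<close>:
  \<open>\<alpha>\<close> and \<open>- \<alpha>\<close> contribute equally, which accounts for the
  factor \<open>2\<close> in the exponent of \<open>exp_angle\<close>.\<close>

definition perturb :: "real^'n \<Rightarrow> real^'n" where
  "perturb x = (\<Sum>\<alpha>\<in>R. (angle t (2 * pi * (\<alpha> \<bullet> x)) / (2 * pi)) *\<^sub>R \<alpha>)"

definition perturb' :: "real^'n \<Rightarrow> real^'n \<Rightarrow> real^'n" where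
  "perturb' x v = (\<Sum>\<alpha>\<in>R. (Re (zeta x \<alpha>) * (\<alpha> \<bullet> v)) *\<^sub>R \<alpha>)"

text \<open>The Bethe equations defining \<open>F_rho\<close> say that \<open>Phi x\<close> is a weight, and the derivative of \<open>Phi\<close> is
  \<open>c\<close> times \<open>H_dagger\<close>.\<close>

definition Phi :: "real^'n \<Rightarrow> real^'n" where "Phi x = c *\<^sub>R x + perturb x"

definition Phi' :: "real^'n \<Rightarrow> real^'n \<Rightarrow> real^'n" where "Phi' x v = c *\<^sub>R v + perturb' x v"

lemma character_exp: "character \<alpha> x = exp (\<i> * complex_of_real (2 * pi * (\<alpha> \<bullet> x)))"
  by (simp add: character_def mult_ac)

lemma perturb_has_derivative: "(perturb has_derivative perturb' x) (at x)"
proof -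
  have 1: "((\<lambda>x. angle t (2 * pi * (\<alpha> \<bullet> x)) / (2 * pi)) has_derivative (\<lambda>v. Re (zeta x \<alpha>) * (\<alpha> \<bullet> v))) (at x)" for \<alpha>
  proof -
    have i: "((\<lambda>x. 2 * pi * (\<alpha> \<bullet> x)) has_derivative (\<lambda>v. 2 * pi * (\<alpha> \<bullet> v))) (at x)"
      by (auto intro!: derivative_eq_intros)
    have "((\<lambda>x. angle t (2 * pi * (\<alpha> \<bullet> x))) has_derivative (\<lambda>v. (2 * pi * (\<alpha> \<bullet> v)) * Re (zeta x \<alpha>))) (at x)"
      using DERIV_compose_FDERIV[OF DERIV_angle[OF t_less] i] by (simp add: zeta_def character_exp)
    from has_derivative_mult_right[OF this, of "1 / (2 * pi)"] show ?thesis by (simp add: mult_ac)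
  qed
  have "((\<lambda>x. \<Sum>\<alpha>\<in>R. (angle t (2 * pi * (\<alpha> \<bullet> x)) / (2 * pi)) *\<^sub>R \<alpha>) has_derivative
      (\<lambda>v. \<Sum>\<alpha>\<in>R. (Re (zeta x \<alpha>) * (\<alpha> \<bullet> v)) *\<^sub>R \<alpha>)) (at x)"
    by (intro has_derivative_sum has_derivative_scaleR_left 1)
  then show ?thesis by (simp add: perturb_def[abs_def] perturb'_def[abs_def])
qed

lemma Phi_has_derivative: "(Phi has_derivative Phi' x) (at x)"
  unfolding Phi_def[abs_def] Phi'_def[abs_def]
  by (intro has_derivative_add perturb_has_derivative has_derivative_scaleR_right has_derivative_ident)

lemma linear_perturb': "linear (perturb' x)"
  unfolding perturb'_def
  by (rule linearI) (auto simp: inner_simps algebra_simps sum.distrib scaleR_sum_right)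

lemma perturb'_bound: "norm (perturb' x v) \<le> c * (norm v / 2)"
proof -
  have "norm (perturb' x v) \<le> (\<Sum>\<alpha>\<in>R. norm ((Re (zeta x \<alpha>) * (\<alpha> \<bullet> v)) *\<^sub>R \<alpha>))"
    unfolding perturb'_def by (rule norm_sum)
  also have "\<dots> \<le> (\<Sum>\<alpha>\<in>R. 4 * \<bar>t\<bar> * norm v)"
  proof (rule sum_mono)
    fix \<alpha> assume a: "\<alpha> \<in> R"
    have n2: "norm \<alpha> * norm \<alpha> \<le> 2" using R_norm_le[OF a] by (simp add: dot_square_norm power2_eq_square)
    have "\<bar>Re (zeta x \<alpha>)\<bar> \<le> 2 * \<bar>t\<bar>"
      using norm_geometric_le[OF t_half, of "character \<alpha> x"] abs_Re_le_cmod[of "zeta x \<alpha>"] unfolding zeta_def by simp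
    moreover have "\<bar>\<alpha> \<bullet> v\<bar> \<le> norm \<alpha> * norm v" by (rule Cauchy_Schwarz_ineq2)
    ultimately have "\<bar>Re (zeta x \<alpha>)\<bar> * \<bar>\<alpha> \<bullet> v\<bar> * norm \<alpha> \<le> (2 * \<bar>t\<bar>) * (norm \<alpha> * norm v) * norm \<alpha>"
      by (intro mult_right_mono mult_mono) auto
    also have "\<dots> = 2 * \<bar>t\<bar> * norm v * (norm \<alpha> * norm \<alpha>)" by (simp add: mult_ac)
    also have "\<dots> \<le> 2 * \<bar>t\<bar> * norm v * 2" using n2 by (intro mult_left_mono) auto
    finally show "norm ((Re (zeta x \<alpha>) * (\<alpha> \<bullet> v)) *\<^sub>R \<alpha>) \<le> 4 * \<bar>t\<bar> * norm v"
      by (simp add: abs_mult)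
  qed
  also have "\<dots> = (8 * real (card R) * \<bar>t\<bar>) * (norm v / 2)" by simp
  also have "\<dots> \<le> c * (norm v / 2)" using t_small by (intro mult_right_mono) auto
  finally show ?thesis .
qed

lemma perturb_lipschitz: "norm (perturb x - perturb y) \<le> (c / 2) * norm (x - y)"
proof (rule differentiable_bound[of UNIV perturb perturb'])
  show "onorm (perturb' x) \<le> c / 2" for x
    using perturb'_bound[of x] c_pos by (intro onorm_bound) auto
qed (use perturb_has_derivative in auto)

lemma Phi_expand: "(c / 2) * norm (x - y) \<le> norm (Phi x - Phi y)"
proof -
  have "c * norm (x - y) = norm ((Phi x - Phi y) - (perturb x - perturb y))"
    using c_pos by (simp add: Phi_def flip: scaleR_diff_right)
  also have "\<dots> \<le> norm (Phi x - Phi y) + norm (perturb x - perturb y)" by (rule norm_triangle_ineq4)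
  finally show ?thesis using perturb_lipschitz[of x y] by simp
qed

lemma Phi_inj: "Phi x = Phi y \<longleftrightarrow> x = y"
  using Phi_expand[of x y] c_pos by (auto simp: mult_le_0_iff)

lemma Phi_surj: "\<exists>x. Phi x = z"
proof -
  \<comment> \<open>Solutions of \<open>Phi x = z\<close> are the fixed points of \<open>F\<close>,
    which contracts by the factor \<open>1/2\<close> because of
    \<open>perturb_lipschitz\<close>.\<close>
  define F where "F x = (1 / c) *\<^sub>R (z - perturb x)" for x
  have "dist (F x) (F y) \<le> (1/2) * dist x y" for x y
  proof -
    have "F x - F y = - ((1 / c) *\<^sub>R (perturb x - perturb y))" by (simp add: F_def algebra_simps)
    then have "dist (F x) (F y) = (1 / c) * norm (perturb x - perturb y)"
      using c_pos by (simp only: dist_norm norm_minus_cancel norm_scaleR) simp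
    also have "\<dots> \<le> (1 / c) * ((c / 2) * norm (x - y))"
      using perturb_lipschitz c_pos by (intro mult_left_mono) auto
    finally show ?thesis using c_pos by (simp add: dist_norm)
  qed
  then obtain x where "F x = x" using banach_fix_type[of "1/2" F] by auto
  then have "c *\<^sub>R x = c *\<^sub>R F x" by simp
  then have "c *\<^sub>R x = z - perturb x" using c_pos by (simp add: F_def)
  then show ?thesis by (intro exI[of _ x]) (simp add: Phi_def)
qed

definition Psi where "Psi = inv Phi"

lemma Psi_Phi: "Psi (Phi x) = x"
  unfolding Psi_def by (rule inv_f_f) (simp add: inj_def Phi_inj)

lemma Phi_Psi: "Phi (Psi z) = z"
  unfolding Psi_def by (rule surj_f_inv_f) (use Phi_surj in \<open>metis surj_def\<close>)

lemma continuous_Psi: "continuous_on UNIV Psi"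
proof -
  have "(2 / c)-lipschitz_on UNIV Psi"
  proof (rule lipschitz_onI)
    fix x y
    have "(c / 2) * dist (Psi x) (Psi y) \<le> dist x y" using Phi_expand[of "Psi x" "Psi y"] by (simp add: dist_norm Phi_Psi)
    then show "dist (Psi x) (Psi y) \<le> 2 / c * dist x y" using c_pos by (simp add: field_simps)
  qed (use c_pos in auto)
  then show ?thesis by (rule lipschitz_on_continuous_on)
qed

lemma Phi'_eq: "Phi' x v = c *\<^sub>R (v + (1 / c) *\<^sub>R perturb' x v)"
  using c_pos by (simp add: Phi'_def scaleR_add_right)

lemma det_Phi'_pos: "0 < det (matrix (Phi' x))"
proof -
  have "0 < det (matrix (\<lambda>v. v + (1 / c) *\<^sub>R perturb' x v))"
  proof (rule det_add_small)
    show "linear (\<lambda>v. (1 / c) *\<^sub>R perturb' x v)" using linear_perturb' by (rule linear_compose_scale_right)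
    show "norm ((1 / c) *\<^sub>R perturb' x v) \<le> norm v / 2" for v
      using perturb'_bound[of x v] c_pos by (simp add: divide_le_eq mult.commute)
  qed
  then show ?thesis using c_pos unfolding Phi'_eq[abs_def] det_matrix_scaleR by simp
qed

lemma one_minus_character: "1 - t * character \<alpha> x \<noteq> 0"
  by (rule one_minus_nonzero[OF t_less]) simp

lemma t_character_neq: "t * character \<alpha> x \<noteq> 1"
  using one_minus_character[of \<alpha> x] by auto

lemma continuous_det_Phi': "continuous_on UNIV (\<lambda>x. det (matrix (Phi' x)))"
  unfolding det_def matrix_def Phi'_def perturb'_def zeta_def
  by (auto intro!: continuous_intros simp: t_character_neq)

lemma zeta_W: "w \<in> W \<Longrightarrow> zeta (w x) (w \<alpha>) = zeta x \<alpha>"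
  by (simp add: zeta_def character_def W_inner)

lemma R_sum_W: assumes w: "w \<in> W" shows "(\<Sum>\<alpha>\<in>R. f \<alpha>) = (\<Sum>\<alpha>\<in>R. f (w \<alpha>))"
proof -
  have "(\<Sum>\<alpha>\<in>R. f \<alpha>) = (\<Sum>\<alpha>\<in>w ` R. f \<alpha>)" by (simp add: W_R[OF w])
  also have "\<dots> = (\<Sum>\<alpha>\<in>R. f (w \<alpha>))" by (subst sum.reindex) (use W_inj[OF w] in \<open>auto simp: inj_on_def\<close>)
  finally show ?thesis .
qed

lemma R_prod_W: assumes w: "w \<in> W" shows "(\<Prod>\<alpha>\<in>R. f \<alpha>) = (\<Prod>\<alpha>\<in>R. f (w \<alpha>))"
proof -
  have "(\<Prod>\<alpha>\<in>R. f \<alpha>) = (\<Prod>\<alpha>\<in>w ` R. f \<alpha>)" by (simp add: W_R[OF w])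
  also have "\<dots> = (\<Prod>\<alpha>\<in>R. f (w \<alpha>))" by (subst prod.reindex) (use W_inj[OF w] in \<open>auto simp: inj_on_def\<close>)
  finally show ?thesis .
qed

lemma Phi_W: assumes w: "w \<in> W" shows "Phi (w x) = w (Phi x)"
proof -
  have "perturb (w x) = (\<Sum>\<alpha>\<in>R. (angle t (2 * pi * (w \<alpha> \<bullet> w x)) / (2 * pi)) *\<^sub>R w \<alpha>)"
    unfolding perturb_def by (rule R_sum_W[OF w])
  also have "\<dots> = w (perturb x)"
    by (simp add: perturb_def linear_sum[OF W_linear[OF w]] W_simps[OF w] W_inner[OF w])
  finally show ?thesis by (simp add: Phi_def W_simps[OF w])
qed

lemma Phi'_W: assumes w: "w \<in> W" shows "Phi' (w x) (w v) = w (Phi' x v)"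
proof -
  have "perturb' (w x) (w v) = (\<Sum>\<alpha>\<in>R. (Re (zeta (w x) (w \<alpha>)) * (w \<alpha> \<bullet> w v)) *\<^sub>R w \<alpha>)"
    unfolding perturb'_def by (rule R_sum_W[OF w])
  also have "\<dots> = w (perturb' x v)"
    by (simp add: perturb'_def linear_sum[OF W_linear[OF w]] W_simps[OF w] W_inner[OF w] zeta_W[OF w])
  finally show ?thesis by (simp add: Phi'_def W_simps[OF w])
qed

lemma det_Phi'_W: assumes w: "w \<in> W" shows "det (matrix (Phi' (w x))) = det (matrix (Phi' x))"
proof -
  have lP: "linear (Phi' y)" for y
    unfolding Phi'_def[abs_def] by (intro linear_compose_add linear_perturb' linear_scaleR)
  have "Phi' (w x) \<circ> w = w \<circ> Phi' x" using Phi'_W[OF w] by auto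
  then have "matrix (Phi' (w x)) ** matrix w = matrix w ** matrix (Phi' x)"
    using matrix_compose[OF W_linear[OF w] lP] matrix_compose[OF lP W_linear[OF w]] by metis
  then have "det (matrix (Phi' (w x))) * det (matrix w) = det (matrix w) * det (matrix (Phi' x))"
    by (metis det_mul)
  moreover have "det (matrix w) \<noteq> 0"
    using det_nz_iff_inj[OF W_linear[OF w]] W_inj[OF w] by (auto simp: inj_def)
  ultimately show ?thesis by (simp add: mult.commute)
qed

lemma root_lattice_int: "\<alpha> \<in> R \<Longrightarrow> q \<in> coroot_lattice R \<Longrightarrow> \<alpha> \<bullet> q \<in> \<int>"
  using root_weight by (auto simp: weights_def)

lemma Phi_lattice: assumes q: "q \<in> coroot_lattice R" shows "Phi (x + q) = Phi x + c *\<^sub>R q"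
proof -
  have "angle t (2 * pi * (\<alpha> \<bullet> (x + q))) = angle t (2 * pi * (\<alpha> \<bullet> x))" if "\<alpha> \<in> R" for \<alpha>
  proof -
    have "\<alpha> \<bullet> q \<in> \<int>" using root_lattice_int that q by blast
    then obtain n where "\<alpha> \<bullet> q = of_int n" by (auto elim: Ints_cases)
    then show ?thesis using angle_periodic[of t "2 * pi * (\<alpha> \<bullet> x)" n] by (simp add: inner_add_right distrib_left)
  qed
  then have "perturb (x + q) = perturb x" by (simp add: perturb_def)
  then show ?thesis by (simp add: Phi_def scaleR_add_right)
qed

lemma zeta_lattice: "q \<in> coroot_lattice R \<Longrightarrow> \<alpha> \<in> R \<Longrightarrow> zeta (x + q) \<alpha> = zeta x \<alpha>"
  by (simp add: zeta_def character_periodic root_lattice_int)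

lemma Phi'_lattice: "q \<in> coroot_lattice R \<Longrightarrow> Phi' (x + q) = Phi' x"
  by (simp add: Phi'_def[abs_def] perturb'_def zeta_lattice)

lemma H_dagger_eq: "Phi' (torus_log f) v = c *\<^sub>R H_dagger R D k t f v"
proof -
  have tc: "torus_char \<alpha> f = character \<alpha> (torus_log f)" for \<alpha> by (simp add: torus_char_def character_def)
  have "Phi' (torus_log f) v \<bullet> y = (c *\<^sub>R H_dagger R D k t f v) \<bullet> y" for y
  proof -
    have "complex_of_real (c * (H_dagger R D k t f v \<bullet> y)) =
           complex_of_real (c * (v \<bullet> y)) +
           (\<Sum>\<alpha>\<in>R. t * torus_char \<alpha> f / (1 - t * torus_char \<alpha> f) * (\<alpha> \<bullet> v) * (\<alpha> \<bullet> y))"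
      by (rule H_dagger_well_defined(2)[OF uminus_R]) (use c_pos in simp)
    \<comment> \<open>Real parts suffice, since both vectors are real and \<open>perturb'\<close>
      contains only the real part of \<open>zeta\<close>.\<close>
    from arg_cong[OF this, of Re]
    have "c * (H_dagger R D k t f v \<bullet> y) = c * (v \<bullet> y) + (\<Sum>\<alpha>\<in>R. Re (zeta (torus_log f) \<alpha> * complex_of_real ((\<alpha> \<bullet> v) * (\<alpha> \<bullet> y))))"
      by (simp add: zeta_def tc mult.assoc)
    then show ?thesis by (simp add: Phi'_def perturb'_def inner_simps inner_sum_left mult.assoc)
  qed
  then have "(Phi' (torus_log f) v - c *\<^sub>R H_dagger R D k t f v) \<bullet> y = 0" for y by (simp only: inner_diff_left)
  then show ?thesis by (metis inner_eq_zero_iff right_minus_eq)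
qed

lemma det_H_dagger: "det (matrix (Phi' (torus_log f))) = c ^ CARD('n) * det (matrix (H_dagger R D k t f))"
proof -
  have "Phi' (torus_log f) = (\<lambda>v. c *\<^sub>R H_dagger R D k t f v)" using H_dagger_eq by auto
  then show ?thesis by (simp add: det_matrix_scaleR)
qed

text \<open>\<open>exp_angle\<close> writes each factor as an exponential, and the integer
  \<open>\<alpha> \<bullet> y\<close> then multiplies its angle; pairing opposite roots assembles
  the angles into \<open>perturb x\<close>.\<close>

lemma bethe_factor:
  assumes y: "y \<in> coroot_lattice R"
  shows "exp (2 * pi * \<i> * (c * (x \<bullet> y))) *
      (\<Prod>\<alpha>\<in>Pos. ((1 - t * character (- \<alpha>) x) / (1 - t * character \<alpha> x)) powi \<lfloor>\<alpha> \<bullet> y\<rfloor>) = character y (Phi x)"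
proof -
  have "((1 - t * character (- \<alpha>) x) / (1 - t * character \<alpha> x)) powi \<lfloor>\<alpha> \<bullet> y\<rfloor>
      = exp (2 * \<i> * complex_of_real (angle t (2 * pi * (\<alpha> \<bullet> x)) * (\<alpha> \<bullet> y)))" if a: "\<alpha> \<in> Pos" for \<alpha>
  proof -
    have "\<alpha> \<bullet> y \<in> \<int>" using root_lattice_int y a Pos_sub by blast
    then obtain n where "\<alpha> \<bullet> y = of_int n" by (auto elim: Ints_cases)
    then have fl: "complex_of_int \<lfloor>\<alpha> \<bullet> y\<rfloor> = complex_of_real (\<alpha> \<bullet> y)" by simp
    have "(1 - t * character (- \<alpha>) x) / (1 - t * character \<alpha> x) = exp (2 * \<i> * angle t (2 * pi * (\<alpha> \<bullet> x)))"
      using exp_angle[OF t_less, of "2 * pi * (\<alpha> \<bullet> x)"] by (simp add: character_exp)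
    then show ?thesis by (simp add: exp_power_int fl mult_ac)
  qed
  then have "(\<Prod>\<alpha>\<in>Pos. ((1 - t * character (- \<alpha>) x) / (1 - t * character \<alpha> x)) powi \<lfloor>\<alpha> \<bullet> y\<rfloor>)
     = exp (\<Sum>\<alpha>\<in>Pos. 2 * \<i> * complex_of_real (angle t (2 * pi * (\<alpha> \<bullet> x)) * (\<alpha> \<bullet> y)))"
    using finite_Pos by (simp add: exp_sum)
  also have "(\<Sum>\<alpha>\<in>Pos. 2 * \<i> * complex_of_real (angle t (2 * pi * (\<alpha> \<bullet> x)) * (\<alpha> \<bullet> y)))
     = 2 * \<i> * complex_of_real (\<Sum>\<alpha>\<in>Pos. angle t (2 * pi * (\<alpha> \<bullet> x)) * (\<alpha> \<bullet> y))"
    by (simp add: sum_distrib_left)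
  also have "(\<Sum>\<alpha>\<in>Pos. angle t (2 * pi * (\<alpha> \<bullet> x)) * (\<alpha> \<bullet> y)) = pi * (y \<bullet> perturb x)"
  proof -
    have "(angle t (2 * pi * (\<alpha> \<bullet> x)) / (2 * pi)) *\<^sub>R \<alpha> + (angle t (2 * pi * ((- \<alpha>) \<bullet> x)) / (2 * pi)) *\<^sub>R (- \<alpha>)
      = (angle t (2 * pi * (\<alpha> \<bullet> x)) / pi) *\<^sub>R \<alpha>" for \<alpha>
      by (simp flip: scaleR_add_left)
    then have "perturb x = (\<Sum>\<alpha>\<in>Pos. (angle t (2 * pi * (\<alpha> \<bullet> x)) / pi) *\<^sub>R \<alpha>)"
      unfolding perturb_def sum_R by (simp only:)
    then show ?thesis by (simp add: inner_sum_right sum_distrib_left inner_commute)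
  qed
  finally show ?thesis
    by (simp add: character_def Phi_def inner_add_right exp_add[symmetric] inner_commute algebra_simps)
qed

lemma lattice_cocompact: "\<exists>r. \<forall>x. \<exists>q\<in>coroot_lattice R. norm (x + q) \<le> r"
proof (intro exI allI)
  fix x :: "real^'n"
  have "span (coroot ` D) = UNIV"
  proof -
    have "D \<subseteq> span (coroot ` D)"
    proof
      fix a assume a: "a \<in> D"
      then have "a \<bullet> a \<noteq> 0" using D_sub nz by auto
      then have "a = ((a \<bullet> a) / 2) *\<^sub>R coroot a" by (simp add: coroot_def)
      then show "a \<in> span (coroot ` D)" using a by (metis imageI span_base span_scale)
    qed
    then show ?thesis using span_D by (metis span_mono span_span top.extremum_unique)
  qed
  moreover have fin: "finite (coroot ` D)" using finite_D by simp
  ultimately obtain u where u: "x = (\<Sum>v\<in>coroot ` D. u v *\<^sub>R v)"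
    using span_finite[OF fin] by (metis (no_types, lifting) UNIV_I image_iff)
  define q where "q = (\<Sum>v\<in>coroot ` D. of_int (- \<lfloor>u v\<rfloor>) *\<^sub>R v)"
  have "q \<in> coroot_lattice R" unfolding q_def
    using D_sub by (intro coroot_lattice_sum coroot_lattice_scale) (auto intro: coroot_lattice_coroot)
  moreover have "norm (x + q) \<le> (\<Sum>v\<in>coroot ` D. norm v)"
  proof -
    have "x + q = (\<Sum>v\<in>coroot ` D. frac (u v) *\<^sub>R v)"
      unfolding u q_def by (simp add: frac_def scaleR_diff_left sum_subtractf sum_negf)
    also have "norm \<dots> \<le> (\<Sum>v\<in>coroot ` D. norm (frac (u v) *\<^sub>R v))" by (rule norm_sum)
    also have "\<dots> \<le> (\<Sum>v\<in>coroot ` D. norm v)"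
    proof (rule sum_mono)
      fix v
      have "0 \<le> frac (u v)" "frac (u v) \<le> 1" using frac_ge_0 frac_lt_1[of "u v"] by auto
      then show "norm (frac (u v) *\<^sub>R v) \<le> norm v" by (simp add: mult_left_le_one_le)
    qed
    finally show ?thesis .
  qed
  ultimately show "\<exists>q\<in>coroot_lattice R. norm (x + q) \<le> (\<Sum>v\<in>coroot ` D. norm v)" by blast
qed

sublocale Q: lattice "coroot_lattice R"
proof
  show "finite {x \<in> coroot_lattice R. norm x \<le> r}" for r
    by (rule finite_subset[OF _ finite_weights_ball[of r]]) (use coroot_lattice_weights in blast)
qed (fact coroot_lattice_0, fact coroot_lattice_add, fact coroot_lattice_minus, fact lattice_cocompact)

lemma simple_enum_exists: "\<exists>b :: 'n \<Rightarrow> real^'n. bij_betw b UNIV D"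
proof -
  have "card D = CARD('n)"
    using dim_eq_card_independent[OF indep_D] dim_span[of D] span_D by (simp add: dim_UNIV)
  then show ?thesis by (intro finite_same_card_bij) (auto simp: finite_D)
qed

definition simple_enum :: "'n \<Rightarrow> real^'n" where "simple_enum = (SOME b. bij_betw b UNIV D)"

lemma simple_enum: "bij_betw simple_enum UNIV D"
  unfolding simple_enum_def by (rule someI_ex[OF simple_enum_exists])

lemma dual_lattices_weights: "dual_lattices weights (coroot_lattice R) (\<lambda>i. coroot (simple_enum i))"
proof
  show "finite {x \<in> weights. norm x \<le> r}" for r by (rule finite_weights_ball)
  show "\<exists>r. \<forall>x. \<exists>q\<in>weights. norm (x + q) \<le> r"
    using lattice_cocompact coroot_lattice_weights by meson
  show "coroot (simple_enum i) \<in> coroot_lattice R" for i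
    using simple_enum D_sub by (auto intro!: coroot_lattice_coroot simp: bij_betw_def)
  show "z \<in> weights \<longleftrightarrow> (\<forall>i. coroot (simple_enum i) \<bullet> z \<in> \<int>)" for z
    using simple_enum unfolding weights_iff_simple bij_betw_def by (metis inner_commute rangeE rangeI)
  show "y \<bullet> z \<in> \<int>" if "y \<in> coroot_lattice R" "z \<in> weights" for y z
    using that by (auto simp: weights_def inner_commute)
qed (fact weights_0, fact weights_add, fact weights_minus, fact coroot_lattice_0, fact coroot_lattice_add, fact coroot_lattice_minus)

end

section \<open>Fourier coefficients of the orthogonality integrals\<close>

lemma spectrum_in_geometric:
  assumes t: "\<bar>t\<bar> < 1"
  shows "spectrum_in {real n *\<^sub>R \<beta> | n. True} (\<lambda>x. 1 / (1 - complex_of_real t * character \<beta> x))"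
proof (rule spectrum_in.lim)
  fix \<epsilon> :: real assume e: "0 < \<epsilon>"
  have "(\<lambda>n. \<bar>t\<bar> ^ n / (1 - \<bar>t\<bar>)) \<longlonglongrightarrow> 0 / (1 - \<bar>t\<bar>)"
    using t by (intro tendsto_intros LIMSEQ_power_zero) auto
  then have "\<forall>\<^sub>F n in sequentially. \<bar>t\<bar> ^ n / (1 - \<bar>t\<bar>) < \<epsilon>" using e by (intro order_tendstoD) auto
  then obtain N where N: "\<bar>t\<bar> ^ N / (1 - \<bar>t\<bar>) < \<epsilon>" by (auto simp: eventually_sequentially)
  have pow: "character (real n *\<^sub>R \<beta>) x = character \<beta> x ^ n" for n x
    by (induction n) (simp_all add: scaleR_add_left character_add)
  define g where "g x = (\<Sum>n<N. complex_of_real (t ^ n) * character (real n *\<^sub>R \<beta>) x)" for x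
  have "spectrum_in {real n *\<^sub>R \<beta> | n. True} g"
    unfolding g_def by (intro spectrum_in_sum spectrum_in.char) auto
  moreover have "norm (1 / (1 - complex_of_real t * character \<beta> x) - g x) \<le> \<epsilon>" for x
  proof -
    define z where "z = complex_of_real t * character \<beta> x"
    have nz: "norm z = \<bar>t\<bar>" by (simp add: z_def norm_mult)
    then have z1: "z \<noteq> 1" using t by auto
    have "g x = (\<Sum>n<N. z ^ n)" by (simp add: g_def z_def pow power_mult_distrib)
    also have "\<dots> = (1 - z ^ N) / (1 - z)" using z1 by (simp add: sum_gp_strict)
    finally have "1 / (1 - z) - g x = z ^ N / (1 - z)" by (simp add: diff_divide_distrib)
    then have "norm (1 / (1 - z) - g x) = \<bar>t\<bar> ^ N / norm (1 - z)" by (simp add: norm_divide norm_power nz)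
    also have "\<dots> \<le> \<bar>t\<bar> ^ N / (1 - \<bar>t\<bar>)"
      using norm_triangle_ineq2[of 1 z] nz t by (intro divide_left_mono mult_pos_pos) auto
    finally show ?thesis using N by (simp add: z_def)
  qed
  ultimately show "\<exists>g. spectrum_in {real n *\<^sub>R \<beta> | n. True} g \<and>
      (\<forall>x. norm (1 / (1 - complex_of_real t * character \<beta> x) - g x) \<le> \<epsilon>)" by blast
qed

text \<open>The factor of one root in the Bethe equations. Negating \<open>\<beta>\<close> inverts
  it, so negative powers for \<open>\<beta>\<close> are positive powers for
  \<open>- \<beta>\<close>.\<close>

definition factor_ratio :: "real \<Rightarrow> 'a::real_inner \<Rightarrow> 'a \<Rightarrow> complex" where
  "factor_ratio t \<beta> x = (1 - t * character (- \<beta>) x) / (1 - t * character \<beta> x)"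

lemma factor_ratio_uminus: "factor_ratio t (- \<beta>) x = inverse (factor_ratio t \<beta> x)"
  by (simp add: factor_ratio_def)

text \<open>The numerator brings the frequency \<open>- \<beta>\<close> at worst and the geometric
  series only nonnegative multiples of \<open>\<beta>\<close>, so \<open>n\<close> factors reach
  down to \<open>- n\<close> times \<open>\<beta>\<close> and no further.\<close>

lemma spectrum_in_factor_ratio_power:
  assumes t: "\<bar>t\<bar> < 1"
  shows "spectrum_in {(real j - real n) *\<^sub>R \<beta> | j. True} (\<lambda>x. factor_ratio t \<beta> x ^ n)"
proof (induction n)
  case 0 then show ?case by (auto intro!: spectrum_in_one exI[of _ 0])
next
  case (Suc n)
  have 1: "spectrum_in {- \<beta>, 0} (\<lambda>x. 1 - complex_of_real t * character (- \<beta>) x)"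
    using spectrum_in.add[OF spectrum_in.char[of 0 "{- \<beta>, 0}" 1] spectrum_in.char[of "- \<beta>" "{- \<beta>, 0}" "- t"]] by simp
  have "spectrum_in {(real j - 1) *\<^sub>R \<beta> | j. True} (\<lambda>x. (1 - complex_of_real t * character (- \<beta>) x) * (1 / (1 - complex_of_real t * character \<beta> x)))"
  proof (rule spectrum_in_mult[OF 1 spectrum_in_geometric[OF t]])
    fix \<mu> \<nu> assume "\<mu> \<in> {- \<beta>, 0}" "\<nu> \<in> {real n *\<^sub>R \<beta> | n. True}"
    then obtain n where n: "\<nu> = real n *\<^sub>R \<beta>" "\<mu> = - \<beta> \<or> \<mu> = 0" by auto
    then have "\<mu> + \<nu> = (real n - 1) *\<^sub>R \<beta> \<or> \<mu> + \<nu> = (real (Suc n) - 1) *\<^sub>R \<beta>"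
      by (auto simp: scaleR_diff_left)
    then show "\<mu> + \<nu> \<in> {(real j - 1) *\<^sub>R \<beta> | j. True}" by blast
  qed
  then have 2: "spectrum_in {(real j - 1) *\<^sub>R \<beta> | j. True} (factor_ratio t \<beta>)"
    by (simp add: factor_ratio_def[abs_def])
  have "spectrum_in {(real j - real (Suc n)) *\<^sub>R \<beta> | j. True} (\<lambda>x. factor_ratio t \<beta> x * factor_ratio t \<beta> x ^ n)"
  proof (rule spectrum_in_mult[OF 2 Suc])
    fix \<mu> \<nu> assume "\<mu> \<in> {(real j - 1) *\<^sub>R \<beta> | j. True}" "\<nu> \<in> {(real j - real n) *\<^sub>R \<beta> | j. True}"
    then obtain i j where "\<mu> = (real i - 1) *\<^sub>R \<beta>" "\<nu> = (real j - real n) *\<^sub>R \<beta>" by blast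
    then have "\<mu> + \<nu> = (real (i + j) - real (Suc n)) *\<^sub>R \<beta>" by (simp flip: scaleR_add_left)
    then show "\<mu> + \<nu> \<in> {(real j - real (Suc n)) *\<^sub>R \<beta> | j. True}" by blast
  qed
  then show ?case by simp
qed

text \<open>Writing the multiple as \<open>i - m\<close> separates a forced shift by
  \<open>- m\<close> from a free part \<open>i\<close> whose sign follows that of \<open>m\<close>.
  In \<open>term_mean_0\<close> the shifts add up explicitly and only the signs of the free parts
  matter.\<close>

lemma spectrum_in_factor_ratio:
  assumes t: "\<bar>t\<bar> < 1"
  shows "spectrum_in {of_int (i - m) *\<^sub>R \<beta> | i. sgn i = sgn m \<or> i = 0} (\<lambda>x. factor_ratio t \<beta> x powi m)"
proof (cases "m \<ge> 0")
  case True
  have "{(real j - real (nat m)) *\<^sub>R \<beta> | j. m = 0 \<longrightarrow> j = 0} \<subseteq> {of_int (i - m) *\<^sub>R \<beta> | i. sgn i = sgn m \<or> i = 0}"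
  proof clarify
    fix j :: nat assume j: "m = 0 \<longrightarrow> j = 0"
    show "\<exists>i. (real j - real (nat m)) *\<^sub>R \<beta> = of_int (i - m) *\<^sub>R \<beta> \<and> (sgn i = sgn m \<or> i = 0)"
      using True j by (intro exI[of _ "int j"]) (auto simp: sgn_if)
  qed
  moreover have "spectrum_in {(real j - real (nat m)) *\<^sub>R \<beta> | j. m = 0 \<longrightarrow> j = 0} (\<lambda>x. factor_ratio t \<beta> x powi m)"
  proof (cases "m = 0")
    case True then show ?thesis by (simp add: spectrum_in_one)
  next
    case False then show ?thesis using spectrum_in_factor_ratio_power[OF t, of "nat m" \<beta>] \<open>m \<ge> 0\<close> by (simp add: power_int_def)
  qed
  ultimately show ?thesis using spectrum_in_mono by blast
next
  case False
  have "{(real j - real (nat (- m))) *\<^sub>R (- \<beta>) | j. True} \<subseteq> {of_int (i - m) *\<^sub>R \<beta> | i. sgn i = sgn m \<or> i = 0}"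
  proof clarify
    fix j :: nat
    show "\<exists>i. (real j - real (nat (- m))) *\<^sub>R (- \<beta>) = of_int (i - m) *\<^sub>R \<beta> \<and> (sgn i = sgn m \<or> i = 0)"
      using False by (intro exI[of _ "- int j"]) (auto simp: sgn_if algebra_simps)
  qed
  moreover have "(\<lambda>x. factor_ratio t (- \<beta>) x ^ nat (- m)) = (\<lambda>x. factor_ratio t \<beta> x powi m)"
    using False by (auto simp: factor_ratio_uminus power_int_def)
  ultimately show ?thesis
    using spectrum_in_mono[OF spectrum_in_factor_ratio_power[OF t, of "nat (- m)" "- \<beta>"]] by simp
qed

context bethe
begin

text \<open>Multiplication by \<open>root_sign\<close> makes an even function odd, which reduces the
  claim to \<open>prod_Pos_odd\<close>.\<close>

lemma prod_Pos_even:
  fixes f :: "real^'n \<Rightarrow> complex"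
  assumes w: "w \<in> W" and f: "\<And>\<alpha>. \<alpha> \<in> R \<Longrightarrow> f (- \<alpha>) = f \<alpha>"
  shows "(\<Prod>\<alpha>\<in>Pos. f (w \<alpha>)) = (\<Prod>\<alpha>\<in>Pos. f \<alpha>)"
proof -
  have "(\<Prod>\<alpha>\<in>Pos. f (w \<alpha>) * root_sign (w \<alpha>)) = of_real (weyl_sign w) * (\<Prod>\<alpha>\<in>Pos. f \<alpha> * root_sign \<alpha>)"
    by (rule prod_Pos_odd[OF w, where g="\<lambda>\<alpha>. f \<alpha> * root_sign \<alpha>"]) (simp add: f root_sign_uminus)
  also have "(\<Prod>\<alpha>\<in>Pos. f \<alpha> * root_sign \<alpha>) = (\<Prod>\<alpha>\<in>Pos. f \<alpha>)"
    by (intro prod.cong) (auto simp: root_sign_def)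
  finally have e: "(\<Prod>\<alpha>\<in>Pos. f (w \<alpha>)) * of_real (weyl_sign w) = of_real (weyl_sign w) * (\<Prod>\<alpha>\<in>Pos. f \<alpha>)"
    by (simp add: prod.distrib weyl_sign_def)
  moreover have "weyl_sign w \<noteq> 0" using weyl_sign_abs[of w] by auto
  ultimately show ?thesis by simp
qed

lemma prod_W_Pos: "w \<in> W \<Longrightarrow> prod f (w ` Pos) = (\<Prod>\<alpha>\<in>Pos. f (w \<alpha>))"
  by (simp add: prod.reindex inj_on_def W_inj)

lemma sum_W_Pos: "w \<in> W \<Longrightarrow> sum f (w ` Pos) = (\<Sum>\<alpha>\<in>Pos. f (w \<alpha>))"
  by (simp add: sum.reindex inj_on_def W_inj)

lemma ratio_prod:
  assumes w: "w \<in> W" and w': "w' \<in> W"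
  shows "(\<Prod>\<alpha>\<in>Pos. 1 - t * character (- w \<alpha>) x) / (\<Prod>\<alpha>\<in>Pos. 1 - t * character (- w' \<alpha>) x)
     = (\<Prod>\<beta>\<in>w ` Pos \<inter> uminus ` w' ` Pos. factor_ratio t \<beta> x)"
proof -
  let ?F = "\<lambda>\<beta>. 1 - complex_of_real t * character (- \<beta>) x"
  let ?I = "w ` Pos \<inter> w' ` Pos" and ?S = "w ` Pos \<inter> uminus ` w' ` Pos"
  note dec = W_Pos_decomp[OF w w']
  have fin: "finite ?I" "finite ?S" using finite_Pos by auto
  have nz: "prod ?F ?I \<noteq> 0" using fin by (simp add: t_character_neq)
  have "prod ?F (w ` Pos) = prod ?F ?I * prod ?F ?S"
    by (subst dec(1), rule prod.union_disjoint) (use fin dec(3) in auto)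
  moreover have "prod ?F (w' ` Pos) = prod ?F ?I * prod ?F (uminus ` ?S)"
    by (subst dec(2), rule prod.union_disjoint) (use fin dec(4) in auto)
  ultimately have "prod ?F (w ` Pos) / prod ?F (w' ` Pos) = prod ?F ?S / prod ?F (uminus ` ?S)"
    using nz by simp
  also have "prod ?F (uminus ` ?S) = (\<Prod>\<beta>\<in>?S. ?F (- \<beta>))" by (simp add: prod.reindex)
  also have "prod ?F ?S / (\<Prod>\<beta>\<in>?S. ?F (- \<beta>)) = (\<Prod>\<beta>\<in>?S. factor_ratio t \<beta> x)"
    by (simp add: factor_ratio_def prod_dividef)
  finally show ?thesis by (simp add: prod_W_Pos w w')
qed

lemma factor_ratio_nonzero: "factor_ratio t \<beta> x \<noteq> 0"
  by (simp add: factor_ratio_def t_character_neq)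

text \<open>Replacing \<open>\<beta>\<close> by \<open>- \<beta>\<close> inverts the base and
  negates the exponent, so the factors are even in \<open>\<beta>\<close> and the positive roots may
  be replaced by their image under \<open>w\<close>, the system adapted to one summand of the
  numerator.\<close>

lemma character_Phi:
  assumes y: "y \<in> coroot_lattice R" and w: "w \<in> W"
  shows "character y (Phi x) = character (c *\<^sub>R y) x * (\<Prod>\<beta>\<in>w ` Pos. factor_ratio t \<beta> x powi \<lfloor>\<beta> \<bullet> y\<rfloor>)"
proof -
  have "factor_ratio t (- \<alpha>) x powi \<lfloor>(- \<alpha>) \<bullet> y\<rfloor> = factor_ratio t \<alpha> x powi \<lfloor>\<alpha> \<bullet> y\<rfloor>" if "\<alpha> \<in> R" for \<alpha>
  proof -
    have "\<alpha> \<bullet> y \<in> \<int>" using root_lattice_int that y by blast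
    then obtain n where "\<alpha> \<bullet> y = of_int n" by (auto elim: Ints_cases)
    then show ?thesis by (simp add: factor_ratio_uminus power_int_minus power_int_inverse)
  qed
  from prod_Pos_even[OF w, of "\<lambda>\<alpha>. factor_ratio t \<alpha> x powi \<lfloor>\<alpha> \<bullet> y\<rfloor>", OF this]
  have "(\<Prod>\<beta>\<in>w ` Pos. factor_ratio t \<beta> x powi \<lfloor>\<beta> \<bullet> y\<rfloor>) = (\<Prod>\<beta>\<in>Pos. factor_ratio t \<beta> x powi \<lfloor>\<beta> \<bullet> y\<rfloor>)"
    by (simp add: prod_W_Pos[OF w])
  moreover have "exp (2 * pi * \<i> * (c * (x \<bullet> y))) = character (c *\<^sub>R y) x"
    by (simp add: character_def inner_commute)
  ultimately show ?thesis using bethe_factor[OF y, of x] by (simp add: factor_ratio_def)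
qed

lemma level_weight_abs:
  assumes l: "\<kappa> \<in> level_weights R D k" and w: "w \<in> W" and b: "\<beta> \<in> R" shows "w \<kappa> \<bullet> \<beta> \<le> real k"
proof -
  have "inv w \<beta> \<in> R" using W_mem[OF W_inv(1)[OF w] b] .
  then show ?thesis using level_weightsD(3)[OF l] W_adj[OF w] by simp
qed

lemma level_0_weight: assumes l: "\<kappa> \<in> level_weights R D 0" shows "\<kappa> = 0"
proof (rule eqI_inner_D)
  fix a assume a: "a \<in> D"
  then have "\<kappa> \<bullet> a \<le> 0" using level_weightsD(3)[OF l] D_sub by fastforce
  then show "\<kappa> \<bullet> a = 0 \<bullet> a" using level_weightsD(2)[OF l a] by simp
qed

text \<open>Frequency zero would force equality in the Voronoi estimates for both weights, hence a Weyl group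
  relation between them.\<close>

lemma frequency_nonzero:
  assumes l: "\<kappa> \<in> level_weights R D k" and m: "\<mu> \<in> level_weights R D k" and ne: "\<kappa> \<noteq> \<mu>"
    and nrm: "norm \<mu> \<le> norm \<kappa>" and w: "w \<in> W" and w': "w' \<in> W" and y: "y \<in> coroot_lattice R"
    and a: "\<And>\<beta>. \<beta> \<in> w ` Pos \<Longrightarrow> 0 \<le> a \<beta> * (\<beta> \<bullet> y)"
      "\<And>\<beta>. \<beta> \<in> w ` Pos \<Longrightarrow> \<beta> \<bullet> y = 0 \<Longrightarrow> 0 \<le> a \<beta>"
  shows "w \<kappa> - w' \<mu> + real k *\<^sub>R y + (\<Sum>\<beta>\<in>w ` Pos. a \<beta> *\<^sub>R \<beta>) \<noteq> 0"
proof
  define X where "X = (\<Sum>\<beta>\<in>w ` Pos. a \<beta> *\<^sub>R \<beta>)"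
  assume "w \<kappa> - w' \<mu> + real k *\<^sub>R y + (\<Sum>\<beta>\<in>w ` Pos. a \<beta> *\<^sub>R \<beta>) = 0"
  then have E: "w' \<mu> = w \<kappa> + real k *\<^sub>R y + X" by (simp add: X_def algebra_simps)
  \<comment> \<open>The Voronoi estimates require a positive level; at level \<open>0\<close> the
    only weight is \<open>0\<close>, which contradicts \<open>ne\<close>.\<close>
  have k: "0 < real k"
  proof (rule ccontr)
    assume "\<not> 0 < real k"
    then have "k = 0" by simp
    then show False using l m ne level_0_weight by metis
  qed
  have fin: "finite (w ` Pos)" using finite_Pos by simp
  have Xy: "X \<bullet> y = (\<Sum>\<beta>\<in>w ` Pos. a \<beta> * (\<beta> \<bullet> y))" by (simp add: X_def inner_sum_left)
  have Xy0: "0 \<le> X \<bullet> y" unfolding Xy by (rule sum_nonneg) (rule a)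
  have v1: "2 * (w \<kappa> \<bullet> (- y)) \<le> real k * ((- y) \<bullet> (- y))"
    by (rule voronoi(1)[OF coroot_lattice_minus[OF y] _ k]) (rule level_weight_abs[OF l w])
  have v2: "2 * (w' \<mu> \<bullet> y) \<le> real k * (y \<bullet> y)"
    by (rule voronoi(1)[OF y _ k]) (rule level_weight_abs[OF m w'])
  have Ey: "w' \<mu> \<bullet> y = w \<kappa> \<bullet> y + real k * (y \<bullet> y) + X \<bullet> y" unfolding E by (simp add: inner_add_left)
  \<comment> \<open>The bounds \<open>v1\<close> for \<open>- y\<close> and \<open>v2\<close> for
    \<open>y\<close>, inserted into the equation paired with \<open>y\<close>, leave no room for a
    positive \<open>X \<bullet> y\<close> and are themselves attained.\<close>
  have eq1: "2 * (w \<kappa> \<bullet> (- y)) = real k * ((- y) \<bullet> (- y))" and Xy': "X \<bullet> y = 0"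
    using v1 v2 Ey Xy0 by (simp_all add: inner_minus_right)
  obtain u where u: "u \<in> W" "w \<kappa> - real k *\<^sub>R (- y) = u (w \<kappa>)"
    using voronoi(2)[OF coroot_lattice_minus[OF y] level_weight_abs[OF l w] k eq1] by blast
  have "\<forall>\<beta>\<in>w ` Pos. a \<beta> * (\<beta> \<bullet> y) = 0"
    using Xy' a(1) fin unfolding Xy by (subst (asm) sum_nonneg_eq_0_iff) auto
  then have ann: "0 \<le> a \<beta>" if "\<beta> \<in> w ` Pos" for \<beta> using a(2)[OF that] that by fastforce
  have Xl: "0 \<le> X \<bullet> w \<kappa>"
    unfolding X_def inner_sum_left
  proof (rule sum_nonneg)
    fix \<beta> assume b: "\<beta> \<in> w ` Pos"
    then obtain \<alpha> where "\<alpha> \<in> Pos" "\<beta> = w \<alpha>" by blast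
    then have "0 \<le> \<beta> \<bullet> w \<kappa>" using level_weightsD(4)[OF l] W_inner[OF w] by (simp add: inner_commute)
    then show "0 \<le> (a \<beta> *\<^sub>R \<beta>) \<bullet> w \<kappa>" using ann[OF b] by simp
  qed
  have E': "w' \<mu> = u (w \<kappa>) + X" using E u(2) by simp
  \<comment> \<open>Comparing squared norms gives that of \<open>\<kappa>\<close> plus two
    nonnegative terms, so the assumption that \<open>\<mu>\<close> is not longer than
    \<open>\<kappa>\<close> forces \<open>X = 0\<close>.\<close>
  have "\<mu> \<bullet> \<mu> = w' \<mu> \<bullet> w' \<mu>" by (simp add: W_inner[OF w'])
  also have "\<dots> = u (w \<kappa>) \<bullet> u (w \<kappa>) + 2 * (X \<bullet> u (w \<kappa>)) + X \<bullet> X"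
    unfolding E' by (simp add: inner_simps inner_commute)
  also have "u (w \<kappa>) \<bullet> u (w \<kappa>) = \<kappa> \<bullet> \<kappa>" by (simp add: W_inner[OF u(1)] W_inner[OF w])
  also have "X \<bullet> u (w \<kappa>) = X \<bullet> w \<kappa>" unfolding u(2)[symmetric] using Xy' by (simp add: inner_simps)
  finally have "\<mu> \<bullet> \<mu> = \<kappa> \<bullet> \<kappa> + 2 * (X \<bullet> w \<kappa>) + X \<bullet> X" .
  moreover have "\<mu> \<bullet> \<mu> \<le> \<kappa> \<bullet> \<kappa>" using nrm by (simp add: norm_le)
  ultimately have "X \<bullet> X \<le> 0" using Xl by linarith
  then have "X = 0" by (metis inner_eq_zero_iff inner_ge_zero order_antisym)
  then have "\<mu> = inv w' (u (w \<kappa>))" using E' W_inv(3)[OF w'] by (metis add.right_neutral)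
  then have "\<mu> = (inv w' \<circ> u \<circ> w) \<kappa>" by simp
  moreover have "inv w' \<circ> u \<circ> w \<in> W" by (intro weyl_comp W_inv(1)[OF w'] u(1) w)
  ultimately have "\<mu> = \<kappa>"
    using dominant_unique[OF _ level_weightsD(2)[OF l], of "inv w' \<circ> u \<circ> w"] level_weightsD(2)[OF m] by simp
  then show False using ne by simp
qed

text \<open>The integrand is \<open>character \<nu>0 x\<close> times powers of
  \<open>factor_ratio\<close> with exponents \<open>mm \<beta>\<close>: the floor stems from the
  Bethe factors, the extra \<open>1\<close> on \<open>S\<close> from the quotient in
  \<open>ratio_prod\<close>. The forced shifts by \<open>- mm \<beta>\<close> cancel
  \<open>h\<close> and \<open>rho\<close> out of \<open>\<nu>0\<close>, by
  \<open>sum_roots_scalar\<close> and \<open>W_rho_diff\<close>, and what remains is excluded from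
  being zero by \<open>frequency_nonzero\<close>.\<close>

lemma term_mean_0:
  assumes l: "\<kappa> \<in> level_weights R D k" and m: "\<mu> \<in> level_weights R D k" and ne: "\<kappa> \<noteq> \<mu>"
    and nrm: "norm \<mu> \<le> norm \<kappa>" and w: "w \<in> W" and w': "w' \<in> W" and y: "y \<in> coroot_lattice R"
  shows "(\<integral>x. Q.partition x * (character (w (\<kappa> + rho)) x * (\<Prod>\<alpha>\<in>Pos. 1 - t * character (- w \<alpha>) x) *
     (character (- w' (\<mu> + rho)) x / (\<Prod>\<alpha>\<in>Pos. 1 - t * character (- w' \<alpha>) x)) * character y (Phi x)) \<partial>lborel) = 0"
proof -
  define S where "S = w ` Pos \<inter> uminus ` w' ` Pos"
  define mm where "mm \<beta> = \<lfloor>\<beta> \<bullet> y\<rfloor> + (if \<beta> \<in> S then 1 else 0)" for \<beta>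
  define \<nu>0 where "\<nu>0 = w (\<kappa> + rho) - w' (\<mu> + rho) + c *\<^sub>R y"
  define E where "E \<beta> = {of_int (i - mm \<beta>) *\<^sub>R \<beta> | i. sgn i = sgn (mm \<beta>) \<or> i = 0}" for \<beta>
  have fin: "finite (w ` Pos)" using finite_Pos by simp
  have wR: "\<beta> \<in> R" if "\<beta> \<in> w ` Pos" for \<beta> using that w W_mem Pos_sub by blast
  have fl: "of_int \<lfloor>\<beta> \<bullet> y\<rfloor> = \<beta> \<bullet> y" if b: "\<beta> \<in> w ` Pos" for \<beta>
  proof -
    have "\<beta> \<bullet> y \<in> \<int>" using root_lattice_int wR[OF b] y by blast
    then show ?thesis by (simp add: of_int_floor_cancel)
  qed
  have pe: "character (w (\<kappa> + rho)) x * (\<Prod>\<alpha>\<in>Pos. 1 - t * character (- w \<alpha>) x) *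
     (character (- w' (\<mu> + rho)) x / (\<Prod>\<alpha>\<in>Pos. 1 - t * character (- w' \<alpha>) x)) * character y (Phi x)
    = character \<nu>0 x * (\<Prod>\<beta>\<in>w ` Pos. factor_ratio t \<beta> x powi mm \<beta>)" for x
  proof -
    have "(\<Prod>\<beta>\<in>S. factor_ratio t \<beta> x) = (\<Prod>\<beta>\<in>w ` Pos. factor_ratio t \<beta> x powi (if \<beta> \<in> S then 1 else 0))"
      unfolding S_def using fin by (intro prod.mono_neutral_cong_left) auto
    then have "(\<Prod>\<beta>\<in>S. factor_ratio t \<beta> x) * (\<Prod>\<beta>\<in>w ` Pos. factor_ratio t \<beta> x powi \<lfloor>\<beta> \<bullet> y\<rfloor>)
       = (\<Prod>\<beta>\<in>w ` Pos. factor_ratio t \<beta> x powi mm \<beta>)"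
      by (simp add: mm_def power_int_add factor_ratio_nonzero mult.commute flip: prod.distrib)
    moreover have "character \<nu>0 x = character (w (\<kappa> + rho)) x * character (- w' (\<mu> + rho)) x * character (c *\<^sub>R y) x"
      unfolding \<nu>0_def diff_conv_add_uminus by (simp only: character_add)
    moreover have "a * N * (b / M) * (d * p) = (a * b * d) * ((N / M) * p)" for a b d p N M :: complex by simp
    ultimately show ?thesis
      unfolding character_Phi[OF y w, of x] by (simp only: ratio_prod[OF w w'] flip: S_def)
  qed
  have sp: "spectrum_in {\<nu>0 + (\<Sum>\<beta>\<in>w ` Pos. e \<beta>) | e. \<forall>\<beta>\<in>w ` Pos. e \<beta> \<in> E \<beta>}
     (\<lambda>x. character \<nu>0 x * (\<Prod>\<beta>\<in>w ` Pos. factor_ratio t \<beta> x powi mm \<beta>))"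
  proof (rule spectrum_in_mult)
    show "spectrum_in {\<nu>0} (character \<nu>0)" by (rule spectrum_in_character) simp
    show "spectrum_in {\<Sum>\<beta>\<in>w ` Pos. e \<beta> | e. \<forall>\<beta>\<in>w ` Pos. e \<beta> \<in> E \<beta>} (\<lambda>x. \<Prod>\<beta>\<in>w ` Pos. factor_ratio t \<beta> x powi mm \<beta>)"
      by (rule spectrum_in_prod[OF fin]) (unfold E_def, rule spectrum_in_factor_ratio[OF t_less])
  qed blast
  have "(\<integral>x. Q.partition x * (character \<nu>0 x * (\<Prod>\<beta>\<in>w ` Pos. factor_ratio t \<beta> x powi mm \<beta>)) \<partial>lborel) = 0"
  proof (rule Q.spectrum_in_mean_0[OF sp])
    show "0 \<notin> {\<nu>0 + (\<Sum>\<beta>\<in>w ` Pos. e \<beta>) | e. \<forall>\<beta>\<in>w ` Pos. e \<beta> \<in> E \<beta>}"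
    proof
      assume "0 \<in> {\<nu>0 + (\<Sum>\<beta>\<in>w ` Pos. e \<beta>) | e. \<forall>\<beta>\<in>w ` Pos. e \<beta> \<in> E \<beta>}"
      then obtain e where e0: "0 = \<nu>0 + (\<Sum>\<beta>\<in>w ` Pos. e \<beta>)" and eE: "\<forall>\<beta>\<in>w ` Pos. e \<beta> \<in> E \<beta>" by blast
      note e = e0[symmetric]
      have "\<forall>\<beta>\<in>w ` Pos. \<exists>i. e \<beta> = of_int (i - mm \<beta>) *\<^sub>R \<beta> \<and> (sgn i = sgn (mm \<beta>) \<or> i = 0)"
        using eE unfolding E_def by blast
      then obtain i where i: "\<And>\<beta>. \<beta> \<in> w ` Pos \<Longrightarrow> e \<beta> = of_int (i \<beta> - mm \<beta>) *\<^sub>R \<beta>"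
        "\<And>\<beta>. \<beta> \<in> w ` Pos \<Longrightarrow> sgn (i \<beta>) = sgn (mm \<beta>) \<or> i \<beta> = 0" by metis
      have "(\<Sum>\<beta>\<in>w ` Pos. e \<beta>) = (\<Sum>\<beta>\<in>w ` Pos. of_int (i \<beta>) *\<^sub>R \<beta>) - (\<Sum>\<beta>\<in>w ` Pos. of_int (mm \<beta>) *\<^sub>R \<beta>)"
        using i by (simp add: scaleR_diff_left sum_subtractf)
      also have "(\<Sum>\<beta>\<in>w ` Pos. of_int (mm \<beta>) *\<^sub>R \<beta>) = (\<Sum>\<beta>\<in>w ` Pos. (\<beta> \<bullet> y) *\<^sub>R \<beta> + (if \<beta> \<in> S then \<beta> else 0))"
      proof (rule sum.cong[OF refl])
        fix \<beta> assume b: "\<beta> \<in> w ` Pos"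
        show "of_int (mm \<beta>) *\<^sub>R \<beta> = (\<beta> \<bullet> y) *\<^sub>R \<beta> + (if \<beta> \<in> S then \<beta> else 0)"
          by (simp only: mm_def of_int_add scaleR_add_left fl[OF b]) simp
      qed
      also have "\<dots> = (\<Sum>\<beta>\<in>w ` Pos. (\<beta> \<bullet> y) *\<^sub>R \<beta>) + \<Sum>S"
        unfolding S_def using fin by (simp add: sum.distrib sum.inter_restrict)
      also have "\<Sum>S = w rho - w' rho" unfolding S_def by (rule W_rho_diff[OF w w'])
      also have "(\<Sum>\<beta>\<in>w ` Pos. (\<beta> \<bullet> y) *\<^sub>R \<beta>) = h *\<^sub>R y"
      proof -
        have "(\<Sum>\<beta>\<in>w ` Pos. (\<beta> \<bullet> y) *\<^sub>R \<beta>) = w (\<Sum>\<alpha>\<in>Pos. (\<alpha> \<bullet> inv w y) *\<^sub>R \<alpha>)"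
          by (simp add: sum_W_Pos[OF w] linear_sum[OF W_linear[OF w]] W_simps[OF w] W_adj[OF w])
        then show ?thesis by (simp add: sum_roots_scalar W_simps[OF w] W_inv[OF w])
      qed
      finally have "w \<kappa> - w' \<mu> + real k *\<^sub>R y + (\<Sum>\<beta>\<in>w ` Pos. of_int (i \<beta>) *\<^sub>R \<beta>) = 0"
        using e by (simp add: \<nu>0_def W_simps[OF w] W_simps[OF w'] scaleR_add_left algebra_simps)
      moreover have "0 \<le> of_int (i \<beta>) * (\<beta> \<bullet> y)" "\<beta> \<bullet> y = 0 \<Longrightarrow> 0 \<le> (of_int (i \<beta>) :: real)" if b: "\<beta> \<in> w ` Pos" for \<beta>
      proof -
        define n where "n = \<lfloor>\<beta> \<bullet> y\<rfloor>"
        have n: "\<beta> \<bullet> y = of_int n" unfolding n_def by (rule fl[OF b, symmetric])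
        \<comment> \<open>The possible excess of one weakens the sign information: a positive
          \<open>mm \<beta>\<close> only gives \<open>0 \<le> n\<close>, and for
          \<open>n = 0\<close> the exponent is \<open>0\<close> or \<open>1\<close>, so that
          \<open>i \<beta>\<close> is nonnegative. This is the reason for the two separate
          hypotheses of \<open>frequency_nonzero\<close>.\<close>
        have mn: "mm \<beta> = n \<or> mm \<beta> = n + 1" by (simp add: mm_def n_def)
        have i3: "sgn (i \<beta>) = sgn (mm \<beta>) \<or> i \<beta> = 0" by (rule i(2)[OF b])
        have "0 \<le> i \<beta> * n"
        proof (cases "i \<beta> > 0")
          case True
          then have "mm \<beta> > 0" using i3 by (auto simp: sgn_if split: if_splits)
          then have "n \<ge> 0" using mn by linarith
          then show ?thesis using True by simp
        next
          case False
          show ?thesis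
          proof (cases "i \<beta> = 0")
            case False
            then have "mm \<beta> < 0" using i3 \<open>\<not> i \<beta> > 0\<close> by (auto simp: sgn_if split: if_splits)
            then have "n \<le> 0" using mn by linarith
            then show ?thesis using \<open>\<not> i \<beta> > 0\<close> by (simp add: mult_nonpos_nonpos)
          qed simp
        qed
        then show "0 \<le> of_int (i \<beta>) * (\<beta> \<bullet> y)" unfolding n by (simp flip: of_int_mult)
        assume "\<beta> \<bullet> y = 0"
        then have "n = 0" using n by simp
        then have "0 \<le> mm \<beta>" using mn by auto
        then have "0 \<le> i \<beta>" using i3 by (auto simp: sgn_if split: if_splits)
        then show "0 \<le> (of_int (i \<beta>) :: real)" by simp
      qed
      ultimately show False using frequency_nonzero[OF l m ne nrm w w' y, of "\<lambda>\<beta>. of_int (i \<beta>)"] by blast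
    qed
    show "\<nu> \<bullet> q \<in> \<int>" if nu: "\<nu> \<in> {\<nu>0 + (\<Sum>\<beta>\<in>w ` Pos. e \<beta>) | e. \<forall>\<beta>\<in>w ` Pos. e \<beta> \<in> E \<beta>}" "q \<in> coroot_lattice R" for \<nu> q
    proof -
      obtain e where e: "\<nu> = \<nu>0 + (\<Sum>\<beta>\<in>w ` Pos. e \<beta>)" "\<forall>\<beta>\<in>w ` Pos. e \<beta> \<in> E \<beta>" using nu by blast
      have "e \<beta> \<in> weights" if b: "\<beta> \<in> w ` Pos" for \<beta>
      proof -
        obtain i where "e \<beta> = of_int (i - mm \<beta>) *\<^sub>R \<beta>" using e(2) b unfolding E_def by blast
        then show ?thesis using weights_scale[OF root_weight[OF wR[OF b]]] by (simp only:)
      qed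
      then have "(\<Sum>\<beta>\<in>w ` Pos. e \<beta>) \<in> weights" by (rule weights_sum)
      moreover have "\<nu>0 \<in> weights" unfolding \<nu>0_def
        by (intro weights_add weights_diff weights_W[OF w] weights_W[OF w'] rho_weight
            level_scale_weight[OF y] level_weightsD(1)[OF l] level_weightsD(1)[OF m])
      ultimately have "\<nu> \<in> weights" using e(1) weights_add by blast
      then show ?thesis using nu(2) by (simp add: weights_def)
    qed
  qed
  then show ?thesis by (simp only: pe)
qed

end

section \<open>Hall--Littlewood sums on the torus\<close>

context bethe
begin

definition root_prod :: "real^'n \<Rightarrow> complex" where
  "root_prod x = (\<Prod>\<alpha>\<in>R. 1 - t * character \<alpha> x)"

text \<open>The analogue for \<open>t\<close> of the numerator in Weyl's character formula:
  \<open>Theta\<close> with its denominators cleared, see \<open>theta_char_numerator\<close>.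
  Unlike the quotient, it also makes sense at singular points.\<close>

definition numerator :: "real^'n \<Rightarrow> real^'n \<Rightarrow> complex" where
  "numerator \<kappa> x = (\<Sum>w\<in>W. weyl_sign w * (character (w (\<kappa> + rho)) x * (\<Prod>\<alpha>\<in>Pos. 1 - t * character (- w \<alpha>) x)))"

text \<open>The conjugate of \<open>numerator \<mu> x\<close> divided by \<open>root_prod x\<close>,
  written term by term so that its products with the terms of \<open>numerator\<close> contain the
  quotient evaluated in \<open>ratio_prod\<close>.\<close>

definition dual_numerator :: "real^'n \<Rightarrow> real^'n \<Rightarrow> complex" where
  "dual_numerator \<mu> x = (\<Sum>w\<in>W. weyl_sign w * (character (- w (\<mu> + rho)) x / (\<Prod>\<alpha>\<in>Pos. 1 - t * character (- w \<alpha>) x)))"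

lemma root_prod_W: assumes w: "w \<in> W"
  shows "root_prod x = (\<Prod>\<alpha>\<in>Pos. 1 - t * character (w \<alpha>) x) * (\<Prod>\<alpha>\<in>Pos. 1 - t * character (- w \<alpha>) x)"
proof -
  have "root_prod x = (\<Prod>\<alpha>\<in>R. 1 - t * character (w \<alpha>) x)" unfolding root_prod_def by (rule R_prod_W[OF w])
  then show ?thesis by (simp add: prod_R W_simps[OF w] prod.distrib)
qed

lemma root_prod_nonzero: "root_prod x \<noteq> 0"
  unfolding root_prod_def by (simp add: finite_R t_character_neq)

lemma cnj_numerator: "cnj (numerator \<mu> x) = dual_numerator \<mu> x * root_prod x"
  unfolding numerator_def dual_numerator_def cnj_sum sum_distrib_right
proof (rule sum.cong[OF refl])
  fix w assume w: "w \<in> W"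
  have nz: "(\<Prod>\<alpha>\<in>Pos. 1 - t * character (- w \<alpha>) x) \<noteq> 0" by (simp add: finite_Pos t_character_neq)
  show "cnj (weyl_sign w * (character (w (\<mu> + rho)) x * (\<Prod>\<alpha>\<in>Pos. 1 - t * character (- w \<alpha>) x)))
    = weyl_sign w * (character (- w (\<mu> + rho)) x / (\<Prod>\<alpha>\<in>Pos. 1 - t * character (- w \<alpha>) x)) * root_prod x"
    unfolding root_prod_W[OF w] using nz by (simp add: character_cnj)
qed

lemma character_W: "v \<in> W \<Longrightarrow> character \<nu> (v x) = character (inv v \<nu>) x"
  by (simp add: character_def W_adj')

lemma numerator_W: assumes v: "v \<in> W" shows "numerator \<kappa> (v x) = weyl_sign v * numerator \<kappa> x"
proof -
  let ?G = "\<lambda>w. character (w (\<kappa> + rho)) x * (\<Prod>\<alpha>\<in>Pos. 1 - t * character (- w \<alpha>) x)"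
  have iv: "inv v \<in> W" using W_inv(1)[OF v] .
  have "numerator \<kappa> (v x) = (\<Sum>w\<in>W. weyl_sign w * ?G (inv v \<circ> w))"
    unfolding numerator_def by (simp add: character_W[OF v] W_simps[OF iv])
  also have "\<dots> = (\<Sum>u\<in>W. weyl_sign (v \<circ> u) * ?G u)"
  proof (rule sum.reindex_bij_witness[of _ "\<lambda>u. v \<circ> u" "\<lambda>w. inv v \<circ> w"])
    fix w assume w: "w \<in> W"
    show 1: "v \<circ> (inv v \<circ> w) = w" using W_inv[OF v] by auto
    show "inv v \<circ> w \<in> W" by (rule weyl_comp[OF iv w])
    show "weyl_sign (v \<circ> (inv v \<circ> w)) * ?G (inv v \<circ> w) = weyl_sign w * ?G (inv v \<circ> w)" unfolding 1 ..
  next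
    fix u assume u: "u \<in> W"
    show "inv v \<circ> (v \<circ> u) = u" using W_inv[OF v] by auto
    show "v \<circ> u \<in> W" by (rule weyl_comp[OF v u])
  qed
  also have "\<dots> = (\<Sum>u\<in>W. weyl_sign v * (weyl_sign u * ?G u))"
    by (rule sum.cong) (simp_all add: weyl_sign_comp[OF v])
  finally show ?thesis by (simp add: numerator_def sum_distrib_left)
qed

lemma weights_lattice_int: "\<nu> \<in> weights \<Longrightarrow> q \<in> coroot_lattice R \<Longrightarrow> \<nu> \<bullet> q \<in> \<int>"
  by (simp add: weights_def)

lemma character_lattice: "\<nu> \<in> weights \<Longrightarrow> q \<in> coroot_lattice R \<Longrightarrow> character \<nu> (x + q) = character \<nu> x"
  by (intro character_periodic weights_lattice_int)

lemma W_root_weight: "w \<in> W \<Longrightarrow> \<alpha> \<in> Pos \<Longrightarrow> w \<alpha> \<in> weights" "w \<in> W \<Longrightarrow> \<alpha> \<in> Pos \<Longrightarrow> - w \<alpha> \<in> weights"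
  using W_mem Pos_sub root_weight weights_minus by blast+

lemma numerator_lattice:
  assumes \<kappa>: "\<kappa> \<in> weights" and q: "q \<in> coroot_lattice R" shows "numerator \<kappa> (x + q) = numerator \<kappa> x"
proof -
  have "w (\<kappa> + rho) \<in> weights" if "w \<in> W" for w by (intro weights_W[OF that] weights_add \<kappa> rho_weight)
  then show ?thesis unfolding numerator_def using q
    by (intro sum.cong refl) (simp add: character_lattice W_root_weight cong: prod.cong)
qed

text \<open>If \<open>\<alpha> \<bullet> x\<close> is an integer, the reflection in
  \<open>\<alpha>\<close> moves \<open>x\<close> by a lattice vector only, so periodicity and
  antisymmetry give opposite values. Hence singular solutions contribute nothing to the
  orthogonality sums.\<close>

lemma numerator_singular:
  assumes \<kappa>: "\<kappa> \<in> weights" and a: "\<alpha> \<in> R" "\<alpha> \<bullet> x \<in> \<int>" shows "numerator \<kappa> x = 0"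
proof -
  obtain n where n: "\<alpha> \<bullet> x = of_int n" using a by (auto elim: Ints_cases)
  have "reflection \<alpha> x = x + of_int (- n) *\<^sub>R coroot \<alpha>" by (simp add: reflection_def n)
  moreover have "of_int (- n) *\<^sub>R coroot \<alpha> \<in> coroot_lattice R" using a coroot_lattice_scale coroot_lattice_coroot by blast
  ultimately have "numerator \<kappa> (reflection \<alpha> x) = numerator \<kappa> x" using numerator_lattice[OF \<kappa>] by (simp only:)
  moreover have "numerator \<kappa> (reflection \<alpha> x) = - numerator \<kappa> x"
    using numerator_W[OF weyl_reflection[OF a(1)]] weyl_sign_reflection[OF a(1)] by simp
  ultimately show ?thesis by simp
qed

text \<open>Half roots make every factor odd in its root, as \<open>prod_Pos_odd\<close> requires;
  they need not be weights, and only the absolute value is used as a function on the torus.\<close>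

definition weyl_denominator :: "real^'n \<Rightarrow> complex" where
  "weyl_denominator x = (\<Prod>\<alpha>\<in>Pos. character ((1/2) *\<^sub>R \<alpha>) x - character (- ((1/2) *\<^sub>R \<alpha>)) x)"

definition theta_char :: "real^'n \<Rightarrow> real^'n \<Rightarrow> complex" where
  "theta_char \<kappa> x = (\<Sum>w\<in>W. character (w \<kappa>) x / (\<Prod>\<alpha>\<in>Pos. (1 - character (- w \<alpha>) x) * (1 - t * character (w \<alpha>) x)))"

lemma torus_char_eq: "torus_char \<nu> f = character \<nu> (torus_log f)"
  by (simp add: torus_char_def character_def)

lemma Theta_eq: "Theta R D \<kappa> t f = theta_char \<kappa> (torus_log f)"
  by (simp add: Theta_def theta_char_def torus_char_eq)

lemma one_minus_character_split:
  "1 - character (- \<alpha>) x = character (- ((1/2) *\<^sub>R \<alpha>)) x * (character ((1/2) *\<^sub>R \<alpha>) x - character (- ((1/2) *\<^sub>R \<alpha>)) x)"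
proof -
  have "(1/2) *\<^sub>R \<alpha> + (1/2) *\<^sub>R \<alpha> = \<alpha>" by (simp flip: scaleR_add_left)
  then have "- \<alpha> = - ((1/2) *\<^sub>R \<alpha>) + - ((1/2) *\<^sub>R \<alpha>)" by (metis minus_add_distrib)
  then have "character (- \<alpha>) x = character (- ((1/2) *\<^sub>R \<alpha>)) x * character (- ((1/2) *\<^sub>R \<alpha>)) x" by (metis character_add)
  moreover have "character (- ((1/2) *\<^sub>R \<alpha>)) x * character ((1/2) *\<^sub>R \<alpha>) x = 1" by (simp flip: character_add)
  ultimately show ?thesis by (simp add: right_diff_distrib)
qed

lemma character_sum: "finite I \<Longrightarrow> character (\<Sum>i\<in>I. f i) x = (\<Prod>i\<in>I. character (f i) x)"
  by (induction I rule: finite_induct) (simp_all add: character_add)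

text \<open>The half roots split off by \<open>one_minus_character_split\<close> add up to
  \<open>- w rho\<close>, and the remaining product is odd.\<close>

lemma character_rho_prod:
  assumes w: "w \<in> W"
  shows "character (w rho) x * (\<Prod>\<alpha>\<in>Pos. 1 - character (- w \<alpha>) x) = weyl_sign w * weyl_denominator x"
proof -
  have "(\<Sum>\<alpha>\<in>Pos. - ((1/2) *\<^sub>R w \<alpha>)) = - ((1/2) *\<^sub>R w (\<Sum>Pos))"
    by (simp add: sum_negf linear_sum[OF W_linear[OF w]] scaleR_sum_right)
  also have "\<dots> = - w rho" by (simp add: sum_Pos W_simps[OF w])
  finally have "(\<Prod>\<alpha>\<in>Pos. character (- ((1/2) *\<^sub>R w \<alpha>)) x) = character (- w rho) x"
    using character_sum[OF finite_Pos, of "\<lambda>\<alpha>. - ((1/2) *\<^sub>R w \<alpha>)" x] by simp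
  moreover have "(\<Prod>\<alpha>\<in>Pos. character ((1/2) *\<^sub>R w \<alpha>) x - character (- ((1/2) *\<^sub>R w \<alpha>)) x) = weyl_sign w * weyl_denominator x"
    unfolding weyl_denominator_def
    using prod_Pos_odd[OF w, of "\<lambda>\<beta>. character ((1/2) *\<^sub>R \<beta>) x - character (- ((1/2) *\<^sub>R \<beta>)) x"] by simp
  moreover have "character (w rho) x * character (- w rho) x = 1" by (simp flip: character_add)
  ultimately show ?thesis
    unfolding one_minus_character_split prod.distrib by (simp flip: mult.assoc)
qed

lemma character_neq_1: "\<alpha> \<bullet> x \<notin> \<int> \<Longrightarrow> character \<alpha> x \<noteq> 1"
  by (simp add: character_eq_1_iff)

lemma weyl_denominator_nonzero:
  assumes "\<And>\<alpha>. \<alpha> \<in> R \<Longrightarrow> \<alpha> \<bullet> x \<notin> \<int>" shows "weyl_denominator x \<noteq> 0"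
proof -
  have "1 - character (- \<alpha>) x \<noteq> 0" if "\<alpha> \<in> Pos" for \<alpha>
    using assms[of "- \<alpha>"] that Pos_sub uminus_mem character_neq_1[of "- \<alpha>" x] by (metis right_minus_eq subsetD)
  then show ?thesis
    unfolding weyl_denominator_def by (simp add: finite_Pos one_minus_character_split)
qed

text \<open>Extending the summand of \<open>w\<close> by \<open>character (w rho) x\<close> and by
  the \<open>t\<close> factors of the negative roots turns its denominator into
  \<open>weyl_denominator x * root_prod x\<close> up to the sign of \<open>w\<close>, so all
  summands share one denominator.\<close>

lemma theta_char_numerator:
  assumes reg: "\<And>\<alpha>. \<alpha> \<in> R \<Longrightarrow> \<alpha> \<bullet> x \<notin> \<int>"
  shows "theta_char \<kappa> x = numerator \<kappa> x / (weyl_denominator x * root_prod x)"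
  unfolding theta_char_def numerator_def sum_divide_distrib
proof (rule sum.cong[OF refl])
  fix w assume w: "w \<in> W"
  let ?A = "\<Prod>\<alpha>\<in>Pos. 1 - character (- w \<alpha>) x"
  let ?P = "\<Prod>\<alpha>\<in>Pos. 1 - t * character (w \<alpha>) x" and ?M = "\<Prod>\<alpha>\<in>Pos. 1 - t * character (- w \<alpha>) x"
  have nzM: "?M \<noteq> 0" "?P \<noteq> 0" by (simp_all add: finite_Pos t_character_neq)
  have nzD: "weyl_denominator x \<noteq> 0" using weyl_denominator_nonzero reg by blast
  have s: "complex_of_real (weyl_sign w) * weyl_sign w = 1" using weyl_sign_abs[of w] by (simp flip: of_real_mult)
  then have s0: "complex_of_real (weyl_sign w) \<noteq> 0" by auto
  have A: "character (w rho) x * ?A = weyl_sign w * weyl_denominator x" by (rule character_rho_prod[OF w])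
  have nzA: "?A \<noteq> 0" using A nzD s0 by auto
  have nzc: "character (w rho) x \<noteq> 0" by (metis norm_character norm_zero zero_neq_one)
  have "character (w \<kappa>) x / (\<Prod>\<alpha>\<in>Pos. (1 - character (- w \<alpha>) x) * (1 - t * character (w \<alpha>) x)) = character (w \<kappa>) x / (?A * ?P)"
    by (simp add: prod.distrib)
  also have "\<dots> = (character (w \<kappa>) x * character (w rho) x * ?M) / ((character (w rho) x * ?A) * (?P * ?M))"
    using nzM nzA nzc by (simp add: field_simps)
  also have "\<dots> = (character (w (\<kappa> + rho)) x * ?M) / ((weyl_sign w * weyl_denominator x) * root_prod x)"
    unfolding A root_prod_W[OF w] by (simp add: W_simps[OF w] character_add)
  also have "\<dots> = weyl_sign w * (character (w (\<kappa> + rho)) x * ?M) / (weyl_denominator x * root_prod x)"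
    using s s0 nzD root_prod_nonzero[of x] by (simp add: field_simps)
  finally show "character (w \<kappa>) x / (\<Prod>\<alpha>\<in>Pos. (1 - character (- w \<alpha>) x) * (1 - t * character (w \<alpha>) x))
    = weyl_sign w * (character (w (\<kappa> + rho)) x * ?M) / (weyl_denominator x * root_prod x)" .
qed

text \<open>Composition with the longest element reindexes the Weyl sum so that
  \<open>w (- w0 \<mu>)\<close> becomes \<open>- u \<mu>\<close>; it also negates the positive roots
  in the denominators, and negating every frequency is complex conjugation.\<close>

lemma theta_char_dual: "theta_char (dual_weight R D \<mu>) x = cnj (theta_char \<mu> x)"
proof -
  define w0 where "w0 = longest_element R D"
  have w0: "w0 \<in> W" "w0 ` Pos = uminus ` Pos" using longest_element_props by (auto simp: w0_def)
  have iw: "inv w0 \<in> W" using W_inv(1)[OF w0(1)] .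
  have ip: "inv w0 ` Pos = uminus ` Pos"
  proof -
    have "Pos = inv w0 ` (w0 ` Pos)" using W_inv(3)[OF w0(1)] by (simp add: image_image)
    also have "\<dots> = (\<lambda>\<alpha>. - inv w0 \<alpha>) ` Pos" unfolding w0(2) by (simp add: image_image W_simps[OF iw])
    finally have "uminus ` Pos = uminus ` (\<lambda>\<alpha>. - inv w0 \<alpha>) ` Pos" by simp
    then show ?thesis by (simp add: image_image)
  qed
  let ?G = "\<lambda>\<beta>. (1 - character (- \<beta>) x) * (1 - t * character \<beta> x)"
  have P: "(\<Prod>\<alpha>\<in>Pos. ?G (u (inv w0 \<alpha>))) = (\<Prod>\<alpha>\<in>Pos. ?G (- u \<alpha>))" if u: "u \<in> W" for u
  proof -
    have "(\<Prod>\<alpha>\<in>Pos. ?G (u (inv w0 \<alpha>))) = (\<Prod>\<beta>\<in>inv w0 ` Pos. ?G (u \<beta>))"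
      by (simp add: prod_W_Pos[OF iw])
    also have "\<dots> = (\<Prod>\<alpha>\<in>Pos. ?G (u (- \<alpha>)))" unfolding ip by (simp add: prod.reindex)
    finally show ?thesis by (simp add: W_simps[OF u])
  qed
  have "theta_char (dual_weight R D \<mu>) x = (\<Sum>w\<in>W. character (w (- w0 \<mu>)) x / (\<Prod>\<alpha>\<in>Pos. ?G (w \<alpha>)))"
    by (simp add: theta_char_def dual_weight_def w0_def)
  also have "\<dots> = (\<Sum>u\<in>W. character (- u \<mu>) x / (\<Prod>\<alpha>\<in>Pos. ?G (u (inv w0 \<alpha>))))"
  proof (rule sum.reindex_bij_witness[of _ "\<lambda>u. u \<circ> inv w0" "\<lambda>w. w \<circ> w0"])
    fix w assume w: "w \<in> W"
    show "(w \<circ> w0) \<circ> inv w0 = w" using W_inv[OF w0(1)] by auto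
    show "w \<circ> w0 \<in> W" by (rule weyl_comp[OF w w0(1)])
    show "character (- (w \<circ> w0) \<mu>) x / (\<Prod>\<alpha>\<in>Pos. ?G ((w \<circ> w0) (inv w0 \<alpha>))) = character (w (- w0 \<mu>)) x / (\<Prod>\<alpha>\<in>Pos. ?G (w \<alpha>))"
      by (simp add: W_simps[OF w] W_inv[OF w0(1)])
  next
    fix u assume u: "u \<in> W"
    show "(u \<circ> inv w0) \<circ> w0 = u" using W_inv[OF w0(1)] by auto
    show "u \<circ> inv w0 \<in> W" by (rule weyl_comp[OF u iw])
  qed
  also have "\<dots> = cnj (theta_char \<mu> x)"
    unfolding theta_char_def cnj_sum
    by (rule sum.cong) (simp_all add: P character_cnj)
  finally show ?thesis .
qed

section \<open>Torus points as cosets, and the solutions of the Bethe equations\<close>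

definition coset :: "real^'n \<Rightarrow> (real^'n) set" where
  "coset x = {y. x - y \<in> coroot_lattice R}"

lemma coroot_lattice_diff: "x \<in> coroot_lattice R \<Longrightarrow> y \<in> coroot_lattice R \<Longrightarrow> x - y \<in> coroot_lattice R"
  using coroot_lattice_add coroot_lattice_minus by fastforce

lemma coset_eq_iff: "coset x = coset y \<longleftrightarrow> x - y \<in> coroot_lattice R"
proof
  assume "coset x = coset y"
  moreover have "y \<in> coset y" by (simp add: coset_def coroot_lattice_0)
  ultimately have "y \<in> coset x" by simp
  then show "x - y \<in> coroot_lattice R" by (simp add: coset_def)
next
  assume xy: "x - y \<in> coroot_lattice R"
  have "x - z \<in> coroot_lattice R \<longleftrightarrow> y - z \<in> coroot_lattice R" for z
    using coroot_lattice_diff[OF _ xy, of "x - z"] coroot_lattice_add[OF _ xy, of "y - z"] by (auto simp: algebra_simps)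
  then show "coset x = coset y" by (simp add: coset_def)
qed

lemma compact_torus_eq: "compact_torus R = range coset"
  unfolding compact_torus_def quotient_def coset_def by auto

lemma torus_log_coset: "torus_log (coset x) - x \<in> coroot_lattice R" 
proof -
  have "x \<in> coset x" by (simp add: coset_def coroot_lattice_0)
  then have "torus_log (coset x) \<in> coset x" unfolding torus_log_def by (rule someI)
  then show ?thesis using coroot_lattice_minus by (fastforce simp: coset_def)
qed

lemma coset_torus_log: "f \<in> compact_torus R \<Longrightarrow> coset (torus_log f) = f"
  using torus_log_coset coset_eq_iff compact_torus_eq by auto

lemma torus_log_cases: obtains q where "q \<in> coroot_lattice R" "torus_log (coset x) = x + q"
  using torus_log_coset[of x] that[of "torus_log (coset x) - x"] by simp

lemma W_coset: assumes w: "w \<in> W" shows "w ` coset x = coset (w x)"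
proof
  show "w ` coset x \<subseteq> coset (w x)"
    using coroot_lattice_W[OF w] by (auto simp: coset_def simp flip: W_simps(4)[OF w])
  show "coset (w x) \<subseteq> w ` coset x"
  proof
    fix y assume "y \<in> coset (w x)"
    then have "w (x - inv w y) \<in> coroot_lattice R" by (simp add: coset_def W_simps[OF w] W_inv[OF w])
    then have "inv w y \<in> coset x" by (simp add: coset_def coroot_lattice_W_iff[OF w])
    then show "y \<in> w ` coset x" using W_inv(2)[OF w] by (metis imageI)
  qed
qed

text \<open>Moving to a vector of minimal norm in its coset puts it in the Voronoi cell of \<open>0\<close>, where the
  equality case of the Voronoi estimate applies.\<close>

lemma regular_iff:
  "(\<forall>w\<in>W. w x - x \<in> coroot_lattice R \<longrightarrow> w = id) \<longleftrightarrow> (\<forall>\<alpha>\<in>R. \<alpha> \<bullet> x \<notin> \<int>)"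
proof
  assume s: "\<forall>w\<in>W. w x - x \<in> coroot_lattice R \<longrightarrow> w = id"
  show "\<forall>\<alpha>\<in>R. \<alpha> \<bullet> x \<notin> \<int>"
  proof (intro ballI notI)
    fix \<alpha> assume a: "\<alpha> \<in> R" "\<alpha> \<bullet> x \<in> \<int>"
    then obtain n where n: "\<alpha> \<bullet> x = of_int n" by (auto elim: Ints_cases)
    have "reflection \<alpha> x - x = of_int (- n) *\<^sub>R coroot \<alpha>" by (simp add: reflection_def n)
    also have "\<dots> \<in> coroot_lattice R" using a coroot_lattice_scale coroot_lattice_coroot by blast
    finally have "reflection \<alpha> = id" using s weyl_reflection[OF a(1)] by blast
    then have "2 *\<^sub>R \<alpha> = 0" using reflection_self[OF nz[OF a(1)]] by (metis add.right_inverse id_apply scaleR_2)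
    then show False using nz[OF a(1)] by simp
  qed
next
  assume reg: "\<forall>\<alpha>\<in>R. \<alpha> \<bullet> x \<notin> \<int>"
  show "\<forall>w\<in>W. w x - x \<in> coroot_lattice R \<longrightarrow> w = id"
  proof (intro ballI impI)
    fix w assume w: "w \<in> W" and wx: "w x - x \<in> coroot_lattice R"
    let ?S = "{q \<in> coroot_lattice R. norm (x + q) \<le> norm x}"
    have "?S \<subseteq> {q \<in> coroot_lattice R. norm q \<le> 2 * norm x}"
    proof clarify
      fix q assume "norm (x + q) \<le> norm x"
      then show "norm q \<le> 2 * norm x" using norm_triangle_ineq4[of "x + q" x] by simp
    qed
    then have fin: "finite ?S" using Q.finite_ball_L finite_subset by blast
    have ne: "?S \<noteq> {}" using coroot_lattice_0 by force
    obtain q where q: "q \<in> ?S" and mn: "\<And>p. p \<in> ?S \<Longrightarrow> norm (x + q) \<le> norm (x + p)"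
      using arg_min_if_finite(1)[OF fin ne, of "\<lambda>q. norm (x + q)"] arg_min_least[OF fin ne, of _ "\<lambda>q. norm (x + q)"] by blast
    define z where "z = x + q"
    have reg_z: "\<alpha> \<bullet> z \<notin> \<int>" if a: "\<alpha> \<in> R" for \<alpha>
    proof
      assume "\<alpha> \<bullet> z \<in> \<int>"
      moreover have "\<alpha> \<bullet> q \<in> \<int>" using root_lattice_int a q by blast
      ultimately have "\<alpha> \<bullet> z - \<alpha> \<bullet> q \<in> \<int>" by (rule Ints_diff)
      then show False using reg a by (simp add: z_def inner_add_right)
    qed
    have z1: "z \<bullet> \<beta> \<le> 1" if b: "\<beta> \<in> R" for \<beta>
    proof (rule ccontr)
      assume "\<not> z \<bullet> \<beta> \<le> 1"
      then have g: "1 < z \<bullet> \<beta>" by simp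
      have bb: "0 < \<beta> \<bullet> \<beta>" using norm_pos b by blast
      \<comment> \<open>A pairing above \<open>1\<close> would allow \<open>z\<close> to be
        shortened by subtracting \<open>coroot \<beta>\<close>, against the minimal choice of
        \<open>q\<close>.\<close>
      have "(z - coroot \<beta>) \<bullet> (z - coroot \<beta>) = z \<bullet> z - 4 * (z \<bullet> \<beta> - 1) / (\<beta> \<bullet> \<beta>)"
        using bb by (simp add: inner_simps coroot_def inner_commute field_simps)
      also have "\<dots> < z \<bullet> z" using g bb by simp
      finally have lt: "norm (z - coroot \<beta>) < norm z" by (simp add: norm_lt)
      moreover have "q - coroot \<beta> \<in> coroot_lattice R" using q coroot_lattice_diff coroot_lattice_coroot b by blast
      moreover have "norm z \<le> norm x" using q by (simp add: z_def)
      ultimately have "q - coroot \<beta> \<in> ?S" by (simp add: z_def algebra_simps)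
      from mn[OF this] lt show False by (simp add: z_def algebra_simps)
    qed
    define y where "y = z - w z"
    have y: "y \<in> coroot_lattice R"
    proof -
      have "y = (q - w q) - (w x - x)" by (simp add: y_def z_def W_simps[OF w])
      then show ?thesis using q wx coroot_lattice_W[OF w] coroot_lattice_diff by auto
    qed
    \<comment> \<open>Equal norms of \<open>z\<close> and \<open>z - y\<close> mean equality in the
      Voronoi estimate with constant \<open>1\<close>; regularity excludes a root pairing to
      \<open>1\<close> with \<open>z\<close>, so only \<open>y = 0\<close> is left.\<close>
    have "(z - y) \<bullet> (z - y) = z \<bullet> z" by (simp add: y_def W_inner[OF w])
    then have "2 * (z \<bullet> y) = 1 * (y \<bullet> y)" by (simp add: inner_simps inner_commute)
    moreover have "z \<bullet> \<beta> \<noteq> 1" if "\<beta> \<in> R" for \<beta> using reg_z[OF that] by (metis Ints_1 inner_commute)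
    ultimately have "y = 0" using voronoi(3)[OF y z1] by auto
    then have "w z = z" by (simp add: y_def)
    moreover have "\<alpha> \<bullet> z \<noteq> 0" if "\<alpha> \<in> R" for \<alpha> using reg_z[OF that] by (metis Ints_0)
    ultimately show "w = id" using regular_stabilizer w by blast
  qed
qed

lemma F_rho_iff: "coset x \<in> F_rho R D k t \<longleftrightarrow> Phi x \<in> weights"
proof -
  obtain q where q: "q \<in> coroot_lattice R" "torus_log (coset x) = x + q" by (rule torus_log_cases)
  have "coset x \<in> F_rho R D k t \<longleftrightarrow> (\<forall>y\<in>coroot_lattice R. character y (Phi (x + q)) = 1)"
    unfolding F_rho_def using bethe_factor[of _ "x + q"] by (simp add: compact_torus_eq torus_char_eq q(2))
  also have "\<dots> \<longleftrightarrow> Phi (x + q) \<in> weights" by (simp add: character_eq_1_iff weights_def inner_commute)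
  also have "\<dots> \<longleftrightarrow> Phi x \<in> weights"
    unfolding Phi_lattice[OF q(1)] using level_scale_weight[OF q(1), of k] weights_add weights_diff by fastforce
  finally show ?thesis .
qed

lemma F_rho_reg_iff: "coset x \<in> F_rho_reg R D k t \<longleftrightarrow> Phi x \<in> weights \<and> (\<forall>\<alpha>\<in>R. \<alpha> \<bullet> x \<notin> \<int>)"
  unfolding F_rho_reg_def by (simp add: F_rho_iff regular_iff[symmetric] W_coset coset_eq_iff)

lemma F_rho_cases: assumes "f \<in> F_rho R D k t" obtains x where "f = coset x" "Phi x \<in> weights" "x = torus_log f"
  using assms F_rho_iff[of "torus_log f"] coset_torus_log[of f] that by (simp add: F_rho_def)

lemma finite_Phi_weights: "finite {x. Phi x \<in> weights \<and> norm x \<le> r}"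
proof -
  have "continuous_on (cball 0 r) Phi"
    by (rule has_derivative_continuous_on) (rule has_derivative_at_withinI[OF Phi_has_derivative])
  then have "bounded (Phi ` cball 0 r)" by (intro compact_imp_bounded compact_continuous_image compact_cball)
  then obtain s where s: "\<forall>z\<in>Phi ` cball 0 r. norm z \<le> s" unfolding bounded_iff by blast
  have "Phi ` {x. Phi x \<in> weights \<and> norm x \<le> r} \<subseteq> {p \<in> weights. norm p \<le> s}" using s by auto
  then have "finite (Phi ` {x. Phi x \<in> weights \<and> norm x \<le> r})" using finite_weights_ball finite_subset by blast
  then show ?thesis by (rule finite_imageD) (simp add: inj_on_def Phi_inj)
qed

lemma finite_cosets:
  assumes S: "\<And>x q. x \<in> S \<Longrightarrow> q \<in> coroot_lattice R \<Longrightarrow> x + q \<in> S" and fin: "\<And>r. finite {x \<in> S. norm x \<le> r}"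
  shows "finite (coset ` S)"
proof -
  obtain r where r: "\<And>x. \<exists>q\<in>coroot_lattice R. norm (x + q) \<le> r" using lattice_cocompact by blast
  have "coset ` S \<subseteq> coset ` {x \<in> S. norm x \<le> r}"
  proof clarify
    fix x assume x: "x \<in> S"
    obtain q where q: "q \<in> coroot_lattice R" "norm (x + q) \<le> r" using r by blast
    have "coset x = coset (x + q)" using q by (simp add: coset_eq_iff coroot_lattice_minus)
    then show "coset x \<in> coset ` {x \<in> S. norm x \<le> r}" using S[OF x q(1)] q(2) by blast
  qed
  then show ?thesis using fin finite_subset by blast
qed

lemma Phi_weights_lattice: "Phi x \<in> weights \<Longrightarrow> q \<in> coroot_lattice R \<Longrightarrow> Phi (x + q) \<in> weights"
  by (simp add: Phi_lattice weights_add level_scale_weight)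

lemma F_rho_image: "F_rho R D k t = coset ` {x. Phi x \<in> weights}"
  using F_rho_iff by (auto elim: F_rho_cases)

lemma finite_F_rho: "finite (F_rho R D k t)"
  unfolding F_rho_image by (rule finite_cosets) (auto simp: Phi_weights_lattice finite_Phi_weights)

lemma F_rho_reg_sub: "F_rho_reg R D k t \<subseteq> F_rho R D k t"
  by (auto simp: F_rho_reg_def)

lemma finite_F_rho_reg: "finite (F_rho_reg R D k t)"
  using finite_F_rho F_rho_reg_sub finite_subset by blast

text \<open>Finiteness matters here: \<open>card\<close> of an infinite set is \<open>0\<close>, and
  the factor \<open>1 / card\<close> in \<open>theta\<close> would then vanish.\<close>

lemma card_F_group_pos: "0 < card (F_group R D k)"
proof -
  have iff: "coset x \<in> F_group R D k \<longleftrightarrow> c *\<^sub>R x \<in> weights" for x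
  proof -
    obtain q where q: "q \<in> coroot_lattice R" "torus_log (coset x) = x + q" by (rule torus_log_cases)
    have "coset x \<in> F_group R D k \<longleftrightarrow> c *\<^sub>R (x + q) \<in> weights"
      by (simp add: F_group_def compact_torus_eq weights_def q(2))
    also have "\<dots> \<longleftrightarrow> c *\<^sub>R x \<in> weights"
      unfolding scaleR_add_right using level_scale_weight[OF q(1), of k] weights_add weights_diff by fastforce
    finally show ?thesis .
  qed
  have "f \<in> F_group R D k \<Longrightarrow> f \<in> coset ` {x. c *\<^sub>R x \<in> weights}" for f
    using iff[of "torus_log f"] coset_torus_log[of f] by (auto simp: F_group_def intro: image_eqI[of _ _ "torus_log f"])
  then have sub: "F_group R D k \<subseteq> coset ` {x. c *\<^sub>R x \<in> weights}" by blast
  have "finite (coset ` {x. c *\<^sub>R x \<in> weights})"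
  proof (rule finite_cosets)
    fix r
    have "(*\<^sub>R) c ` {x \<in> {x. c *\<^sub>R x \<in> weights}. norm x \<le> r} \<subseteq> {p \<in> weights. norm p \<le> c * r}"
      using c_pos by auto
    then have "finite ((*\<^sub>R) c ` {x \<in> {x. c *\<^sub>R x \<in> weights}. norm x \<le> r})" using finite_weights_ball finite_subset by blast
    then show "finite {x \<in> {x. c *\<^sub>R x \<in> weights}. norm x \<le> r}"
      by (rule finite_imageD) (use c_pos in \<open>simp add: inj_on_def\<close>)
  qed (simp add: scaleR_add_right weights_add level_scale_weight)
  then have "finite (F_group R D k)" using sub finite_subset by blast
  moreover have "coset 0 \<in> F_group R D k" using iff weights_0 by simp
  ultimately show ?thesis by (auto simp: card_gt_0_iff)
qed

end

section \<open>Orthogonality\<close>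

context bethe
begin

text \<open>The values of \<open>partition\<close> along one coset add up to \<open>1\<close>, so
  the weighted sum counts each torus point once. This connects the vectors produced by Poisson
  summation with points of the torus.\<close>

lemma sum_cosets:
  fixes g :: "real^'n \<Rightarrow> complex"
  assumes S: "\<And>x q. x \<in> S \<Longrightarrow> q \<in> coroot_lattice R \<Longrightarrow> x + q \<in> S" and fin: "\<And>r. finite {x \<in> S. norm x \<le> r}"
    and g: "\<And>x q. q \<in> coroot_lattice R \<Longrightarrow> g (x + q) = g x"
  shows "(\<Sum>x\<in>{x \<in> S. Q.partition x \<noteq> 0}. Q.partition x * g x) = (\<Sum>f\<in>coset ` S. g (torus_log f))"
proof -
  let ?S0 = "{x \<in> S. Q.partition x \<noteq> 0}"
  obtain r where "\<And>x. Q.partition x \<noteq> 0 \<Longrightarrow> norm x \<le> r"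
    using Q.bounded_support_partition by (auto simp: bounded_support_def)
  then have "?S0 \<subseteq> {x \<in> S. norm x \<le> r}" by blast
  then have fin0: "finite ?S0" using fin finite_subset by blast
  have "(\<Sum>x\<in>?S0. Q.partition x * g x) = (\<Sum>f\<in>coset ` S. \<Sum>x\<in>{x \<in> ?S0. coset x = f}. Q.partition x * g x)"
    by (rule sum.group[symmetric]) (use fin0 finite_cosets[OF S fin] in auto)
  also have "\<dots> = (\<Sum>f\<in>coset ` S. g (torus_log f))"
  proof (rule sum.cong[OF refl])
    fix f assume "f \<in> coset ` S"
    then obtain x1 where x1: "x1 \<in> S" "f = coset x1" by blast
    define x0 where "x0 = torus_log f"
    obtain q1 where q1: "q1 \<in> coroot_lattice R" "x0 = x1 + q1" unfolding x0_def x1(2) by (rule torus_log_cases)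
    have x0: "x0 \<in> S" "coset x0 = f" using q1 x1 S by (auto simp: coset_eq_iff)
    have e: "coset x = f \<longleftrightarrow> x - x0 \<in> coroot_lattice R" for x unfolding x0(2)[symmetric] by (rule coset_eq_iff)
    have "(\<Sum>x\<in>{x \<in> ?S0. coset x = f}. Q.partition x * g x) = (\<Sum>q\<in>{q \<in> coroot_lattice R. Q.partition (x0 + q) \<noteq> 0}. Q.partition (x0 + q) * g x0)"
    proof (rule sum.reindex_bij_witness[of _ "\<lambda>q. x0 + q" "\<lambda>x. x - x0"])
      fix x assume x: "x \<in> {x \<in> ?S0. coset x = f}"
      then have q: "x - x0 \<in> coroot_lattice R" using e by blast
      show "x0 + (x - x0) = x" by simp
      show "x - x0 \<in> {q \<in> coroot_lattice R. Q.partition (x0 + q) \<noteq> 0}" using x q by simp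
      show "Q.partition (x0 + (x - x0)) * g x0 = Q.partition x * g x" using g[OF q, of x0] by simp
    next
      fix q assume "q \<in> {q \<in> coroot_lattice R. Q.partition (x0 + q) \<noteq> 0}"
      then show "x0 + q \<in> {x \<in> ?S0. coset x = f}" using S[OF x0(1)] e by simp
    qed simp
    also have "\<dots> = complex_of_real (Q.periodize Q.partition x0) * g x0"
      by (simp add: Q.periodize_def sum_distrib_right)
    finally show "(\<Sum>x\<in>{x \<in> ?S0. coset x = f}. Q.partition x * g x) = g (torus_log f)"
      by (simp add: Q.periodize_partition x0_def)
  qed
  finally show ?thesis .
qed

lemma continuous_Phi: "continuous_on S Phi"
  by (rule has_derivative_continuous_on) (rule has_derivative_at_withinI[OF Phi_has_derivative])

lemma continuous_numerator: "continuous_on S (numerator \<kappa>)"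
  unfolding numerator_def by (intro continuous_intros)

lemma continuous_dual_numerator: "continuous_on S (dual_numerator \<kappa>)"
  unfolding dual_numerator_def by (intro continuous_intros) (auto simp: finite_Pos t_character_neq)

lemma dual_numerator_eq: "dual_numerator \<mu> x = cnj (numerator \<mu> x) / root_prod x"
  using cnj_numerator[of \<mu> x] root_prod_nonzero[of x] by simp

lemma root_prod_lattice: "q \<in> coroot_lattice R \<Longrightarrow> root_prod (x + q) = root_prod x"
  unfolding root_prod_def by (intro prod.cong refl) (simp add: character_lattice root_weight)

text \<open>Multiplying by \<open>partition\<close> gives a function \<open>u\<close> of bounded
  support, all of whose integrals against \<open>character y (Phi x)\<close> vanish by
  \<open>term_mean_0\<close>. The result is first a sum over weights \<open>p\<close> at the points
  \<open>Psi p\<close>, then by \<open>sum_cosets\<close> one over all solutions, including the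
  singular ones.\<close>

lemma numerator_orthogonal:
  assumes l: "\<kappa> \<in> level_weights R D k" and m: "\<mu> \<in> level_weights R D k" and ne: "\<kappa> \<noteq> \<mu>" and nrm: "norm \<mu> \<le> norm \<kappa>"
  shows "(\<Sum>f\<in>F_rho R D k t. numerator \<kappa> (torus_log f) * dual_numerator \<mu> (torus_log f) / det (matrix (Phi' (torus_log f)))) = 0"
proof -
  define U where "U x = numerator \<kappa> x * dual_numerator \<mu> x" for x
  define u where "u x = complex_of_real (Q.partition x) * U x" for x
  have cU: "continuous_on UNIV U" unfolding U_def by (intro continuous_intros continuous_numerator continuous_dual_numerator)
  have cu: "continuous_on UNIV u" unfolding u_def by (intro continuous_intros Q.continuous_partition cU)
  have bu: "bounded_support u" using Q.bounded_support_partition by (auto simp: bounded_support_def u_def)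
  have zero: "(\<integral>x. u x * character y (Phi x) \<partial>lborel) = 0" if y: "y \<in> coroot_lattice R" for y
  proof -
    define T where "T w w' x = character (w (\<kappa> + rho)) x * (\<Prod>\<alpha>\<in>Pos. 1 - t * character (- w \<alpha>) x) *
     (character (- w' (\<mu> + rho)) x / (\<Prod>\<alpha>\<in>Pos. 1 - t * character (- w' \<alpha>) x)) * character y (Phi x)" for w w' x
    have ct: "continuous_on UNIV (T w w')" for w w'
      unfolding T_def by (intro continuous_intros continuous_Phi) (auto simp: finite_Pos t_character_neq)
    have it: "integrable lborel (\<lambda>x. Q.partition x * T w w' x)" for w w'
      by (intro integrable_continuous_bounded_support continuous_intros Q.continuous_partition ct)
         (use Q.bounded_support_partition in \<open>auto simp: bounded_support_def\<close>)
    have "u x * character y (Phi x) = (\<Sum>w\<in>W. \<Sum>w'\<in>W. (weyl_sign w * weyl_sign w') * (Q.partition x * T w w' x))" for x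
    proof -
      have "u x * character y (Phi x) = (Q.partition x * character y (Phi x)) * U x" by (simp add: u_def)
      also have "\<dots> = (\<Sum>w\<in>W. \<Sum>w'\<in>W. (Q.partition x * character y (Phi x)) *
         (weyl_sign w * (character (w (\<kappa> + rho)) x * (\<Prod>\<alpha>\<in>Pos. 1 - t * character (- w \<alpha>) x)) *
          (weyl_sign w' * (character (- w' (\<mu> + rho)) x / (\<Prod>\<alpha>\<in>Pos. 1 - t * character (- w' \<alpha>) x)))))"
        unfolding U_def numerator_def dual_numerator_def sum_product by (simp only: sum_distrib_left)
      also have "\<dots> = (\<Sum>w\<in>W. \<Sum>w'\<in>W. (weyl_sign w * weyl_sign w') * (Q.partition x * T w w' x))"
        unfolding T_def by (intro sum.cong refl) (simp add: mult_ac)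
      finally show ?thesis .
    qed
    then have "(\<integral>x. u x * character y (Phi x) \<partial>lborel)
       = (\<Sum>w\<in>W. \<Sum>w'\<in>W. (weyl_sign w * weyl_sign w') * (\<integral>x. Q.partition x * T w w' x \<partial>lborel))"
      using it by (simp add: Bochner_Integration.integral_sum)
    also have "\<dots> = 0"
    proof -
      have "(\<integral>x. Q.partition x * T w w' x \<partial>lborel) = 0" if "w \<in> W" "w' \<in> W" for w w'
        unfolding T_def by (rule term_mean_0[OF l m ne nrm that y])
      then show ?thesis by simp
    qed
    finally show ?thesis .
  qed
  have P: "(\<Sum>p | p \<in> weights \<and> u (Psi p) \<noteq> 0. u (Psi p) / det (matrix (Phi' (Psi p)))) = 0"
    by (rule poisson_pullback_0[OF dual_lattices_weights cu bu Psi_Phi Phi_Psi continuous_Psi Phi_has_derivative continuous_det_Phi' det_Phi'_pos zero])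
  define S where "S = {x. Phi x \<in> weights}"
  define g where "g x = U x / det (matrix (Phi' x))" for x
  have SL: "x + q \<in> S" if "x \<in> S" "q \<in> coroot_lattice R" for x q using that by (simp add: S_def Phi_weights_lattice)
  have Sf: "finite {x \<in> S. norm x \<le> r}" for r using finite_Phi_weights by (simp add: S_def)
  have gL: "g (x + q) = g x" if q: "q \<in> coroot_lattice R" for x q
    using level_weightsD(1) l m q
    by (simp add: g_def U_def dual_numerator_eq numerator_lattice root_prod_lattice Phi'_lattice)
  obtain r where r: "\<And>x. Q.partition x \<noteq> 0 \<Longrightarrow> norm x \<le> r"
    using Q.bounded_support_partition by (auto simp: bounded_support_def)
  have fin0: "finite {x \<in> S. Q.partition x \<noteq> 0}" by (rule finite_subset[OF _ Sf[of r]]) (use r in blast)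
  have "(\<Sum>f\<in>F_rho R D k t. g (torus_log f)) = (\<Sum>x\<in>{x \<in> S. Q.partition x \<noteq> 0}. Q.partition x * g x)"
    unfolding F_rho_image S_def[symmetric] by (rule sum_cosets[symmetric]) (use SL Sf gL in auto)
  also have "\<dots> = (\<Sum>x\<in>{x \<in> S. u x \<noteq> 0}. Q.partition x * g x)"
    by (rule sum.mono_neutral_right) (use fin0 in \<open>auto simp: u_def g_def\<close>)
  also have "\<dots> = (\<Sum>p | p \<in> weights \<and> u (Psi p) \<noteq> 0. u (Psi p) / det (matrix (Phi' (Psi p))))"
    by (rule sum.reindex_bij_witness[of _ Psi Phi]) (auto simp: S_def Psi_Phi Phi_Psi u_def g_def)
  finally show ?thesis using P by (simp add: g_def U_def)
qed

section \<open>The weights \<open>theta\<close> and the orthogonality of the functions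
  \<open>Theta\<close>\<close>

definition root_prod1 :: "real^'n \<Rightarrow> complex" where
  "root_prod1 x = (\<Prod>\<alpha>\<in>R. 1 - character \<alpha> x)"

lemma root_prod1_eq: "root_prod1 x = weyl_denominator x * cnj (weyl_denominator x)"
proof -
  have "(1 - character \<alpha> x) * (1 - character (- \<alpha>) x)
     = (character ((1/2) *\<^sub>R \<alpha>) x - character (- ((1/2) *\<^sub>R \<alpha>)) x) * cnj (character ((1/2) *\<^sub>R \<alpha>) x - character (- ((1/2) *\<^sub>R \<alpha>)) x)" for \<alpha>
  proof -
    have "character (- ((1/2) *\<^sub>R \<alpha>)) x * character ((1/2) *\<^sub>R \<alpha>) x = 1" by (simp flip: character_add)
    then show ?thesis
      using one_minus_character_split[of \<alpha> x] one_minus_character_split[of "- \<alpha>" x]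
      by (simp add: character_cnj) (simp add: mult_ac)
  qed
  then show ?thesis by (simp add: root_prod1_def prod_R weyl_denominator_def prod.distrib)
qed

definition root_norm :: "real^'n \<Rightarrow> real" where
  "root_norm x = (\<Prod>\<alpha>\<in>Pos. (norm (1 - t * character \<alpha> x))\<^sup>2)"

lemma root_norm_pos: "0 < root_norm x"
  unfolding root_norm_def by (intro prod_pos) (simp add: t_character_neq)

lemma root_prod_eq: "root_prod x = root_norm x"
proof -
  have "(1 - t * character \<alpha> x) * (1 - t * character (- \<alpha>) x) = complex_of_real ((norm (1 - t * character \<alpha> x))\<^sup>2)" for \<alpha>
    unfolding complex_norm_square by (simp add: character_cnj)
  then show ?thesis unfolding root_prod_def prod_R root_norm_def by simp
qed

definition theta_const :: real where
  "theta_const = (1 - t) ^ CARD('n) * c ^ CARD('n) / card (F_group R D k)"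

lemma theta_const_pos: "0 < theta_const"
  using card_F_group_pos c_pos t_less by (simp add: theta_const_def)

definition theta_real :: "real^'n \<Rightarrow> real" where
  "theta_real x = theta_const * (norm (weyl_denominator x))\<^sup>2 * root_norm x / det (matrix (Phi' x))"

lemma theta_eq: "theta R D k t f = theta_real (torus_log f)"
proof -
  let ?x = "torus_log f"
  have "(\<Prod>\<alpha>\<in>R. (1 - torus_char \<alpha> f) * (1 - t * torus_char \<alpha> f)) = root_prod1 ?x * root_prod ?x"
    by (simp add: root_prod1_def root_prod_def torus_char_eq prod.distrib)
  also have "\<dots> = complex_of_real ((norm (weyl_denominator ?x))\<^sup>2 * root_norm ?x)"
    unfolding root_prod1_eq root_prod_eq of_real_mult complex_norm_square ..
  finally have p: "(\<Prod>\<alpha>\<in>R. (1 - torus_char \<alpha> f) * (1 - t * torus_char \<alpha> f)) = complex_of_real ((norm (weyl_denominator ?x))\<^sup>2 * root_norm ?x)" .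
  have d: "det (matrix (H_dagger R D k t f)) = det (matrix (Phi' ?x)) / c ^ CARD('n)"
    using det_H_dagger[of f] c_pos by simp
  show ?thesis
    unfolding theta_def p d theta_real_def theta_const_def by simp
qed

lemma theta_real_pos:
  assumes "\<And>\<alpha>. \<alpha> \<in> R \<Longrightarrow> \<alpha> \<bullet> x \<notin> \<int>" shows "0 < theta_real x"
  using weyl_denominator_nonzero[OF assms] theta_const_pos root_norm_pos[of x] det_Phi'_pos[of x] by (simp add: theta_real_def)

text \<open>The two copies of \<open>Theta\<close> carry the squared modulus of
  \<open>weyl_denominator\<close> and two factors \<open>root_prod\<close> below;
  \<open>theta_real\<close> supplies the former and one of the latter above. The surviving
  \<open>root_prod\<close> turns the conjugate numerator into \<open>dual_numerator\<close>.\<close>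

lemma theta_term:
  assumes reg: "\<And>\<alpha>. \<alpha> \<in> R \<Longrightarrow> \<alpha> \<bullet> x \<notin> \<int>"
  shows "theta_real x * theta_char \<kappa> x * cnj (theta_char \<mu> x)
     = theta_const * (numerator \<kappa> x * dual_numerator \<mu> x / det (matrix (Phi' x)))"
proof -
  have d: "weyl_denominator x \<noteq> 0" by (rule weyl_denominator_nonzero[OF reg])
  have r: "complex_of_real (root_norm x) \<noteq> 0" using root_norm_pos[of x] by simp
  have "complex_of_real (theta_real x) = theta_const * (weyl_denominator x * cnj (weyl_denominator x)) * root_norm x / det (matrix (Phi' x))"
    unfolding theta_real_def by (simp only: of_real_mult of_real_divide complex_norm_square)
  moreover have "a * (W1 * W2) * r / e * (N / (W1 * r)) * (M / (W2 * r)) = a * (N * (M / r) / e)"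
    if "W1 \<noteq> 0" "W2 \<noteq> 0" "r \<noteq> 0" for a W1 W2 r e N M :: complex using that by (simp add: field_simps)
  moreover have tc: "theta_char \<nu> x = numerator \<nu> x / (weyl_denominator x * root_prod x)" for \<nu>
    by (rule theta_char_numerator) (rule reg)
  ultimately show ?thesis
    unfolding tc dual_numerator_eq root_prod_eq using d r by simp
qed

lemma F_rho_reg_regular: assumes "f \<in> F_rho_reg R D k t" "\<alpha> \<in> R" shows "\<alpha> \<bullet> torus_log f \<notin> \<int>"
proof -
  have "f \<in> F_rho R D k t" using assms F_rho_reg_sub by blast
  then have "f = coset (torus_log f)" by (rule F_rho_cases) simp
  then show ?thesis using assms F_rho_reg_iff by metis
qed

lemma theta_orthogonal_aux:
  assumes l: "\<kappa> \<in> level_weights R D k" and m: "\<mu> \<in> level_weights R D k" and ne: "\<kappa> \<noteq> \<mu>" and nrm: "norm \<mu> \<le> norm \<kappa>"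
  shows "(\<Sum>f\<in>F_rho_reg R D k t. theta R D k t f * Theta R D \<kappa> t f * cnj (Theta R D \<mu> t f)) = 0"
proof -
  let ?g = "\<lambda>x. numerator \<kappa> x * dual_numerator \<mu> x / det (matrix (Phi' x))"
  have "(\<Sum>f\<in>F_rho_reg R D k t. theta R D k t f * Theta R D \<kappa> t f * cnj (Theta R D \<mu> t f))
    = (\<Sum>f\<in>F_rho_reg R D k t. theta_const * ?g (torus_log f))"
    unfolding theta_eq Theta_eq by (intro sum.cong refl theta_term F_rho_reg_regular)
  \<comment> \<open>The regular solutions are completed to all solutions, the added terms being zero
    by \<open>numerator_singular\<close>.\<close>
  also have "\<dots> = (\<Sum>f\<in>F_rho R D k t. theta_const * ?g (torus_log f))"
  proof (rule sum.mono_neutral_left[OF finite_F_rho F_rho_reg_sub], intro ballI)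
    fix f assume f: "f \<in> F_rho R D k t - F_rho_reg R D k t"
    then obtain x where x: "f = coset x" "Phi x \<in> weights" "x = torus_log f" by (auto elim: F_rho_cases)
    have "coset x \<notin> F_rho_reg R D k t" using f x(1) by simp
    then obtain \<alpha> where "\<alpha> \<in> R" "\<alpha> \<bullet> x \<in> \<int>" using F_rho_reg_iff[of x] x(2) by blast
    then have "numerator \<kappa> x = 0" by (rule numerator_singular[OF level_weightsD(1)[OF l]])
    then show "theta_const * ?g (torus_log f) = 0" unfolding x(3)[symmetric] by simp
  qed
  also have "\<dots> = 0" by (simp only: sum_distrib_left[symmetric] numerator_orthogonal[OF l m ne nrm] mult_zero_right)
  finally show ?thesis .
qed

text \<open>The frequency argument compares norms; in the remaining case the two weights are
  exchanged and the sum conjugated, which is harmless because \<open>theta\<close> is real.\<close>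

lemma theta_orthogonal:
  assumes l: "\<kappa> \<in> level_weights R D k" and m: "\<mu> \<in> level_weights R D k" and ne: "\<kappa> \<noteq> \<mu>"
  shows "(\<Sum>f\<in>F_rho_reg R D k t. theta R D k t f * Theta R D \<kappa> t f * cnj (Theta R D \<mu> t f)) = 0"
proof (cases "norm \<mu> \<le> norm \<kappa>")
  case True then show ?thesis using theta_orthogonal_aux assms by blast
next
  case False
  then have "(\<Sum>f\<in>F_rho_reg R D k t. theta R D k t f * Theta R D \<mu> t f * cnj (Theta R D \<kappa> t f)) = 0"
    using theta_orthogonal_aux[OF m l] ne by simp
  from arg_cong[OF this, of cnj] show ?thesis by (simp add: theta_eq mult_ac)
qed

lemma theta_char_lattice:
  assumes \<kappa>: "\<kappa> \<in> weights" and q: "q \<in> coroot_lattice R" shows "theta_char \<kappa> (x + q) = theta_char \<kappa> x"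
  unfolding theta_char_def using q
  by (intro sum.cong refl) (simp add: character_lattice W_root_weight weights_W[OF _ \<kappa>] cong: prod.cong)

lemma theta_char_W: assumes v: "v \<in> W" shows "theta_char \<kappa> (v x) = theta_char \<kappa> x"
proof -
  let ?G = "\<lambda>w. character (w \<kappa>) x / (\<Prod>\<alpha>\<in>Pos. (1 - character (- w \<alpha>) x) * (1 - t * character (w \<alpha>) x))"
  have iv: "inv v \<in> W" using W_inv(1)[OF v] .
  have "theta_char \<kappa> (v x) = (\<Sum>w\<in>W. ?G (inv v \<circ> w))"
    unfolding theta_char_def by (simp add: character_W[OF v] W_simps[OF iv])
  also have "\<dots> = (\<Sum>u\<in>W. ?G u)"
    by (rule sum.reindex_bij_witness[of _ "\<lambda>u. v \<circ> u" "\<lambda>w. inv v \<circ> w"])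
       (auto simp: fun_eq_iff W_inv[OF v] intro: weyl_comp[OF iv] weyl_comp[OF v])
  finally show ?thesis by (simp add: theta_char_def)
qed

lemma root_norm_lattice: "q \<in> coroot_lattice R \<Longrightarrow> root_norm (x + q) = root_norm x"
  unfolding root_norm_def using Pos_sub
  by (intro prod.cong refl) (simp add: character_lattice root_weight subset_iff)

lemma weyl_denominator_norm: "complex_of_real ((norm (weyl_denominator x))\<^sup>2) = root_prod1 x"
  by (simp only: complex_norm_square root_prod1_eq)

lemma theta_real_lattice: assumes q: "q \<in> coroot_lattice R" shows "theta_real (x + q) = theta_real x"
proof -
  have "root_prod1 (x + q) = root_prod1 x"
    unfolding root_prod1_def by (intro prod.cong refl) (simp add: character_lattice root_weight q)
  then have "(norm (weyl_denominator (x + q)))\<^sup>2 = (norm (weyl_denominator x))\<^sup>2"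
    unfolding weyl_denominator_norm[symmetric] by (simp only: of_real_eq_iff)
  then show ?thesis by (simp add: theta_real_def root_norm_lattice[OF q] Phi'_lattice[OF q])
qed

lemma theta_real_W: assumes w: "w \<in> W" shows "theta_real (w x) = theta_real x"
proof -
  have ch: "character (w \<alpha>) (w x) = character \<alpha> x" for \<alpha> by (simp add: character_def W_inner[OF w])
  have "root_prod1 (w x) = root_prod1 x"
    unfolding root_prod1_def by (subst R_prod_W[OF w]) (simp add: ch)
  then have "(norm (weyl_denominator (w x)))\<^sup>2 = (norm (weyl_denominator x))\<^sup>2"
    unfolding weyl_denominator_norm[symmetric] by (simp only: of_real_eq_iff)
  moreover have "root_prod (w x) = root_prod x"
    unfolding root_prod_def by (subst R_prod_W[OF w]) (simp add: ch)
  then have "root_norm (w x) = root_norm x" by (simp add: root_prod_eq)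
  ultimately show ?thesis by (simp add: theta_real_def det_Phi'_W[OF w])
qed

lemma torus_log_W: assumes "f \<in> compact_torus R" "w \<in> W"
  obtains q where "q \<in> coroot_lattice R" "torus_log (w ` f) = w (torus_log f) + q"
proof -
  have "w ` f = coset (w (torus_log f))" using W_coset[OF assms(2)] coset_torus_log[OF assms(1)] by metis
  then show ?thesis using torus_log_cases[of "w (torus_log f)"] that by metis
qed

lemma theta_orbit: assumes "f \<in> compact_torus R" "w \<in> W" shows "theta R D k t (w ` f) = theta R D k t f"
proof -
  obtain q where "q \<in> coroot_lattice R" "torus_log (w ` f) = w (torus_log f) + q" using torus_log_W[OF assms] .
  then show ?thesis by (simp add: theta_eq theta_real_lattice theta_real_W[OF assms(2)])
qed

lemma Theta_orbit: assumes "\<kappa> \<in> weights" "f \<in> compact_torus R" "w \<in> W" shows "Theta R D \<kappa> t (w ` f) = Theta R D \<kappa> t f"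
proof -
  obtain q where "q \<in> coroot_lattice R" "torus_log (w ` f) = w (torus_log f) + q" using torus_log_W[OF assms(2,3)] .
  then show ?thesis by (simp add: Theta_eq theta_char_lattice[OF assms(1)] theta_char_W[OF assms(3)])
qed

section \<open>Weyl orbits of regular solutions\<close>

definition orbit :: "(real^'n) set \<Rightarrow> (real^'n) set set" where
  "orbit f = (\<lambda>w. w ` f) ` W"

lemma weyl_orbits_eq: "weyl_orbits R S = orbit ` S"
  by (simp add: weyl_orbits_def orbit_def)

lemma orbit_self: "f \<in> orbit f"
  unfolding orbit_def using weyl_group.id[of R] by (auto intro: image_eqI[of _ _ id])

lemma orbit_W: assumes w: "w \<in> W" shows "orbit (w ` f) = orbit f"
proof
  show "orbit (w ` f) \<subseteq> orbit f"
  proof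
    fix g assume "g \<in> orbit (w ` f)"
    then obtain v where v: "v \<in> W" "g = (v \<circ> w) ` f" by (auto simp: orbit_def image_image)
    then show "g \<in> orbit f" unfolding orbit_def using weyl_comp[OF v(1) w] by blast
  qed
  show "orbit f \<subseteq> orbit (w ` f)"
  proof
    fix g assume "g \<in> orbit f"
    then obtain v where v: "v \<in> W" "g = v ` f" by (auto simp: orbit_def)
    have "(v \<circ> inv w) ` (w ` f) = g" using v by (simp add: image_image W_inv[OF w])
    moreover have "v \<circ> inv w \<in> W" by (rule weyl_comp[OF v(1) W_inv(1)[OF w]])
    ultimately show "g \<in> orbit (w ` f)" unfolding orbit_def by (metis imageI)
  qed
qed

lemma F_rho_reg_torus: "f \<in> F_rho_reg R D k t \<Longrightarrow> f \<in> compact_torus R"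
  by (simp add: F_rho_reg_def F_rho_def)

lemma F_rho_reg_W: assumes f: "f \<in> F_rho_reg R D k t" and w: "w \<in> W" shows "w ` f \<in> F_rho_reg R D k t"
proof -
  have "f \<in> F_rho R D k t" using f F_rho_reg_sub by blast
  then obtain x where x: "f = coset x" "Phi x \<in> weights" by (rule F_rho_cases)
  have r: "\<forall>\<alpha>\<in>R. \<alpha> \<bullet> x \<notin> \<int>" using f x F_rho_reg_iff by blast
  have "\<alpha> \<bullet> w x \<notin> \<int>" if "\<alpha> \<in> R" for \<alpha>
    using r W_mem[OF W_inv(1)[OF w] that] by (simp add: W_adj'[OF w])
  then show ?thesis unfolding x(1) W_coset[OF w] F_rho_reg_iff using x(2) by (simp add: Phi_W[OF w] weights_W[OF w])
qed

text \<open>Regularity makes the action free. Sums over regular solutions and sums over orbits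
  therefore differ by the single constant \<open>card W\<close>.\<close>

lemma card_orbit: assumes f: "f \<in> F_rho_reg R D k t" shows "card (orbit f) = card W"
proof -
  have "inj_on (\<lambda>w. w ` f) W"
  proof (rule inj_onI)
    fix v w assume vw: "v \<in> W" "w \<in> W" "v ` f = w ` f"
    have "(inv w \<circ> v) ` f = inv w ` (v ` f)" by (simp add: image_comp)
    also have "\<dots> = f" unfolding vw(3) by (simp add: image_image W_inv[OF vw(2)])
    finally have "(inv w \<circ> v) ` f = f" .
    moreover have "inv w \<circ> v \<in> W" by (rule weyl_comp[OF W_inv(1)[OF vw(2)] vw(1)])
    ultimately have "inv w \<circ> v = id" using f by (simp add: F_rho_reg_def)
    then have "inv w (v y) = y" for y by (metis comp_apply id_apply)
    then have "w (inv w (v y)) = w y" for y by simp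
    then show "v = w" by (auto simp: W_inv[OF vw(2)])
  qed
  then show ?thesis by (simp add: orbit_def card_image)
qed

abbreviation Orb where "Orb \<equiv> weyl_orbits R (F_rho_reg R D k t)"
abbreviation rep :: "(real^'n) set set \<Rightarrow> (real^'n) set" where "rep orb \<equiv> SOME f. f \<in> orb"

lemma finite_Orb: "finite Orb"
  by (simp add: weyl_orbits_eq finite_F_rho_reg)

lemma rep_F: assumes "orb \<in> Orb" shows "rep orb \<in> F_rho_reg R D k t" "rep orb \<in> orb" "orbit (rep orb) = orb"
proof -
  obtain f where f: "f \<in> F_rho_reg R D k t" "orb = orbit f" using assms by (auto simp: weyl_orbits_eq)
  show r: "rep orb \<in> orb" unfolding f(2) by (rule someI[of "\<lambda>g. g \<in> orbit f", OF orbit_self])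
  then obtain w where w: "w \<in> W" "rep orb = w ` f" unfolding f(2) orbit_def by blast
  show "rep orb \<in> F_rho_reg R D k t" using w F_rho_reg_W[OF f(1) w(1)] by simp
  show "orbit (rep orb) = orb" using w orbit_W f by simp
qed

lemma sum_orbits:
  fixes g :: "(real^'n) set \<Rightarrow> complex"
  assumes g: "\<And>f w. f \<in> F_rho_reg R D k t \<Longrightarrow> w \<in> W \<Longrightarrow> g (w ` f) = g f"
  shows "(\<Sum>f\<in>F_rho_reg R D k t. g f) = of_nat (card W) * (\<Sum>orb\<in>Orb. g (rep orb))"
proof -
  have "(\<Sum>f\<in>F_rho_reg R D k t. g f) = (\<Sum>orb\<in>Orb. \<Sum>f\<in>{f \<in> F_rho_reg R D k t. orbit f = orb}. g f)"
    by (rule sum.group[symmetric]) (auto simp: finite_F_rho_reg finite_Orb weyl_orbits_eq)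
  also have "\<dots> = (\<Sum>orb\<in>Orb. of_nat (card W) * g (rep orb))"
  proof (rule sum.cong[OF refl])
    fix orb assume o: "orb \<in> Orb"
    note r = rep_F[OF o]
    have "{f \<in> F_rho_reg R D k t. orbit f = orb} = orb"
    proof
      show "{f \<in> F_rho_reg R D k t. orbit f = orb} \<subseteq> orb" using orbit_self by blast
      show "orb \<subseteq> {f \<in> F_rho_reg R D k t. orbit f = orb}"
      proof
        fix f assume "f \<in> orb"
        then obtain w where w: "w \<in> W" "f = w ` rep orb" using r(3) unfolding orbit_def by blast
        then show "f \<in> {f \<in> F_rho_reg R D k t. orbit f = orb}" using F_rho_reg_W[OF r(1) w(1)] orbit_W[OF w(1)] r(3) by simp
      qed
    qed
    moreover have "g f = g (rep orb)" if f: "f \<in> orb" for f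
    proof -
      obtain w where w: "w \<in> W" "f = w ` rep orb" using f r(3) unfolding orbit_def by blast
      then show ?thesis using g[OF r(1) w(1)] by simp
    qed
    moreover have "card orb = card W" using card_orbit[OF r(1)] r(3) by simp
    ultimately show "(\<Sum>f\<in>{f \<in> F_rho_reg R D k t. orbit f = orb}. g f) = of_nat (card W) * g (rep orb)" by simp
  qed
  finally show ?thesis by (simp add: sum_distrib_left)
qed

lemma card_W_pos: "0 < card W"
  using finite_W weyl_group.id[of R] by (auto simp: card_gt_0_iff)

lemma orbit_orthogonal:
  assumes l: "\<kappa> \<in> level_weights R D k" and m: "\<mu> \<in> level_weights R D k" and ne: "\<kappa> \<noteq> \<mu>"
  shows "(\<Sum>orb\<in>Orb. theta_real (torus_log (rep orb)) * Theta R D \<kappa> t (rep orb) * cnj (Theta R D \<mu> t (rep orb))) = 0"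
proof -
  have "of_nat (card W) * (\<Sum>orb\<in>Orb. theta R D k t (rep orb) * Theta R D \<kappa> t (rep orb) * cnj (Theta R D \<mu> t (rep orb))) = 0"
    using theta_orthogonal[OF l m ne]
    by (subst (asm) sum_orbits) (simp_all add: theta_orbit Theta_orbit F_rho_reg_torus level_weightsD(1)[OF l] level_weightsD(1)[OF m])
  then show ?thesis using card_W_pos by (simp add: theta_eq)
qed

text \<open>Each regular solution is moved by the affine Weyl group to the one whose weight is closest to
  \<open>rho\<close>, and this weight lies strictly inside the alcove.\<close>

lemma orbit_level_weight:
  assumes f: "f \<in> F_rho_reg R D k t"
  shows "\<exists>\<kappa>\<in>level_weights R D k. orbit f = orbit (coset (Psi (\<kappa> + rho)))"
proof -
  have "f \<in> F_rho R D k t" using f F_rho_reg_sub by blast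
  then obtain x where x: "f = coset x" "Phi x \<in> weights" by (rule F_rho_cases)
  have reg: "\<forall>\<alpha>\<in>R. \<alpha> \<bullet> x \<notin> \<int>" using f x F_rho_reg_iff by blast
  \<comment> \<open>The orbit of \<open>Phi x\<close> under the affine Weyl group at level
    \<open>c\<close>; its members are the values of \<open>Phi\<close> at the points
    \<open>w x + q\<close>.\<close>
  define A where "A = {w (Phi x) + c *\<^sub>R q | w q. w \<in> W \<and> q \<in> coroot_lattice R}"
  have AP: "A \<subseteq> weights"
  proof
    fix p assume "p \<in> A"
    then obtain w q where "w \<in> W" "q \<in> coroot_lattice R" "p = w (Phi x) + c *\<^sub>R q" unfolding A_def by blast
    then show "p \<in> weights" using weights_add[OF weights_W[OF _ x(2)] level_scale_weight] by simp
  qed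
  have A0: "Phi x \<in> A" unfolding A_def using weyl_group.id[of R] coroot_lattice_0 by force
  let ?S = "{p \<in> A. norm (p - rho) \<le> norm (Phi x - rho)}"
  have "?S \<subseteq> {p \<in> weights. norm p \<le> norm (Phi x - rho) + norm rho}"
  proof
    fix p assume p: "p \<in> ?S"
    have "norm p \<le> norm (p - rho) + norm rho" using norm_triangle_ineq[of "p - rho" rho] by simp
    then show "p \<in> {p \<in> weights. norm p \<le> norm (Phi x - rho) + norm rho}" using p AP by auto
  qed
  then have fin: "finite ?S" using finite_weights_ball finite_subset by blast
  have ne: "?S \<noteq> {}" using A0 by blast
  obtain p where p: "p \<in> ?S" and mn0: "\<And>q. q \<in> ?S \<Longrightarrow> norm (p - rho) \<le> norm (q - rho)"
    using arg_min_if_finite(1)[OF fin ne, of "\<lambda>p. norm (p - rho)"] arg_min_least[OF fin ne, of _ "\<lambda>p. norm (p - rho)"] by blast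
  have mn: "norm (p - rho) \<le> norm (q - rho)" if "q \<in> A" for q using mn0[of q] that p by force
  obtain w q where wq: "w \<in> W" "q \<in> coroot_lattice R" "p = w (Phi x) + c *\<^sub>R q" using p by (auto simp: A_def)
  have pP: "p \<in> weights" using p AP by blast
  define z where "z = w x + q"
  have Pz: "Phi z = p" using wq by (simp add: z_def Phi_lattice Phi_W)
  have regz: "\<alpha> \<bullet> z \<notin> \<int>" if a: "\<alpha> \<in> R" for \<alpha>
  proof
    assume "\<alpha> \<bullet> z \<in> \<int>"
    moreover have "\<alpha> \<bullet> q \<in> \<int>" using root_lattice_int a wq by blast
    ultimately have "\<alpha> \<bullet> z - \<alpha> \<bullet> q \<in> \<int>" by (rule Ints_diff)
    then have "inv w \<alpha> \<bullet> x \<in> \<int>" by (simp add: z_def inner_add_right W_adj'[OF wq(1)])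
    then show False using reg W_mem[OF W_inv(1)[OF wq(1)] a] by blast
  qed
  have A_refl: "reflection \<alpha> p + c *\<^sub>R y \<in> A" if "\<alpha> \<in> R" "y \<in> coroot_lattice R" for \<alpha> y
  proof -
    note sW = weyl_reflection[OF that(1)]
    have "reflection \<alpha> p + c *\<^sub>R y = (reflection \<alpha> \<circ> w) (Phi x) + c *\<^sub>R (reflection \<alpha> q + y)"
      by (simp add: wq(3) W_simps[OF sW] scaleR_add_right)
    moreover have "reflection \<alpha> \<circ> w \<in> W" using weyl_comp[OF sW wq(1)] .
    moreover have "reflection \<alpha> q + y \<in> coroot_lattice R" using coroot_lattice_W[OF sW wq(2)] that(2) coroot_lattice_add by blast
    ultimately show ?thesis unfolding A_def by blast
  qed
  have pos: "0 < p \<bullet> a" if a: "a \<in> D" for a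
  proof -
    have aR: "a \<in> R" using a D_sub by blast
    have "reflection a p \<in> A" using A_refl[OF aR coroot_lattice_0] by simp
    then have "norm (p - rho) \<le> norm (reflection a p - rho)" by (rule mn)
    then have "(p - rho) \<bullet> (p - rho) \<le> (reflection a p - rho) \<bullet> (reflection a p - rho)" by (simp add: norm_le)
    moreover have "reflection a p \<bullet> rho = p \<bullet> rho - p \<bullet> a"
      using reflection_adjoint[OF nz[OF aR], of p rho] rho_refl[OF a] by (simp add: inner_diff_right)
    moreover have "reflection a p \<bullet> reflection a p = p \<bullet> p" by (rule reflection_inner[OF nz[OF aR]])
    ultimately have "0 \<le> p \<bullet> a" by (simp add: inner_simps inner_commute)
    \<comment> \<open>Minimality gives only the weak inequality. If \<open>p\<close> were on the
      wall, injectivity and equivariance of \<open>Phi\<close> would put \<open>z\<close> on it too,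
      against regularity.\<close>
    moreover have "p \<bullet> a \<noteq> 0"
    proof
      assume "p \<bullet> a = 0"
      then have "reflection a p = p" by (simp add: reflection_fixed_iff[OF nz[OF aR]] inner_commute)
      then have "Phi (reflection a z) = Phi z" using Phi_W[OF weyl_reflection[OF aR]] Pz by simp
      then have "reflection a z = z" by (simp add: Phi_inj)
      then have "a \<bullet> z = 0" by (simp add: reflection_fixed_iff[OF nz[OF aR]])
      then show False using regz[OF aR] by simp
    qed
    ultimately show ?thesis by simp
  qed
  define d where "d = p \<bullet> theta_root - c"
  have d: "d < 0"
  proof (rule ccontr)
    assume "\<not> d < 0"
    \<comment> \<open>The affine reflection in the wall where the pairing with
      \<open>theta_root\<close> equals \<open>c\<close>; it subtracts
      \<open>d *\<^sub>R theta_root\<close>.\<close>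
    let ?p = "reflection theta_root p + c *\<^sub>R theta_root"
    have pe: "?p = p - d *\<^sub>R theta_root"
      by (simp add: reflection_def coroot_theta d_def inner_commute algebra_simps)
    show False
    proof (cases "d = 0")
      case True
      have "Phi (reflection theta_root z + theta_root) = ?p"
        using Phi_W[OF weyl_reflection[OF theta_R]] Pz by (simp add: Phi_lattice[OF theta_lattice])
      also have "\<dots> = Phi z" using pe True Pz by simp
      finally have "reflection theta_root z + theta_root = z" by (simp add: Phi_inj)
      then have "(theta_root \<bullet> z) *\<^sub>R theta_root = 1 *\<^sub>R theta_root" by (simp add: reflection_def coroot_theta algebra_simps)
      then have "theta_root \<bullet> z = 1" using nz[OF theta_R] by (metis scaleR_cancel_right)
      then show False using regz[OF theta_R] by simp
    next
      case False
      then have dp: "0 < d" using \<open>\<not> d < 0\<close> by simp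
      have "norm (p - rho) \<le> norm (?p - rho)" by (rule mn[OF A_refl[OF theta_R theta_lattice]])
      then have "(p - rho) \<bullet> (p - rho) \<le> (p - d *\<^sub>R theta_root - rho) \<bullet> (p - d *\<^sub>R theta_root - rho)"
        unfolding pe by (simp only: norm_le)
      also have "\<dots> = (p - rho) \<bullet> (p - rho) - 2 * d * (p \<bullet> theta_root - rho \<bullet> theta_root - d)"
        by (simp add: inner_simps inner_commute theta_norm algebra_simps)
      \<comment> \<open>This is \<open>c - rho \<bullet> theta_root\<close> with
        \<open>rho \<bullet> theta_root = h - 1\<close>; its positivity shows that
        \<open>rho\<close> is on the inner side of the affine wall.\<close>
      also have "p \<bullet> theta_root - rho \<bullet> theta_root - d = real k + 1" by (simp add: d_def h_eq)
      finally have "d * (real k + 1) \<le> 0" by simp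
      then show False using dp by (simp add: mult_le_0_iff)
    qed
  qed
  \<comment> \<open>Strict inequalities between integers leave room for one unit, which the
    subtraction of \<open>rho\<close> uses up on each simple wall; on the affine wall the bound
    becomes \<open>k + 1\<close> strictly, hence \<open>k\<close>.\<close>
  define \<kappa> where "\<kappa> = p - rho"
  have kP: "\<kappa> \<in> weights" unfolding \<kappa>_def by (rule weights_diff[OF pP rho_weight])
  have "\<kappa> \<in> level_weights R D k"
  proof (rule level_weightsI[OF kP])
    fix a assume a: "a \<in> D"
    then have aa: "0 < a \<bullet> a" using D_sub norm_pos by blast
    have "p \<bullet> coroot a \<in> \<int>" using pP weights_iff_simple a by blast
    then obtain n where n: "p \<bullet> coroot a = of_int n" by (auto elim: Ints_cases)
    have "0 < p \<bullet> coroot a" using pos[OF a] aa by (simp add: coroot_inner)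
    then have "1 \<le> n" using n by simp
    then have "0 \<le> \<kappa> \<bullet> coroot a" using n rho_coroot[OF a] by (simp add: \<kappa>_def inner_diff_left)
    then show "0 \<le> \<kappa> \<bullet> a" using aa by (simp add: coroot_inner zero_le_divide_iff zero_le_mult_iff)
  next
    have "\<kappa> \<bullet> theta_root \<in> \<int>" using kP theta_lattice by (simp add: weights_def)
    then obtain n where n: "\<kappa> \<bullet> theta_root = of_int n" by (auto elim: Ints_cases)
    have "\<kappa> \<bullet> theta_root < real k + 1" using d by (simp add: \<kappa>_def d_def h_eq inner_diff_left)
    then have "real_of_int n < of_int (int k + 1)" using n by simp
    then have "n \<le> int k" by (simp only: of_int_less_iff)
    then have "real_of_int n \<le> of_int (int k)" by (simp only: of_int_le_iff)
    then show "\<kappa> \<bullet> theta_root \<le> real k" using n by simp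
  qed
  moreover have "coset (Psi (\<kappa> + rho)) = w ` f"
  proof -
    have "Psi (\<kappa> + rho) = z" using Pz Psi_Phi[of z] by (simp add: \<kappa>_def)
    moreover have "coset z = coset (w x)" using wq(2) by (simp add: z_def coset_eq_iff)
    ultimately show ?thesis using x(1) W_coset[OF wq(1)] by simp
  qed
  ultimately show ?thesis using orbit_W[OF wq(1)] by metis
qed

lemma card_Orb_le: "card Orb \<le> card (level_weights R D k)"
proof -
  have "Orb \<subseteq> (\<lambda>\<kappa>. orbit (coset (Psi (\<kappa> + rho)))) ` level_weights R D k"
    using orbit_level_weight by (auto simp: weyl_orbits_eq)
  then show ?thesis using surj_card_le[OF finite_level_weights] by blast
qed

end

section \<open>Completeness and gluing\<close>

text \<open>The Gram matrix of the columns is a projection whose trace is the number of rows.\<close>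

lemma orthogonal_rows_imp_columns:
  fixes B :: "'l \<Rightarrow> 'o \<Rightarrow> complex" and \<theta> :: "'o \<Rightarrow> real" and n :: "'l \<Rightarrow> real"
  assumes fin: "finite \<Lambda>" "finite \<O>" and card: "card \<O> \<le> card \<Lambda>"
    and \<theta>: "\<And>x. x \<in> \<O> \<Longrightarrow> 0 < \<theta> x" and n: "\<And>\<kappa>. \<kappa> \<in> \<Lambda> \<Longrightarrow> 0 < n \<kappa>"
    and orth: "\<And>\<kappa> \<mu>. \<kappa> \<in> \<Lambda> \<Longrightarrow> \<mu> \<in> \<Lambda> \<Longrightarrow>
       (\<Sum>x\<in>\<O>. \<theta> x * B \<kappa> x * cnj (B \<mu> x)) = (if \<kappa> = \<mu> then complex_of_real (n \<kappa>) else 0)"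
    and x: "x \<in> \<O>" and y: "y \<in> \<O>"
  shows "(\<Sum>\<kappa>\<in>\<Lambda>. B \<kappa> x * cnj (B \<kappa> y) / n \<kappa>) = (if x = y then 1 / \<theta> x else 0)"
proof -
  define Q where "Q x y = (\<Sum>\<kappa>\<in>\<Lambda>. B \<kappa> x * cnj (B \<kappa> y) / n \<kappa>)" for x y
  have cnjQ: "cnj (Q x y) = Q y x" for x y by (simp add: Q_def mult.commute)
  have QQ: "(\<Sum>y\<in>\<O>. \<theta> y * (Q x y * Q y z)) = Q x z" for x z
  proof -
    have "(\<Sum>y\<in>\<O>. \<theta> y * (Q x y * Q y z))
      = (\<Sum>y\<in>\<O>. \<Sum>\<kappa>\<in>\<Lambda>. \<Sum>\<mu>\<in>\<Lambda>. (B \<kappa> x / n \<kappa>) * (cnj (B \<mu> z) / n \<mu>) * (\<theta> y * B \<mu> y * cnj (B \<kappa> y)))"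
      unfolding Q_def sum_product unfolding sum_distrib_left by (intro sum.cong refl) (simp add: mult_ac)
    also have "\<dots> = (\<Sum>\<kappa>\<in>\<Lambda>. \<Sum>y\<in>\<O>. \<Sum>\<mu>\<in>\<Lambda>. (B \<kappa> x / n \<kappa>) * (cnj (B \<mu> z) / n \<mu>) * (\<theta> y * B \<mu> y * cnj (B \<kappa> y)))"
      by (rule sum.swap)
    also have "\<dots> = (\<Sum>\<kappa>\<in>\<Lambda>. \<Sum>\<mu>\<in>\<Lambda>. \<Sum>y\<in>\<O>. (B \<kappa> x / n \<kappa>) * (cnj (B \<mu> z) / n \<mu>) * (\<theta> y * B \<mu> y * cnj (B \<kappa> y)))"
      by (intro sum.cong refl sum.swap)
    also have "\<dots> = (\<Sum>\<kappa>\<in>\<Lambda>. \<Sum>\<mu>\<in>\<Lambda>. (B \<kappa> x / n \<kappa>) * (cnj (B \<mu> z) / n \<mu>) * (if \<mu> = \<kappa> then complex_of_real (n \<mu>) else 0))"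
      by (intro sum.cong refl) (simp only: sum_distrib_left[symmetric] orth)
    also have "\<dots> = (\<Sum>\<kappa>\<in>\<Lambda>. (B \<kappa> x / n \<kappa>) * (cnj (B \<kappa> z) / n \<kappa>) * complex_of_real (n \<kappa>))"
      using fin by (intro sum.cong refl) (simp add: if_distrib cong: if_cong)
    also have "\<dots> = Q x z"
      unfolding Q_def using n by (intro sum.cong refl) (simp add: less_imp_neq[symmetric])
    finally show ?thesis .
  qed
  have Qr: "Q x x = complex_of_real (Re (Q x x))" for x using cnjQ[of x x] by (simp add: complex_eq_iff)
  have sq: "Re (Q x x) = (\<Sum>y\<in>\<O>. \<theta> y * (norm (Q x y))\<^sup>2)" for x
  proof -
    have "Q x x = (\<Sum>y\<in>\<O>. complex_of_real (\<theta> y * (norm (Q x y))\<^sup>2))"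
      unfolding of_real_mult complex_norm_square cnjQ using QQ[of x x] by simp
    from arg_cong[OF this, of Re] show ?thesis by simp
  qed
  \<comment> \<open>A diagonal entry of a projection is at least its own square, hence at most
    \<open>1\<close>; the weights \<open>\<theta>\<close> rescale the entries.\<close>
  have le1: "\<theta> x * Re (Q x x) \<le> 1" if x: "x \<in> \<O>" for x
  proof -
    have "\<theta> x * (Re (Q x x))\<^sup>2 \<le> \<theta> x * (norm (Q x x))\<^sup>2"
      using \<theta>[OF x] by (metis Qr mult_left_mono norm_of_real order_less_imp_le order_refl power2_abs)
    also have "\<dots> \<le> (\<Sum>y\<in>\<O>. \<theta> y * (norm (Q x y))\<^sup>2)"
      using x fin \<theta> by (intro member_le_sum) (auto simp: less_imp_le)
    finally have "\<theta> x * (Re (Q x x))\<^sup>2 \<le> Re (Q x x)" by (simp add: sq)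
    moreover have "0 \<le> Re (Q x x)" unfolding sq using \<theta> by (intro sum_nonneg) (simp add: less_imp_le)
    ultimately show ?thesis
      by (cases "Re (Q x x) = 0") (auto simp: power2_eq_square mult.assoc[symmetric])
  qed
  have tr: "(\<Sum>x\<in>\<O>. \<theta> x * Re (Q x x)) = real (card \<Lambda>)"
  proof -
    have "(\<Sum>x\<in>\<O>. \<theta> x * Q x x) = (\<Sum>x\<in>\<O>. \<Sum>\<kappa>\<in>\<Lambda>. (\<theta> x * B \<kappa> x * cnj (B \<kappa> x)) / n \<kappa>)"
      unfolding Q_def sum_distrib_left by (simp add: mult.assoc)
    also have "\<dots> = (\<Sum>\<kappa>\<in>\<Lambda>. \<Sum>x\<in>\<O>. (\<theta> x * B \<kappa> x * cnj (B \<kappa> x)) / n \<kappa>)" by (rule sum.swap)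
    also have "\<dots> = (\<Sum>\<kappa>\<in>\<Lambda>. 1)"
      using n by (intro sum.cong refl) (simp add: sum_divide_distrib[symmetric] orth less_imp_neq[symmetric])
    finally have "(\<Sum>x\<in>\<O>. \<theta> x * Q x x) = of_nat (card \<Lambda>)" by simp
    from arg_cong[OF this, of Re] show ?thesis by simp
  qed
  \<comment> \<open>At most \<open>card \<Lambda>\<close> diagonal entries, none above
    \<open>1\<close>, have the sum \<open>card \<Lambda>\<close>, so each equals
    \<open>1\<close>.\<close>
  have eq1: "\<theta> x * Re (Q x x) = 1" if x: "x \<in> \<O>" for x
  proof -
    have "(\<Sum>x\<in>\<O>. 1 - \<theta> x * Re (Q x x)) = real (card \<O>) - real (card \<Lambda>)" by (simp add: sum_subtractf tr)
    then have "(\<Sum>x\<in>\<O>. 1 - \<theta> x * Re (Q x x)) \<le> 0" using card by simp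
    moreover have nn: "0 \<le> 1 - \<theta> x * Re (Q x x)" if "x \<in> \<O>" for x using le1[OF that] by simp
    ultimately have "(\<Sum>x\<in>\<O>. 1 - \<theta> x * Re (Q x x)) = 0" by (meson order_antisym sum_nonneg)
    then show ?thesis using nn sum_nonneg_eq_0_iff[OF fin(2), of "\<lambda>x. 1 - \<theta> x * Re (Q x x)"] x by fastforce
  qed
  have "Q x y = (if x = y then 1 / \<theta> x else 0)"
  proof (cases "x = y")
    case True
    have "Re (Q x x) = 1 / \<theta> x" using eq1[OF x] \<theta>[OF x] by (simp add: field_simps)
    then show ?thesis using True Qr[of x] by simp
  next
    case False
    \<comment> \<open>The weighted square sum of the row of \<open>x\<close> is exhausted by its
      diagonal entry, so the other entries vanish.\<close>
    have "\<theta> x * (\<Sum>y\<in>\<O>. \<theta> y * (norm (Q x y))\<^sup>2) = 1" using eq1[OF x] by (simp add: sq)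
    moreover have "(\<Sum>y\<in>\<O>. \<theta> y * (norm (Q x y))\<^sup>2) = \<theta> x * (norm (Q x x))\<^sup>2 + (\<Sum>y\<in>\<O> - {x}. \<theta> y * (norm (Q x y))\<^sup>2)"
      using x fin by (simp add: sum.remove)
    moreover have "\<theta> x * (\<theta> x * (norm (Q x x))\<^sup>2) = 1"
    proof -
      have "norm (Q x x) = \<bar>Re (Q x x)\<bar>" by (metis Qr norm_of_real)
      then have "\<theta> x * (\<theta> x * (norm (Q x x))\<^sup>2) = (\<theta> x * Re (Q x x))\<^sup>2" by (simp add: power2_eq_square mult_ac)
      then show ?thesis using eq1[OF x] by simp
    qed
    ultimately have "\<theta> x * (\<Sum>y\<in>\<O> - {x}. \<theta> y * (norm (Q x y))\<^sup>2) = 0" by (simp add: distrib_left)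
    then have "(\<Sum>y\<in>\<O> - {x}. \<theta> y * (norm (Q x y))\<^sup>2) = 0" using \<theta>[OF x] by simp
    then have "\<theta> y * (norm (Q x y))\<^sup>2 = 0"
      using y False fin \<theta> sum_nonneg_eq_0_iff[of "\<O> - {x}" "\<lambda>y. \<theta> y * (norm (Q x y))\<^sup>2"]
      by (simp add: less_imp_le)
    then show ?thesis using \<theta>[OF y] False by simp
  qed
  then show ?thesis by (simp add: Q_def)
qed

text \<open>Artin's argument: translating the relation by \<open>g\<close> and subtracting
  \<open>\<phi> j g\<close> times the original one kills the term of \<open>j\<close>, and
  \<open>g\<close> is chosen so that the term of \<open>i\<close> survives.\<close>

lemma characters_independent:
  fixes \<phi> :: "'i \<Rightarrow> 'a::ab_group_add \<Rightarrow> complex"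
  assumes "finite I" and G: "\<And>x y. x \<in> G \<Longrightarrow> y \<in> G \<Longrightarrow> x + y \<in> G" "0 \<in> G"
    and mult: "\<And>i x y. i \<in> I \<Longrightarrow> \<phi> i (x + y) = \<phi> i x * \<phi> i y" and one: "\<And>i. i \<in> I \<Longrightarrow> \<phi> i 0 = 1"
    and dist: "\<And>i j. i \<in> I \<Longrightarrow> j \<in> I \<Longrightarrow> i \<noteq> j \<Longrightarrow> \<exists>x\<in>G. \<phi> i x \<noteq> \<phi> j x"
    and zero: "\<And>x. x \<in> G \<Longrightarrow> (\<Sum>i\<in>I. a i * \<phi> i x) = 0" and i: "i \<in> I"
  shows "a i = 0"
  using assms(1) mult one dist zero i
proof (induction I arbitrary: a i rule: finite_induct)
  case (insert j I)
  have step: "a i = 0" if i: "i \<in> I" for i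
  proof -
    have "i \<noteq> j" using i insert by blast
    then obtain g where g: "g \<in> G" "\<phi> i g \<noteq> \<phi> j g" using insert.prems(3)[of i j] i by blast
    have "(\<Sum>i\<in>I. (a i * (\<phi> i g - \<phi> j g)) * \<phi> i x) = 0" if x: "x \<in> G" for x
    proof -
      have "(\<Sum>i\<in>insert j I. a i * \<phi> i (x + g)) = 0" using insert.prems(4) G g x by blast
      moreover have "\<phi> j g * (\<Sum>i\<in>insert j I. a i * \<phi> i x) = 0" using insert.prems(4) x by simp
      ultimately have "(\<Sum>i\<in>insert j I. a i * \<phi> i (x + g)) - \<phi> j g * (\<Sum>i\<in>insert j I. a i * \<phi> i x) = 0" by simp
      moreover have "(\<Sum>i\<in>insert j I. a i * \<phi> i (x + g)) - \<phi> j g * (\<Sum>i\<in>insert j I. a i * \<phi> i x)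
         = (\<Sum>i\<in>insert j I. (a i * (\<phi> i g - \<phi> j g)) * \<phi> i x)"
        unfolding sum_distrib_left sum_subtractf[symmetric]
        by (rule sum.cong[OF refl]) (simp add: insert.prems(1) algebra_simps)
      ultimately show ?thesis using insert.hyps by simp
    qed
    then have "a i * (\<phi> i g - \<phi> j g) = 0"
      using insert.IH[of "\<lambda>i. a i * (\<phi> i g - \<phi> j g)" i] insert.prems i by blast
    then show ?thesis using g by simp
  qed
  have "(\<Sum>i\<in>insert j I. a i * \<phi> i 0) = 0" using insert.prems(4) G by blast
  then have "a j = 0" using step insert.hyps insert.prems(2) by simp
  then show ?case using step insert.prems(5) by blast
qed simp

section \<open>Nonvanishing of the norms for small \<open>t\<close>\<close>

context normalized_root_system
begin

text \<open>The coefficient of \<open>coroot a\<close> in \<open>v\<close> is the pairing of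
  \<open>v\<close> with the fundamental weight of \<open>a\<close>, obtained here as
  \<open>\<omega>\<close> through the adjoint of a linear functional.\<close>

lemma lattice_double_dual:
  assumes v: "\<And>x. x \<in> weights \<Longrightarrow> v \<bullet> x \<in> \<int>" shows "v \<in> coroot_lattice R"
proof -
  have "v \<in> span D" by (simp add: span_D)
  then obtain s where s: "v = (\<Sum>b\<in>D. s b *\<^sub>R b)"
    unfolding span_finite[OF finite_D] by blast
  have "\<exists>n. (s a * (a \<bullet> a) / 2) = of_int n" if a: "a \<in> D" for a
  proof -
    obtain g :: "real^'n \<Rightarrow> real" where g: "linear g" "\<forall>b\<in>D. g b = (if b = a then (a \<bullet> a) / 2 else 0)"
      using linear_independent_extend[OF indep_D, of "\<lambda>b. if b = a then (a \<bullet> a) / 2 else 0"] by blast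
    define \<omega> where "\<omega> = adjoint g 1"
    have w: "x \<bullet> \<omega> = g x" for x using adjoint_works[OF g(1), of x 1] by (simp add: \<omega>_def)
    have "\<omega> \<bullet> coroot b \<in> \<int>" if b: "b \<in> D" for b
    proof -
      have "b \<bullet> b \<noteq> 0" using b D_sub nz by auto
      then have "\<omega> \<bullet> coroot b = (if b = a then 1 else 0)"
        using g(2) b w[of b] by (simp add: coroot_inner inner_commute)
      then show ?thesis by simp
    qed
    then have "v \<bullet> \<omega> \<in> \<int>" using v weights_iff_simple by blast
    moreover have "v \<bullet> \<omega> = s a * (a \<bullet> a) / 2"
    proof -
      have "v \<bullet> \<omega> = (\<Sum>b\<in>D. s b * g b)" unfolding w s by (simp add: linear_sum[OF g(1)] linear_scale[OF g(1)])
      also have "\<dots> = (\<Sum>b\<in>D. if b = a then s a * (a \<bullet> a) / 2 else 0)"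
        by (rule sum.cong[OF refl]) (simp add: g(2))
      finally show ?thesis using a finite_D by simp
    qed
    ultimately show ?thesis by (auto elim: Ints_cases)
  qed
  then obtain n where n: "\<And>a. a \<in> D \<Longrightarrow> s a * (a \<bullet> a) / 2 = of_int (n a)" by metis
  have "v = (\<Sum>a\<in>D. of_int (n a) *\<^sub>R coroot a)"
    unfolding s
  proof (rule sum.cong[OF refl])
    fix a assume a: "a \<in> D"
    then have "a \<bullet> a \<noteq> 0" using D_sub nz by auto
    then show "s a *\<^sub>R a = of_int (n a) *\<^sub>R coroot a" unfolding n[OF a, symmetric] by (simp add: coroot_def)
  qed
  then show ?thesis
    using D_sub by (auto intro!: coroot_lattice_sum coroot_lattice_scale coroot_lattice_coroot)
qed

text \<open>For \<open>t = 0\<close> the Bethe solutions are the weights divided by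
  \<open>k + h\<close>. Since \<open>\<kappa> + rho\<close> lies strictly inside the alcove,
  \<open>regular_iff\<close> shows that its Weyl images, divided by \<open>k + h\<close>, are
  distinct modulo the coroot lattice; they then give distinct characters of the weight lattice, and
  an alternating sum of distinct characters cannot vanish identically.\<close>

lemma undeformed_nonvanishing:
  assumes \<kappa>: "\<kappa> \<in> level_weights R D k"
  shows "\<exists>p\<in>weights. (\<Sum>w\<in>W. weyl_sign w * character (w (\<kappa> + rho)) ((1 / (real k + h)) *\<^sub>R p)) \<noteq> 0"
proof (rule ccontr)
  interpret B: bethe R D k 0 by unfold_locales (use h_pos[of k] in auto)
  define c where "c = real k + h"
  have c: "0 < c" using h_pos by (simp add: c_def)
  define p where "p = \<kappa> + rho"
  assume "\<not> ?thesis"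
  then have z: "(\<Sum>w\<in>W. weyl_sign w * character (w p) ((1 / c) *\<^sub>R x)) = 0" if "x \<in> weights" for x
    using that by (auto simp: p_def c_def)
  have reg: "\<alpha> \<bullet> ((1 / c) *\<^sub>R p) \<notin> \<int>" if a: "\<alpha> \<in> R" for \<alpha>
  proof -
    have bd: "0 < \<beta> \<bullet> p \<and> \<beta> \<bullet> p < c" if b: "\<beta> \<in> Pos" for \<beta>
    proof -
      have bR: "\<beta> \<in> R" using b Pos_sub by blast
      have "rho \<bullet> \<beta> \<le> rho \<bullet> theta_root" using dominant_le_theta[OF _ bR, of rho] rho_simple by (simp add: less_imp_le)
      then show ?thesis
        using level_weightsD(3)[OF \<kappa> bR] level_weightsD(4)[OF \<kappa> b] rho_Pos[OF b]
        by (simp add: p_def c_def h_eq inner_add_right inner_commute)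
    qed
    have "0 < \<bar>\<alpha> \<bullet> p\<bar> \<and> \<bar>\<alpha> \<bullet> p\<bar> < c" using Pos_cases[OF a] bd[of \<alpha>] bd[of "- \<alpha>"] by auto
    then have b: "0 < \<bar>\<alpha> \<bullet> ((1 / c) *\<^sub>R p)\<bar>" "\<bar>\<alpha> \<bullet> ((1 / c) *\<^sub>R p)\<bar> < 1" using c by (simp_all add: abs_mult)
    show ?thesis
    proof
      assume "\<alpha> \<bullet> ((1 / c) *\<^sub>R p) \<in> \<int>"
      then obtain m where m: "\<alpha> \<bullet> ((1 / c) *\<^sub>R p) = of_int m" by (auto elim: Ints_cases)
      have "0 < \<bar>m\<bar>" "\<bar>m\<bar> < 1" using b unfolding m by linarith+
      then show False by linarith
    qed
  qed
  have dist: "\<exists>x\<in>weights. character (w p) ((1 / c) *\<^sub>R x) \<noteq> character (w' p) ((1 / c) *\<^sub>R x)"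
    if w: "w \<in> W" and w': "w' \<in> W" and ne: "w \<noteq> w'" for w w'
  proof (rule ccontr)
    assume a: "\<not> ?thesis"
    have "((1 / c) *\<^sub>R (w p - w' p)) \<bullet> x \<in> \<int>" if x: "x \<in> weights" for x
    proof -
      have "character (w p) ((1 / c) *\<^sub>R x) = character (w' p) ((1 / c) *\<^sub>R x)" using a x by blast
      then have "character (w p + - w' p) ((1 / c) *\<^sub>R x) = character (w' p + - w' p) ((1 / c) *\<^sub>R x)" by (simp only: character_add)
      then have "(w p - w' p) \<bullet> ((1 / c) *\<^sub>R x) \<in> \<int>" by (simp add: character_eq_1_iff)
      then show ?thesis by simp
    qed
    then have "(1 / c) *\<^sub>R (w p - w' p) \<in> coroot_lattice R" by (rule lattice_double_dual)
    then have "inv w' ((1 / c) *\<^sub>R (w p - w' p)) \<in> coroot_lattice R" by (rule coroot_lattice_W[OF W_inv(1)[OF w']])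
    moreover have "inv w' ((1 / c) *\<^sub>R (w p - w' p)) = (inv w' \<circ> w) ((1 / c) *\<^sub>R p) - (1 / c) *\<^sub>R p"
      by (simp add: W_simps[OF W_inv(1)[OF w']] W_simps[OF w] W_inv[OF w'] scaleR_diff_right)
    ultimately have "(inv w' \<circ> w) ((1 / c) *\<^sub>R p) - (1 / c) *\<^sub>R p \<in> coroot_lattice R" by simp
    then have "inv w' \<circ> w = id" using B.regular_iff reg weyl_comp[OF W_inv(1)[OF w'] w] by blast
    then have "inv w' (w y) = y" for y by (metis comp_apply id_apply)
    then have "w' (inv w' (w y)) = w' y" for y by simp
    then show False using ne by (auto simp: W_inv[OF w'])
  qed
  have "complex_of_real (weyl_sign id) = 0"
    by (rule characters_independent[of W weights "\<lambda>w x. character (w p) ((1 / c) *\<^sub>R x)" "\<lambda>w. complex_of_real (weyl_sign w)" id])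
       (use finite_W weights_add weights_0 dist z weyl_group.id[of R] in
         \<open>auto simp: scaleR_add_right character_add_arg character_def[of _ 0]\<close>)
  then show False by (simp add: weyl_sign_id)
qed

text \<open>At the undeformed solution \<open>?x0\<close> the deformed map misses \<open>p\<close>
  by \<open>E t\<close>, so \<open>Phi_expand\<close> keeps the deformed solution within
  \<open>(2 / c) * norm (E t)\<close> of it. As \<open>E t\<close> tends to \<open>0\<close>,
  continuity of the numerator in \<open>t\<close> and \<open>x\<close> preserves the nonzero
  value.\<close>

lemma deformed_nonvanishing:
  assumes \<kappa>: "\<kappa> \<in> level_weights R D k"
  shows "\<forall>\<^sub>F t in nhds (0::real). bethe R D k t \<longrightarrow>
    (\<exists>x. bethe.Phi R D k t x \<in> weights \<and> bethe.numerator R D t \<kappa> x \<noteq> 0)"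
proof -
  define c where "c = real k + h"
  have c: "0 < c" using h_pos by (simp add: c_def)
  obtain p where p: "p \<in> weights" and p0: "(\<Sum>w\<in>W. weyl_sign w * character (w (\<kappa> + rho)) ((1 / c) *\<^sub>R p)) \<noteq> 0"
    using undeformed_nonvanishing[OF \<kappa>] by (auto simp: c_def)
  let ?x0 = "(1 / c) *\<^sub>R p"
  define E where "E t = (\<Sum>\<alpha>\<in>R. (angle t (2 * pi * (\<alpha> \<bullet> ?x0)) / (2 * pi)) *\<^sub>R \<alpha>)" for t
  \<comment> \<open>The default \<open>?x0\<close> makes \<open>X\<close> total, so that the
    estimate and the limit at \<open>0\<close> can be stated for all \<open>t\<close>.\<close>
  define X where "X t = (if bethe R D k t then bethe.Psi R D k t p else ?x0)" for t
  have bd: "norm (X t - ?x0) \<le> (2 / c) * norm (E t)" for t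
  proof (cases "bethe R D k t")
    case True
    then interpret B: bethe R D k t .
    have "B.Phi ?x0 = p + E t" using c by (simp add: B.Phi_def B.perturb_def E_def c_def)
    then have "(c / 2) * norm (X t - ?x0) \<le> norm (E t)"
      using B.Phi_expand[of "B.Psi p" ?x0] True by (simp add: X_def B.Phi_Psi c_def norm_minus_commute)
    then show ?thesis using c by (simp add: field_simps)
  next
    case False then show ?thesis using c by (simp add: X_def)
  qed
  have "((\<lambda>t. angle t s) \<longlongrightarrow> 0) (nhds 0)" for s
  proof -
    have "((\<lambda>t. arctan (t * sin s / (1 - t * cos s))) \<longlongrightarrow> arctan (0 * sin s / (1 - 0 * cos s))) (nhds 0)"
      by (intro tendsto_intros) (auto intro: filterlim_ident)
    then show ?thesis by (simp add: angle_def)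
  qed
  then have "(E \<longlongrightarrow> (\<Sum>\<alpha>\<in>R. (0 / (2 * pi)) *\<^sub>R \<alpha>)) (nhds 0)"
    unfolding E_def by (intro tendsto_intros) auto
  then have "((\<lambda>t. (2 / c) * norm (E t)) \<longlongrightarrow> (2 / c) * norm (0 :: real^'n)) (nhds 0)"
    by (intro tendsto_intros) simp
  then have "((\<lambda>t. X t - ?x0) \<longlongrightarrow> 0) (nhds 0)"
    by (intro Lim_null_comparison[of "\<lambda>t. X t - ?x0" "\<lambda>t. (2 / c) * norm (E t)"] always_eventually allI bd) simp
  then have X: "(X \<longlongrightarrow> ?x0) (nhds 0)" by (simp add: LIM_zero_iff)
  define N where "N t x = (\<Sum>w\<in>W. weyl_sign w * (character (w (\<kappa> + rho)) x * (\<Prod>\<alpha>\<in>Pos. 1 - complex_of_real t * character (- w \<alpha>) x)))" for t x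
  have ch: "((\<lambda>t. character \<nu> (X t)) \<longlongrightarrow> character \<nu> ?x0) (nhds 0)" for \<nu>
    unfolding character_def by (intro tendsto_intros X)
  have "((\<lambda>t. N t (X t)) \<longlongrightarrow> N 0 ?x0) (nhds 0)"
    unfolding N_def by (intro tendsto_intros ch) (auto intro: filterlim_ident)
  moreover have "N 0 ?x0 \<noteq> 0" using p0 by (simp add: N_def)
  ultimately have "\<forall>\<^sub>F t in nhds 0. N t (X t) \<noteq> 0" by (rule tendsto_imp_eventually_ne)
  then show ?thesis
  proof eventually_elim
    case (elim t)
    show ?case
    proof
      assume b: "bethe R D k t"
      then interpret B: bethe R D k t .
      have "B.numerator \<kappa> (X t) \<noteq> 0" using elim by (simp add: B.numerator_def N_def)
      moreover have "B.Phi (X t) \<in> weights" using b p by (simp add: X_def B.Phi_Psi)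
      ultimately show "\<exists>x. B.Phi x \<in> weights \<and> B.numerator \<kappa> x \<noteq> 0" by blast
    qed
  qed
qed

lemma eventually_bethe: "\<forall>\<^sub>F t in nhds (0::real). bethe R D k t"
proof -
  have "((\<lambda>t. \<bar>t\<bar>) \<longlongrightarrow> \<bar>0\<bar>) (nhds (0::real))" by (intro tendsto_intros) (auto intro: filterlim_ident)
  then have "\<forall>\<^sub>F t in nhds (0::real). \<bar>t\<bar> < 1/2" by (intro order_tendstoD) auto
  moreover have "((\<lambda>t. 8 * real (card R) * \<bar>t\<bar>) \<longlongrightarrow> 8 * real (card R) * \<bar>0\<bar>) (nhds (0::real))"
    by (intro tendsto_intros) (auto intro: filterlim_ident)
  then have "\<forall>\<^sub>F t in nhds (0::real). 8 * real (card R) * \<bar>t\<bar> < real k + h" using h_pos by (intro order_tendstoD) auto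
  ultimately show ?thesis by eventually_elim (unfold_locales, auto)
qed

end

context bethe
begin

lemma verlinde_eq:
  "verlinde R D k g \<mu>s t =
    (\<Sum>orb\<in>Orb. complex_of_real (theta_real (torus_log (rep orb))) powi (1 - int g) * prod_list (map (\<lambda>\<mu>. Theta R D \<mu> t (rep orb)) \<mu>s))"
  unfolding verlinde_def Let_def theta_eq
  by (simp add: prod.list_conv_set_nth atLeast0LessThan)

theorem verlinde_gluing:
  assumes nonvanishing: "\<And>\<kappa>. \<kappa> \<in> level_weights R D k \<Longrightarrow> \<exists>x. Phi x \<in> weights \<and> numerator \<kappa> x \<noteq> 0"
  shows "verlinde R D k (g + 1) \<mu>s t =
        (\<Sum>\<mu>\<in>level_weights R D k. verlinde R D k g (\<mu>s @ [\<mu>, dual_weight R D \<mu>]) t * verlinde_norm R D k \<mu> t)"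
    and "verlinde R D k (g1 + g2) (\<mu>s1 @ \<mu>s2) t =
        (\<Sum>\<mu>\<in>level_weights R D k. verlinde R D k g1 (\<mu>s1 @ [\<mu>]) t *
           verlinde R D k g2 (\<mu>s2 @ [dual_weight R D \<mu>]) t * verlinde_norm R D k \<mu> t)"
proof -
  let ?\<Lambda> = "level_weights R D k"
  define th where "th orb = theta_real (torus_log (rep orb))" for orb
  define B where "B \<mu> orb = Theta R D \<mu> t (rep orb)" for \<mu> orb
  define n where "n \<mu> = (\<Sum>orb\<in>Orb. th orb * (norm (B \<mu> orb))\<^sup>2)" for \<mu>
  have dual: "B (dual_weight R D \<mu>) orb = cnj (B \<mu> orb)" for \<mu> orb
    by (simp add: B_def Theta_eq theta_char_dual)
  have th: "0 < th orb" if "orb \<in> Orb" for orb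
    unfolding th_def using F_rho_reg_regular[OF rep_F(1)[OF that]] by (intro theta_real_pos)
  \<comment> \<open>The point given by \<open>nonvanishing\<close> is regular, since numerators
    vanish at singular ones; so one orbit contributes a positive term.\<close>
  have npos: "0 < n \<kappa>" if \<kappa>: "\<kappa> \<in> ?\<Lambda>" for \<kappa>
  proof -
    obtain x where x: "Phi x \<in> weights" "numerator \<kappa> x \<noteq> 0" using nonvanishing[OF \<kappa>] by blast
    have reg: "\<alpha> \<bullet> x \<notin> \<int>" if "\<alpha> \<in> R" for \<alpha> using numerator_singular[OF level_weightsD(1)[OF \<kappa>] that] x by blast
    define f where "f = coset x"
    have f: "f \<in> F_rho_reg R D k t" unfolding f_def F_rho_reg_iff using x reg by blast
    then have ob: "orbit f \<in> Orb" by (simp add: weyl_orbits_eq)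
    obtain q where q: "q \<in> coroot_lattice R" "torus_log f = x + q" unfolding f_def by (rule torus_log_cases)
    obtain w where w: "w \<in> W" "rep (orbit f) = w ` f" using rep_F(2)[OF ob] unfolding orbit_def by blast
    have "B \<kappa> (orbit f) = Theta R D \<kappa> t f"
      unfolding B_def w(2) by (rule Theta_orbit[OF level_weightsD(1)[OF \<kappa>] F_rho_reg_torus[OF f] w(1)])
    also have "\<dots> = theta_char \<kappa> x" by (simp add: Theta_eq q theta_char_lattice[OF level_weightsD(1)[OF \<kappa>]])
    also have "\<dots> = numerator \<kappa> x / (weyl_denominator x * root_prod x)" by (rule theta_char_numerator) (rule reg)
    finally have "B \<kappa> (orbit f) \<noteq> 0" using x weyl_denominator_nonzero[OF reg] root_prod_nonzero by simp
    then have "0 < th (orbit f) * (norm (B \<kappa> (orbit f)))\<^sup>2" using th[OF ob] by simp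
    then show ?thesis unfolding n_def
      using th finite_Orb ob by (intro sum_pos2[of _ "orbit f"]) (auto simp: less_imp_le)
  qed
  have self: "(\<Sum>orb\<in>Orb. th orb * B \<kappa> orb * cnj (B \<kappa> orb)) = complex_of_real (n \<kappa>)" for \<kappa>
    unfolding n_def of_real_sum of_real_mult complex_norm_square by (simp only: mult.assoc)
  have orth: "(\<Sum>orb\<in>Orb. th orb * B \<kappa> orb * cnj (B \<mu> orb)) = (if \<kappa> = \<mu> then complex_of_real (n \<kappa>) else 0)"
    if "\<kappa> \<in> ?\<Lambda>" "\<mu> \<in> ?\<Lambda>" for \<kappa> \<mu>
  proof (cases "\<kappa> = \<mu>")
    case True then show ?thesis using self by simp
  next
    case False then show ?thesis using orbit_orthogonal[OF that False] by (simp add: th_def B_def)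
  qed
  have complete: "(\<Sum>\<kappa>\<in>?\<Lambda>. B \<kappa> x * cnj (B \<kappa> y) / n \<kappa>) = (if x = y then 1 / th x else 0)"
    if "x \<in> Orb" "y \<in> Orb" for x y
    by (rule orthogonal_rows_imp_columns[OF finite_level_weights finite_Orb card_Orb_le th npos orth that])
  have v: "verlinde R D k g \<mu>s t = (\<Sum>orb\<in>Orb. complex_of_real (th orb) powi (1 - int g) * prod_list (map (\<lambda>\<mu>. B \<mu> orb) \<mu>s))" for g \<mu>s
    unfolding verlinde_eq th_def B_def ..
  \<comment> \<open>In genus \<open>0\<close> with the insertions \<open>\<mu>\<close> and its dual,
    the sum is exactly the squared norm \<open>n \<mu>\<close>.\<close>
  have nrm: "verlinde_norm R D k \<mu> t = 1 / n \<mu>" for \<mu>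
    using self[of \<mu>] unfolding verlinde_norm_def v by (simp add: dual mult.assoc inverse_eq_divide)
  have pw: "complex_of_real (th ob) powi m / th ob = complex_of_real (th ob) powi (m - 1)" if "ob \<in> Orb" for ob m
    using th[OF that] by (simp add: power_int_diff)
  show "verlinde R D k (g + 1) \<mu>s t =
        (\<Sum>\<mu>\<in>?\<Lambda>. verlinde R D k g (\<mu>s @ [\<mu>, dual_weight R D \<mu>]) t * verlinde_norm R D k \<mu> t)"
  proof -
    let ?P = "\<lambda>ob. prod_list (map (\<lambda>\<mu>. B \<mu> ob) \<mu>s)"
    have "(\<Sum>\<mu>\<in>?\<Lambda>. verlinde R D k g (\<mu>s @ [\<mu>, dual_weight R D \<mu>]) t * verlinde_norm R D k \<mu> t)
      = (\<Sum>\<mu>\<in>?\<Lambda>. \<Sum>ob\<in>Orb. complex_of_real (th ob) powi (1 - int g) * ?P ob * (B \<mu> ob * cnj (B \<mu> ob) / n \<mu>))"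
      unfolding v nrm sum_distrib_right by (intro sum.cong refl) (simp add: dual mult_ac)
    also have "\<dots> = (\<Sum>ob\<in>Orb. \<Sum>\<mu>\<in>?\<Lambda>. complex_of_real (th ob) powi (1 - int g) * ?P ob * (B \<mu> ob * cnj (B \<mu> ob) / n \<mu>))"
      by (rule sum.swap)
    \<comment> \<open>A dual pair of insertions at the same orbit sums to \<open>1 / th ob\<close>,
      which lowers the exponent \<open>1 - g\<close> by one and so raises the genus.\<close>
    also have "\<dots> = (\<Sum>ob\<in>Orb. complex_of_real (th ob) powi (1 - int g) * ?P ob * (1 / th ob))"
      by (rule sum.cong[OF refl]) (simp only: sum_distrib_left[symmetric] complete if_True refl)
    also have "\<dots> = (\<Sum>ob\<in>Orb. complex_of_real (th ob) powi (1 - int (g + 1)) * ?P ob)"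
    proof (rule sum.cong[OF refl])
      fix ob assume ob: "ob \<in> Orb"
      have "complex_of_real (th ob) powi (1 - int g) * ?P ob * (1 / th ob) = (complex_of_real (th ob) powi (1 - int g) / th ob) * ?P ob" by simp
      also have "\<dots> = complex_of_real (th ob) powi (1 - int (g + 1)) * ?P ob" unfolding pw[OF ob] by (simp add: algebra_simps)
      finally show "complex_of_real (th ob) powi (1 - int g) * ?P ob * (1 / th ob) = complex_of_real (th ob) powi (1 - int (g + 1)) * ?P ob" .
    qed
    finally show ?thesis unfolding v by simp
  qed
  show "verlinde R D k (g1 + g2) (\<mu>s1 @ \<mu>s2) t =
        (\<Sum>\<mu>\<in>?\<Lambda>. verlinde R D k g1 (\<mu>s1 @ [\<mu>]) t *
           verlinde R D k g2 (\<mu>s2 @ [dual_weight R D \<mu>]) t * verlinde_norm R D k \<mu> t)"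
  proof -
    define A1 where "A1 ob = complex_of_real (th ob) powi (1 - int g1) * prod_list (map (\<lambda>\<mu>. B \<mu> ob) \<mu>s1)" for ob
    define A2 where "A2 ob = complex_of_real (th ob) powi (1 - int g2) * prod_list (map (\<lambda>\<mu>. B \<mu> ob) \<mu>s2)" for ob
    have "(\<Sum>\<mu>\<in>?\<Lambda>. verlinde R D k g1 (\<mu>s1 @ [\<mu>]) t *
           verlinde R D k g2 (\<mu>s2 @ [dual_weight R D \<mu>]) t * verlinde_norm R D k \<mu> t)
      = (\<Sum>\<mu>\<in>?\<Lambda>. \<Sum>x\<in>Orb. \<Sum>y\<in>Orb. (A1 x * A2 y) * (B \<mu> x * cnj (B \<mu> y) / n \<mu>))"
      unfolding v nrm sum_product unfolding sum_distrib_right A1_def A2_def by (intro sum.cong refl) (simp add: dual mult_ac)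
    also have "\<dots> = (\<Sum>x\<in>Orb. \<Sum>\<mu>\<in>?\<Lambda>. \<Sum>y\<in>Orb. (A1 x * A2 y) * (B \<mu> x * cnj (B \<mu> y) / n \<mu>))"
      by (rule sum.swap)
    also have "\<dots> = (\<Sum>x\<in>Orb. \<Sum>y\<in>Orb. \<Sum>\<mu>\<in>?\<Lambda>. (A1 x * A2 y) * (B \<mu> x * cnj (B \<mu> y) / n \<mu>))"
      by (intro sum.cong refl sum.swap)
    \<comment> \<open>Column orthogonality collapses the double sum to the diagonal; the exponents
      \<open>1 - g1\<close>, \<open>1 - g2\<close> and \<open>-1\<close> then add up to
      \<open>1 - (g1 + g2)\<close>.\<close>
    also have "\<dots> = (\<Sum>x\<in>Orb. \<Sum>y\<in>Orb. (A1 x * A2 y) * (if x = y then 1 / th x else 0))"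
      by (intro sum.cong refl) (simp only: sum_distrib_left[symmetric] complete)
    also have "\<dots> = (\<Sum>x\<in>Orb. A1 x * A2 x / th x)"
      using finite_Orb by (intro sum.cong refl) (simp add: if_distrib cong: if_cong)
    also have "\<dots> = (\<Sum>x\<in>Orb. complex_of_real (th x) powi (1 - int (g1 + g2)) * prod_list (map (\<lambda>\<mu>. B \<mu> x) (\<mu>s1 @ \<mu>s2)))"
    proof (rule sum.cong[OF refl])
      fix x assume x: "x \<in> Orb"
      have nz: "complex_of_real (th x) \<noteq> 0" using th[OF x] by simp
      have "complex_of_real (th x) powi (1 - int g1) * complex_of_real (th x) powi (1 - int g2) / th x
        = complex_of_real (th x) powi ((1 - int g1) + (1 - int g2) - 1)"
        unfolding power_int_add[OF disjI1[OF nz], symmetric] by (rule pw[OF x])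
      also have "(1 - int g1) + (1 - int g2) - 1 = 1 - int (g1 + g2)" by simp
      finally show "A1 x * A2 x / th x = complex_of_real (th x) powi (1 - int (g1 + g2)) * prod_list (map (\<lambda>\<mu>. B \<mu> x) (\<mu>s1 @ \<mu>s2))"
        unfolding A1_def A2_def by (simp add: mult_ac divide_inverse)
    qed
    finally show ?thesis unfolding v by simp
  qed
qed

end

theorem theorem4:
  fixes R D :: "(real ^ 'n::finite) set"
    and k g g1 g2 n n1 n2 :: nat
    and \<mu>s \<mu>s1 \<mu>s2 :: "(real ^ 'n) list"
  assumes "irreducible_root_system R" and "normalized_form R" and "root_base R D"
    and "n \<ge> 2"
    and "length \<mu>s = n - 2" and "set \<mu>s \<subseteq> level_weights R D k"
    and "length \<mu>s1 = n1" and "set \<mu>s1 \<subseteq> level_weights R D k"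
    and "length \<mu>s2 = n2" and "set \<mu>s2 \<subseteq> level_weights R D k"
  shows "\<forall>\<^sub>F t in nhds (0::real).
      verlinde R D k (g + 1) \<mu>s t =
        (\<Sum>\<mu>\<in>level_weights R D k.
           verlinde R D k g (\<mu>s @ [\<mu>, dual_weight R D \<mu>]) t * verlinde_norm R D k \<mu> t)
    \<and> verlinde R D k (g1 + g2) (\<mu>s1 @ \<mu>s2) t =
        (\<Sum>\<mu>\<in>level_weights R D k.
           verlinde R D k g1 (\<mu>s1 @ [\<mu>]) t *
           verlinde R D k g2 (\<mu>s2 @ [dual_weight R D \<mu>]) t * verlinde_norm R D k \<mu> t)"
proof -
  interpret normalized_root_system R D
    by unfold_locales (use assms(1-3) in \<open>auto simp: irreducible_root_system_def\<close>)
  \<comment> \<open>There are finitely many weights of level \<open>k\<close>, so one neighbourhood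
    of \<open>0\<close> serves all of them.\<close>
  have nv: "\<forall>\<^sub>F t in nhds (0::real). \<forall>\<kappa>\<in>level_weights R D k. bethe R D k t \<longrightarrow>
    (\<exists>x. bethe.Phi R D k t x \<in> weights \<and> bethe.numerator R D t \<kappa> x \<noteq> 0)"
    by (rule eventually_ball_finite[OF finite_level_weights]) (use deformed_nonvanishing in blast)
  from eventually_conj[OF nv eventually_bethe[of k]] show ?thesis
  proof (rule eventually_mono)
    fix t :: real
    assume t: "(\<forall>\<kappa>\<in>level_weights R D k. bethe R D k t \<longrightarrow>
      (\<exists>x. bethe.Phi R D k t x \<in> weights \<and> bethe.numerator R D t \<kappa> x \<noteq> 0)) \<and> bethe R D k t"
    then interpret bethe R D k t by blast
    have "\<exists>x. Phi x \<in> weights \<and> numerator \<kappa> x \<noteq> 0" if "\<kappa> \<in> level_weights R D k" for \<kappa>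
      using t that by blast
    note gluing = verlinde_gluing[OF this]
    show "verlinde R D k (g + 1) \<mu>s t =
        (\<Sum>\<mu>\<in>level_weights R D k.
           verlinde R D k g (\<mu>s @ [\<mu>, dual_weight R D \<mu>]) t * verlinde_norm R D k \<mu> t)
    \<and> verlinde R D k (g1 + g2) (\<mu>s1 @ \<mu>s2) t =
        (\<Sum>\<mu>\<in>level_weights R D k.
           verlinde R D k g1 (\<mu>s1 @ [\<mu>]) t *
           verlinde R D k g2 (\<mu>s2 @ [dual_weight R D \<mu>]) t * verlinde_norm R D k \<mu> t)"
      using gluing by blast
  qed
qed

end
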